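(* Let $\alpha>0$ and $\kappa>0$. The condition number of the preconditioned operator $\mathcal B^{-1}\mathcal A$ is bounded by \[ \operatorname{cond}\left(\mathcal B^{-1}\mathcal A\right)\le 2\,\frac{\cos(\pi/7)}{\sin(\pi/14)}\approx 8.10 . \]
   Context: Let $d\in\{2,3\}$, let $\Omega\subset\mathbb R^d$ be a bounded open domain with Lipschitz boundary, $T>0$, $Q_T=(0,T)\times\Omega$, and let $q_t\subseteq Q_T$ be a (measurable) observation domain. $\Delta$ acts in the space variable only. Let $H(\Delta,\Omega):=\{v\in L^2(\Omega):\Delta v\in L^2(\Omega)\}$ (weak Laplacian) with norm $\|v\|_{H(\Delta,\Omega)}^2=\|v\|_{L^2(\Omega)}^2+\|\Delta v\|_{L^2(\Omega)}^2$. Let $H^1_{0,*}((0,T);L^2(\Omega))$ be the space of functions in $H^1((0,T);L^2(\Omega))$ vanishing at $t=0$ (not necessarily at $t=T$). Set \[ Y:=L^2((0,T);H(\Delta,\Omega)\cap H_0^1(\Omega))\cap H^1_{0,*}((0,T);L^2(\Omega)),\qquad \|y\|_Y:=\|\partial_t y-\kappa\Delta y\|_{L^2(Q_T)},\qquad U:=L^2(Q_T); \] $Y$ is complete with respect to $\|\cdot\|_Y$. A prime denotes the dual space or the adjoint operator. Define $M:U\to U'$ by $\langle Mu,\lambda\rangle=(u,\lambda)_{L^2(Q_T)}$, $M_{q_t}:U\to U'$ by $\langle M_{q_t}u,\lambda\rangle=(u,\lambda)_{L^2(q_t)}$ (also used as an operator $Y\to Y'$ by restriction), $L:Y\to U'$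 by $\langle Ly,\lambda\rangle=(\partial_ty-\kappa\Delta y,\lambda)_{L^2(Q_T)}$, and $B,C:Y\to Y'$ by $\langle By,\tilde y\rangle=(\Delta y,\Delta\tilde y)_{L^2(Q_T)}$ and $\langle Cy,\tilde y\rangle=(\partial_ty,\partial_t\tilde y)_{L^2(Q_T)}$. On $X:=Y\times U\times U$ define the operators $X\to X'$ \[ \mathcal A=\begin{pmatrix}M_{q_t}&0&L'\\0&\alpha M&M\\L&M&0\end{pmatrix},\qquad \mathcal B=\begin{pmatrix}M_{q_t}+\alpha\kappa^2B+\alpha C&0&0\\0&\alpha M&0\\0&0&\frac1\alpha M\end{pmatrix}. \] The condition number is $\operatorname{cond}(\mathcal B^{-1}\mathcal A)=\|\mathcal B^{-1}\mathcal A\|\,\|(\mathcal B^{-1}\mathcal A)^{-1}\|$, where operator norms on $X$ are taken with respect to the norm $\|\mathbf x\|_{\mathcal B}=\langle\mathcal B\mathbf x,\mathbf x\rangle^{1/2}$. *)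

theory Defs
  imports "HOL-Analysis.Analysis"
begin

section \<open>Domains and test functions\<close>

text \<open>
  Near each boundary point, in suitable orthogonal coordinates with vertical axis \<^term>\<open>e\<close>, the set
  is the part below the graph of a Lipschitz function of the remaining coordinates.
\<close>

definition lipschitz_boundary :: "'a::euclidean_space set \<Rightarrow> bool" where
  "lipschitz_boundary \<Omega> \<longleftrightarrow>
     (\<forall>p\<in>frontier \<Omega>. \<exists>e W C \<gamma>. norm e = 1 \<and> open W \<and> p \<in> W \<and>
        C-lipschitz_on {z. z \<bullet> e = 0} (\<gamma> :: 'a \<Rightarrow> real) \<and>
        \<Omega> \<inter> W = {x \<in> W. x \<bullet> e < \<gamma> (x - (x \<bullet> e) *\<^sub>R e)})"

definition partial :: "'a::euclidean_space \<Rightarrow> ('a \<Rightarrow> real) \<Rightarrow> 'a \<Rightarrow> real" where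
  "partial i f x = frechet_derivative f (at x) i"

primrec Ck :: "nat \<Rightarrow> ('a::euclidean_space \<Rightarrow> real) \<Rightarrow> bool" where
  "Ck 0 f \<longleftrightarrow> continuous_on UNIV f"
| "Ck (Suc k) f \<longleftrightarrow> f differentiable_on UNIV \<and> (\<forall>i\<in>Basis. Ck k (partial i f))"

definition test_fun :: "'a::euclidean_space set \<Rightarrow> ('a \<Rightarrow> real) \<Rightarrow> bool" where
  "test_fun S \<phi> \<longleftrightarrow> (\<forall>k. Ck k \<phi>) \<and> compact (closure {x. \<phi> x \<noteq> 0}) \<and> closure {x. \<phi> x \<noteq> 0} \<subseteq> S"


section \<open>Square-integrable functions and Sobolev spaces\<close>

definition L2_fun :: "'a::euclidean_space set \<Rightarrow> ('a \<Rightarrow> real) \<Rightarrow> bool" where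
  "L2_fun S f \<longleftrightarrow>
     f \<in> borel_measurable (lebesgue_on S) \<and> integrable (lebesgue_on S) (\<lambda>x. (f x)\<^sup>2)"

definition L2_norm_fun :: "'a::euclidean_space set \<Rightarrow> ('a \<Rightarrow> real) \<Rightarrow> real" where
  "L2_norm_fun S f = sqrt (LINT x|lebesgue_on S. (f x)\<^sup>2)"

definition weak_partial ::
    "'a::euclidean_space set \<Rightarrow> 'a \<Rightarrow> ('a \<Rightarrow> real) \<Rightarrow> ('a \<Rightarrow> real) \<Rightarrow> bool" where
  "weak_partial \<Omega> i v g \<longleftrightarrow> (\<forall>\<phi>. test_fun \<Omega> \<phi> \<longrightarrow>
     (LINT x|lebesgue_on \<Omega>. v x * partial i \<phi> x) = - (LINT x|lebesgue_on \<Omega>. g x * \<phi> x))"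

definition weak_laplacian ::
    "'a::euclidean_space set \<Rightarrow> ('a \<Rightarrow> real) \<Rightarrow> ('a \<Rightarrow> real) \<Rightarrow> bool" where
  "weak_laplacian \<Omega> v g \<longleftrightarrow> (\<forall>\<phi>. test_fun \<Omega> \<phi> \<longrightarrow>
     (LINT x|lebesgue_on \<Omega>. v x * (\<Sum>i\<in>Basis. partial i (partial i \<phi>) x)) =
     (LINT x|lebesgue_on \<Omega>. g x * \<phi> x))"

definition H_Delta :: "'a::euclidean_space set \<Rightarrow> ('a \<Rightarrow> real) set" where
  "H_Delta \<Omega> = {v. L2_fun \<Omega> v \<and> (\<exists>g. L2_fun \<Omega> g \<and> weak_laplacian \<Omega> v g)}"

text \<open>The closure of the test functions in the \<open>H\<^sup>1\<close>-norm; \<^term>\<open>G i\<close> is the weak derivative in direction \<^term>\<open>i\<close>.\<close>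

definition H1_0 :: "'a::euclidean_space set \<Rightarrow> ('a \<Rightarrow> real) set" where
  "H1_0 \<Omega> = {v. L2_fun \<Omega> v \<and>
     (\<exists>G. (\<forall>i\<in>Basis. L2_fun \<Omega> (G i) \<and> weak_partial \<Omega> i v (G i)) \<and>
        (\<forall>\<epsilon>>0. \<exists>\<phi>. test_fun \<Omega> \<phi> \<and>
           sqrt ((L2_norm_fun \<Omega> (\<lambda>x. v x - \<phi> x))\<^sup>2 +
                 (\<Sum>i\<in>Basis. (L2_norm_fun \<Omega> (\<lambda>x. G i x - partial i \<phi> x))\<^sup>2)) < \<epsilon>))}"


section \<open>The Hilbert space of classes of square-integrable functions\<close>

quotient_type (overloaded) 'a l2 = "'a::euclidean_space \<Rightarrow> real" / partial:
  "\<lambda>f g. L2_fun UNIV f \<and> L2_fun UNIV g \<and> (AE x in lebesgue. f x = g x)"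
proof (rule part_equivpI)
  show "\<exists>f::'a \<Rightarrow> real. L2_fun UNIV f \<and> L2_fun UNIV f \<and> (AE x in lebesgue. f x = f x)"
    by (rule exI[of _ "\<lambda>_. 0"]) (simp add: L2_fun_def)
  show "symp (\<lambda>f g :: 'a \<Rightarrow> real. L2_fun UNIV f \<and> L2_fun UNIV g \<and> (AE x in lebesgue. f x = g x))"
    by (rule sympI) (auto elim: eventually_mono)
  show "transp (\<lambda>f g :: 'a \<Rightarrow> real. L2_fun UNIV f \<and> L2_fun UNIV g \<and> (AE x in lebesgue. f x = g x))"
    by (rule transpI) (auto elim: eventually_elim2)
qed

lemma L2_fun_scale: "L2_fun S f \<Longrightarrow> L2_fun S (\<lambda>x. c * f x)"
  by (auto simp: L2_fun_def power_mult_distrib)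

lemma L2_fun_add:
  assumes "L2_fun S f" and "L2_fun S g"
  shows "L2_fun S (\<lambda>x. f x + g x)"
proof -
  have m [measurable]: "f \<in> borel_measurable (lebesgue_on S)" "g \<in> borel_measurable (lebesgue_on S)"
    using assms by (auto simp: L2_fun_def)
  have "integrable (lebesgue_on S) (\<lambda>x. 2 * (f x)\<^sup>2 + 2 * (g x)\<^sup>2)"
    using assms by (auto simp: L2_fun_def)
  then have "integrable (lebesgue_on S) (\<lambda>x. (f x + g x)\<^sup>2)"
  proof (rule Bochner_Integration.integrable_bound)
    have "(a + b)\<^sup>2 \<le> 2 * a\<^sup>2 + 2 * b\<^sup>2" for a b :: real
      using sum_squares_bound[of a b] by (simp add: power2_sum)
    then show "AE x in lebesgue_on S. norm ((f x + g x)\<^sup>2) \<le> norm (2 * (f x)\<^sup>2 + 2 * (g x)\<^sup>2)"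
      by simp
  qed measurable
  then show ?thesis by (simp add: L2_fun_def)
qed

instantiation l2 :: (euclidean_space) real_vector
begin

lift_definition zero_l2 :: "'a l2" is "\<lambda>_. 0"
  by (simp add: L2_fun_def)

lift_definition plus_l2 :: "'a l2 \<Rightarrow> 'a l2 \<Rightarrow> 'a l2" is "\<lambda>f g x. f x + g x"
  by (auto intro: L2_fun_add elim: eventually_elim2)

lift_definition scaleR_l2 :: "real \<Rightarrow> 'a l2 \<Rightarrow> 'a l2" is "\<lambda>c f x. c * f x"
  by (auto intro: L2_fun_scale elim: eventually_mono)

definition uminus_l2 :: "'a l2 \<Rightarrow> 'a l2" where "uminus_l2 u = (- 1) *\<^sub>R u"

definition minus_l2 :: "'a l2 \<Rightarrow> 'a l2 \<Rightarrow> 'a l2" where "minus_l2 u v = u + (- v)"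

instance
proof
  fix u v w :: "'a l2" and a b :: real
  show "u + v + w = u + (v + w)"
    by transfer (auto intro!: L2_fun_add simp: add.assoc)
  show "u + v = v + u"
    by transfer (auto intro!: L2_fun_add simp: add.commute)
  show "0 + u = u"
    by transfer auto
  show "- u + u = 0"
    unfolding uminus_l2_def
    by transfer (auto intro!: L2_fun_add simp: L2_fun_def)
  show "u - v = u + - v"
    by (simp add: minus_l2_def)
  show "a *\<^sub>R (u + v) = a *\<^sub>R u + a *\<^sub>R v"
    by transfer (auto intro!: L2_fun_add L2_fun_scale simp: distrib_left)
  show "(a + b) *\<^sub>R u = a *\<^sub>R u + b *\<^sub>R u"
    by transfer (auto intro!: L2_fun_add L2_fun_scale simp: distrib_right)
  show "a *\<^sub>R b *\<^sub>R u = (a * b) *\<^sub>R u"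
    by transfer (auto intro!: L2_fun_scale simp: mult.assoc)
  show "1 *\<^sub>R u = u"
    by transfer auto
qed

end

text \<open>\<open>L\<^sup>2(S)\<close>, as the subspace of the classes that vanish almost everywhere outside \<open>S\<close>.\<close>

definition L2_space :: "'a::euclidean_space set \<Rightarrow> 'a l2 set" where
  "L2_space S = {u. AE x in lebesgue. x \<notin> S \<longrightarrow> rep_l2 u x = 0}"

definition l2_inner :: "'a::euclidean_space set \<Rightarrow> 'a l2 \<Rightarrow> 'a l2 \<Rightarrow> real" where
  "l2_inner S u v = (LINT x|lebesgue_on S. rep_l2 u x * rep_l2 v x)"

definition l2_norm :: "'a::euclidean_space set \<Rightarrow> 'a l2 \<Rightarrow> real" where
  "l2_norm S u = sqrt (l2_inner S u u)"


section \<open>Function spaces on the space-time cylinder\<close>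

definition cyl :: "real \<Rightarrow> 'a set \<Rightarrow> (real \<times> 'a) set" where
  "cyl T \<Omega> = {0<..<T} \<times> \<Omega>"

definition slice :: "(real \<times> 'a::euclidean_space) l2 \<Rightarrow> real \<Rightarrow> 'a \<Rightarrow> real" where
  "slice u t = (\<lambda>x. rep_l2 u (t, x))"

text \<open>
  \<open>L\<^sup>2((0,T); L\<^sup>2(\<Omega>))\<close> is identified with \<open>L\<^sup>2(Q\<^sub>T)\<close>. Under this identification the two relations below
  say that \<^term>\<open>g\<close> is the Laplacian of \<^term>\<open>y\<close>, taken at almost every time, respectively the weak
  derivative of \<^term>\<open>y\<close> as an \<open>L\<^sup>2(\<Omega>)\<close>-valued function on \<open>(0,T)\<close>.
\<close>

definition is_laplacian ::
    "real \<Rightarrow> 'a::euclidean_space set \<Rightarrow> (real \<times> 'a) l2 \<Rightarrow> (real \<times> 'a) l2 \<Rightarrow> bool" where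
  "is_laplacian T \<Omega> y g \<longleftrightarrow> (AE t in lebesgue_on {0<..<T}. weak_laplacian \<Omega> (slice y t) (slice g t))"

definition is_time_deriv ::
    "real \<Rightarrow> 'a::euclidean_space set \<Rightarrow> (real \<times> 'a) l2 \<Rightarrow> (real \<times> 'a) l2 \<Rightarrow> bool" where
  "is_time_deriv T \<Omega> y g \<longleftrightarrow> (\<forall>\<phi>. test_fun {0<..<T} \<phi> \<longrightarrow>
     (AE x in lebesgue_on \<Omega>.
        (LINT t|lebesgue_on {0<..<T}. slice y t x * deriv \<phi> t) =
        - (LINT t|lebesgue_on {0<..<T}. slice g t x * \<phi> t)))"

text \<open>The representative \<^term>\<open>z\<close> of \<^term>\<open>y\<close> in \<open>C([0,T]; L\<^sup>2(\<Omega>))\<close> is zero at time 0.\<close>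

definition vanishes_initially ::
    "real \<Rightarrow> 'a::euclidean_space set \<Rightarrow> (real \<times> 'a) l2 \<Rightarrow> bool" where
  "vanishes_initially T \<Omega> y \<longleftrightarrow> (\<exists>z :: real \<Rightarrow> 'a \<Rightarrow> real.
     (\<forall>t\<in>{0..T}. L2_fun \<Omega> (z t)) \<and>
     (\<forall>t\<in>{0..T}. ((\<lambda>s. L2_norm_fun \<Omega> (\<lambda>x. z s x - z t x)) \<longlongrightarrow> 0) (at t within {0..T})) \<and>
     (AE t in lebesgue_on {0<..<T}. AE x in lebesgue_on \<Omega>. z t x = slice y t x) \<and>
     (AE x in lebesgue_on \<Omega>. z 0 x = 0))"

text \<open>
  \<open>L\<^sup>2((0,T); H(\<Delta>,\<Omega>) \<inter> H\<^sub>0\<^sup>1(\<Omega>))\<close>, where \<open>H(\<Delta>,\<Omega>) \<inter> H\<^sub>0\<^sup>1(\<Omega>)\<close> carries the graph norm of the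
  Laplacian.
\<close>

definition L2_HDelta_H10 :: "real \<Rightarrow> 'a::euclidean_space set \<Rightarrow> (real \<times> 'a) l2 set" where
  "L2_HDelta_H10 T \<Omega> = {y \<in> L2_space (cyl T \<Omega>).
     (AE t in lebesgue_on {0<..<T}. slice y t \<in> H_Delta \<Omega> \<inter> H1_0 \<Omega>) \<and>
     (\<exists>g\<in>L2_space (cyl T \<Omega>). is_laplacian T \<Omega> y g)}"

definition H1_0star :: "real \<Rightarrow> 'a::euclidean_space set \<Rightarrow> (real \<times> 'a) l2 set" where
  "H1_0star T \<Omega> = {y \<in> L2_space (cyl T \<Omega>).
     (\<exists>g\<in>L2_space (cyl T \<Omega>). is_time_deriv T \<Omega> y g) \<and> vanishes_initially T \<Omega> y}"

definition Y_space :: "real \<Rightarrow> 'a::euclidean_space set \<Rightarrow> (real \<times> 'a) l2 set" where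
  "Y_space T \<Omega> = L2_HDelta_H10 T \<Omega> \<inter> H1_0star T \<Omega>"

definition U_space :: "real \<Rightarrow> 'a::euclidean_space set \<Rightarrow> (real \<times> 'a) l2 set" where
  "U_space T \<Omega> = L2_space (cyl T \<Omega>)"

definition lap :: "real \<Rightarrow> 'a::euclidean_space set \<Rightarrow> (real \<times> 'a) l2 \<Rightarrow> (real \<times> 'a) l2" where
  "lap T \<Omega> y = (THE g. g \<in> L2_space (cyl T \<Omega>) \<and> is_laplacian T \<Omega> y g)"

definition dt :: "real \<Rightarrow> 'a::euclidean_space set \<Rightarrow> (real \<times> 'a) l2 \<Rightarrow> (real \<times> 'a) l2" where
  "dt T \<Omega> y = (THE g. g \<in> L2_space (cyl T \<Omega>) \<and> is_time_deriv T \<Omega> y g)"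

definition heat :: "real \<Rightarrow> real \<Rightarrow> 'a::euclidean_space set \<Rightarrow> (real \<times> 'a) l2 \<Rightarrow> (real \<times> 'a) l2" where
  "heat \<kappa> T \<Omega> y = dt T \<Omega> y - \<kappa> *\<^sub>R lap T \<Omega> y"

definition Y_norm :: "real \<Rightarrow> real \<Rightarrow> 'a::euclidean_space set \<Rightarrow> (real \<times> 'a) l2 \<Rightarrow> real" where
  "Y_norm \<kappa> T \<Omega> y = l2_norm (cyl T \<Omega>) (heat \<kappa> T \<Omega> y)"

type_synonym 'a triple = "(real \<times> 'a) l2 \<times> (real \<times> 'a) l2 \<times> (real \<times> 'a) l2"

definition X_space :: "real \<Rightarrow> 'a::euclidean_space set \<Rightarrow> 'a triple set" where
  "X_space T \<Omega> = Y_space T \<Omega> \<times> U_space T \<Omega> \<times> U_space T \<Omega>"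

definition X_norm :: "real \<Rightarrow> real \<Rightarrow> 'a::euclidean_space set \<Rightarrow> 'a triple \<Rightarrow> real" where
  "X_norm \<kappa> T \<Omega> = (\<lambda>(y, u, \<mu>).
     sqrt ((Y_norm \<kappa> T \<Omega> y)\<^sup>2 + (l2_norm (cyl T \<Omega>) u)\<^sup>2 + (l2_norm (cyl T \<Omega>) \<mu>)\<^sup>2))"

text \<open>
  The bounded linear functionals on a subspace \<^term>\<open>V\<close> with norm \<^term>\<open>N\<close>; extensionality makes
  equality of functionals mean equality on \<^term>\<open>V\<close>.
\<close>

definition dual_space :: "'v::real_vector set \<Rightarrow> ('v \<Rightarrow> real) \<Rightarrow> ('v \<Rightarrow> real) set" where
  "dual_space V N = {F \<in> extensional V.
     (\<forall>x\<in>V. \<forall>y\<in>V. F (x + y) = F x + F y) \<and>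
     (\<forall>c. \<forall>x\<in>V. F (c *\<^sub>R x) = c * F x) \<and>
     (\<exists>C. \<forall>x\<in>V. \<bar>F x\<bar> \<le> C * N x)}"

definition X_dual :: "real \<Rightarrow> real \<Rightarrow> 'a::euclidean_space set \<Rightarrow> ('a triple \<Rightarrow> real) set" where
  "X_dual \<kappa> T \<Omega> = dual_space (X_space T \<Omega>) (X_norm \<kappa> T \<Omega>)"


section \<open>Operators\<close>

text \<open>An operator into a dual space takes its argument first and the test element second.\<close>

definition op_M ::
    "real \<Rightarrow> 'a::euclidean_space set \<Rightarrow> (real \<times> 'a) l2 \<Rightarrow> (real \<times> 'a) l2 \<Rightarrow> real" where
  "op_M T \<Omega> u \<mu> = l2_inner (cyl T \<Omega>) u \<mu>"

definition op_Mq ::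
    "(real \<times> 'a::euclidean_space) set \<Rightarrow> (real \<times> 'a) l2 \<Rightarrow> (real \<times> 'a) l2 \<Rightarrow> real" where
  "op_Mq q u \<mu> = l2_inner q u \<mu>"

definition op_L ::
    "real \<Rightarrow> real \<Rightarrow> 'a::euclidean_space set \<Rightarrow> (real \<times> 'a) l2 \<Rightarrow> (real \<times> 'a) l2 \<Rightarrow> real" where
  "op_L \<kappa> T \<Omega> y \<mu> = l2_inner (cyl T \<Omega>) (heat \<kappa> T \<Omega> y) \<mu>"

text \<open>The adjoint maps \<open>U\<close>, identified with its bidual, to \<open>Y'\<close>.\<close>

definition adj :: "('v \<Rightarrow> 'w \<Rightarrow> real) \<Rightarrow> 'w \<Rightarrow> 'v \<Rightarrow> real" where
  "adj K \<mu> y = K y \<mu>"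

definition op_B ::
    "real \<Rightarrow> 'a::euclidean_space set \<Rightarrow> (real \<times> 'a) l2 \<Rightarrow> (real \<times> 'a) l2 \<Rightarrow> real" where
  "op_B T \<Omega> y y' = l2_inner (cyl T \<Omega>) (lap T \<Omega> y) (lap T \<Omega> y')"

definition op_C ::
    "real \<Rightarrow> 'a::euclidean_space set \<Rightarrow> (real \<times> 'a) l2 \<Rightarrow> (real \<times> 'a) l2 \<Rightarrow> real" where
  "op_C T \<Omega> y y' = l2_inner (cyl T \<Omega>) (dt T \<Omega> y) (dt T \<Omega> y')"

definition cal_A ::
    "real \<Rightarrow> real \<Rightarrow> real \<Rightarrow> 'a::euclidean_space set \<Rightarrow> (real \<times> 'a) set
     \<Rightarrow> 'a triple \<Rightarrow> 'a triple \<Rightarrow> real" where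
  "cal_A \<alpha> \<kappa> T \<Omega> q = (\<lambda>(y, u, \<mu>). restrict (\<lambda>(y', u', \<mu>').
       (op_Mq q y y' + adj (op_L \<kappa> T \<Omega>) \<mu> y')
     + (\<alpha> * op_M T \<Omega> u u' + op_M T \<Omega> \<mu> u')
     + (op_L \<kappa> T \<Omega> y \<mu>' + op_M T \<Omega> u \<mu>')) (X_space T \<Omega>))"

definition cal_B ::
    "real \<Rightarrow> real \<Rightarrow> real \<Rightarrow> 'a::euclidean_space set \<Rightarrow> (real \<times> 'a) set
     \<Rightarrow> 'a triple \<Rightarrow> 'a triple \<Rightarrow> real" where
  "cal_B \<alpha> \<kappa> T \<Omega> q = (\<lambda>(y, u, \<mu>). restrict (\<lambda>(y', u', \<mu>').
       (op_Mq q y y' + \<alpha> * \<kappa>\<^sup>2 * op_B T \<Omega> y y' + \<alpha> * op_C T \<Omega> y y')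
     + \<alpha> * op_M T \<Omega> u u'
     + (1 / \<alpha>) * op_M T \<Omega> \<mu> \<mu>') (X_space T \<Omega>))"

definition norm_cal_B ::
    "real \<Rightarrow> real \<Rightarrow> real \<Rightarrow> 'a::euclidean_space set \<Rightarrow> (real \<times> 'a) set \<Rightarrow> 'a triple \<Rightarrow> real" where
  "norm_cal_B \<alpha> \<kappa> T \<Omega> q x = sqrt (cal_B \<alpha> \<kappa> T \<Omega> q x x)"

text \<open>Only meaningful when \<^const>\<open>cal_B\<close> is a bijection of \<^const>\<open>X_space\<close> onto \<^const>\<open>X_dual\<close>.\<close>

definition precond_op ::
    "real \<Rightarrow> real \<Rightarrow> real \<Rightarrow> 'a::euclidean_space set \<Rightarrow> (real \<times> 'a) set \<Rightarrow> 'a triple \<Rightarrow> 'a triple" where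
  "precond_op \<alpha> \<kappa> T \<Omega> q x = inv_into (X_space T \<Omega>) (cal_B \<alpha> \<kappa> T \<Omega> q) (cal_A \<alpha> \<kappa> T \<Omega> q x)"

text \<open>Valued in \<^typ>\<open>ennreal\<close>, so that an unbounded operator has norm \<open>\<infinity>\<close>.\<close>

definition op_norm :: "'v::real_vector set \<Rightarrow> ('v \<Rightarrow> real) \<Rightarrow> ('v \<Rightarrow> 'v) \<Rightarrow> ennreal" where
  "op_norm V N K = (SUP x\<in>V - {0}. ennreal (N (K x) / N x))"

text \<open>Only meaningful when \<^term>\<open>K\<close> is a bijection of \<^term>\<open>V\<close> onto itself.\<close>

definition cond_number :: "'v::real_vector set \<Rightarrow> ('v \<Rightarrow> real) \<Rightarrow> ('v \<Rightarrow> 'v) \<Rightarrow> ennreal" where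
  "cond_number V N K = op_norm V N K * op_norm V N (inv_into V K)"

end

theory Submission
  imports Defs "HOL-Computational_Algebra.Polynomial"
begin

text \<open>
  For \<open>y \<in> Y\<close> one has \<open>\<langle>\<partial>\<^sub>t y, \<Delta>y\<rangle> \<le> 0\<close>: since \<open>-\<Delta>\<close> is symmetric and nonnegative on \<open>H\<^sub>0\<^sup>1(\<Omega>)\<close> and \<open>y\<close> vanishes
  at time 0, \<open>\<langle>\<Delta>y, y - y(\<cdot> - h)\<rangle> \<le> 0\<close> for all \<open>h > 0\<close>, and the difference is an average of translates of
  \<open>\<partial>\<^sub>t y\<close>. Hence \<open>\<parallel>\<partial>\<^sub>t y\<parallel>\<^sup>2 + \<kappa>\<^sup>2 \<parallel>\<Delta>y\<parallel>\<^sup>2 \<le> \<parallel>\<partial>\<^sub>t y - \<kappa> \<Delta>y\<parallel>\<^sup>2 \<le> 2 (\<parallel>\<partial>\<^sub>t y\<parallel>\<^sup>2 + \<kappa>\<^sup>2 \<parallel>\<Delta>y\<parallel>\<^sup>2)\<close>, so the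
  preconditioner \<open>B\<close> and the preconditioner \<open>B'\<close> obtained from it with \<open>\<alpha> \<parallel>\<partial>\<^sub>t y - \<kappa> \<Delta>y\<parallel>\<^sup>2\<close> in the first block
  satisfy \<open>B \<le> B' \<le> 2 B\<close>; this costs the factor 2. In the norm of \<open>B'\<close> the operator \<open>A\<close> is bounded by
  \<open>2 cos (\<pi>/7)\<close> and its inverse by \<open>1 / (2 sin (\<pi>/14))\<close>: by symmetry the quadratic forms of both suffice,
  and after elimination of two unknowns these are estimated by weighted Young inequalities whose weights come
  from the roots of \<open>\<lambda>\<^sup>3 - \<lambda>\<^sup>2 - 2 \<lambda> + 1\<close>. The space \<open>Y\<close> is complete because \<open>y\<close> is the primitive of \<open>\<partial>\<^sub>t y\<close> and the
  Dirichlet Laplacian is closed, by Green's formula.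
\<close>

section \<open>The Hilbert space of square-integrable functions\<close>

text \<open>The cubic is the characteristic polynomial of the matrix with rows (0,0,1), (0,1,1),
  (1,1,0), to which \<open>A\<close> reduces in the norm of \<open>B'\<close> when the observation
  term is dropped. Its roots are 2 cos(pi/7), 2 cos(3 pi/7) = 2 sin(pi/14) and 2 cos(5 pi/7), so the
  two bounds are the norms of this matrix and of its inverse. Only the bound of \<open>A\<close>
  pays the factor 2; the bound of the inverse uses B \<le> B' alone. Formally, the pairing of the
  time derivative with the Laplacian is minus half the growth of the Dirichlet energy. The time
  derivative is merely square-integrable in space and need not have a gradient, so this cannot be
  differentiated directly. A backward difference stays in the domain of the Laplacian and asks only
  for symmetry and sign. A second obstacle is measurability: elements are classes of Lebesgue
  measurable functions on space-time, whereas the spaces are defined through slices. Borel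
  representatives mediate between the two.\<close>

lemma L2_fun_UNIV:
  "L2_fun UNIV f \<longleftrightarrow> f \<in> borel_measurable lebesgue \<and> integrable lebesgue (\<lambda>x. (f x)\<^sup>2)"
  by (simp add: L2_fun_def lebesgue_on_UNIV_eq)

lemma L2_fun_rep_l2: "L2_fun UNIV (rep_l2 u)"
  using Quotient3_rep_reflp[OF Quotient3_l2, of u] by simp

lemma rep_abs_l2: "L2_fun UNIV f \<Longrightarrow> AE x in lebesgue. rep_l2 (abs_l2 f) x = f x"
  using Quotient3_rep_abs[OF Quotient3_l2, of f] by simp

lemma l2_eqI: "(AE x in lebesgue. rep_l2 u x = rep_l2 v x) \<Longrightarrow> u = v"
  using Quotient3_rel_rep[OF Quotient3_l2, of u v] L2_fun_rep_l2[of u] L2_fun_rep_l2[of v] by simp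

lemma l2_eq_iff: "u = v \<longleftrightarrow> (AE x in lebesgue. rep_l2 u x = rep_l2 v x)"
  using l2_eqI by auto

lemma rep_l2_measurable [measurable]: "rep_l2 u \<in> borel_measurable lebesgue"
  using L2_fun_rep_l2[of u] by (simp add: L2_fun_UNIV)

lemma L2_fun_mult_integrable:
  assumes "L2_fun S f" "L2_fun S g"
  shows "integrable (lebesgue_on S) (\<lambda>x. f x * g x)"
proof -
  have m [measurable]: "f \<in> borel_measurable (lebesgue_on S)" "g \<in> borel_measurable (lebesgue_on S)"
    using assms by (auto simp: L2_fun_def)
  have "integrable (lebesgue_on S) (\<lambda>x. (f x)\<^sup>2 + (g x)\<^sup>2)"
    using assms by (auto simp: L2_fun_def)
  then show ?thesis
  proof (rule Bochner_Integration.integrable_bound)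
    have "\<bar>a * b\<bar> \<le> a\<^sup>2 + b\<^sup>2" for a b :: real
      using sum_squares_bound[of "\<bar>a\<bar>" "\<bar>b\<bar>"] zero_le_power2[of a] zero_le_power2[of b]
      using mult_nonneg_nonneg[OF abs_ge_zero[of a] abs_ge_zero[of b]] unfolding abs_mult power2_abs
      by linarith
    then show "AE x in lebesgue_on S. norm (f x * g x) \<le> norm ((f x)\<^sup>2 + (g x)\<^sup>2)"
      by simp
  qed measurable
qed

lemma rep_l2_mult_integrable: "integrable lebesgue (\<lambda>x. rep_l2 u x * rep_l2 v x)"
  using L2_fun_mult_integrable[OF L2_fun_rep_l2[of u] L2_fun_rep_l2[of v]]
  by (simp add: lebesgue_on_UNIV_eq)

lemma rep_l2_add: "AE x in lebesgue. rep_l2 (u + v) x = rep_l2 u x + rep_l2 v x"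
  unfolding plus_l2_def using rep_abs_l2[OF L2_fun_add[OF L2_fun_rep_l2[of u] L2_fun_rep_l2[of v]]] by simp

lemma rep_l2_scaleR: "AE x in lebesgue. rep_l2 (c *\<^sub>R u) x = c * rep_l2 u x"
  unfolding scaleR_l2_def using rep_abs_l2[OF L2_fun_scale[OF L2_fun_rep_l2[of u]], of c] by simp

lemma rep_l2_zero: "AE x in lebesgue. rep_l2 0 x = 0"
  unfolding zero_l2_def by (rule rep_abs_l2) (simp add: L2_fun_def)

lemma rep_l2_uminus: "AE x in lebesgue. rep_l2 (- u) x = - rep_l2 u x"
  unfolding uminus_l2_def using rep_l2_scaleR[of "-1" u] by simp

lemma rep_l2_diff: "AE x in lebesgue. rep_l2 (u - v) x = rep_l2 u x - rep_l2 v x"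
  unfolding minus_l2_def using rep_l2_add[of u "-v"] rep_l2_uminus[of v] by eventually_elim simp

text \<open>A single Hilbert space, that of the whole Euclidean space, serves all domains. Functions
  on \<open>S\<close> are the elements vanishing outside \<open>S\<close>, a closed subspace, so the
  theory of inner product spaces applies to them without a type for each domain.\<close>

instantiation l2 :: (euclidean_space) real_inner
begin

definition inner_l2 :: "'a l2 \<Rightarrow> 'a l2 \<Rightarrow> real" where
  "inner_l2 u v = (LINT x|lebesgue. rep_l2 u x * rep_l2 v x)"

definition norm_l2 :: "'a l2 \<Rightarrow> real" where "norm_l2 u = sqrt (inner u u)"

definition dist_l2 :: "'a l2 \<Rightarrow> 'a l2 \<Rightarrow> real" where "dist_l2 u v = norm (u - v)"

definition sgn_l2 :: "'a l2 \<Rightarrow> 'a l2" where "sgn_l2 u = u /\<^sub>R norm u"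

definition uniformity_l2 :: "('a l2 \<times> 'a l2) filter" where
  "uniformity_l2 = (INF e\<in>{0<..}. principal {(u, v). dist u v < e})"

definition open_l2 :: "'a l2 set \<Rightarrow> bool" where
  "open_l2 S \<longleftrightarrow> (\<forall>u\<in>S. \<forall>\<^sub>F (u', v) in uniformity. u' = u \<longrightarrow> v \<in> S)"

instance
proof
  fix u v w :: "'a l2" and r :: real and S :: "'a l2 set"
  show "dist u v = norm (u - v)" by (rule dist_l2_def)
  show "uniformity = (INF e\<in>{0<..}. principal {(u, v). dist u v < e} :: ('a l2 \<times> 'a l2) filter)"
    by (rule uniformity_l2_def)
  show "open S \<longleftrightarrow> (\<forall>u\<in>S. \<forall>\<^sub>F (u', v) in uniformity. u' = u \<longrightarrow> v \<in> S)"
    by (rule open_l2_def)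
  show "sgn u = u /\<^sub>R norm u" by (rule sgn_l2_def)
  show "norm u = sqrt (inner u u)" by (rule norm_l2_def)
  show "inner u v = inner v u" by (simp add: inner_l2_def mult.commute)
  show "inner (u + v) w = inner u w + inner v w"
  proof -
    have "inner (u + v) w = (LINT x|lebesgue. rep_l2 u x * rep_l2 w x + rep_l2 v x * rep_l2 w x)"
      unfolding inner_l2_def
    proof (rule integral_cong_AE)
      show "AE x in lebesgue. rep_l2 (u + v) x * rep_l2 w x = rep_l2 u x * rep_l2 w x + rep_l2 v x * rep_l2 w x"
        using rep_l2_add[of u v] by eventually_elim (simp add: distrib_right)
    qed measurable
    then show ?thesis unfolding inner_l2_def
      by (simp add: Bochner_Integration.integral_add[OF rep_l2_mult_integrable rep_l2_mult_integrable])
  qed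
  show "inner (r *\<^sub>R u) v = r * inner u v"
  proof -
    have "inner (r *\<^sub>R u) v = (LINT x|lebesgue. r * (rep_l2 u x * rep_l2 v x))"
      unfolding inner_l2_def
    proof (rule integral_cong_AE)
      show "AE x in lebesgue. rep_l2 (r *\<^sub>R u) x * rep_l2 v x = r * (rep_l2 u x * rep_l2 v x)"
        using rep_l2_scaleR[of r u] by eventually_elim simp
    qed measurable
    then show ?thesis unfolding inner_l2_def by simp
  qed
  show "0 \<le> inner u u" unfolding inner_l2_def by (rule Bochner_Integration.integral_nonneg) simp
  show "inner u u = 0 \<longleftrightarrow> u = 0"
  proof
    assume "inner u u = 0"
    then have "AE x in lebesgue. rep_l2 u x * rep_l2 u x = 0"
      unfolding inner_l2_def
      by (subst (asm) integral_nonneg_eq_0_iff_AE) (auto simp: rep_l2_mult_integrable)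
    then have "AE x in lebesgue. rep_l2 u x = rep_l2 0 x"
      using rep_l2_zero by eventually_elim simp
    then show "u = 0" by (rule l2_eqI)
  next
    assume "u = 0"
    have "inner u u = (LINT (x::'a)|lebesgue. (0 :: real))"
      unfolding inner_l2_def
    proof (rule integral_cong_AE)
      show "AE x in lebesgue. rep_l2 u x * rep_l2 u x = 0"
        using rep_l2_zero unfolding \<open>u = 0\<close> by eventually_elim simp
    qed measurable
    then show "inner u u = 0" by simp
  qed
qed

end

lemma inner_l2_cong:
  assumes "AE x in lebesgue. rep_l2 u x = f x" "AE x in lebesgue. rep_l2 v x = g x"
    and "f \<in> borel_measurable lebesgue" "g \<in> borel_measurable lebesgue"
  shows "inner u v = (LINT x|lebesgue. f x * g x)"
  unfolding inner_l2_def
proof (rule integral_cong_AE)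
  show "AE x in lebesgue. rep_l2 u x * rep_l2 v x = f x * g x"
    using assms(1,2) by eventually_elim simp
qed (use assms(3,4) in measurable)

section \<open>Completeness of the space of classes\<close>

lemma norm_l2_square: "(norm (u :: 'a::euclidean_space l2))\<^sup>2 = (LINT x|lebesgue. (rep_l2 u x)\<^sup>2)"
  unfolding power2_norm_eq_inner inner_l2_def by (simp add: power2_eq_square)

text \<open>
  The squared increments decay like \<open>4\<^sup>-\<^sup>k\<close>, so that even the series weighted by
  \<open>2\<^sup>k\<close> has a finite integral; this makes the increments summable at almost every point.
\<close>

lemma l2_fast_Cauchy_converges_AE:
  fixes u :: "nat \<Rightarrow> 'a::euclidean_space l2"
  assumes "\<And>k. norm (u (Suc k) - u k) \<le> (1/2) ^ k"
  shows "AE x in lebesgue. convergent (\<lambda>k. rep_l2 (u k) x)"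
proof -
  define d where "d k x = rep_l2 (u (Suc k)) x - rep_l2 (u k) x" for k x
  have [measurable]: "d k \<in> borel_measurable lebesgue" for k unfolding d_def by measurable
  have nn: "(\<integral>\<^sup>+ x. ennreal (2 ^ k * (d k x)\<^sup>2) \<partial>lebesgue) \<le> ennreal ((1/2) ^ k)" for k
  proof -
    have "AE x in lebesgue. rep_l2 (u (Suc k) - u k) x = d k x"
      using rep_l2_diff[of "u (Suc k)" "u k"] unfolding d_def .
    then have "(\<integral>\<^sup>+ x. ennreal (2 ^ k * (d k x)\<^sup>2) \<partial>lebesgue)
        = (\<integral>\<^sup>+ x. ennreal (2 ^ k * (rep_l2 (u (Suc k) - u k) x)\<^sup>2) \<partial>lebesgue)"
      by (intro nn_integral_cong_AE) (auto elim!: eventually_mono)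
    also have "\<dots> = ennreal (LINT x|lebesgue. 2 ^ k * (rep_l2 (u (Suc k) - u k) x)\<^sup>2)"
      by (rule nn_integral_eq_integral)
        (use L2_fun_rep_l2[of "u (Suc k) - u k"] in \<open>auto simp: L2_fun_UNIV\<close>)
    also have "\<dots> = ennreal (2 ^ k * (norm (u (Suc k) - u k))\<^sup>2)"
      by (simp add: norm_l2_square)
    also have "\<dots> \<le> ennreal (2 ^ k * ((1/2) ^ k)\<^sup>2)"
      by (intro ennreal_leI mult_left_mono power_mono assms) auto
    also have "2 ^ k * ((1/2) ^ k)\<^sup>2 = ((1/2) ^ k :: real)"
      by (simp add: power2_eq_square power_divide)
    finally show ?thesis .
  qed
  have "(\<integral>\<^sup>+ x. (\<Sum>k. ennreal (2 ^ k * (d k x)\<^sup>2)) \<partial>lebesgue)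
      = (\<Sum>k. \<integral>\<^sup>+ x. ennreal (2 ^ k * (d k x)\<^sup>2) \<partial>lebesgue)"
    by (rule nn_integral_suminf) measurable
  also have "\<dots> \<le> (\<Sum>k. ennreal ((1/2) ^ k))"
    by (rule suminf_le[OF nn]) auto
  also have "\<dots> = ennreal (\<Sum>k. (1/2) ^ k)"
    by (rule suminf_ennreal2) (auto intro: summable_geometric)
  also have "\<dots> < \<infinity>" by simp
  finally have "(\<integral>\<^sup>+ x. (\<Sum>k. ennreal (2 ^ k * (d k x)\<^sup>2)) \<partial>lebesgue) \<noteq> \<infinity>" by simp
  then have "AE x in lebesgue. (\<Sum>k. ennreal (2 ^ k * (d k x)\<^sup>2)) \<noteq> \<infinity>"
    by (rule nn_integral_PInf_AE[rotated]) measurable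
  then show ?thesis
  proof eventually_elim
    case (elim x)
    have sm: "summable (\<lambda>k. 2 ^ k * (d k x)\<^sup>2)"
      by (rule summable_suminf_not_top) (use elim in auto)
    have g: "summable (\<lambda>k. (1/2 :: real) ^ k)" by (auto intro: summable_geometric)
    have "summable (\<lambda>k. d k x)"
    proof (rule summable_comparison_test'[OF summable_add[OF sm g]])
      fix k :: nat
      \<comment> \<open>Weights that split the increment into two factors: their squares are the
        terms of two series already known to converge.\<close>
      define a where "a = sqrt (2 ^ k) * \<bar>d k x\<bar>"
      define b where "b = 1 / sqrt (2 ^ k :: real)"
      have "a * b = \<bar>d k x\<bar>" unfolding a_def b_def by simp
      moreover have "a\<^sup>2 = 2 ^ k * (d k x)\<^sup>2" "b\<^sup>2 = (1/2) ^ k"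
        unfolding a_def b_def by (simp_all add: power_mult_distrib power_divide)
      ultimately show "norm (d k x) \<le> 2 ^ k * (d k x)\<^sup>2 + (1/2) ^ k"
        using sum_squares_bound[of a b] zero_le_power2[of a] zero_le_power2[of b] by simp
    qed
    then have "convergent (\<lambda>n. \<Sum>k<n. d k x)" by (simp add: summable_iff_convergent)
    moreover have "(\<Sum>k<n. d k x) = rep_l2 (u n) x - rep_l2 (u 0) x" for n
      unfolding d_def by (rule sum_lessThan_telescope)
    ultimately have "convergent (\<lambda>n. rep_l2 (u n) x - rep_l2 (u 0) x)" by simp
    then have "convergent (\<lambda>n. (rep_l2 (u n) x - rep_l2 (u 0) x) + rep_l2 (u 0) x)"
      by (intro convergent_add convergent_const)
    then show ?case by simp
  qed
qed

text \<open>The pointwise limit is the candidate. Fatou's lemma bounds its distance to each member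
  of the sequence by the Cauchy bound; this yields its square-integrability and then convergence in
  norm.\<close>

lemma l2_fast_Cauchy_convergent:
  fixes u :: "nat \<Rightarrow> 'a::euclidean_space l2"
  assumes "\<And>k. norm (u (Suc k) - u k) \<le> (1/2) ^ k" and C: "Cauchy u"
  shows "convergent u"
proof -
  define f where "f x = lim (\<lambda>k. rep_l2 (u k) x)" for x
  have f_meas [measurable]: "f \<in> borel_measurable lebesgue"
    unfolding f_def by measurable
  have lim: "AE x in lebesgue. (\<lambda>k. rep_l2 (u k) x) \<longlonglongrightarrow> f x"
    using l2_fast_Cauchy_converges_AE[OF assms(1)]
    by eventually_elim (simp add: f_def convergent_LIMSEQ_iff)
  have bound: "integrable lebesgue (\<lambda>x. (f x - rep_l2 (u m) x)\<^sup>2) \<and>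
      (LINT x|lebesgue. (f x - rep_l2 (u m) x)\<^sup>2) \<le> e\<^sup>2"
    if e: "e > 0" and m: "\<And>n. n \<ge> m \<Longrightarrow> norm (u n - u m) \<le> e" for e m
  proof -
    have le: "(\<integral>\<^sup>+ x. ennreal ((rep_l2 (u n) x - rep_l2 (u m) x)\<^sup>2) \<partial>lebesgue) \<le> ennreal (e\<^sup>2)"
      if "n \<ge> m" for n
    proof -
      have "AE x in lebesgue. rep_l2 (u n - u m) x = rep_l2 (u n) x - rep_l2 (u m) x"
        by (rule rep_l2_diff)
      then have "(\<integral>\<^sup>+ x. ennreal ((rep_l2 (u n) x - rep_l2 (u m) x)\<^sup>2) \<partial>lebesgue)
          = (\<integral>\<^sup>+ x. ennreal ((rep_l2 (u n - u m) x)\<^sup>2) \<partial>lebesgue)"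
        by (intro nn_integral_cong_AE) (auto elim!: eventually_mono)
      also have "\<dots> = ennreal ((norm (u n - u m))\<^sup>2)"
        unfolding norm_l2_square
        by (rule nn_integral_eq_integral)
          (use L2_fun_rep_l2[of "u n - u m"] in \<open>auto simp: L2_fun_UNIV\<close>)
      also have "\<dots> \<le> ennreal (e\<^sup>2)"
        by (intro ennreal_leI power_mono m that) auto
      finally show ?thesis .
    qed
    have "(\<integral>\<^sup>+ x. ennreal ((f x - rep_l2 (u m) x)\<^sup>2) \<partial>lebesgue)
        = (\<integral>\<^sup>+ x. liminf (\<lambda>n. ennreal ((rep_l2 (u n) x - rep_l2 (u m) x)\<^sup>2)) \<partial>lebesgue)"
    proof (rule nn_integral_cong_AE)
      show "AE x in lebesgue. ennreal ((f x - rep_l2 (u m) x)\<^sup>2)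
          = liminf (\<lambda>n. ennreal ((rep_l2 (u n) x - rep_l2 (u m) x)\<^sup>2))"
        using lim
      proof eventually_elim
        case (elim x)
        have "(\<lambda>n. ennreal ((rep_l2 (u n) x - rep_l2 (u m) x)\<^sup>2)) \<longlonglongrightarrow> ennreal ((f x - rep_l2 (u m) x)\<^sup>2)"
          by (intro tendsto_intros tendsto_ennrealI elim)
        then show ?case by (rule lim_imp_Liminf[OF sequentially_bot, symmetric])
      qed
    qed
    also have "\<dots> \<le> liminf (\<lambda>n. \<integral>\<^sup>+ x. ennreal ((rep_l2 (u n) x - rep_l2 (u m) x)\<^sup>2) \<partial>lebesgue)"
      by (rule nn_integral_liminf) measurable
    also have "\<dots> \<le> liminf (\<lambda>n. ennreal (e\<^sup>2))"
      by (rule Liminf_mono) (use le in \<open>auto intro: eventually_sequentiallyI\<close>)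
    also have "\<dots> = ennreal (e\<^sup>2)" by (simp add: Liminf_const)
    finally have fin: "(\<integral>\<^sup>+ x. ennreal ((f x - rep_l2 (u m) x)\<^sup>2) \<partial>lebesgue) \<le> ennreal (e\<^sup>2)" .
    have int: "integrable lebesgue (\<lambda>x. (f x - rep_l2 (u m) x)\<^sup>2)"
      by (rule integrableI_bounded) (use fin in \<open>auto simp: le_less_trans ennreal_less_top\<close>)
    then have "ennreal (LINT x|lebesgue. (f x - rep_l2 (u m) x)\<^sup>2) \<le> ennreal (e\<^sup>2)"
      using fin by (subst (asm) nn_integral_eq_integral) auto
    then show ?thesis using int by (simp add: ennreal_le_iff)
  qed
  have ev: "\<exists>M. \<forall>m\<ge>M. \<forall>n\<ge>M. norm (u n - u m) < e" if "e > 0" for e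
    using C that unfolding Cauchy_def dist_norm by meson
  have L2f: "L2_fun UNIV f"
  proof -
    obtain M where M: "\<forall>m\<ge>M. \<forall>n\<ge>M. norm (u n - u m) < 1" using ev[of 1] by auto
    have "integrable lebesgue (\<lambda>x. (f x - rep_l2 (u M) x)\<^sup>2)"
      using bound[of 1 M] M by (auto intro: less_imp_le)
    then have "L2_fun UNIV (\<lambda>x. f x - rep_l2 (u M) x)" by (simp add: L2_fun_UNIV)
    from L2_fun_add[OF this L2_fun_rep_l2[of "u M"]] show ?thesis by simp
  qed
  have "u \<longlonglongrightarrow> abs_l2 f"
  proof (rule LIMSEQ_I)
    fix r :: real assume r: "r > 0"
    obtain M where M: "\<forall>m\<ge>M. \<forall>n\<ge>M. norm (u n - u m) < r/2" using ev[of "r/2"] r by auto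
    have "norm (u m - abs_l2 f) < r" if "m \<ge> M" for m
    proof -
      have ae: "AE x in lebesgue. rep_l2 (u m - abs_l2 f) x = rep_l2 (u m) x - f x"
        using rep_l2_diff[of "u m" "abs_l2 f"] rep_abs_l2[OF L2f] by eventually_elim simp
      have "(norm (u m - abs_l2 f))\<^sup>2 = (LINT x|lebesgue. (f x - rep_l2 (u m) x)\<^sup>2)"
        unfolding norm_l2_square
      proof (rule integral_cong_AE)
        show "AE x in lebesgue. (rep_l2 (u m - abs_l2 f) x)\<^sup>2 = (f x - rep_l2 (u m) x)\<^sup>2"
          using ae by eventually_elim (simp add: power2_commute)
      qed measurable
      also have "\<dots> \<le> (r/2)\<^sup>2"
        by (rule conjunct2[OF bound]) (use M r that in \<open>fastforce intro: less_imp_le\<close>)+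
      finally have "norm (u m - abs_l2 f) \<le> r/2"
        by (rule power2_le_imp_le) (use r in simp)
      then show ?thesis using r by simp
    qed
    then show "\<exists>no. \<forall>n\<ge>no. norm (u n - abs_l2 f) < r" by blast
  qed
  then show ?thesis by (rule convergentI)
qed

lemma Cauchy_fast_subseq:
  fixes u :: "nat \<Rightarrow> 'a::real_normed_vector"
  assumes "Cauchy u"
  obtains r where "strict_mono r" "\<And>k. norm (u (r (Suc k)) - u (r k)) \<le> (1/2) ^ k"
proof -
  have "\<exists>r. strict_mono r \<and> (\<forall>k. \<forall>n\<ge>r k. norm (u n - u (r k)) \<le> (1/2) ^ k)"
  proof -
    have "\<forall>k. \<exists>N. \<forall>m\<ge>N. \<forall>n\<ge>N. norm (u n - u m) < (1/2) ^ k"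
    proof
      fix k :: nat
      have "(1/2 :: real) ^ k > 0" by simp
      then show "\<exists>N. \<forall>m\<ge>N. \<forall>n\<ge>N. norm (u n - u m) < (1/2) ^ k"
        using assms unfolding Cauchy_def dist_norm by meson
    qed
    then obtain N where N: "\<And>k m n. m \<ge> N k \<Longrightarrow> n \<ge> N k \<Longrightarrow> norm (u n - u m) < (1/2) ^ k"
      by metis
    define r where "r = rec_nat (N 0) (\<lambda>k rk. max (Suc rk) (N (Suc k)))"
    have r_Suc: "r (Suc k) = max (Suc (r k)) (N (Suc k))" for k by (simp add: r_def)
    have "r k \<ge> N k" for k by (cases k) (auto simp: r_def)
    moreover have "strict_mono r" by (rule strict_monoI_Suc) (simp add: r_Suc)
    ultimately show ?thesis using N by (meson less_imp_le order_trans)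
  qed
  then obtain r where r: "strict_mono r" "\<And>k n. n \<ge> r k \<Longrightarrow> norm (u n - u (r k)) \<le> (1/2) ^ k"
    by auto
  show thesis
    by (rule that[OF r(1)]) (use r in \<open>auto simp: strict_mono_less_eq\<close>)
qed

instance l2 :: (euclidean_space) complete_space
proof
  fix u :: "nat \<Rightarrow> 'a l2"
  assume C: "Cauchy u"
  obtain r where r: "strict_mono r" "\<And>k. norm (u (r (Suc k)) - u (r k)) \<le> (1/2) ^ k"
    using Cauchy_fast_subseq[OF C] by metis
  have "convergent (\<lambda>k. u (r k))"
    using l2_fast_Cauchy_convergent[OF r(2)] Cauchy_subseq_Cauchy[OF C r(1)] by (simp add: o_def)
  then obtain l where "(u \<circ> r) \<longlonglongrightarrow> l" by (auto simp: convergent_def o_def)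
  then have "u \<longlonglongrightarrow> l" by (rule Cauchy_converges_subseq[OF C r(1)])
  then show "convergent u" by (rule convergentI)
qed

text \<open>\<open>rep_l2 u\<close> is only Lebesgue measurable, a property that slices do not
  inherit on a product. A Borel representative has Borel slices everywhere, and Fubini's theorem for
  \<open>lborel\<close> applies to it directly.\<close>

definition bor :: "'a::euclidean_space l2 \<Rightarrow> 'a \<Rightarrow> real" where
  "bor u = (SOME f. f \<in> borel_measurable borel \<and> (AE x in lborel. rep_l2 u x = f x))"

lemma bor_measurable [measurable]: "bor u \<in> borel_measurable borel"
  and rep_eq_bor: "AE x in lborel. rep_l2 u x = bor u x"
proof -
  have "\<exists>f. f \<in> borel_measurable borel \<and> (AE x in lborel. rep_l2 u x = f x)"
    using completion_ex_borel_measurable_real[of "rep_l2 u" lborel] by auto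
  then have "bor u \<in> borel_measurable borel \<and> (AE x in lborel. rep_l2 u x = bor u x)"
    unfolding bor_def by (rule someI_ex)
  then show "bor u \<in> borel_measurable borel" "AE x in lborel. rep_l2 u x = bor u x" by auto
qed

lemma inner_bor: "inner u v = (LINT x|lborel. bor u x * bor v x)"
proof -
  have "inner u v = (LINT x|lebesgue. bor u x * bor v x)"
    by (rule inner_l2_cong) (auto intro: AE_completion rep_eq_bor measurable_completion)
  then show ?thesis by (simp add: integral_completion)
qed

lemma bor_mult_integrable: "integrable lborel (\<lambda>x. bor u x * bor v x)"
proof -
  have "AE x in lebesgue. rep_l2 u x * rep_l2 v x = bor u x * bor v x"
    using AE_completion[OF rep_eq_bor[of u]] AE_completion[OF rep_eq_bor[of v]]
    by eventually_elim simp
  then have "integrable lebesgue (\<lambda>x. bor u x * bor v x)"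
    by (intro integrable_cong_AE_imp[OF rep_l2_mult_integrable[of u v]] measurable_completion) simp_all
  then show ?thesis by (simp add: integrable_completion)
qed

lemma bor_square_integrable: "integrable lborel (\<lambda>x. (bor u x)\<^sup>2)"
  using bor_mult_integrable[of u u] by (simp add: power2_eq_square)

lemma norm_bor_square: "(norm u)\<^sup>2 = (LINT x|lborel. (bor u x)\<^sup>2)"
  unfolding power2_norm_eq_inner inner_bor by (simp add: power2_eq_square)

lemma bor_eqI: "(AE x in lborel. bor u x = bor v x) \<Longrightarrow> u = v"
proof (rule l2_eqI, rule AE_completion)
  assume "AE x in lborel. bor u x = bor v x"
  then show "AE x in lborel. rep_l2 u x = rep_l2 v x"
    using rep_eq_bor[of u] rep_eq_bor[of v] by eventually_elim simp
qed

lemma bor_add: "AE x in lborel. bor (u + v) x = bor u x + bor v x"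
  using rep_l2_add[of u v, unfolded AE_completion_iff] rep_eq_bor[of u] rep_eq_bor[of v] rep_eq_bor[of "u + v"]
  by eventually_elim simp

lemma bor_scaleR: "AE x in lborel. bor (c *\<^sub>R u) x = c * bor u x"
  using rep_l2_scaleR[of c u, unfolded AE_completion_iff] rep_eq_bor[of u] rep_eq_bor[of "c *\<^sub>R u"]
  by eventually_elim simp

lemma bor_diff: "AE x in lborel. bor (u - v) x = bor u x - bor v x"
  using rep_l2_diff[of u v, unfolded AE_completion_iff] rep_eq_bor[of u] rep_eq_bor[of v] rep_eq_bor[of "u - v"]
  by eventually_elim simp

lemma bor_zero: "AE x in lborel. bor 0 x = 0"
  using rep_l2_zero[unfolded AE_completion_iff] rep_eq_bor[of 0] by eventually_elim simp

lemma bor_abs_l2: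
  assumes "f \<in> borel_measurable borel" "integrable lborel (\<lambda>x. (f x)\<^sup>2)"
  shows "AE x in lborel. bor (abs_l2 f) x = f x"
proof -
  have "L2_fun UNIV f"
    using assms by (simp add: L2_fun_UNIV measurable_completion integrable_completion)
  from rep_abs_l2[OF this, unfolded AE_completion_iff] rep_eq_bor[of "abs_l2 f"]
  show ?thesis by eventually_elim simp
qed

section \<open>Smooth functions with compact support\<close>

lemma partial_has_derivative: "(f has_derivative f') (at x) \<Longrightarrow> partial i f x = f' i"
  by (simp add: partial_def frechet_derivative_at[symmetric])

lemma Ck_differentiable: "Ck (Suc k) f \<Longrightarrow> f differentiable at x"
  by (simp add: differentiable_on_def)

lemma Ck_has_derivative: "Ck (Suc k) f \<Longrightarrow> (f has_derivative frechet_derivative f (at x)) (at x)"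
  using Ck_differentiable frechet_derivative_works by blast

lemma Ck_Suc_D: "Ck (Suc k) f \<Longrightarrow> Ck k f"
proof (induction k arbitrary: f)
  case 0
  then show ?case by (simp add: differentiable_imp_continuous_on)
next
  case (Suc k)
  then have "f differentiable_on UNIV" "\<forall>i\<in>Basis. Ck (Suc k) (partial i f)"
    unfolding Ck.simps(2)[of "Suc k"] by blast+
  then have "\<forall>i\<in>Basis. Ck k (partial i f)" using Suc.IH by blast
  with \<open>f differentiable_on UNIV\<close> show ?case unfolding Ck.simps(2)[of k] by blast
qed

lemma Ck_continuous: "Ck k f \<Longrightarrow> continuous_on UNIV f"
  by (induction k) (auto dest: Ck_Suc_D simp: differentiable_imp_continuous_on)

lemma Ck_const: "Ck k (\<lambda>_. c)"
proof (induction k arbitrary: c)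
  case (Suc k)
  have "partial i (\<lambda>_. c) = (\<lambda>_. 0)" for i :: 'a
    by (rule ext) (rule partial_has_derivative[OF has_derivative_const])
  with Suc show ?case by simp
qed simp

lemma Ck_add: "Ck k f \<Longrightarrow> Ck k g \<Longrightarrow> Ck k (\<lambda>x. f x + g x)"
proof (induction k arbitrary: f g)
  case 0
  then show ?case by (auto intro: continuous_on_add)
next
  case (Suc k)
  have "partial i (\<lambda>x. f x + g x) = (\<lambda>x. partial i f x + partial i g x)" for i
    using partial_has_derivative[OF has_derivative_add[OF Ck_has_derivative[OF Suc.prems(1)] Ck_has_derivative[OF Suc.prems(2)]]]
    by (auto simp: partial_def)
  with Suc show ?case by (auto intro: differentiable_on_add)
qed

lemma Ck_mult: "Ck k f \<Longrightarrow> Ck k g \<Longrightarrow> Ck k (\<lambda>x. f x * g x)"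
proof (induction k arbitrary: f g)
  case 0
  then show ?case by (auto intro: continuous_on_mult)
next
  case (Suc k)
  have p: "partial i (\<lambda>x. f x * g x) = (\<lambda>x. f x * partial i g x + partial i f x * g x)" for i
    using partial_has_derivative[OF has_derivative_mult[OF Ck_has_derivative[OF Suc.prems(1)] Ck_has_derivative[OF Suc.prems(2)]]]
    by (auto simp: partial_def)
  have "Ck k (partial i (\<lambda>x. f x * g x))" if "i \<in> Basis" for i
    unfolding p using Suc.prems that by (intro Ck_add Suc.IH Ck_Suc_D[of k f] Ck_Suc_D[of k g]) auto
  with Suc.prems show ?case by (auto intro: differentiable_on_mult)
qed

lemma Ck_prod: "finite I \<Longrightarrow> (\<And>i. i \<in> I \<Longrightarrow> Ck k (f i)) \<Longrightarrow> Ck k (\<lambda>x. \<Prod>i\<in>I. f i x)"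
  by (induction I rule: finite_induct) (auto intro: Ck_mult Ck_const)

lemma Ck_compose_affine:
  fixes h :: "real \<Rightarrow> real" and v :: "'a::euclidean_space"
  shows "Ck k h \<Longrightarrow> Ck k (\<lambda>x. h (c + v \<bullet> x))"
proof (induction k arbitrary: h)
  case 0
  then show ?case
    by (auto intro!: continuous_on_compose2[of UNIV h] continuous_intros)
next
  case (Suc k)
  have d: "((\<lambda>x. h (c + v \<bullet> x)) has_derivative (\<lambda>y. (v \<bullet> y) * partial 1 h (c + v \<bullet> x))) (at x)" for x
  proof -
    have "((\<lambda>x. c + v \<bullet> x) has_derivative (\<lambda>y. v \<bullet> y)) (at x)"
      by (auto intro!: derivative_eq_intros)
    from has_derivative_compose[OF this Ck_has_derivative[OF Suc.prems]]
    have "((\<lambda>x. h (c + v \<bullet> x)) has_derivative (\<lambda>y. frechet_derivative h (at (c + v \<bullet> x)) (v \<bullet> y))) (at x)" .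
    moreover have "frechet_derivative h (at z) r = r * partial 1 h z" for r z
      using linear_cmul[OF linear_frechet_derivative[OF Ck_differentiable[OF Suc.prems, of z]], of r 1]
      by (simp add: partial_def)
    ultimately show ?thesis by simp
  qed
  then have p: "partial i (\<lambda>x. h (c + v \<bullet> x)) = (\<lambda>x. (v \<bullet> i) * partial 1 h (c + v \<bullet> x))" for i
    by (auto intro!: ext partial_has_derivative)
  have "Ck k (partial i (\<lambda>x. h (c + v \<bullet> x)))" for i
    unfolding p using Suc.prems by (intro Ck_mult Ck_const Suc.IH) simp
  then show ?case using d by (auto simp: differentiable_on_def differentiable_def)
qed

lemma Ck_real_Suc:
  fixes h h' :: "real \<Rightarrow> real"
  assumes "\<And>x. (h has_real_derivative h' x) (at x)"
  shows "Ck (Suc k) h \<longleftrightarrow> Ck k h'"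
proof -
  have "partial 1 h = h'"
    using assms by (auto intro!: ext partial_has_derivative[THEN trans] simp: has_field_derivative_def)
  moreover have "h differentiable_on UNIV"
    using assms by (auto simp: differentiable_on_def real_differentiable_def)
  ultimately show ?thesis by simp
qed

text \<open>The functions p(1/t) exp(-1/t), continued by 0, form a family closed under
  differentiation. Smoothness of the standard flat function \<open>flat_exp [:1:]\<close> thus
  follows by an induction that ranges over all polynomials at once.\<close>

definition flat_exp :: "real poly \<Rightarrow> real \<Rightarrow> real" where
  "flat_exp p t = (if t > 0 then poly p (1 / t) * exp (- (1 / t)) else 0)"

lemma poly_times_exp_tendsto_0: "((\<lambda>s. poly p s * exp (- s)) \<longlongrightarrow> (0::real)) at_top"
proof -
  have "((\<lambda>s. \<Sum>i\<le>degree p. coeff p i * (s ^ i / exp s)) \<longlongrightarrow> (\<Sum>i\<le>degree p. coeff p i * 0)) at_top"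
    by (intro tendsto_intros tendsto_power_div_exp_0)
  moreover have "(\<Sum>i\<le>degree p. coeff p i * (s ^ i / exp s)) = poly p s * exp (- s)" for s
    by (simp add: poly_altdef sum_distrib_right exp_minus divide_inverse mult.assoc)
  ultimately show ?thesis by simp
qed

lemma flat_exp_tendsto_0: "(flat_exp p \<longlongrightarrow> 0) (at 0)"
proof -
  have "(flat_exp p \<longlongrightarrow> 0) (at_right 0)"
  proof (rule Lim_transform_eventually)
    have "filterlim (\<lambda>t::real. 1 / t) at_top (at_right 0)"
      using filterlim_inverse_at_top_right by (simp add: divide_inverse)
    from filterlim_compose[OF poly_times_exp_tendsto_0 this]
    show "((\<lambda>t. poly p (1 / t) * exp (- (1 / t))) \<longlongrightarrow> 0) (at_right 0)" .
    show "\<forall>\<^sub>F t in at_right 0. poly p (1 / t) * exp (- (1 / t)) = flat_exp p t"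
      by (auto simp: flat_exp_def eventually_at intro!: exI[of _ 1])
  qed
  moreover have "(flat_exp p \<longlongrightarrow> 0) (at_left 0)"
    by (rule Lim_transform_eventually[of "\<lambda>_. 0"])
      (auto simp: flat_exp_def eventually_at intro!: exI[of _ 1])
  ultimately show ?thesis by (simp add: filterlim_split_at)
qed

text \<open>For s = 1/t one has ds/dt = -s^2, so p(s) exp(-s) has derivative s^2 (p - p')(s)
  exp(-s); this is the factor \<open>[:0, 0, 1:]\<close>. At 0 the difference quotient is the member
  of the family with polynomial \<open>pCons 0 p\<close>, which tends to 0.\<close>

lemma flat_exp_has_derivative:
  "(flat_exp p has_real_derivative flat_exp ([:0, 0, 1:] * (p - pderiv p)) t) (at t)"
proof -
  consider "t > 0" | "t < 0" | "t = 0" by linarith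
  then show ?thesis
  proof cases
    case 1
    have "((\<lambda>t. poly p (1 / t) * exp (- (1 / t))) has_real_derivative
        flat_exp ([:0, 0, 1:] * (p - pderiv p)) t) (at t)"
    proof -
      have "((\<lambda>t. 1 / t) has_real_derivative - (1 / t\<^sup>2)) (at t)"
        using 1 by (auto intro!: derivative_eq_intros simp: power2_eq_square)
      note d = this
      have "((\<lambda>t. poly p (1 / t) * exp (- (1 / t))) has_real_derivative
          poly (pderiv p) (1 / t) * - (1 / t\<^sup>2) * exp (- (1 / t))
          + exp (- (1 / t)) * - (- (1 / t\<^sup>2)) * poly p (1 / t)) (at t)"
        by (intro DERIV_mult DERIV_chain2[OF poly_DERIV d] DERIV_chain2[OF DERIV_exp DERIV_minus[OF d]])
      then show ?thesis
        using 1 by (simp add: flat_exp_def algebra_simps power2_eq_square)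
    qed
    then show ?thesis
      by (rule has_field_derivative_transform_within_open[where S = "{0<..}"])
        (use 1 in \<open>auto simp: flat_exp_def\<close>)
  next
    case 2
    have "((\<lambda>_. 0) has_real_derivative flat_exp ([:0, 0, 1:] * (p - pderiv p)) t) (at t)"
      using 2 by (simp add: flat_exp_def)
    then show ?thesis
      by (rule has_field_derivative_transform_within_open[where S = "{..<0}"])
        (use 2 in \<open>auto simp: flat_exp_def\<close>)
  next
    case 3
    have "flat_exp p h / h = flat_exp (pCons 0 p) h" for h
      by (simp add: flat_exp_def)
    then show ?thesis
      using flat_exp_tendsto_0[of "pCons 0 p"] 3 unfolding DERIV_def by (simp add: flat_exp_def[of _ 0])
  qed
qed

lemma Ck_flat_exp: "Ck k (flat_exp p)"
proof (induction k arbitrary: p)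
  case 0
  show ?case
    using flat_exp_has_derivative[of p] by (metis Ck.simps(1) DERIV_isCont continuous_at_imp_continuous_on)
next
  case (Suc k)
  then show ?case by (subst Ck_real_Suc[OF flat_exp_has_derivative]) simp
qed

text \<open>The parameter \<open>n\<close> steepens the flanks without moving the support: the
  function is positive exactly on the open box, at most 1, and tends to the indicator of the box as
  \<open>n\<close> grows.\<close>

definition bump :: "real \<Rightarrow> 'a::euclidean_space \<Rightarrow> 'a \<Rightarrow> 'a \<Rightarrow> real" where
  "bump n a b x =
     (\<Prod>i\<in>Basis. flat_exp [:1:] (n * (x \<bullet> i - a \<bullet> i)) * flat_exp [:1:] (n * (b \<bullet> i - x \<bullet> i)))"

lemma flat_exp_1_bounds: "0 \<le> flat_exp [:1:] t" "flat_exp [:1:] t \<le> 1"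
  by (auto simp: flat_exp_def)

lemma bump_nonneg: "0 \<le> bump n a b x" and bump_le_1: "bump n a b x \<le> 1"
  unfolding bump_def
  by (auto intro!: prod_nonneg prod_le_1 mult_nonneg_nonneg mult_le_one flat_exp_1_bounds)

lemma Ck_bump: "Ck k (bump n a b)"
proof -
  have "Ck k (\<lambda>x. flat_exp [:1:] (n * (x \<bullet> i - a \<bullet> i)))" for i
    using Ck_compose_affine[OF Ck_flat_exp, of k "[:1:]" "- n * (a \<bullet> i)" "n *\<^sub>R i"]
    by (simp add: algebra_simps inner_commute)
  moreover have "Ck k (\<lambda>x. flat_exp [:1:] (n * (b \<bullet> i - x \<bullet> i)))" for i
    using Ck_compose_affine[OF Ck_flat_exp, of k "[:1:]" "n * (b \<bullet> i)" "- n *\<^sub>R i"]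
    by (simp add: algebra_simps inner_commute)
  ultimately show ?thesis
    unfolding bump_def[abs_def] by (intro Ck_prod Ck_mult) auto
qed

lemma bump_pos_iff: "n > 0 \<Longrightarrow> bump n a b x > 0 \<longleftrightarrow> x \<in> box a b"
proof
  assume n: "n > 0" and "bump n a b x > 0"
  then have "flat_exp [:1:] (n * (x \<bullet> i - a \<bullet> i)) * flat_exp [:1:] (n * (b \<bullet> i - x \<bullet> i)) \<noteq> 0"
    if "i \<in> Basis" for i
    using that unfolding bump_def
    by (metis (no_types, lifting) finite_Basis less_irrefl prod_zero_iff)
  then have "n * (x \<bullet> i - a \<bullet> i) > 0 \<and> n * (b \<bullet> i - x \<bullet> i) > 0" if "i \<in> Basis" for i
    using that by (metis flat_exp_def mult_zero_left mult_zero_right)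
  then show "x \<in> box a b" using n by (auto simp: mem_box zero_less_mult_iff)
next
  assume "n > 0" "x \<in> box a b"
  then show "bump n a b x > 0"
    unfolding bump_def by (auto intro!: prod_pos simp: flat_exp_def mem_box)
qed

lemma bump_eq_0: "n > 0 \<Longrightarrow> x \<notin> box a b \<Longrightarrow> bump n a b x = 0"
  using bump_pos_iff[of n a b x] bump_nonneg[of n a b x] by auto

lemma bump_tendsto_indicator: "(\<lambda>n. bump (real (Suc n)) a b x) \<longlonglongrightarrow> indicator (box a b) x"
proof (cases "x \<in> box a b")
  case True
  have f: "(\<lambda>n. flat_exp [:1:] (real (Suc n) * t)) \<longlonglongrightarrow> 1" if "t > 0" for t
  proof -
    have "(\<lambda>n. exp (- ((1 / t) * (1 / real (Suc n))))) \<longlonglongrightarrow> exp (- ((1 / t) * 0))"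
      by (intro tendsto_intros LIMSEQ_Suc[OF lim_1_over_n])
    then show ?thesis using that by (simp add: flat_exp_def mult.commute)
  qed
  have "(\<lambda>n. bump (real (Suc n)) a b x) \<longlonglongrightarrow> (\<Prod>i\<in>(Basis::'a set). 1 * 1)"
    unfolding bump_def using True by (intro tendsto_prod tendsto_mult f) (auto simp: mem_box)
  then show ?thesis using True by simp
qed (simp add: bump_eq_0)

lemma test_fun_bump:
  assumes "n > 0" "cbox a b \<subseteq> S"
  shows "test_fun S (bump n a b)"
proof -
  have "{x. bump n a b x \<noteq> 0} \<subseteq> cbox a b"
    using bump_eq_0[OF assms(1)] box_subset_cbox by blast
  then have c: "closure {x. bump n a b x \<noteq> 0} \<subseteq> cbox a b"
    by (rule closure_minimal) (rule closed_cbox)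
  then show ?thesis
    unfolding test_fun_def using assms Ck_bump
    by (meson bounded_cbox bounded_subset closed_closure compact_eq_bounded_closed order_trans)
qed

lemma test_fun_continuous: "test_fun S \<phi> \<Longrightarrow> continuous_on UNIV \<phi>"
  unfolding test_fun_def using Ck_continuous by blast

lemma test_fun_bounded:
  assumes "test_fun S \<phi>"
  obtains B where "B > 0" "\<And>x. \<bar>\<phi> x\<bar> \<le> B"
proof -
  let ?K = "closure {x. \<phi> x \<noteq> 0}"
  have "compact (\<phi> ` ?K)"
    using assms test_fun_continuous[OF assms]
    by (intro compact_continuous_image) (auto simp: test_fun_def intro: continuous_on_subset)
  then obtain B where B: "B > 0" "\<And>y. y \<in> \<phi> ` ?K \<Longrightarrow> norm y \<le> B"
    using compact_imp_bounded bounded_pos by metis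
  have "\<bar>\<phi> x\<bar> \<le> B" for x
    using B closure_subset[of "{x. \<phi> x \<noteq> 0}"] by (cases "\<phi> x = 0") auto
  with B(1) show thesis by (rule that)
qed

lemma test_fun_support: "test_fun S \<phi> \<Longrightarrow> x \<notin> S \<Longrightarrow> \<phi> x = 0"
  unfolding test_fun_def using closure_subset[of "{x. \<phi> x \<noteq> 0}"] by auto

lemma test_fun_partial:
  assumes "test_fun S \<phi>" "i \<in> Basis"
  shows "test_fun S (partial i \<phi>)"
proof -
  have "partial i \<phi> x = 0" if "x \<notin> closure {x. \<phi> x \<noteq> 0}" for x
  proof -
    have "(\<phi> has_derivative (\<lambda>_. 0)) (at x)"
    proof (rule has_derivative_transform_within_open[OF has_derivative_const])
      show "open (- closure {x. \<phi> x \<noteq> 0})" by (rule open_Compl[OF closed_closure])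
      show "x \<in> - closure {x. \<phi> x \<noteq> 0}" using that by simp
      show "0 = \<phi> y" if "y \<in> - closure {x. \<phi> x \<noteq> 0}" for y
        using that closure_subset[of "{x. \<phi> x \<noteq> 0}"] by auto
    qed
    then show ?thesis by (rule partial_has_derivative)
  qed
  then have sub: "closure {x. partial i \<phi> x \<noteq> 0} \<subseteq> closure {x. \<phi> x \<noteq> 0}"
    by (intro closure_minimal) auto
  have "Ck k (partial i \<phi>)" for k
    using assms unfolding test_fun_def by (metis Ck.simps(2))
  moreover have "compact (closure {x. partial i \<phi> x \<noteq> 0})"
    using sub assms(1) unfolding test_fun_def
    by (meson closed_closure compact_closure bounded_closure bounded_subset compact_imp_bounded compact_eq_bounded_closed)
  ultimately show ?thesis using assms(1) sub unfolding test_fun_def by blast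
qed

lemma bounded_measurable_zero_outside_integrable:
  fixes \<phi> :: "'a::euclidean_space \<Rightarrow> real"
  assumes [measurable]: "\<phi> \<in> borel_measurable borel" and "\<And>x. \<bar>\<phi> x\<bar> \<le> B"
    and "bounded K" "\<And>x. x \<notin> K \<Longrightarrow> \<phi> x = 0"
  shows "integrable lborel (\<lambda>x. (\<phi> x)\<^sup>2)"
proof -
  obtain a b where K: "K \<subseteq> cbox a (b :: 'a)"
    using assms(3) bounded_subset_cbox_symmetric by metis
  have "integrable lborel (\<lambda>x. B\<^sup>2 * indicator (cbox a b) x)"
    using emeasure_lborel_cbox_finite[of a b] by (intro integrable_mult_right integrable_real_indicator) simp_all
  then show ?thesis
  proof (rule Bochner_Integration.integrable_bound)
    show "AE x in lborel. norm ((\<phi> x)\<^sup>2) \<le> norm (B\<^sup>2 * indicator (cbox a b) x)"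
    proof (rule AE_I2)
      fix x
      have "(\<phi> x)\<^sup>2 \<le> B\<^sup>2"
        using assms(2)[of x] by (intro power2_le_iff_abs_le[THEN iffD2]) auto
      then show "norm ((\<phi> x)\<^sup>2) \<le> norm (B\<^sup>2 * indicator (cbox a b) x)"
        using K assms(4)[of x] by (auto simp: indicator_def)
    qed
  qed measurable
qed

lemma test_fun_square_integrable:
  assumes "test_fun S \<phi>"
  shows "\<phi> \<in> borel_measurable borel" "integrable lborel (\<lambda>x. (\<phi> x)\<^sup>2)"
proof -
  show m: "\<phi> \<in> borel_measurable borel"
    using test_fun_continuous[OF assms] by (rule borel_measurable_continuous_onI)
  obtain B where "B > 0" "\<And>x. \<bar>\<phi> x\<bar> \<le> B"
    using test_fun_bounded[OF assms] by metis
  then show "integrable lborel (\<lambda>x. (\<phi> x)\<^sup>2)"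
    using assms closure_subset[of "{x. \<phi> x \<noteq> 0}"]
    by (intro bounded_measurable_zero_outside_integrable[OF m, where K = "closure {x. \<phi> x \<noteq> 0}"])
      (auto simp: test_fun_def compact_imp_bounded)
qed

section \<open>Square-integrable functions orthogonal to boxes or test functions\<close>

definition box_l2 :: "'a::euclidean_space \<Rightarrow> 'a \<Rightarrow> 'a l2" where
  "box_l2 a b = abs_l2 (indicator (box a b))"

lemma bor_box_l2: "AE x in lborel. bor (box_l2 a b) x = indicator (box a b) x"
  unfolding box_l2_def
  by (rule bor_abs_l2)
    (auto intro!: bounded_measurable_zero_outside_integrable[where B = 1 and K = "box a b"] simp: bounded_box)

lemma bor_test_fun:
  assumes "test_fun S \<phi>"
  shows "AE x in lborel. bor (abs_l2 \<phi>) x = \<phi> x"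
  by (rule bor_abs_l2[OF test_fun_square_integrable[OF assms]])

lemma inner_bor_cong:
  assumes "AE x in lborel. bor v x = g x" "g \<in> borel_measurable borel"
  shows "inner u v = (LINT x|lborel. bor u x * g x)"
  unfolding inner_bor
proof (rule integral_cong_AE)
  show "AE x in lborel. bor u x * bor v x = bor u x * g x"
    using assms(1) by eventually_elim simp
qed (use assms(2) in \<open>simp_all add: borel_measurable_times\<close>)

lemma bor_mult_integrable_cong:
  assumes "AE x in lborel. bor v x = g x" "g \<in> borel_measurable borel"
  shows "integrable lborel (\<lambda>x. bor u x * g x)"
proof (rule integrable_cong_AE_imp[OF bor_mult_integrable[of u v]])
  show "AE x in lborel. bor u x * bor v x = bor u x * g x"
    using assms(1) by eventually_elim simp
qed (use assms(2) in \<open>simp_all add: borel_measurable_times\<close>)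

text \<open>Inside a closed box contained in \<open>S\<close>, the Borel sets over which the
  function integrates to 0 form a Dynkin system that contains the open boxes, a generator stable
  under intersection. Hence all these integrals vanish and the function is 0 there. Countably many
  such boxes exhaust \<open>S\<close>.\<close>

lemma zero_AE_if_orthogonal_boxes:
  fixes u :: "'a::euclidean_space l2"
  assumes "open S" and orth: "\<And>a b. cbox a b \<subseteq> S \<Longrightarrow> inner u (box_l2 a b) = 0"
  shows "AE x in lborel. x \<in> S \<longrightarrow> bor u x = 0"
proof -
  have int0: "(LINT x|lborel. bor u x * indicator (box a b) x) = 0" if "cbox a b \<subseteq> S" for a b
    using orth[OF that] inner_bor_cong[OF bor_box_l2[of a b], of u] by simp
  have on_box: "AE x in lborel. x \<in> box a b \<longrightarrow> bor u x = 0" if ab: "cbox a b \<subseteq> S" for a b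
  proof -
    define f where "f x = bor u x * indicator (box a b) x" for x
    have f: "integrable lborel f"
      unfolding f_def by (rule bor_mult_integrable_cong[OF bor_box_l2]) simp
    have f0: "set_lebesgue_integral lborel UNIV f = 0"
      using int0[OF ab] by (simp add: set_lebesgue_integral_def f_def)
    have si: "set_integrable lborel A f" if "A \<in> sets borel" for A
      using f that unfolding set_integrable_def by (intro integrable_mult_indicator) auto
    have "set_lebesgue_integral lborel A f = 0" if "A \<in> sets borel" for A
    proof -
      have "Int_stable (range (\<lambda>(c, d). box c (d :: 'a)))"
        by (auto simp: Int_stable_def box_Int_box)
      moreover have "range (\<lambda>(c, d). box c (d :: 'a)) \<subseteq> Pow UNIV" by simp
      moreover have "A \<in> sigma_sets UNIV (range (\<lambda>(c, d). box c (d :: 'a)))"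
        using that by (simp add: borel_eq_box)
      ultimately show ?thesis
      proof (induction rule: sigma_sets_induct_disjoint)
        case (basic A)
        then obtain c d where A: "A = box c d" by auto
        let ?l = "\<Sum>i\<in>Basis. max (a \<bullet> i) (c \<bullet> i) *\<^sub>R i" and ?r = "\<Sum>i\<in>Basis. min (b \<bullet> i) (d \<bullet> i) *\<^sub>R i"
        have e: "box a b \<inter> box c d = box ?l ?r" by (rule box_Int_box)
        have "cbox ?l ?r \<subseteq> cbox a b" by (auto simp: mem_box)
        then have "(LINT x|lborel. bor u x * indicator (box ?l ?r) x) = 0"
          using ab by (intro int0) auto
        moreover have "indicator A x *\<^sub>R f x = bor u x * indicator (box ?l ?r) x" for x
          unfolding e[symmetric] by (auto simp: A f_def indicator_def)
        ultimately show ?case by (simp add: set_lebesgue_integral_def)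
      next
        case empty
        show ?case by (simp add: set_lebesgue_integral_def)
      next
        case (compl A)
        then have "A \<in> sets borel" by (simp add: borel_eq_box)
        then have "set_lebesgue_integral lborel (A \<union> (UNIV - A)) f =
            set_lebesgue_integral lborel A f + set_lebesgue_integral lborel (UNIV - A) f"
          by (intro set_integral_Un si) auto
        with compl f0 show ?case by simp
      next
        case (union A)
        then have A: "A i \<in> sets borel" for i by (auto simp: borel_eq_box)
        have "set_lebesgue_integral lborel (\<Union>(range A)) f = (\<Sum>i. set_lebesgue_integral lborel (A i) f)"
          using A union by (intro lebesgue_integral_countable_add si) (auto simp: disjoint_family_on_def)
        with union show ?case by simp
      qed
    qed
    then have "AE x in lborel. f x = 0" using sigma_finite_measure.density_zero[OF sigma_finite_lborel f] by simp
    then show ?thesis by eventually_elim (auto simp: f_def)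
  qed
  \<comment> \<open>The countable cover used below consists of closed boxes, so their boundaries,
    null sets, have to be added.\<close>
  have on_cbox: "AE x in lborel. x \<in> cbox a b \<longrightarrow> bor u x = 0" if ab: "cbox a b \<subseteq> S" for a b
  proof -
    have "cbox a b - box a b \<in> null_sets lebesgue"
      using negligible_frontier_interval[of a b] by (simp add: negligible_iff_null_sets)
    then have "AE x in lborel. x \<notin> cbox a b - box a b"
      using AE_not_in AE_completion_iff by blast
    with on_box[OF ab] show ?thesis by eventually_elim auto
  qed
  obtain \<D> where D: "countable \<D>" "\<D> \<subseteq> Pow S" "\<And>X. X \<in> \<D> \<Longrightarrow> \<exists>a b. X = cbox a b" "\<Union>\<D> = S"
    using open_countable_Union_open_cbox[OF assms(1)] by metis
  have "AE x in lborel. \<forall>X\<in>\<D>. x \<in> X \<longrightarrow> bor u x = 0"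
  proof (subst AE_ball_countable[OF D(1)], intro ballI)
    fix X assume "X \<in> \<D>"
    then show "AE x in lborel. x \<in> X \<longrightarrow> bor u x = 0"
      using D(2) D(3)[of X] on_cbox by blast
  qed
  then show ?thesis by eventually_elim (use D(4) in auto)
qed

lemma zero_if_orthogonal_boxes:
  fixes u :: "'a::euclidean_space l2"
  assumes "\<And>a b. inner u (box_l2 a b) = 0"
  shows "u = 0"
proof (rule bor_eqI)
  show "AE x in lborel. bor u x = bor 0 x"
    using zero_AE_if_orthogonal_boxes[OF open_UNIV, of u] assms bor_zero by auto
qed

text \<open>The fundamental lemma of the calculus of variations, reduced to boxes: steepening bumps
  converge to the indicator of a box and are dominated by it.\<close>

lemma zero_AE_if_orthogonal_test_fun:
  fixes u :: "'a::euclidean_space l2"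
  assumes "open S" and orth: "\<And>\<phi>. test_fun S \<phi> \<Longrightarrow> (LINT x|lborel. bor u x * \<phi> x) = 0"
  shows "AE x in lborel. x \<in> S \<longrightarrow> bor u x = 0"
proof (rule zero_AE_if_orthogonal_boxes[OF assms(1)])
  fix a b :: 'a
  assume ab: "cbox a b \<subseteq> S"
  have "(\<lambda>n. LINT x|lborel. bor u x * bump (real (Suc n)) a b x)
      \<longlonglongrightarrow> (LINT x|lborel. bor u x * indicator (box a b) x)"
  proof (rule integral_dominated_convergence)
    have [measurable]: "bump (real (Suc n)) a b \<in> borel_measurable borel" for n
      using Ck_continuous[OF Ck_bump] by (rule borel_measurable_continuous_onI)
    show "(\<lambda>x. bor u x * bump (real (Suc n)) a b x) \<in> borel_measurable lborel" for n
      by measurable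
    show "integrable lborel (\<lambda>x. \<bar>bor u x * indicator (box a b) x\<bar>)"
      by (intro integrable_abs bor_mult_integrable_cong[OF bor_box_l2]) simp
    show "AE x in lborel. (\<lambda>n. bor u x * bump (real (Suc n)) a b x) \<longlonglongrightarrow> bor u x * indicator (box a b) x"
      by (intro AE_I2 tendsto_intros bump_tendsto_indicator)
    show "AE x in lborel. norm (bor u x * bump (real (Suc n)) a b x) \<le> \<bar>bor u x * indicator (box a b) x\<bar>" for n
    proof (rule AE_I2)
      fix x
      have "bump (real (Suc n)) a b x \<le> indicator (box a b) x"
        using bump_le_1 bump_eq_0[of "real (Suc n)" x a b] by (auto simp: indicator_def)
      then show "norm (bor u x * bump (real (Suc n)) a b x) \<le> \<bar>bor u x * indicator (box a b) x\<bar>"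
        using bump_nonneg[of "real (Suc n)" a b x] by (simp add: abs_mult mult_left_mono)
    qed
  qed measurable
  then show "inner u (box_l2 a b) = 0"
    using orth[OF test_fun_bump[OF _ ab]] inner_bor_cong[OF bor_box_l2[of a b], of u]
    by (simp add: LIMSEQ_const_iff)
qed

section \<open>Functions on a subset and their slices\<close>

definition toL2 :: "'a::euclidean_space set \<Rightarrow> ('a \<Rightarrow> real) \<Rightarrow> 'a l2" where
  "toL2 S f = abs_l2 (\<lambda>x. indicator S x * f x)"

lemma L2_fun_indicator:
  assumes "S \<in> sets lebesgue"
  shows "L2_fun UNIV (\<lambda>x. indicator S x * f x) \<longleftrightarrow> L2_fun S f"
proof -
  have "(\<lambda>x. (indicator S x * f x)\<^sup>2) = (\<lambda>x. indicator S x *\<^sub>R (f x)\<^sup>2)"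
    by (auto simp: indicator_def)
  then show ?thesis
    using assms by (simp add: L2_fun_UNIV L2_fun_def integrable_restrict_space borel_measurable_restrict_space_iff)
qed

lemma rep_toL2:
  assumes "S \<in> sets lebesgue" "L2_fun S f"
  shows "AE x in lebesgue. rep_l2 (toL2 S f) x = indicator S x * f x"
  unfolding toL2_def using assms by (intro rep_abs_l2) (simp add: L2_fun_indicator)

lemma L2_fun_restrict:
  assumes "S \<in> sets lebesgue" "L2_fun UNIV f"
  shows "L2_fun S f"
  using assms by (auto simp: L2_fun_UNIV L2_fun_def integrable_restrict_space borel_measurable_restrict_space_iff
      intro!: integrable_mult_indicator[where 'b = real, simplified] borel_measurable_times)

lemma inner_toL2:
  assumes "S \<in> sets lebesgue" "L2_fun S f"
  shows "inner u (toL2 S f) = (LINT x|lebesgue_on S. rep_l2 u x * f x)"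
proof -
  have "(\<lambda>x. indicator S x * f x) \<in> borel_measurable lebesgue"
    using assms L2_fun_indicator[of S f] by (simp add: L2_fun_UNIV)
  then have "inner u (toL2 S f) = (LINT x|lebesgue. rep_l2 u x * (indicator S x * f x))"
    by (intro inner_l2_cong rep_toL2 assms) auto
  also have "\<dots> = (LINT x|lebesgue. indicator S x *\<^sub>R (rep_l2 u x * f x))"
    by (simp add: algebra_simps)
  also have "\<dots> = (LINT x|lebesgue_on S. rep_l2 u x * f x)"
    using assms by (simp add: integral_restrict_space)
  finally show ?thesis .
qed

lemma AE_lebesgue_on_iff:
  "S \<in> sets lebesgue \<Longrightarrow> (AE x in lebesgue_on S. P x) \<longleftrightarrow> (AE x in lebesgue. x \<in> S \<longrightarrow> P x)"
  by (rule AE_restrict_space_iff) simp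

lemma inner_toL2_toL2:
  assumes "S \<in> sets lebesgue" "L2_fun S f" "L2_fun S g"
  shows "inner (toL2 S f) (toL2 S g) = (LINT x|lebesgue_on S. f x * g x)"
  unfolding inner_toL2[OF assms(1,3)]
proof (rule integral_cong_AE)
  show "AE x in lebesgue_on S. rep_l2 (toL2 S f) x * g x = f x * g x"
    using rep_toL2[OF assms(1,2)] unfolding AE_lebesgue_on_iff[OF assms(1)]
    by eventually_elim auto
  show "(\<lambda>x. rep_l2 (toL2 S f) x * g x) \<in> borel_measurable (lebesgue_on S)"
    using assms(3) measurable_restrict_space1[OF rep_l2_measurable]
    by (intro borel_measurable_times) (auto simp: L2_fun_def)
  show "(\<lambda>x. f x * g x) \<in> borel_measurable (lebesgue_on S)"
    using assms(2,3) by (intro borel_measurable_times) (auto simp: L2_fun_def)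
qed

lemma norm_toL2:
  assumes "S \<in> sets lebesgue" "L2_fun S f"
  shows "norm (toL2 S f) = L2_norm_fun S f"
  unfolding norm_eq_sqrt_inner inner_toL2_toL2[OF assms assms(2)] L2_norm_fun_def
  by (simp add: power2_eq_square)

lemma toL2_eq_iff:
  assumes "S \<in> sets lebesgue" "L2_fun S f" "L2_fun S g"
  shows "toL2 S f = toL2 S g \<longleftrightarrow> (AE x in lebesgue_on S. f x = g x)"
  unfolding l2_eq_iff AE_lebesgue_on_iff[OF assms(1)]
proof
  assume "AE x in lebesgue. rep_l2 (toL2 S f) x = rep_l2 (toL2 S g) x"
  then show "AE x in lebesgue. x \<in> S \<longrightarrow> f x = g x"
    using rep_toL2[OF assms(1,2)] rep_toL2[OF assms(1,3)] by eventually_elim auto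
next
  assume "AE x in lebesgue. x \<in> S \<longrightarrow> f x = g x"
  then show "AE x in lebesgue. rep_l2 (toL2 S f) x = rep_l2 (toL2 S g) x"
    using rep_toL2[OF assms(1,2)] rep_toL2[OF assms(1,3)] by eventually_elim (auto simp: indicator_def)
qed

lemma toL2_add:
  assumes "S \<in> sets lebesgue" "L2_fun S f" "L2_fun S g"
  shows "toL2 S (\<lambda>x. f x + g x) = toL2 S f + toL2 S g"
  using rep_toL2[OF assms(1,2)] rep_toL2[OF assms(1,3)] rep_toL2[OF assms(1) L2_fun_add[OF assms(2,3)]]
    rep_l2_add[of "toL2 S f" "toL2 S g"] unfolding l2_eq_iff
  by eventually_elim (simp add: algebra_simps)

lemma toL2_scale:
  assumes "S \<in> sets lebesgue" "L2_fun S f"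
  shows "toL2 S (\<lambda>x. c * f x) = c *\<^sub>R toL2 S f"
  using rep_toL2[OF assms] rep_toL2[OF assms(1) L2_fun_scale[OF assms(2)], of c]
    rep_l2_scaleR[of c "toL2 S f"] unfolding l2_eq_iff
  by eventually_elim (simp add: algebra_simps)

lemma L2_fun_diff: "L2_fun S f \<Longrightarrow> L2_fun S g \<Longrightarrow> L2_fun S (\<lambda>x. f x - g x)"
  using L2_fun_add[of S f "\<lambda>x. - 1 * g x"] L2_fun_scale[of S g "- 1"] by simp

lemma toL2_diff:
  assumes "S \<in> sets lebesgue" "L2_fun S f" "L2_fun S g"
  shows "toL2 S (\<lambda>x. f x - g x) = toL2 S f - toL2 S g"
  using toL2_add[OF assms(1,2) L2_fun_scale[OF assms(3)], of "- 1"] toL2_scale[OF assms(1,3), of "- 1"]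
  by simp

lemma toL2_in_L2_space:
  assumes "S \<in> sets lebesgue" "L2_fun S f"
  shows "toL2 S f \<in> L2_space S"
  using rep_toL2[OF assms] unfolding L2_space_def by (auto elim!: eventually_mono)

text \<open>This is the orthogonal projection onto \<open>L2_space S\<close>.\<close>

definition cut :: "'a::euclidean_space set \<Rightarrow> 'a l2 \<Rightarrow> 'a l2" where
  "cut S u = toL2 S (rep_l2 u)"

lemma L2_fun_on_rep_l2: "S \<in> sets lebesgue \<Longrightarrow> L2_fun S (rep_l2 u)"
  by (rule L2_fun_restrict[OF _ L2_fun_rep_l2])

lemma rep_cut: "S \<in> sets lebesgue \<Longrightarrow> AE x in lebesgue. rep_l2 (cut S u) x = indicator S x * rep_l2 u x"
  unfolding cut_def by (rule rep_toL2) (auto intro: L2_fun_on_rep_l2)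

lemma bor_cut: "S \<in> sets lebesgue \<Longrightarrow> AE x in lborel. bor (cut S u) x = indicator S x * bor u x"
  using rep_cut[of S u, unfolded AE_completion_iff] rep_eq_bor[of u] rep_eq_bor[of "cut S u"]
  by (auto elim!: eventually_elim2 simp: eq_commute)

lemma cut_in_L2_space: "S \<in> sets lebesgue \<Longrightarrow> cut S u \<in> L2_space S"
  unfolding cut_def by (intro toL2_in_L2_space L2_fun_on_rep_l2)

lemma cut_eq: "S \<in> sets lebesgue \<Longrightarrow> u \<in> L2_space S \<Longrightarrow> cut S u = u"
  using rep_cut[of S u] unfolding l2_eq_iff L2_space_def
  by (auto elim!: eventually_elim2 simp: indicator_def)

lemma L2_space_iff_cut: "S \<in> sets lebesgue \<Longrightarrow> u \<in> L2_space S \<longleftrightarrow> cut S u = u"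
  using cut_eq cut_in_L2_space by metis

lemma cut_add:
  assumes S: "S \<in> sets lebesgue"
  shows "cut S (u + v) = cut S u + cut S v"
  using rep_cut[OF S, of "u + v"] rep_cut[OF S, of u] rep_cut[OF S, of v]
    rep_l2_add[of u v] rep_l2_add[of "cut S u" "cut S v"]
  unfolding l2_eq_iff by eventually_elim (simp add: algebra_simps)

lemma cut_scaleR:
  assumes S: "S \<in> sets lebesgue"
  shows "cut S (c *\<^sub>R u) = c *\<^sub>R cut S u"
  using rep_cut[OF S, of "c *\<^sub>R u"] rep_cut[OF S, of u]
    rep_l2_scaleR[of c u] rep_l2_scaleR[of c "cut S u"]
  unfolding l2_eq_iff by eventually_elim (simp add: algebra_simps)

lemma linear_cut: "S \<in> sets lebesgue \<Longrightarrow> linear (cut S)"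
  by (intro linearI cut_add cut_scaleR)

lemma l2_inner_cut: "S \<in> sets lebesgue \<Longrightarrow> l2_inner S u v = inner (cut S u) (cut S v)"
  unfolding l2_inner_def cut_def by (simp add: inner_toL2_toL2 L2_fun_on_rep_l2)

lemma inner_cut_right:
  assumes "S \<in> sets lebesgue"
  shows "inner (cut S u) (cut S v) = inner u (cut S v)"
  unfolding cut_def inner_toL2_toL2[OF assms L2_fun_on_rep_l2[OF assms] L2_fun_on_rep_l2[OF assms]]
  by (rule inner_toL2[OF assms L2_fun_on_rep_l2[OF assms], symmetric])

lemma l2_inner_eq: "S \<in> sets lebesgue \<Longrightarrow> v \<in> L2_space S \<Longrightarrow> l2_inner S u v = inner u v"
  using l2_inner_cut inner_cut_right cut_eq by metis

lemma l2_norm_eq: "S \<in> sets lebesgue \<Longrightarrow> v \<in> L2_space S \<Longrightarrow> l2_norm S v = norm v"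
  by (simp add: l2_norm_def norm_eq_sqrt_inner l2_inner_eq)

lemma norm_cut_le: "S \<in> sets lebesgue \<Longrightarrow> norm (cut S u) \<le> norm u"
proof -
  assume S: "S \<in> sets lebesgue"
  have "(norm (cut S u))\<^sup>2 = inner u (cut S u)"
    unfolding power2_norm_eq_inner using inner_cut_right[OF S] .
  also have "\<dots> \<le> norm u * norm (cut S u)" by (rule norm_cauchy_schwarz)
  finally show ?thesis
    by (cases "norm (cut S u) = 0") (auto simp: power2_eq_square)
qed

lemma subspace_L2_space: "S \<in> sets lebesgue \<Longrightarrow> subspace (L2_space S)"
  unfolding subspace_def
  by (simp add: L2_space_iff_cut cut_add cut_scaleR linear_0[OF linear_cut])

lemma closed_L2_space:
  assumes S: "S \<in> sets lebesgue"
  shows "closed (L2_space S)"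
proof -
  have "bounded_linear (cut S)"
    using linear_cut[OF S] norm_cut_le[OF S]
    by (intro bounded_linear_intro[where K = 1]) (auto simp: linear_add linear_cmul)
  then have "continuous_on UNIV (cut S)" by (rule linear_continuous_on)
  then have "closed {u. cut S u = u}" by (intro closed_Collect_eq continuous_on_id)
  then show ?thesis by (simp flip: L2_space_iff_cut[OF S])
qed

lemma L2_space_bor_iff:
  "u \<in> L2_space S \<longleftrightarrow> (AE x in lborel. x \<notin> S \<longrightarrow> bor u x = 0)"
proof -
  have "u \<in> L2_space S \<longleftrightarrow> (AE x in lborel. x \<notin> S \<longrightarrow> rep_l2 u x = 0)"
    unfolding L2_space_def AE_completion_iff by simp
  also have "\<dots> \<longleftrightarrow> (AE x in lborel. x \<notin> S \<longrightarrow> bor u x = 0)"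
    using rep_eq_bor[of u] by (auto elim!: eventually_elim2)
  finally show ?thesis .
qed

text \<open>Completeness of Lebesgue measure: the set where \<open>f\<close> and \<open>g\<close>
  differ is contained in a null set, so every part of it is measurable.\<close>

lemma lebesgue_measurable_AE_cong:
  fixes f g :: "'a::euclidean_space \<Rightarrow> real"
  assumes [measurable]: "g \<in> borel_measurable lebesgue" and ae: "AE x in lebesgue. f x = g x"
  shows "f \<in> borel_measurable lebesgue"
proof (rule measurableI)
  fix A :: "real set"
  assume [measurable]: "A \<in> sets borel"
  have ae': "AE x in lborel. f x = g x" using ae unfolding AE_completion_iff .
  have [measurable]: "Measurable.pred lebesgue (\<lambda>x. g x \<in> A \<and> f x \<noteq> g x)"
    by (rule sets_completion_AE) (use ae' in \<open>auto elim!: eventually_mono\<close>)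
  have [measurable]: "Measurable.pred lebesgue (\<lambda>x. f x \<in> A \<and> f x \<noteq> g x)"
    by (rule sets_completion_AE) (use ae' in \<open>auto elim!: eventually_mono\<close>)
  have "f -` A \<inter> space lebesgue =
      {x \<in> space lebesgue. (g x \<in> A \<and> \<not> (g x \<in> A \<and> f x \<noteq> g x)) \<or> (f x \<in> A \<and> f x \<noteq> g x)}"
    by auto
  also have "\<dots> \<in> sets lebesgue" by measurable
  finally show "f -` A \<inter> space lebesgue \<in> sets lebesgue" .
qed simp

lemma L2_fun_AE_cong:
  assumes "L2_fun UNIV g" "AE x in lebesgue. f x = g x"
  shows "L2_fun UNIV f"
proof -
  have m: "f \<in> borel_measurable lebesgue" "g \<in> borel_measurable lebesgue"
    using assms lebesgue_measurable_AE_cong by (auto simp: L2_fun_UNIV)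
  have "integrable lebesgue (\<lambda>x. (f x)\<^sup>2)"
  proof (rule integrable_cong_AE_imp)
    show "integrable lebesgue (\<lambda>x. (g x)\<^sup>2)" using assms by (simp add: L2_fun_UNIV)
    show "AE x in lebesgue. (g x)\<^sup>2 = (f x)\<^sup>2" using assms(2) by eventually_elim simp
  qed (use m in simp)
  with m show ?thesis by (simp add: L2_fun_UNIV)
qed

section \<open>Time slices of functions on space-time\<close>

lemma AE_lborel_pair:
  assumes "AE z in (lborel :: ('a::euclidean_space \<times> 'b::euclidean_space) measure). P z"
  shows "AE t in lborel. AE x in lborel. P (t, x)"
  by (rule lborel_pair.AE_pair[of P, unfolded lborel_prod, OF assms])

text \<open>The property \<open>P\<close> need not be measurable, whereas exchanging the two
  quantifiers asks for a measurable set. The exchange is therefore made for a measurable null set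
  \<open>N\<close> that contains all exceptions.\<close>

lemma AE_lborel_pair_swap:
  assumes "AE z in (lborel :: ('a::euclidean_space \<times> 'b::euclidean_space) measure). P z"
  shows "AE x in lborel. AE t in lborel. P (t, x)"
proof -
  obtain N where N: "N \<in> null_sets lborel" "{z \<in> space lborel. \<not> P z} \<subseteq> N"
    using assms by (auto elim!: AE_E simp: null_sets_def)
  have "AE t in lborel. AE x in lborel. (t, x) \<notin> N"
    using AE_lborel_pair[OF AE_not_in[OF N(1)]] .
  moreover have "{z \<in> space (lborel \<Otimes>\<^sub>M lborel). (fst z, snd z) \<notin> N} = - N"
    by (auto simp: space_pair_measure)
  moreover have "- N \<in> sets (lborel \<Otimes>\<^sub>M lborel)"
    unfolding lborel_prod using N(1) by (auto simp: null_sets_def)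
  ultimately have "AE x in lborel. AE t in lborel. (t, x) \<notin> N"
    using lborel_pair.AE_commute[of "\<lambda>t x. (t, x) \<notin> N"] by simp
  then show ?thesis
    by (elim eventually_mono) (use N(2) in \<open>auto elim!: eventually_mono\<close>)
qed

lemma AE_slice_square_integrable: "AE t in lborel. integrable lborel (\<lambda>x. (bor u (t, x))\<^sup>2)"
  for u :: "(real \<times> 'a::euclidean_space) l2"
  using lborel_pair.AE_integrable_fst'[of "\<lambda>z. (bor u z)\<^sup>2"] bor_square_integrable[of u]
  by (simp add: lborel_prod)

lemma slice_AE:
  "AE t in lborel. AE x in lebesgue. slice u t x = bor u (t, x)"
  unfolding slice_def AE_completion_iff by (rule AE_lborel_pair[OF rep_eq_bor])

text \<open>
  The slices are taken from a Borel representative, and those that are not square-integrable are replaced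
  by 0: this makes inner products of slices Borel measurable functions of time.
\<close>

definition sl :: "'a::euclidean_space set \<Rightarrow> (real \<times> 'a) l2 \<Rightarrow> real \<Rightarrow> 'a l2" where
  "sl \<Omega> u t = (if integrable lborel (\<lambda>x. (bor u (t, x))\<^sup>2)
     then abs_l2 (\<lambda>x. indicator \<Omega> x * bor u (t, x)) else 0)"

context
  fixes \<Omega> :: "'a::euclidean_space set"
  assumes \<Omega> [measurable]: "\<Omega> \<in> sets borel"
begin

lemma bor_sl_if:
  assumes "integrable lborel (\<lambda>x. (bor u (t, x))\<^sup>2)"
  shows "AE x in lborel. bor (sl \<Omega> u t) x = indicator \<Omega> x * bor u (t, x)"
proof -
  have [measurable]: "(\<lambda>x. bor u (t, x)) \<in> borel_measurable borel" by measurable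
  have "integrable lborel (\<lambda>x. indicator \<Omega> x *\<^sub>R (bor u (t, x))\<^sup>2)"
    by (intro integrable_mult_indicator assms) simp
  also have "(\<lambda>x. indicator \<Omega> x *\<^sub>R (bor u (t, x))\<^sup>2) = (\<lambda>x. (indicator \<Omega> x * bor u (t, x))\<^sup>2)"
    by (auto simp: indicator_def)
  finally show ?thesis
    unfolding sl_def using assms by (simp add: bor_abs_l2)
qed

lemma bor_sl: "AE t in lborel. AE x in lborel. bor (sl \<Omega> u t) x = indicator \<Omega> x * bor u (t, x)"
  using AE_slice_square_integrable[of u] by eventually_elim (rule bor_sl_if)

text \<open>The formula holds at every time and not merely almost every time. Its right-hand side is
  visibly Borel in \<open>t\<close>, which is how measurability of inner products of slices is
  obtained.\<close>

lemma inner_sl_eq: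
  "inner (sl \<Omega> u t) (sl \<Omega> v t) =
    (if integrable lborel (\<lambda>x. (bor u (t, x))\<^sup>2) \<and> integrable lborel (\<lambda>x. (bor v (t, x))\<^sup>2)
     then LINT x|lborel. indicator \<Omega> x * (bor u (t, x) * bor v (t, x)) else 0)"
proof (cases "integrable lborel (\<lambda>x. (bor u (t, x))\<^sup>2) \<and> integrable lborel (\<lambda>x. (bor v (t, x))\<^sup>2)")
  case True
  have "inner (sl \<Omega> u t) (sl \<Omega> v t) = (LINT x|lborel. indicator \<Omega> x * (bor u (t, x) * bor v (t, x)))"
    unfolding inner_bor
  proof (rule integral_cong_AE)
    show "AE x in lborel. bor (sl \<Omega> u t) x * bor (sl \<Omega> v t) x = indicator \<Omega> x * (bor u (t, x) * bor v (t, x))"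
      using bor_sl_if[OF conjunct1[OF True]] bor_sl_if[OF conjunct2[OF True]]
      by eventually_elim (auto simp: indicator_def)
  qed measurable
  with True show ?thesis by simp
qed (auto simp: sl_def)

lemma L2_fun_slice: "AE t in lborel. L2_fun \<Omega> (slice u t)"
proof -
  show ?thesis using AE_slice_square_integrable[of u] slice_AE[of u]
  proof eventually_elim
    case (elim t)
    have [measurable]: "(\<lambda>x. bor u (t, x)) \<in> borel_measurable borel" by measurable
    have "L2_fun UNIV (\<lambda>x. bor u (t, x))"
      using elim(1) by (simp add: L2_fun_UNIV measurable_completion integrable_completion)
    then have "L2_fun UNIV (slice u t)"
      using elim(2) by (rule L2_fun_AE_cong)
    then show ?case by (rule L2_fun_restrict[rotated]) simp
  qed
qed

text \<open>The bridge from the slices in the definitions of the spaces, which use an arbitrary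
  representative, to the Borel slices \<open>sl\<close>.\<close>

lemma toL2_slice: "AE t in lborel. toL2 \<Omega> (slice u t) = sl \<Omega> u t"
  using slice_AE[of u] L2_fun_slice[of u] bor_sl[of u]
proof eventually_elim
  case (elim t)
  have "AE x in lebesgue. rep_l2 (toL2 \<Omega> (slice u t)) x = indicator \<Omega> x * slice u t x"
    using elim(2) by (intro rep_toL2) auto
  moreover have "AE x in lebesgue. bor (sl \<Omega> u t) x = indicator \<Omega> x * bor u (t, x)"
    using elim(3) by (rule AE_completion)
  moreover have "AE x in lebesgue. rep_l2 (sl \<Omega> u t) x = bor (sl \<Omega> u t) x"
    using rep_eq_bor by (rule AE_completion)
  ultimately show ?case
    unfolding l2_eq_iff using elim(1) by eventually_elim simp
qed

lemma sl_in_L2_space: "AE t in lborel. sl \<Omega> u t \<in> L2_space \<Omega>"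
  using toL2_slice[of u] L2_fun_slice[of u]
proof eventually_elim
  case (elim t)
  have "toL2 \<Omega> (slice u t) \<in> L2_space \<Omega>" using elim(2) by (intro toL2_in_L2_space) auto
  then show ?case using elim(1) by simp
qed

lemma sl_add: "AE t in lborel. sl \<Omega> (u + v) t = sl \<Omega> u t + sl \<Omega> v t"
  using AE_lborel_pair[OF bor_add[of u v]] bor_sl[of u] bor_sl[of v] bor_sl[of "u + v"]
proof eventually_elim
  case (elim t)
  show ?case
    by (rule bor_eqI, use elim bor_add[of "sl \<Omega> u t" "sl \<Omega> v t"] in eventually_elim)
      (simp add: algebra_simps)
qed

lemma sl_scaleR: "AE t in lborel. sl \<Omega> (c *\<^sub>R u) t = c *\<^sub>R sl \<Omega> u t"
  using AE_lborel_pair[OF bor_scaleR[of c u]] bor_sl[of u] bor_sl[of "c *\<^sub>R u"]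
proof eventually_elim
  case (elim t)
  show ?case
    by (rule bor_eqI, use elim bor_scaleR[of c "sl \<Omega> u t"] in eventually_elim)
      (simp add: algebra_simps)
qed

lemma sl_diff: "AE t in lborel. sl \<Omega> (u - v) t = sl \<Omega> u t - sl \<Omega> v t"
  using sl_add[of u "- v"] sl_scaleR[of "- 1" v] by eventually_elim simp

lemma cyl_measurable [measurable]: "cyl T \<Omega> \<in> sets borel"
  unfolding cyl_def using \<Omega> by (simp add: borel_prod[symmetric] pair_measureI)

lemma sl_outside:
  assumes "u \<in> L2_space (cyl T \<Omega>)"
  shows "AE t in lborel. t \<notin> {0<..<T} \<longrightarrow> sl \<Omega> u t = 0"
  using AE_lborel_pair[OF assms[unfolded L2_space_bor_iff]] bor_sl[of u]
proof eventually_elim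
  case (elim t)
  show ?case
  proof
    assume "t \<notin> {0<..<T}"
    then show "sl \<Omega> u t = 0"
      by (intro bor_eqI, use elim bor_zero in eventually_elim) (auto simp: cyl_def)
  qed
qed

text \<open>Fubini's theorem. One factor vanishing outside the cylinder suffices: it makes the
  product blind to the restriction to \<Omega> that is built into \<open>sl\<close>.\<close>

lemma inner_sl:
  assumes "u \<in> L2_space (cyl T \<Omega>)"
  shows "integrable lborel (\<lambda>t. inner (sl \<Omega> u t) (sl \<Omega> v t))"
    and "inner u v = (LINT t|lborel. inner (sl \<Omega> u t) (sl \<Omega> v t))"
proof -
  let ?f = "\<lambda>z. bor u z * bor v z"
  have f: "integrable (lborel \<Otimes>\<^sub>M lborel) ?f"
    using bor_mult_integrable[of u v] by (simp add: lborel_prod)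
  have ae: "AE t in lborel. (LINT x|lborel. ?f (t, x)) = inner (sl \<Omega> u t) (sl \<Omega> v t)"
    using AE_lborel_pair[OF assms[unfolded L2_space_bor_iff]] bor_sl[of u] bor_sl[of v]
  proof eventually_elim
    case (elim t)
    have [measurable]: "(\<lambda>x. bor w (t, x)) \<in> borel_measurable borel" for w :: "(real \<times> 'a) l2"
      by measurable
    show ?case unfolding inner_bor
      by (rule integral_cong_AE, measurable, use elim in eventually_elim)
        (auto simp: cyl_def indicator_def)
  qed
  have m: "(\<lambda>t. inner (sl \<Omega> u t) (sl \<Omega> v t)) \<in> borel_measurable lborel"
    unfolding inner_sl_eq by measurable
  show "integrable lborel (\<lambda>t. inner (sl \<Omega> u t) (sl \<Omega> v t))"
    by (rule integrable_cong_AE_imp[OF lborel_pair.integrable_fst'[OF f] m ae])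
  have "inner u v = (LINT t|lborel. LINT x|lborel. ?f (t, x))"
    unfolding inner_bor using lborel_pair.integral_fst'[OF f] by (simp add: lborel_prod)
  also have "\<dots> = (LINT t|lborel. inner (sl \<Omega> u t) (sl \<Omega> v t))"
    by (rule integral_cong_AE) (use m ae borel_measurable_integrable[OF lborel_pair.integrable_fst'[OF f]] in auto)
  finally show "inner u v = (LINT t|lborel. inner (sl \<Omega> u t) (sl \<Omega> v t))" .
qed

end

lemma eq_if_sl_eq:
  assumes \<Omega>: "\<Omega> \<in> sets borel" and u: "u \<in> L2_space (cyl T \<Omega>)" and v: "v \<in> L2_space (cyl T \<Omega>)"
    and eq: "AE t in lborel. t \<in> {0<..<T} \<longrightarrow> sl \<Omega> u t = sl \<Omega> v t"
  shows "u = v"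
proof -
  have cyl: "cyl T \<Omega> \<in> sets lebesgue" using cyl_measurable[OF \<Omega>] by simp
  have uv: "u - v \<in> L2_space (cyl T \<Omega>)" using subspace_diff[OF subspace_L2_space[OF cyl] u v] .
  have "inner (u - v) (u - v) = (LINT t|lborel. inner (sl \<Omega> (u - v) t) (sl \<Omega> (u - v) t))"
    by (rule inner_sl[OF \<Omega> uv])
  also have "\<dots> = 0"
  proof (rule integral_eq_zero_AE)
    show "AE t in lborel. inner (sl \<Omega> (u - v) t) (sl \<Omega> (u - v) t) = 0"
      using eq sl_diff[OF \<Omega>, of u v] sl_outside[OF \<Omega> uv] by eventually_elim auto
  qed
  finally show ?thesis by simp
qed

text \<open>Convergence in norm says that the squared norms of the slices of \<open>u n - v\<close>
  tend to 0 in L1 of the time axis, and an L1 null sequence has a subsequence that tends to 0 almost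
  everywhere.\<close>

lemma sl_subseq_tendsto:
  assumes \<Omega>: "\<Omega> \<in> sets borel" and u: "\<And>n. u n \<in> L2_space (cyl T \<Omega>)" and lim: "u \<longlonglongrightarrow> v"
  obtains r where "strict_mono r" "AE t in lborel. (\<lambda>n. sl \<Omega> (u (r n)) t) \<longlonglongrightarrow> sl \<Omega> v t"
proof -
  have cyl: "cyl T \<Omega> \<in> sets lebesgue" using cyl_measurable[OF \<Omega>] by simp
  have v: "v \<in> L2_space (cyl T \<Omega>)"
    using closed_sequentially[OF closed_L2_space[OF cyl]] u lim by blast
  have d: "u n - v \<in> L2_space (cyl T \<Omega>)" for n
    by (rule subspace_diff[OF subspace_L2_space[OF cyl] u v])
  let ?f = "\<lambda>n t. inner (sl \<Omega> (u n - v) t) (sl \<Omega> (u n - v) t)"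
  have "(\<lambda>n. inner (u n - v) (u n - v)) \<longlonglongrightarrow> inner (v - v) (v - v)"
    by (intro tendsto_intros lim)
  then have "(\<lambda>n. LINT t|lborel. norm (?f n t)) \<longlonglongrightarrow> 0"
    using inner_sl(2)[OF \<Omega> d] by simp
  from tendsto_L1_AE_subseq[OF inner_sl(1)[OF \<Omega> d] this] obtain r :: "nat \<Rightarrow> nat" where
    r: "strict_mono r" "AE t in lborel. (\<lambda>n. ?f (r n) t) \<longlonglongrightarrow> 0" by auto
  have "AE t in lborel. \<forall>n. sl \<Omega> (u n - v) t = sl \<Omega> (u n) t - sl \<Omega> v t"
    unfolding AE_all_countable using sl_diff[OF \<Omega>] by blast
  with r(2) have "AE t in lborel. (\<lambda>n. sl \<Omega> (u (r n)) t) \<longlonglongrightarrow> sl \<Omega> v t"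
  proof eventually_elim
    case (elim t)
    have "(\<lambda>n. sqrt (?f (r n) t)) \<longlonglongrightarrow> sqrt 0"
      by (rule tendsto_real_sqrt[OF elim(1)])
    then have "(\<lambda>n. norm (sl \<Omega> (u (r n)) t - sl \<Omega> v t)) \<longlonglongrightarrow> 0"
      using elim(2) by (simp add: norm_eq_sqrt_inner)
    then show ?case by (rule LIM_zero_cancel[OF tendsto_norm_zero_cancel])
  qed
  with r(1) show thesis by (rule that)
qed

section \<open>The Dirichlet Laplacian\<close>

lemma test_fun_scale: "test_fun S \<phi> \<Longrightarrow> test_fun S (\<lambda>x. c * \<phi> x)"
proof -
  assume \<phi>: "test_fun S \<phi>"
  have sub: "closure {x. c * \<phi> x \<noteq> 0} \<subseteq> closure {x. \<phi> x \<noteq> 0}"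
    by (intro closure_mono) auto
  moreover have "Ck k (\<lambda>x. c * \<phi> x)" for k
    using \<phi> by (intro Ck_mult Ck_const) (auto simp: test_fun_def)
  moreover have "compact (closure {x. c * \<phi> x \<noteq> 0})"
    using sub \<phi> unfolding test_fun_def
    by (meson bounded_subset closed_closure compact_eq_bounded_closed)
  ultimately show ?thesis using \<phi> unfolding test_fun_def by blast
qed

lemma test_fun_add:
  assumes "test_fun S \<phi>" "test_fun S \<psi>"
  shows "test_fun S (\<lambda>x. \<phi> x + \<psi> x)"
proof -
  let ?K = "closure {x. \<phi> x \<noteq> 0} \<union> closure {x. \<psi> x \<noteq> 0}"
  have sub: "closure {x. \<phi> x + \<psi> x \<noteq> 0} \<subseteq> ?K"
  proof (intro closure_minimal closed_Un closed_closure)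
    have "{x. \<phi> x + \<psi> x \<noteq> 0} \<subseteq> {x. \<phi> x \<noteq> 0} \<union> {x. \<psi> x \<noteq> 0}" by auto
    also have "\<dots> \<subseteq> ?K" by (intro Un_mono closure_subset)
    finally show "{x. \<phi> x + \<psi> x \<noteq> 0} \<subseteq> ?K" .
  qed
  have K: "compact ?K" "?K \<subseteq> S" using assms by (auto simp: test_fun_def)
  have "compact (closure {x. \<phi> x + \<psi> x \<noteq> 0})"
    using sub K(1) by (meson bounded_subset closed_closure compact_eq_bounded_closed)
  moreover have "Ck k (\<lambda>x. \<phi> x + \<psi> x)" for k
    using assms by (intro Ck_add) (auto simp: test_fun_def)
  ultimately show ?thesis using sub K(2) unfolding test_fun_def by blast
qed

lemma L2_fun_test_fun: "test_fun S \<phi> \<Longrightarrow> L2_fun UNIV \<phi>"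
  using test_fun_square_integrable[of S \<phi>]
  by (simp add: L2_fun_UNIV measurable_completion integrable_completion)

lemma toL2_test_fun: "test_fun S \<phi> \<Longrightarrow> toL2 S \<phi> = abs_l2 \<phi>"
proof -
  assume "test_fun S \<phi>"
  then have "(\<lambda>x. indicator S x * \<phi> x) = \<phi>"
    using test_fun_support[of S \<phi>] by (intro ext) (auto simp: indicator_def)
  then show ?thesis by (simp add: toL2_def)
qed

lemma abs_l2_add: "L2_fun UNIV f \<Longrightarrow> L2_fun UNIV g \<Longrightarrow> abs_l2 (\<lambda>x. f x + g x) = abs_l2 f + abs_l2 g"
  using toL2_add[of UNIV f g] by (simp add: toL2_def)

lemma abs_l2_scale: "L2_fun UNIV f \<Longrightarrow> abs_l2 (\<lambda>x. c * f x) = c *\<^sub>R abs_l2 f"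
  using toL2_scale[of UNIV f c] by (simp add: toL2_def)

lemma L2_fun_sum: "finite I \<Longrightarrow> (\<And>i. i \<in> I \<Longrightarrow> L2_fun S (f i)) \<Longrightarrow> L2_fun S (\<lambda>x. \<Sum>i\<in>I. f i x)"
proof (induction I rule: finite_induct)
  case empty
  then show ?case by (simp add: L2_fun_def)
next
  case (insert i I)
  then show ?case by (simp add: L2_fun_add)
qed

lemma toL2_sum:
  assumes "S \<in> sets lebesgue"
  shows "finite I \<Longrightarrow> (\<And>i. i \<in> I \<Longrightarrow> L2_fun S (f i)) \<Longrightarrow> toL2 S (\<lambda>x. \<Sum>i\<in>I. f i x) = (\<Sum>i\<in>I. toL2 S (f i))"
proof (induction I rule: finite_induct)
  case empty
  then show ?case by (simp add: toL2_def zero_l2_def)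
next
  case (insert i I)
  then show ?case
    using toL2_add[OF assms, of "f i" "\<lambda>x. \<Sum>i\<in>I. f i x"] L2_fun_sum[of I S f] by simp
qed

lemma sqrt_sum_squares_less:
  fixes a :: real and b :: "'i \<Rightarrow> real"
  assumes "finite I" "a \<ge> 0" "\<And>i. i \<in> I \<Longrightarrow> b i \<ge> 0" "a < \<epsilon> / (1 + card I)" "\<And>i. i \<in> I \<Longrightarrow> b i < \<epsilon> / (1 + card I)"
  shows "sqrt (a\<^sup>2 + (\<Sum>i\<in>I. (b i)\<^sup>2)) < \<epsilon>"
proof -
  have "sqrt (a\<^sup>2 + (\<Sum>i\<in>I. (b i)\<^sup>2)) = sqrt (a\<^sup>2 + (L2_set b I)\<^sup>2)"
    by (simp add: L2_set_def sum_nonneg)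
  also have "\<dots> \<le> a + L2_set b I"
    by (intro sqrt_sum_squares_le_sum assms L2_set_nonneg)
  also have "L2_set b I \<le> (\<Sum>i\<in>I. b i)"
    by (intro L2_set_le_sum assms)
  also have "a + (\<Sum>i\<in>I. b i) \<le> a + (\<Sum>i\<in>I. \<epsilon> / (1 + card I))"
    using assms(5) by (intro add_left_mono sum_mono) (auto intro: less_imp_le)
  also have "a + (\<Sum>i\<in>I. \<epsilon> / (1 + card I)) < \<epsilon> / (1 + card I) + (\<Sum>i\<in>I. \<epsilon> / (1 + card I))"
    using assms(4) by simp
  also have "\<dots> = (1 + real (card I)) * (\<epsilon> / (1 + card I))" by (simp add: distrib_right add_divide_distrib)
  also have "\<dots> = \<epsilon>" by simp
  finally show ?thesis by simp
qed

text \<open>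
  The element \<open>v\<close> of \<open>H\<^sub>0\<^sup>1(\<Omega>)\<close> has gradient \<open>G\<close> and Laplacian \<open>k\<close>.
\<close>

definition dirichlet_lap ::
    "'a::euclidean_space set \<Rightarrow> 'a l2 \<Rightarrow> 'a l2 \<Rightarrow> ('a \<Rightarrow> 'a l2) \<Rightarrow> bool" where
  "dirichlet_lap \<Omega> v k G \<longleftrightarrow>
     v \<in> L2_space \<Omega> \<and> k \<in> L2_space \<Omega> \<and> (\<forall>i\<in>Basis. G i \<in> L2_space \<Omega>) \<and>
     (\<forall>\<phi>. test_fun \<Omega> \<phi> \<longrightarrow>
        inner v (\<Sum>i\<in>Basis. abs_l2 (partial i (partial i \<phi>))) = inner k (abs_l2 \<phi>)) \<and>
     (\<forall>\<phi>. test_fun \<Omega> \<phi> \<longrightarrow>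
        (\<forall>i\<in>Basis. inner v (abs_l2 (partial i \<phi>)) = - inner (G i) (abs_l2 \<phi>))) \<and>
     (\<forall>\<epsilon>>0. \<exists>\<phi>. test_fun \<Omega> \<phi> \<and> norm (v - abs_l2 \<phi>) < \<epsilon> \<and>
        (\<forall>i\<in>Basis. norm (G i - abs_l2 (partial i \<phi>)) < \<epsilon>))"

context
  fixes \<Omega> :: "'a::euclidean_space set"
  assumes \<Omega>: "open \<Omega>"
begin

lemma \<Omega>_lebesgue: "\<Omega> \<in> sets lebesgue" and \<Omega>_borel: "\<Omega> \<in> sets borel"
  using \<Omega> by auto

lemma L2_fun_test: "test_fun \<Omega> \<phi> \<Longrightarrow> L2_fun \<Omega> \<phi>"
  by (rule L2_fun_restrict[OF \<Omega>_lebesgue L2_fun_test_fun])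

lemma weak_laplacian_iff:
  assumes "L2_fun \<Omega> f" "L2_fun \<Omega> g"
  shows "weak_laplacian \<Omega> f g \<longleftrightarrow> (\<forall>\<phi>. test_fun \<Omega> \<phi> \<longrightarrow>
    inner (toL2 \<Omega> f) (\<Sum>i\<in>Basis. abs_l2 (partial i (partial i \<phi>))) = inner (toL2 \<Omega> g) (abs_l2 \<phi>))"
proof -
  have "(LINT x|lebesgue_on \<Omega>. f x * (\<Sum>i\<in>Basis. partial i (partial i \<phi>) x)) =
      inner (toL2 \<Omega> f) (\<Sum>i\<in>Basis. abs_l2 (partial i (partial i \<phi>)))"
    and "(LINT x|lebesgue_on \<Omega>. g x * \<phi> x) = inner (toL2 \<Omega> g) (abs_l2 \<phi>)"
    if \<phi>: "test_fun \<Omega> \<phi>" for \<phi>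
  proof -
    have t: "test_fun \<Omega> (partial i (partial i \<phi>))" if "i \<in> Basis" for i
      using \<phi> that by (intro test_fun_partial)
    have "toL2 \<Omega> (\<lambda>x. \<Sum>i\<in>Basis. partial i (partial i \<phi>) x) = (\<Sum>i\<in>Basis. toL2 \<Omega> (partial i (partial i \<phi>)))"
      using t by (intro toL2_sum \<Omega>_lebesgue L2_fun_test) auto
    also have "\<dots> = (\<Sum>i\<in>Basis. abs_l2 (partial i (partial i \<phi>)))"
      using t by (intro sum.cong refl toL2_test_fun)
    finally show "(LINT x|lebesgue_on \<Omega>. f x * (\<Sum>i\<in>Basis. partial i (partial i \<phi>) x)) =
      inner (toL2 \<Omega> f) (\<Sum>i\<in>Basis. abs_l2 (partial i (partial i \<phi>)))"
      using inner_toL2_toL2[OF \<Omega>_lebesgue assms(1) L2_fun_sum[of Basis \<Omega> "\<lambda>i. partial i (partial i \<phi>)"]]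
        t L2_fun_test by simp
    show "(LINT x|lebesgue_on \<Omega>. g x * \<phi> x) = inner (toL2 \<Omega> g) (abs_l2 \<phi>)"
      using inner_toL2_toL2[OF \<Omega>_lebesgue assms(2) L2_fun_test[OF \<phi>]] toL2_test_fun[OF \<phi>] by simp
  qed
  then show ?thesis unfolding weak_laplacian_def by auto
qed

lemma weak_partial_iff:
  assumes "L2_fun \<Omega> f" "L2_fun \<Omega> g" "i \<in> Basis"
  shows "weak_partial \<Omega> i f g \<longleftrightarrow> (\<forall>\<phi>. test_fun \<Omega> \<phi> \<longrightarrow>
    inner (toL2 \<Omega> f) (abs_l2 (partial i \<phi>)) = - inner (toL2 \<Omega> g) (abs_l2 \<phi>))"
proof -
  have "(LINT x|lebesgue_on \<Omega>. f x * \<phi> x) = inner (toL2 \<Omega> f) (abs_l2 \<phi>)"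
    if \<phi>: "test_fun \<Omega> \<phi>" and "L2_fun \<Omega> f" for \<phi> f
    using inner_toL2_toL2[OF \<Omega>_lebesgue that(2) L2_fun_test[OF \<phi>]] toL2_test_fun[OF \<phi>] by simp
  then show ?thesis
    unfolding weak_partial_def using assms test_fun_partial[OF _ assms(3)] by auto
qed

lemma norm_toL2_diff_test:
  assumes "L2_fun \<Omega> f" "test_fun \<Omega> \<phi>"
  shows "L2_norm_fun \<Omega> (\<lambda>x. f x - \<phi> x) = norm (toL2 \<Omega> f - abs_l2 \<phi>)"
  using norm_toL2[OF \<Omega>_lebesgue L2_fun_diff[OF assms(1) L2_fun_test[OF assms(2)]]]
    toL2_diff[OF \<Omega>_lebesgue assms(1) L2_fun_test[OF assms(2)]] toL2_test_fun[OF assms(2)] by simp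

lemma toL2_rep: "v \<in> L2_space \<Omega> \<Longrightarrow> toL2 \<Omega> (rep_l2 v) = v"
  using cut_eq[OF \<Omega>_lebesgue, of v] by (simp add: cut_def)

text \<open>Moves the definitions from functions to elements of the Hilbert space, where limits and
  bilinearity are available. The joint H1 distance to a test function is traded for smallness of
  every component.\<close>

lemma dirichlet_lap_iff:
  assumes f: "L2_fun \<Omega> f" and g: "L2_fun \<Omega> g"
  shows "f \<in> H1_0 \<Omega> \<and> weak_laplacian \<Omega> f g \<longleftrightarrow> (\<exists>G. dirichlet_lap \<Omega> (toL2 \<Omega> f) (toL2 \<Omega> g) G)"
proof
  assume fg: "f \<in> H1_0 \<Omega> \<and> weak_laplacian \<Omega> f g"
  then obtain G where G: "\<And>i. i \<in> Basis \<Longrightarrow> L2_fun \<Omega> (G i) \<and> weak_partial \<Omega> i f (G i)"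
    and approx: "\<And>\<epsilon>. \<epsilon> > 0 \<Longrightarrow> \<exists>\<phi>. test_fun \<Omega> \<phi> \<and> sqrt ((L2_norm_fun \<Omega> (\<lambda>x. f x - \<phi> x))\<^sup>2 +
                 (\<Sum>i\<in>Basis. (L2_norm_fun \<Omega> (\<lambda>x. G i x - partial i \<phi> x))\<^sup>2)) < \<epsilon>"
    unfolding H1_0_def by auto
  have "dirichlet_lap \<Omega> (toL2 \<Omega> f) (toL2 \<Omega> g) (\<lambda>i. toL2 \<Omega> (G i))"
    unfolding dirichlet_lap_def
  proof (intro conjI ballI allI impI)
    show "toL2 \<Omega> f \<in> L2_space \<Omega>" "toL2 \<Omega> g \<in> L2_space \<Omega>"
      using f g by (auto intro: toL2_in_L2_space \<Omega>_lebesgue)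
    show "toL2 \<Omega> (G i) \<in> L2_space \<Omega>" if "i \<in> Basis" for i
      using G[OF that] by (auto intro: toL2_in_L2_space \<Omega>_lebesgue)
    show "inner (toL2 \<Omega> f) (\<Sum>i\<in>Basis. abs_l2 (partial i (partial i \<phi>))) = inner (toL2 \<Omega> g) (abs_l2 \<phi>)"
      if "test_fun \<Omega> \<phi>" for \<phi>
      using fg weak_laplacian_iff[OF f g] that by blast
    show "inner (toL2 \<Omega> f) (abs_l2 (partial i \<phi>)) = - inner (toL2 \<Omega> (G i)) (abs_l2 \<phi>)"
      if "test_fun \<Omega> \<phi>" "i \<in> Basis" for \<phi> i
      using G[OF that(2)] weak_partial_iff[OF f _ that(2)] that(1) by blast
    fix \<epsilon> :: real assume "\<epsilon> > 0"
    from approx[OF this] obtain \<phi> where \<phi>: "test_fun \<Omega> \<phi>"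
      "sqrt ((L2_norm_fun \<Omega> (\<lambda>x. f x - \<phi> x))\<^sup>2 +
                 (\<Sum>i\<in>Basis. (L2_norm_fun \<Omega> (\<lambda>x. G i x - partial i \<phi> x))\<^sup>2)) < \<epsilon>" by auto
    have n: "L2_norm_fun \<Omega> (\<lambda>x. G i x - partial i \<phi> x) = norm (toL2 \<Omega> (G i) - abs_l2 (partial i \<phi>))"
      if "i \<in> Basis" for i
      using G[OF that] test_fun_partial[OF \<phi>(1) that] by (intro norm_toL2_diff_test) auto
    have \<epsilon>2: "sqrt ((norm (toL2 \<Omega> f - abs_l2 \<phi>))\<^sup>2 +
                 (\<Sum>i\<in>Basis. (norm (toL2 \<Omega> (G i) - abs_l2 (partial i \<phi>)))\<^sup>2)) < \<epsilon>"
      using \<phi>(2) n norm_toL2_diff_test[OF f \<phi>(1)] by simp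
    have "norm (toL2 \<Omega> f - abs_l2 \<phi>) \<le> sqrt ((norm (toL2 \<Omega> f - abs_l2 \<phi>))\<^sup>2 +
                 (\<Sum>i\<in>Basis. (norm (toL2 \<Omega> (G i) - abs_l2 (partial i \<phi>)))\<^sup>2))"
      by (intro real_le_rsqrt) (simp add: sum_nonneg)
    moreover have "norm (toL2 \<Omega> (G i) - abs_l2 (partial i \<phi>)) \<le> sqrt ((norm (toL2 \<Omega> f - abs_l2 \<phi>))\<^sup>2 +
                 (\<Sum>i\<in>Basis. (norm (toL2 \<Omega> (G i) - abs_l2 (partial i \<phi>)))\<^sup>2))" if "i \<in> Basis" for i
      using member_le_sum[OF that, of "\<lambda>i. (norm (toL2 \<Omega> (G i) - abs_l2 (partial i \<phi>)))\<^sup>2"]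
      by (intro real_le_rsqrt) (simp add: add_increasing)
    ultimately show "\<exists>\<phi>. test_fun \<Omega> \<phi> \<and> norm (toL2 \<Omega> f - abs_l2 \<phi>) < \<epsilon> \<and>
        (\<forall>i\<in>Basis. norm (toL2 \<Omega> (G i) - abs_l2 (partial i \<phi>)) < \<epsilon>)"
      using \<phi>(1) \<epsilon>2 by (meson order_le_less_trans)
  qed
  then show "\<exists>G. dirichlet_lap \<Omega> (toL2 \<Omega> f) (toL2 \<Omega> g) G" by blast
next
  assume "\<exists>G. dirichlet_lap \<Omega> (toL2 \<Omega> f) (toL2 \<Omega> g) G"
  then obtain G where G: "dirichlet_lap \<Omega> (toL2 \<Omega> f) (toL2 \<Omega> g) G" by blast
  have Gi: "toL2 \<Omega> (rep_l2 (G i)) = G i" "L2_fun \<Omega> (rep_l2 (G i))" if "i \<in> Basis" for i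
    using G that by (auto simp: dirichlet_lap_def intro: toL2_rep L2_fun_on_rep_l2 \<Omega>_lebesgue)
  have "weak_laplacian \<Omega> f g"
    using G weak_laplacian_iff[OF f g] by (simp add: dirichlet_lap_def)
  moreover have "weak_partial \<Omega> i f (rep_l2 (G i))" if "i \<in> Basis" for i
    using G weak_partial_iff[OF f Gi(2)[OF that] that] Gi(1)[OF that] that
    by (simp add: dirichlet_lap_def)
  moreover have "\<exists>\<phi>. test_fun \<Omega> \<phi> \<and> sqrt ((L2_norm_fun \<Omega> (\<lambda>x. f x - \<phi> x))\<^sup>2 +
                 (\<Sum>i\<in>Basis. (L2_norm_fun \<Omega> (\<lambda>x. rep_l2 (G i) x - partial i \<phi> x))\<^sup>2)) < \<epsilon>"
    if "\<epsilon> > 0" for \<epsilon>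
  proof -
    \<comment> \<open>One component for the function and one for each partial derivative: each takes
      an equal share of \<epsilon>.\<close>
    let ?\<delta> = "\<epsilon> / (1 + card (Basis :: 'a set))"
    have "?\<delta> > 0" using that by simp
    then obtain \<phi> where \<phi>: "test_fun \<Omega> \<phi>" "norm (toL2 \<Omega> f - abs_l2 \<phi>) < ?\<delta>"
      "\<And>i. i \<in> Basis \<Longrightarrow> norm (G i - abs_l2 (partial i \<phi>)) < ?\<delta>"
      using G unfolding dirichlet_lap_def by blast
    have n: "L2_norm_fun \<Omega> (\<lambda>x. rep_l2 (G i) x - partial i \<phi> x) = norm (G i - abs_l2 (partial i \<phi>))"
      if "i \<in> Basis" for i
      using norm_toL2_diff_test[OF Gi(2)[OF that] test_fun_partial[OF \<phi>(1) that]] Gi(1)[OF that] by simp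
    have "sqrt ((norm (toL2 \<Omega> f - abs_l2 \<phi>))\<^sup>2 +
                 (\<Sum>i\<in>Basis. (norm (G i - abs_l2 (partial i \<phi>)))\<^sup>2)) < \<epsilon>"
      by (rule sqrt_sum_squares_less) (use \<phi> in auto)
    then show ?thesis using \<phi>(1) n norm_toL2_diff_test[OF f \<phi>(1)] by auto
  qed
  ultimately show "f \<in> H1_0 \<Omega> \<and> weak_laplacian \<Omega> f g"
    using f Gi(2) unfolding H1_0_def by (auto intro!: exI[of _ "\<lambda>i. rep_l2 (G i)"])
qed

lemma dirichlet_lap_add:
  assumes "dirichlet_lap \<Omega> v k G" "dirichlet_lap \<Omega> w l H"
  shows "dirichlet_lap \<Omega> (v + w) (k + l) (\<lambda>i. G i + H i)"
  unfolding dirichlet_lap_def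
proof (intro conjI ballI allI impI)
  note s = subspace_add[OF subspace_L2_space[OF \<Omega>_lebesgue]]
  show "v + w \<in> L2_space \<Omega>" "k + l \<in> L2_space \<Omega>" "\<And>i. i \<in> Basis \<Longrightarrow> G i + H i \<in> L2_space \<Omega>"
    using assms by (auto simp: dirichlet_lap_def intro: s)
  fix \<epsilon> :: real assume "\<epsilon> > 0"
  then have e: "\<epsilon> / 2 > 0" by simp
  obtain \<phi> where \<phi>: "test_fun \<Omega> \<phi>" "norm (v - abs_l2 \<phi>) < \<epsilon> / 2"
      "\<And>i. i \<in> Basis \<Longrightarrow> norm (G i - abs_l2 (partial i \<phi>)) < \<epsilon> / 2"
    using assms(1) e unfolding dirichlet_lap_def by blast
  obtain \<psi> where \<psi>: "test_fun \<Omega> \<psi>" "norm (w - abs_l2 \<psi>) < \<epsilon> / 2"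
      "\<And>i. i \<in> Basis \<Longrightarrow> norm (H i - abs_l2 (partial i \<psi>)) < \<epsilon> / 2"
    using assms(2) e unfolding dirichlet_lap_def by blast
  have ck: "Ck (Suc 0) \<phi>" "Ck (Suc 0) \<psi>" using \<phi>(1) \<psi>(1) unfolding test_fun_def by blast+
  have p: "partial i (\<lambda>x. \<phi> x + \<psi> x) = (\<lambda>x. partial i \<phi> x + partial i \<psi> x)" for i
    using partial_has_derivative[OF has_derivative_add[OF Ck_has_derivative[OF ck(1)] Ck_has_derivative[OF ck(2)]]]
    by (auto simp: partial_def)
  have "norm ((v + w) - abs_l2 (\<lambda>x. \<phi> x + \<psi> x)) < \<epsilon>"
    using norm_triangle_ineq[of "v - abs_l2 \<phi>" "w - abs_l2 \<psi>"] \<phi>(1,2) \<psi>(1,2)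
    by (simp add: abs_l2_add[OF L2_fun_test_fun L2_fun_test_fun] algebra_simps)
  moreover have "norm ((G i + H i) - abs_l2 (partial i (\<lambda>x. \<phi> x + \<psi> x))) < \<epsilon>" if "i \<in> Basis" for i
    using norm_triangle_ineq[of "G i - abs_l2 (partial i \<phi>)" "H i - abs_l2 (partial i \<psi>)"]
      \<phi>(3)[OF that] \<psi>(3)[OF that] test_fun_partial[OF \<phi>(1) that] test_fun_partial[OF \<psi>(1) that]
    by (simp add: p abs_l2_add[OF L2_fun_test_fun L2_fun_test_fun] algebra_simps)
  ultimately show "\<exists>\<phi>. test_fun \<Omega> \<phi> \<and> norm (v + w - abs_l2 \<phi>) < \<epsilon> \<and>
      (\<forall>i\<in>Basis. norm (G i + H i - abs_l2 (partial i \<phi>)) < \<epsilon>)"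
    using test_fun_add[OF \<phi>(1) \<psi>(1)] by blast
qed (use assms in \<open>auto simp: dirichlet_lap_def inner_add_left\<close>)

lemma dirichlet_lap_scaleR:
  assumes "dirichlet_lap \<Omega> v k G"
  shows "dirichlet_lap \<Omega> (c *\<^sub>R v) (c *\<^sub>R k) (\<lambda>i. c *\<^sub>R G i)"
  unfolding dirichlet_lap_def
proof (intro conjI ballI allI impI)
  note s = subspace_scale[OF subspace_L2_space[OF \<Omega>_lebesgue]]
  show "c *\<^sub>R v \<in> L2_space \<Omega>" "c *\<^sub>R k \<in> L2_space \<Omega>" "\<And>i. i \<in> Basis \<Longrightarrow> c *\<^sub>R G i \<in> L2_space \<Omega>"
    using assms by (auto simp: dirichlet_lap_def intro: s)
  fix \<epsilon> :: real assume e: "\<epsilon> > 0"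
  then have "\<epsilon> / (\<bar>c\<bar> + 1) > 0" by simp
  then obtain \<phi> where \<phi>: "test_fun \<Omega> \<phi>" "norm (v - abs_l2 \<phi>) < \<epsilon> / (\<bar>c\<bar> + 1)"
      "\<And>i. i \<in> Basis \<Longrightarrow> norm (G i - abs_l2 (partial i \<phi>)) < \<epsilon> / (\<bar>c\<bar> + 1)"
    using assms(1) unfolding dirichlet_lap_def by blast
  have ck: "Ck (Suc 0) \<phi>" using \<phi>(1) unfolding test_fun_def by blast
  have p: "partial i (\<lambda>x. c * \<phi> x) = (\<lambda>x. c * partial i \<phi> x)" for i
    using partial_has_derivative[OF has_derivative_mult_right[OF Ck_has_derivative[OF ck]]]
    by (auto simp: partial_def)
  have b: "norm (c *\<^sub>R x) < \<epsilon>" if "norm x < \<epsilon> / (\<bar>c\<bar> + 1)" for x :: "'a l2"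
  proof -
    have "\<bar>c\<bar> * norm x \<le> (\<bar>c\<bar> + 1) * norm x" by (simp add: mult_right_mono)
    also have "\<dots> < \<epsilon>" using that by (simp add: field_simps)
    finally show ?thesis by simp
  qed
  have "norm (c *\<^sub>R v - abs_l2 (\<lambda>x. c * \<phi> x)) < \<epsilon>"
    using b[OF \<phi>(2)] \<phi>(1) by (simp add: abs_l2_scale[OF L2_fun_test_fun] scaleR_diff_right)
  moreover have "norm (c *\<^sub>R G i - abs_l2 (partial i (\<lambda>x. c * \<phi> x))) < \<epsilon>" if "i \<in> Basis" for i
    using b[OF \<phi>(3)[OF that]] test_fun_partial[OF \<phi>(1) that]
    by (simp add: p abs_l2_scale[OF L2_fun_test_fun] scaleR_diff_right)
  ultimately show "\<exists>\<phi>. test_fun \<Omega> \<phi> \<and> norm (c *\<^sub>R v - abs_l2 \<phi>) < \<epsilon> \<and>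
      (\<forall>i\<in>Basis. norm (c *\<^sub>R G i - abs_l2 (partial i \<phi>)) < \<epsilon>)"
    using test_fun_scale[OF \<phi>(1)] by blast
qed (use assms in \<open>auto simp: dirichlet_lap_def\<close>)

lemma dirichlet_lap_diff:
  assumes "dirichlet_lap \<Omega> v k G" "dirichlet_lap \<Omega> w l H"
  shows "dirichlet_lap \<Omega> (v - w) (k - l) (\<lambda>i. G i - H i)"
  using dirichlet_lap_add[OF assms(1) dirichlet_lap_scaleR[OF assms(2), of "- 1"]] by simp

lemma dirichlet_lap_zero: "dirichlet_lap \<Omega> 0 0 (\<lambda>_. 0)"
proof -
  have "test_fun \<Omega> (\<lambda>_. 0)" using Ck_const by (auto simp: test_fun_def)
  moreover have "partial i (\<lambda>_::'a. 0) = (\<lambda>_. 0)" for i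
    by (rule ext) (rule partial_has_derivative[OF has_derivative_const])
  ultimately show ?thesis
    using subspace_0[OF subspace_L2_space[OF \<Omega>_lebesgue]]
    by (auto simp: dirichlet_lap_def zero_l2_def[symmetric] intro!: exI[of _ "\<lambda>_. 0"])
qed

lemma dirichlet_lap_unique:
  assumes "dirichlet_lap \<Omega> v k G" "dirichlet_lap \<Omega> v l H"
  shows "k = l"
proof (rule bor_eqI)
  have kl: "k - l \<in> L2_space \<Omega>"
    using assms subspace_diff[OF subspace_L2_space[OF \<Omega>_lebesgue]] by (auto simp: dirichlet_lap_def)
  have "AE x in lborel. x \<in> \<Omega> \<longrightarrow> bor (k - l) x = 0"
  proof (rule zero_AE_if_orthogonal_test_fun[OF \<Omega>])
    fix \<phi> assume \<phi>: "test_fun \<Omega> \<phi>"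
    have "inner (k - l) (abs_l2 \<phi>) = 0"
      using assms \<phi> unfolding dirichlet_lap_def inner_diff_left by simp
    then show "(LINT x|lborel. bor (k - l) x * \<phi> x) = 0"
      using inner_bor_cong[OF bor_test_fun[OF \<phi>], of "k - l"] test_fun_square_integrable(1)[OF \<phi>] by simp
  qed
  then show "AE x in lborel. bor k x = bor l x"
    using kl[unfolded L2_space_bor_iff] bor_diff[of k l] by eventually_elim auto
qed

text \<open>
  The formula holds with a test function in place of \<open>w\<close> by the definition of weak derivatives,
  and test functions approximate \<open>w\<close> together with its gradient.
\<close>

lemma dirichlet_lap_green:
  assumes v: "dirichlet_lap \<Omega> v k G" and w: "dirichlet_lap \<Omega> w l H"
  shows "inner k w = - (\<Sum>i\<in>Basis. inner (G i) (H i))"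
proof -
  have "\<forall>n. \<exists>\<phi>. test_fun \<Omega> \<phi> \<and> norm (w - abs_l2 \<phi>) < inverse (real (Suc n)) \<and>
      (\<forall>i\<in>Basis. norm (H i - abs_l2 (partial i \<phi>)) < inverse (real (Suc n)))"
    using w unfolding dirichlet_lap_def by simp
  then obtain \<phi> where \<phi>: "\<And>n. test_fun \<Omega> (\<phi> n)" "\<And>n. norm (w - abs_l2 (\<phi> n)) < inverse (real (Suc n))"
      "\<And>n i. i \<in> Basis \<Longrightarrow> norm (H i - abs_l2 (partial i (\<phi> n))) < inverse (real (Suc n))"
    by metis
  have lim: "f \<longlonglongrightarrow> a" if "\<And>n. norm (a - f n) < inverse (real (Suc n))" for a :: "'a l2" and f
  proof (rule LIM_zero_cancel, rule Lim_null_comparison)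
    show "\<forall>\<^sub>F n in sequentially. norm (f n - a) \<le> inverse (real (Suc n))"
      using that by (auto simp: norm_minus_commute less_imp_le)
    show "(\<lambda>n. inverse (real (Suc n))) \<longlonglongrightarrow> 0" by (rule LIMSEQ_inverse_real_of_nat)
  qed
  have eq: "inner k (abs_l2 (\<phi> n)) = - (\<Sum>i\<in>Basis. inner (G i) (abs_l2 (partial i (\<phi> n))))" for n
  proof -
    have "inner k (abs_l2 (\<phi> n)) = inner v (\<Sum>i\<in>Basis. abs_l2 (partial i (partial i (\<phi> n))))"
      using v \<phi>(1)[of n] unfolding dirichlet_lap_def by simp
    also have "\<dots> = (\<Sum>i\<in>Basis. - inner (G i) (abs_l2 (partial i (\<phi> n))))"
      unfolding inner_sum_right
      using v test_fun_partial[OF \<phi>(1)[of n]] unfolding dirichlet_lap_def by (intro sum.cong refl) blast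
    finally show ?thesis by (simp add: sum_negf)
  qed
  have "(\<lambda>n. inner k (abs_l2 (\<phi> n))) \<longlonglongrightarrow> inner k w"
    by (intro tendsto_intros lim \<phi>)
  moreover have "(\<lambda>n. - (\<Sum>i\<in>Basis. inner (G i) (abs_l2 (partial i (\<phi> n))))) \<longlonglongrightarrow> - (\<Sum>i\<in>Basis. inner (G i) (H i))"
    by (intro tendsto_intros lim \<phi>)
  ultimately show ?thesis unfolding eq by (rule LIMSEQ_unique)
qed

lemma dirichlet_lap_symmetric:
  assumes "dirichlet_lap \<Omega> v k G" and "dirichlet_lap \<Omega> w l H"
  shows "inner k w = inner l v"
  using dirichlet_lap_green[OF assms] dirichlet_lap_green[OF assms(2,1)]
  by (simp add: inner_commute)

lemma dirichlet_lap_nonpos: "dirichlet_lap \<Omega> v k G \<Longrightarrow> inner k v \<le> 0"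
  using dirichlet_lap_green[of v k G v k G] by (simp add: sum_nonneg)

text \<open>Nothing is assumed about the gradients, but Green's formula for differences bounds the
  squared gradient of \<open>v m - v n\<close> by the product of the norms of
  \<open>k m - k n\<close> and \<open>v m - v n\<close>. The gradients are therefore Cauchy, and all
  defining conditions pass to the limit.\<close>

lemma dirichlet_lap_closed:
  assumes vk: "\<And>n. \<exists>G. dirichlet_lap \<Omega> (v n) (k n) G" and v: "v \<longlonglongrightarrow> v'" and k: "k \<longlonglongrightarrow> k'"
  shows "\<exists>G. dirichlet_lap \<Omega> v' k' G"
proof -
  obtain G where G: "\<And>n. dirichlet_lap \<Omega> (v n) (k n) (G n)" using vk by metis
  have "Cauchy (\<lambda>n. G n i)" if i: "i \<in> Basis" for i
  proof (rule metric_CauchyI)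
    fix e :: real assume e: "e > 0"
    have Cv: "Cauchy v" and Ck: "Cauchy k" using v k by (auto intro: LIMSEQ_imp_Cauchy)
    obtain M where M: "\<And>m n. m \<ge> M \<Longrightarrow> n \<ge> M \<Longrightarrow> norm (v m - v n) < e"
      using CauchyD[OF Cv e] by blast
    obtain N where N: "\<And>m n. m \<ge> N \<Longrightarrow> n \<ge> N \<Longrightarrow> norm (k m - k n) < e"
      using CauchyD[OF Ck e] by blast
    have "dist (G m i) (G n i) < e" if mn: "m \<ge> max M N" "n \<ge> max M N" for m n
    proof -
      have "(norm (G m i - G n i))\<^sup>2 \<le> (\<Sum>i\<in>Basis. (norm (G m i - G n i))\<^sup>2)"
        using i by (intro member_le_sum) auto
      also have "\<dots> = - inner (k m - k n) (v m - v n)"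
        using dirichlet_lap_green[OF dirichlet_lap_diff[OF G[of m] G[of n]] dirichlet_lap_diff[OF G[of m] G[of n]]]
        by (simp add: power2_norm_eq_inner)
      also have "\<dots> \<le> norm (k m - k n) * norm (v m - v n)"
        using Cauchy_Schwarz_ineq2[of "k m - k n" "v m - v n"] by linarith
      also have "\<dots> < e * e"
        using mn by (intro mult_strict_mono' M N) auto
      finally show ?thesis
        using e by (simp add: dist_norm power2_eq_square[symmetric] power_less_imp_less_base[of _ 2 e])
    qed
    then show "\<exists>M. \<forall>m\<ge>M. \<forall>n\<ge>M. dist (G m i) (G n i) < e" by blast
  qed
  then have "\<forall>i\<in>Basis. \<exists>l. (\<lambda>n. G n i) \<longlonglongrightarrow> l"
    by (auto simp: Cauchy_convergent_iff convergent_def)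
  then obtain G' where G': "\<And>i. i \<in> Basis \<Longrightarrow> (\<lambda>n. G n i) \<longlonglongrightarrow> G' i" by metis
  have "dirichlet_lap \<Omega> v' k' G'"
    unfolding dirichlet_lap_def
  proof (intro conjI ballI allI impI)
    note c = closed_sequentially[OF closed_L2_space[OF \<Omega>_lebesgue]]
    show "v' \<in> L2_space \<Omega>" by (rule c[OF _ v]) (use G in \<open>auto simp: dirichlet_lap_def\<close>)
    show "k' \<in> L2_space \<Omega>" by (rule c[OF _ k]) (use G in \<open>auto simp: dirichlet_lap_def\<close>)
    show "G' i \<in> L2_space \<Omega>" if "i \<in> Basis" for i
      by (rule c[OF _ G'[OF that]]) (use G that in \<open>auto simp: dirichlet_lap_def\<close>)
    show "inner v' (\<Sum>i\<in>Basis. abs_l2 (partial i (partial i \<phi>))) = inner k' (abs_l2 \<phi>)"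
      if "test_fun \<Omega> \<phi>" for \<phi>
    proof (rule LIMSEQ_unique)
      show "(\<lambda>n. inner (k n) (abs_l2 \<phi>)) \<longlonglongrightarrow> inner k' (abs_l2 \<phi>)"
        by (intro tendsto_intros k)
      have "(\<lambda>n. inner (v n) (\<Sum>i\<in>Basis. abs_l2 (partial i (partial i \<phi>))))
          \<longlonglongrightarrow> inner v' (\<Sum>i\<in>Basis. abs_l2 (partial i (partial i \<phi>)))"
        by (intro tendsto_inner tendsto_const v)
      then show "(\<lambda>n. inner (k n) (abs_l2 \<phi>)) \<longlonglongrightarrow> inner v' (\<Sum>i\<in>Basis. abs_l2 (partial i (partial i \<phi>)))"
        using G that unfolding dirichlet_lap_def by simp
    qed
    show "inner v' (abs_l2 (partial i \<phi>)) = - inner (G' i) (abs_l2 \<phi>)"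
      if "test_fun \<Omega> \<phi>" "i \<in> Basis" for \<phi> i
    proof (rule LIMSEQ_unique)
      show "(\<lambda>n. inner (v n) (abs_l2 (partial i \<phi>))) \<longlonglongrightarrow> inner v' (abs_l2 (partial i \<phi>))"
        by (intro tendsto_intros v)
      have "(\<lambda>n. - inner (G n i) (abs_l2 \<phi>)) \<longlonglongrightarrow> - inner (G' i) (abs_l2 \<phi>)"
        by (intro tendsto_intros G' that)
      then show "(\<lambda>n. inner (v n) (abs_l2 (partial i \<phi>))) \<longlonglongrightarrow> - inner (G' i) (abs_l2 \<phi>)"
        using G that unfolding dirichlet_lap_def by simp
    qed
    fix \<epsilon> :: real assume "\<epsilon> > 0"
    then have e: "\<epsilon> / 2 > 0" by simp
    have "\<forall>\<^sub>F n in sequentially. norm (v n - v') < \<epsilon> / 2 \<and> (\<forall>i\<in>Basis. norm (G n i - G' i) < \<epsilon> / 2)"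
      using tendstoD[OF v e] tendstoD[OF G' e]
      by (auto simp: dist_norm eventually_ball_finite_distrib intro!: eventually_conj)
    then obtain n where n: "norm (v n - v') < \<epsilon> / 2" "\<And>i. i \<in> Basis \<Longrightarrow> norm (G n i - G' i) < \<epsilon> / 2"
      by (auto simp: eventually_sequentially)
    obtain \<phi> where \<phi>: "test_fun \<Omega> \<phi>" "norm (v n - abs_l2 \<phi>) < \<epsilon> / 2"
        "\<And>i. i \<in> Basis \<Longrightarrow> norm (G n i - abs_l2 (partial i \<phi>)) < \<epsilon> / 2"
      using G[of n] e unfolding dirichlet_lap_def by blast
    have tri: "norm (c - b) < \<epsilon>" if "norm (a - c) < \<epsilon> / 2" "norm (a - b) < \<epsilon> / 2" for a b c :: "'a l2"
      using norm_triangle_ineq[of "c - a" "a - b"] that by (simp add: norm_minus_commute)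
    show "\<exists>\<phi>. test_fun \<Omega> \<phi> \<and> norm (v' - abs_l2 \<phi>) < \<epsilon> \<and>
      (\<forall>i\<in>Basis. norm (G' i - abs_l2 (partial i \<phi>)) < \<epsilon>)"
      using \<phi>(1) tri[OF n(1) \<phi>(2)] tri[OF n(2) \<phi>(3)] by blast
  qed
  then show ?thesis by blast
qed

end

section \<open>Symmetric forms on subspaces and the Riesz representation\<close>

lemma mult_self_le_imp_le: "p * p \<le> q * p \<Longrightarrow> p \<ge> 0 \<Longrightarrow> q \<ge> 0 \<Longrightarrow> p \<le> q" for p q :: real
  by (cases "p = 0") (auto simp: mult_le_cancel_right)

text \<open>A Hilbert space given by a form on a subspace rather than by a type class instance,
  because two different forms on the same product space have to be compared. Completeness is
  expressed through the form itself.\<close>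

locale hilbert_form =
  fixes V :: "'v::real_vector set" and b :: "'v \<Rightarrow> 'v \<Rightarrow> real"
  assumes subspace: "subspace V"
    and add_left: "x \<in> V \<Longrightarrow> y \<in> V \<Longrightarrow> z \<in> V \<Longrightarrow> b (x + y) z = b x z + b y z"
    and scale_left: "x \<in> V \<Longrightarrow> y \<in> V \<Longrightarrow> b (c *\<^sub>R x) y = c * b x y"
    and sym: "x \<in> V \<Longrightarrow> y \<in> V \<Longrightarrow> b x y = b y x"
    and nonneg: "x \<in> V \<Longrightarrow> b x x \<ge> 0"
    and definite: "x \<in> V \<Longrightarrow> b x x = 0 \<Longrightarrow> x = 0"
    and complete: "\<lbrakk>\<And>n. u n \<in> V; \<And>\<epsilon>. \<epsilon> > 0 \<Longrightarrow> \<exists>M. \<forall>m\<ge>M. \<forall>n\<ge>M. b (u m - u n) (u m - u n) < \<epsilon>\<rbrakk>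
      \<Longrightarrow> \<exists>l\<in>V. (\<lambda>n. b (u n - l) (u n - l)) \<longlonglongrightarrow> 0"
begin

lemmas closed_add = subspace_add[OF subspace]
  and closed_scale = subspace_scale[OF subspace]
  and closed_diff = subspace_diff[OF subspace]
  and closed_zero = subspace_0[OF subspace]

lemma add_right: "x \<in> V \<Longrightarrow> y \<in> V \<Longrightarrow> z \<in> V \<Longrightarrow> b z (x + y) = b z x + b z y"
  using add_left[of x y z] sym closed_add by simp

lemma scale_right: "x \<in> V \<Longrightarrow> y \<in> V \<Longrightarrow> b x (c *\<^sub>R y) = c * b x y"
  using scale_left[of y x c] sym closed_scale by simp

lemma diff_left: "x \<in> V \<Longrightarrow> y \<in> V \<Longrightarrow> z \<in> V \<Longrightarrow> b (x - y) z = b x z - b y z"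
  using add_left[of x "- 1 *\<^sub>R y" z] scale_left[of y z "- 1"] closed_scale[of y "- 1"] by simp

lemma diff_right: "x \<in> V \<Longrightarrow> y \<in> V \<Longrightarrow> z \<in> V \<Longrightarrow> b z (x - y) = b z x - b z y"
  using diff_left[of x y z] sym closed_diff by simp

lemma square_add_scale:
  "x \<in> V \<Longrightarrow> y \<in> V \<Longrightarrow> b (x + s *\<^sub>R y) (x + s *\<^sub>R y) = b x x + 2 * s * b x y + s\<^sup>2 * b y y"
  by (simp add: add_left add_right scale_left scale_right closed_add closed_scale sym[of y x]
      power2_eq_square algebra_simps)

lemma Cauchy_Schwarz_square: "x \<in> V \<Longrightarrow> y \<in> V \<Longrightarrow> (b x y)\<^sup>2 \<le> b x x * b y y"
proof (cases "b y y = 0")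
  case True
  assume "x \<in> V" "y \<in> V"
  with True definite[of y] have "b x y = 0" using scale_right[of x y 0] by auto
  then show ?thesis using True by simp
next
  case False
  assume xy: "x \<in> V" "y \<in> V"
  then have pos: "b y y > 0" using False nonneg[of y] by simp
  have "0 \<le> b (x + (- b x y / b y y) *\<^sub>R y) (x + (- b x y / b y y) *\<^sub>R y)"
    using xy by (intro nonneg closed_add closed_scale)
  also have "\<dots> = b x x - (b x y)\<^sup>2 / b y y"
    unfolding square_add_scale[OF xy] using False by (simp add: power2_eq_square field_simps)
  finally show ?thesis using pos by (simp add: field_simps)
qed

lemma Cauchy_Schwarz: "x \<in> V \<Longrightarrow> y \<in> V \<Longrightarrow> \<bar>b x y\<bar> \<le> sqrt (b x x) * sqrt (b y y)"
  using real_sqrt_le_mono[OF Cauchy_Schwarz_square[of x y]] by (simp add: real_sqrt_mult)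

text \<open>The representing element minimizes \<open>x \<mapsto> b x x - 2 F x\<close>.\<close>

lemma riesz:
  assumes F_add: "\<And>x y. x \<in> V \<Longrightarrow> y \<in> V \<Longrightarrow> F (x + y) = F x + F y"
    and F_scale: "\<And>c x. x \<in> V \<Longrightarrow> F (c *\<^sub>R x) = c * F x"
    and F_bound: "\<And>x. x \<in> V \<Longrightarrow> \<bar>F x\<bar> \<le> C * sqrt (b x x)"
  shows "\<exists>v\<in>V. \<forall>x\<in>V. b v x = F x"
proof -
  define Q where "Q x = b x x - 2 * F x" for x
  have lower: "- C\<^sup>2 \<le> Q x" if "x \<in> V" for x
  proof -
    have "0 \<le> (sqrt (b x x) - C)\<^sup>2" by simp
    also have "\<dots> = b x x - 2 * (C * sqrt (b x x)) + C\<^sup>2"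
      using nonneg[OF that] by (simp add: power2_diff algebra_simps)
    also have "\<dots> \<le> Q x + C\<^sup>2" using F_bound[OF that] by (simp add: Q_def)
    finally show ?thesis by simp
  qed
  define I where "I = Inf (Q ` V)"
  have bdd: "bdd_below (Q ` V)" using lower by (auto intro!: bdd_belowI2)
  have I_le: "I \<le> Q x" if "x \<in> V" for x
    unfolding I_def using that by (intro cINF_lower bdd)
  have "\<exists>x\<in>V. Q x < I + inverse (real (Suc n))" for n
  proof -
    have "Inf (Q ` V) < I + inverse (real (Suc n))" by (simp add: I_def)
    then show ?thesis using cInf_lessD[of "Q ` V"] closed_zero by blast
  qed
  then obtain u where u: "\<And>n. u n \<in> V" "\<And>n. Q (u n) < I + inverse (real (Suc n))" by metis
  \<comment> \<open>The parallelogram identity: at the midpoint \<open>?w\<close> the functional is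
    still at least \<open>I\<close>, so two near-minimizers are close to each other.\<close>
  have par: "b (u m - u n) (u m - u n) \<le> 2 * (inverse (real (Suc m)) + inverse (real (Suc n)))" for m n
  proof -
    let ?w = "(1/2) *\<^sub>R (u m + u n)"
    have w: "?w \<in> V" by (intro closed_scale closed_add u)
    have "b (u m - u n) (u m - u n) = 2 * Q (u m) + 2 * Q (u n) - 4 * Q ?w"
      using u(1) sym[OF u(1)[of n] u(1)[of m]] by (simp add: Q_def diff_left diff_right add_left add_right scale_left scale_right F_add F_scale closed_diff
          closed_add closed_scale algebra_simps)
    also have "\<dots> \<le> 2 * (inverse (real (Suc m)) + inverse (real (Suc n)))"
      using u(2)[of m] u(2)[of n] I_le[OF w] by argo
    finally show ?thesis .
  qed
  have "\<exists>l\<in>V. (\<lambda>n. b (u n - l) (u n - l)) \<longlonglongrightarrow> 0"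
  proof (rule complete[OF u(1)])
    fix \<epsilon> :: real assume "\<epsilon> > 0"
    then obtain M where M: "inverse (real (Suc M)) < \<epsilon> / 4" using reals_Archimedean[of "\<epsilon> / 4"] by auto
    have "b (u m - u n) (u m - u n) < \<epsilon>" if "m \<ge> M" "n \<ge> M" for m n
    proof -
      have "inverse (real (Suc m)) \<le> inverse (real (Suc M))" "inverse (real (Suc n)) \<le> inverse (real (Suc M))"
        using that by (auto intro: le_imp_inverse_le)
      moreover have "p < e" if "i \<le> k" "j \<le> k" "p \<le> 2 * (i + j)" "k < e / 4" for p i j k e :: real
        using that by argo
      ultimately show ?thesis using par[of m n] M by blast
    qed
    then show "\<exists>M. \<forall>m\<ge>M. \<forall>n\<ge>M. b (u m - u n) (u m - u n) < \<epsilon>" by blast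
  qed
  then obtain l where l: "l \<in> V" "(\<lambda>n. b (u n - l) (u n - l)) \<longlonglongrightarrow> 0" by blast
  have "b l x = F x" if x: "x \<in> V" for x
  proof -
    have lim: "(\<lambda>n. b (u n) x) \<longlonglongrightarrow> b l x"
    proof (rule LIM_zero_cancel, rule Lim_null_comparison)
      show "\<forall>\<^sub>F n in sequentially. norm (b (u n) x - b l x) \<le> sqrt (b (u n - l) (u n - l)) * sqrt (b x x)"
        using Cauchy_Schwarz[OF closed_diff[OF u(1) l(1)] x] diff_left[OF u(1) l(1) x] by auto
      have "(\<lambda>n. sqrt (b (u n - l) (u n - l)) * sqrt (b x x)) \<longlonglongrightarrow> sqrt 0 * sqrt (b x x)"
        by (intro tendsto_intros l)
      then show "(\<lambda>n. sqrt (b (u n - l) (u n - l)) * sqrt (b x x)) \<longlonglongrightarrow> 0" by simp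
    qed
    \<comment> \<open>The variation is carried out at the approximants, whose distance from the
      infimum is at most \<open>inverse (real (Suc n))\<close>, and only then is the limit taken.
      This avoids a proof that \<open>Q\<close> is continuous.\<close>
    have quad: "0 \<le> 2 * s * (b l x - F x) + s\<^sup>2 * b x x" for s
    proof (rule LIMSEQ_le_const)
      have "(\<lambda>n. inverse (real (Suc n)) + (2 * s * (b (u n) x - F x) + s\<^sup>2 * b x x))
          \<longlonglongrightarrow> 0 + (2 * s * (b l x - F x) + s\<^sup>2 * b x x)"
        by (intro tendsto_intros lim LIMSEQ_inverse_real_of_nat)
      then show "(\<lambda>n. inverse (real (Suc n)) + (2 * s * (b (u n) x - F x) + s\<^sup>2 * b x x))
          \<longlonglongrightarrow> 2 * s * (b l x - F x) + s\<^sup>2 * b x x" by simp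
      have "0 \<le> inverse (real (Suc n)) + (2 * s * (b (u n) x - F x) + s\<^sup>2 * b x x)" for n
      proof -
        have w: "u n + s *\<^sub>R x \<in> V" by (intro closed_add closed_scale u x)
        have "Q (u n + s *\<^sub>R x) = Q (u n) + (2 * s * (b (u n) x - F x) + s\<^sup>2 * b x x)"
          unfolding Q_def square_add_scale[OF u(1) x]
          using F_add[OF u(1) closed_scale[OF x]] F_scale[OF x] by (simp add: algebra_simps)
        then show ?thesis using I_le[OF w] u(2)[of n] by linarith
      qed
      then show "\<exists>N. \<forall>n\<ge>N. 0 \<le> inverse (real (Suc n)) + (2 * s * (b (u n) x - F x) + s\<^sup>2 * b x x)"
        by blast
    qed
    show ?thesis
    proof (rule ccontr)
      assume ne: "b l x \<noteq> F x"
      define d where "d = b l x - F x"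
      \<comment> \<open>The optimal step would divide by \<open>b x x\<close>, which may be 0;
        adding 1 keeps the denominator positive and still gives a strictly negative value when
        \<open>d\<close> is nonzero.\<close>
      define p where "p = b x x + 1"
      have p: "p > 0" using nonneg[OF x] by (simp add: p_def)
      have "0 \<le> 2 * (- d / p) * d + (- d / p)\<^sup>2 * b x x" using quad[of "- d / p"] by (simp add: d_def)
      also have "\<dots> \<le> 2 * (- d / p) * d + (- d / p)\<^sup>2 * p"
        by (intro add_left_mono mult_left_mono) (auto simp: p_def)
      also have "\<dots> = - (d\<^sup>2 / p)" using p by (simp add: field_simps power2_eq_square)
      finally have "d\<^sup>2 / p \<le> 0" by simp
      then show False using p ne by (auto simp: d_def divide_le_0_iff)
    qed
  qed
  with l(1) show ?thesis by blast
qed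

lemma represent_unique:
  assumes "v \<in> V" "w \<in> V" "\<And>x. x \<in> V \<Longrightarrow> b v x = b w x"
  shows "v = w"
  using definite[OF closed_diff[OF assms(1,2)]] assms closed_diff[OF assms(1,2)] diff_left by simp

end

lemma hilbert_form_closed_subspace:
  fixes V :: "'h::{real_inner, complete_space} set"
  assumes "subspace V" "closed V"
  shows "hilbert_form V inner"
proof
  show "subspace V" by fact
  fix u :: "nat \<Rightarrow> 'h"
  assume u: "\<And>n. u n \<in> V"
    and C: "\<And>\<epsilon>. \<epsilon> > 0 \<Longrightarrow> \<exists>M. \<forall>m\<ge>M. \<forall>n\<ge>M. inner (u m - u n) (u m - u n) < \<epsilon>"
  have "Cauchy u"
  proof (rule metric_CauchyI)
    fix e :: real assume e: "e > 0"
    then obtain M where M: "\<And>m n. m \<ge> M \<Longrightarrow> n \<ge> M \<Longrightarrow> inner (u m - u n) (u m - u n) < e\<^sup>2"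
      using C[of "e\<^sup>2"] by auto
    have "dist (u m) (u n) < e" if "m \<ge> M" "n \<ge> M" for m n
      using M[OF that] e unfolding dist_norm power2_norm_eq_inner[symmetric]
      by (simp add: power_less_imp_less_base)
    then show "\<exists>M. \<forall>m\<ge>M. \<forall>n\<ge>M. dist (u m) (u n) < e" by blast
  qed
  then obtain l where l: "u \<longlonglongrightarrow> l" by (auto simp: Cauchy_convergent_iff convergent_def)
  have "(\<lambda>n. inner (u n - l) (u n - l)) \<longlonglongrightarrow> inner (l - l) (l - l)"
    by (intro tendsto_intros l)
  then show "\<exists>l\<in>V. (\<lambda>n. inner (u n - l) (u n - l)) \<longlonglongrightarrow> 0"
    using closed_sequentially[OF assms(2)] u l by auto
qed (auto simp: inner_add_left intro: inner_commute)

text \<open>Subtracting the orthogonal projection, supplied by the Riesz representation, leaves a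
  vector orthogonal to \<open>V\<close>. The lemma turns density into a statement about
  orthogonality.\<close>

lemma closed_subspace_eq_UNIV:
  fixes V :: "'h::{real_inner, complete_space} set"
  assumes V: "subspace V" "closed V" and orth: "\<And>u. (\<And>v. v \<in> V \<Longrightarrow> inner u v = 0) \<Longrightarrow> u = 0"
  shows "V = UNIV"
proof -
  interpret hilbert_form V inner by (rule hilbert_form_closed_subspace[OF V])
  have "u \<in> V" for u
  proof -
    have "\<exists>v\<in>V. \<forall>x\<in>V. inner v x = inner u x"
      by (rule riesz[where C = "norm u"])
        (auto simp: inner_add_right Cauchy_Schwarz_ineq2 simp flip: norm_eq_sqrt_inner)
    then obtain v where v: "v \<in> V" "\<And>x. x \<in> V \<Longrightarrow> inner v x = inner u x" by blast
    have "u - v = 0" by (rule orth) (simp add: inner_diff_left v)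
    with v(1) show ?thesis by simp
  qed
  then show ?thesis by blast
qed

text \<open>
  The polarization identity and scaling turn a bound of the quadratic form by another into a bound of
  the bilinear form.
\<close>

lemma polarization_bound:
  fixes a n :: "'v::real_vector \<Rightarrow> 'v \<Rightarrow> real"
  assumes V: "subspace V"
    and a_add: "\<And>x y z. x \<in> V \<Longrightarrow> y \<in> V \<Longrightarrow> z \<in> V \<Longrightarrow> a (x + y) z = a x z + a y z"
    and a_scale: "\<And>c x y. x \<in> V \<Longrightarrow> y \<in> V \<Longrightarrow> a (c *\<^sub>R x) y = c * a x y"
    and a_sym: "\<And>x y. x \<in> V \<Longrightarrow> y \<in> V \<Longrightarrow> a x y = a y x"
    and n_add: "\<And>x y z. x \<in> V \<Longrightarrow> y \<in> V \<Longrightarrow> z \<in> V \<Longrightarrow> n (x + y) z = n x z + n y z"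
    and n_scale: "\<And>c x y. x \<in> V \<Longrightarrow> y \<in> V \<Longrightarrow> n (c *\<^sub>R x) y = c * n x y"
    and n_sym: "\<And>x y. x \<in> V \<Longrightarrow> y \<in> V \<Longrightarrow> n x y = n y x"
    and n_pos: "\<And>x. x \<in> V \<Longrightarrow> x \<noteq> 0 \<Longrightarrow> n x x > 0"
    and bound: "\<And>x. x \<in> V \<Longrightarrow> \<bar>a x x\<bar> \<le> K * n x x"
    and x: "x \<in> V" and y: "y \<in> V"
  shows "\<bar>a x y\<bar> \<le> K * (sqrt (n x x) * sqrt (n y y))"
proof -
  note cl = subspace_add[OF V] subspace_scale[OF V] subspace_diff[OF V]
  have zero: "f 0 z = 0" if "\<And>c x y. x \<in> V \<Longrightarrow> y \<in> V \<Longrightarrow> f (c *\<^sub>R x) y = c * f x y" "z \<in> V"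
    for f :: "'v \<Rightarrow> 'v \<Rightarrow> real" and z
    using that(1)[of z z 0] that(2) by simp
  have pol: "2 * \<bar>a x y\<bar> \<le> K * (n x x + n y y)" if x: "x \<in> V" and y: "y \<in> V" for x y
  proof -
    have expand: "f (x + c *\<^sub>R y) (x + c *\<^sub>R y) = f x x + 2 * c * f x y + c\<^sup>2 * f y y"
      if f: "\<And>x y z. x \<in> V \<Longrightarrow> y \<in> V \<Longrightarrow> z \<in> V \<Longrightarrow> f (x + y) z = f x z + f y z"
        "\<And>c x y. x \<in> V \<Longrightarrow> y \<in> V \<Longrightarrow> f (c *\<^sub>R x) y = c * f x y"
        "\<And>x y. x \<in> V \<Longrightarrow> y \<in> V \<Longrightarrow> f x y = f y x" for f :: "'v \<Rightarrow> 'v \<Rightarrow> real" and c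
    proof -
      have cy: "c *\<^sub>R y \<in> V" "x + c *\<^sub>R y \<in> V" using x y by (auto intro: cl)
      have "f (x + c *\<^sub>R y) (x + c *\<^sub>R y) = f x (x + c *\<^sub>R y) + c * f y (x + c *\<^sub>R y)"
        using f x y cy by simp
      also have "f x (x + c *\<^sub>R y) = f x x + c * f x y"
        using f(3)[OF x cy(2)] f(1)[OF x cy(1) x] f(2)[OF y x] f(3)[OF x y] by simp
      also have "f y (x + c *\<^sub>R y) = f x y + c * f y y"
        using f(3)[OF y cy(2)] f(1)[OF x cy(1) y] f(2)[OF y y] by simp
      finally show ?thesis by (simp add: power2_eq_square algebra_simps)
    qed
    have "4 * a x y = a (x + 1 *\<^sub>R y) (x + 1 *\<^sub>R y) - a (x + (- 1) *\<^sub>R y) (x + (- 1) *\<^sub>R y)"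
      using expand[of a 1, OF a_add a_scale a_sym] expand[of a "- 1", OF a_add a_scale a_sym] by simp
    moreover have "\<bar>a (x + c *\<^sub>R y) (x + c *\<^sub>R y)\<bar> \<le> K * n (x + c *\<^sub>R y) (x + c *\<^sub>R y)" for c
      using x y by (intro bound cl)
    ultimately have "4 * \<bar>a x y\<bar> \<le> K * n (x + 1 *\<^sub>R y) (x + 1 *\<^sub>R y) + K * n (x + (- 1) *\<^sub>R y) (x + (- 1) *\<^sub>R y)"
      by (smt (verit))
    also have "\<dots> = K * (n (x + 1 *\<^sub>R y) (x + 1 *\<^sub>R y) + n (x + (- 1) *\<^sub>R y) (x + (- 1) *\<^sub>R y))"
      by (simp only: distrib_left)
    also have "\<dots> = K * (2 * (n x x + n y y))"
      using expand[of n 1, OF n_add n_scale n_sym] expand[of n "- 1", OF n_add n_scale n_sym] by simp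
    finally show ?thesis by (simp add: distrib_left)
  qed
  show ?thesis
  proof (cases "x = 0 \<or> y = 0")
    case True
    then have "a x y = 0" using zero[of a x, OF a_scale x] zero[of a y, OF a_scale y] a_sym[OF x y] by auto
    moreover have "n x x = 0 \<or> n y y = 0" using True zero[of n x, OF n_scale x] zero[of n y, OF n_scale y] by auto
    ultimately show ?thesis by auto
  next
    case False
    define p q where "p = sqrt (n x x)" and "q = sqrt (n y y)"
    have pq: "p > 0" "q > 0" "p\<^sup>2 = n x x" "q\<^sup>2 = n y y"
      using n_pos x y False unfolding p_def q_def by (auto simp: less_imp_le)
    let ?x = "inverse p *\<^sub>R x" and ?y = "inverse q *\<^sub>R y"
    have xy: "?x \<in> V" "?y \<in> V" using x y by (auto intro: cl)
    have sc: "f (c *\<^sub>R z) (d *\<^sub>R w) = c * d * f z w"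
      if "\<And>c x y. x \<in> V \<Longrightarrow> y \<in> V \<Longrightarrow> f (c *\<^sub>R x) y = c * f x y"
        "\<And>x y. x \<in> V \<Longrightarrow> y \<in> V \<Longrightarrow> f x y = f y x" "z \<in> V" "w \<in> V" for f :: "'v \<Rightarrow> 'v \<Rightarrow> real" and c d z w
      using that(1)[OF that(3) cl(2)[OF that(4)], of c d] that(2)[OF that(3) cl(2)[OF that(4)], of d]
        that(1)[OF that(4,3), of d] that(2)[OF that(3,4)] by simp
    have "2 * \<bar>a ?x ?y\<bar> \<le> K * (n ?x ?x + n ?y ?y)" by (rule pol[OF xy])
    moreover have "n ?x ?x = 1" "n ?y ?y = 1"
      using pq by (simp_all add: sc[of n, OF n_scale n_sym] x y pq(3,4)[symmetric] power2_eq_square field_simps)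
    moreover have "a ?x ?y = a x y / (p * q)"
      by (simp add: sc[of a, OF a_scale a_sym] x y divide_inverse)
    ultimately have "\<bar>a x y / (p * q)\<bar> \<le> K" by simp
    then have "\<bar>a x y\<bar> / (p * q) \<le> K" using pq by (simp add: abs_mult)
    then show ?thesis using pq by (simp add: p_def[symmetric] q_def[symmetric] field_simps)
  qed
qed

section \<open>Dual spaces, operator norms and the condition number of a preconditioned form\<close>

lemma dual_spaceI:
  assumes "\<And>x y. x \<in> V \<Longrightarrow> y \<in> V \<Longrightarrow> F (x + y) = F x + F y"
    and "\<And>c x. x \<in> V \<Longrightarrow> F (c *\<^sub>R x) = c * F x"
    and "\<And>x. x \<in> V \<Longrightarrow> \<bar>F x\<bar> \<le> C * N x"
    and "subspace V"
  shows "restrict F V \<in> dual_space V N"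
  unfolding dual_space_def using assms subspace_add[OF assms(4)] subspace_scale[OF assms(4)]
  by (auto intro!: exI[of _ C])

lemma op_norm_le:
  assumes "\<And>x. x \<in> V \<Longrightarrow> N (K x) \<le> C * N x" "\<And>x. x \<in> V \<Longrightarrow> x \<noteq> 0 \<Longrightarrow> N x > 0"
  shows "op_norm V N K \<le> ennreal C"
  unfolding op_norm_def
proof (rule SUP_least)
  fix x assume "x \<in> V - {0}"
  then show "ennreal (N (K x) / N x) \<le> ennreal C"
    using assms(1)[of x] assms(2)[of x] by (intro ennreal_leI) (simp add: pos_divide_le_eq)
qed

text \<open>\<open>b\<close> is the preconditioner, \<open>a\<close> the operator, and
  \<open>N\<close> the norm that defines the dual space. The assumption \<open>lower\<close> is the
  bound of the inverse, phrased for a representative \<open>z\<close> of \<open>a x\<close> so that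
  it can be stated before the preconditioned operator \<open>P\<close> is known to be well
  defined.\<close>

locale preconditioned = hilbert_form X b for X :: "'v::real_vector set" and b +
  fixes a :: "'v \<Rightarrow> 'v \<Rightarrow> real" and N :: "'v \<Rightarrow> real" and c\<^sub>1 c\<^sub>2 Mu Ml :: real
  assumes a_add: "x \<in> X \<Longrightarrow> y \<in> X \<Longrightarrow> z \<in> X \<Longrightarrow> a (x + y) z = a x z + a y z"
    and a_scale: "x \<in> X \<Longrightarrow> y \<in> X \<Longrightarrow> a (c *\<^sub>R x) y = c * a x y"
    and a_sym: "x \<in> X \<Longrightarrow> y \<in> X \<Longrightarrow> a x y = a y x"
    and N_le: "x \<in> X \<Longrightarrow> N x \<le> c\<^sub>1 * sqrt (b x x)"
    and le_N: "x \<in> X \<Longrightarrow> sqrt (b x x) \<le> c\<^sub>2 * N x"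
    and upper: "x \<in> X \<Longrightarrow> y \<in> X \<Longrightarrow> \<bar>a x y\<bar> \<le> Mu * (sqrt (b x x) * sqrt (b y y))"
    and lower: "x \<in> X \<Longrightarrow> z \<in> X \<Longrightarrow> (\<And>y. y \<in> X \<Longrightarrow> b z y = a x y) \<Longrightarrow> sqrt (b x x) \<le> Ml * sqrt (b z z)"
    and surjective: "z \<in> X \<Longrightarrow> \<exists>x\<in>X. \<forall>y\<in>X. a x y = b z y"
    and N_nonneg: "x \<in> X \<Longrightarrow> N x \<ge> 0" and Mu_nonneg: "Mu \<ge> 0" and Ml_nonneg: "Ml \<ge> 0"
begin

definition "A x = restrict (a x) X"
definition "B x = restrict (b x) X"
definition "P x = inv_into X B (A x)"

lemma A_dual: "A \<in> X \<rightarrow> dual_space X N"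
proof
  fix x assume x: "x \<in> X"
  show "A x \<in> dual_space X N" unfolding A_def
  proof (rule dual_spaceI[OF _ _ _ subspace])
    fix y z assume yz: "y \<in> X" "z \<in> X"
    show "a x (y + z) = a x y + a x z"
      using a_sym[OF x closed_add[OF yz]] a_add[OF yz x] a_sym[OF x] yz by simp
  next
    fix c y assume y: "y \<in> X"
    show "a x (c *\<^sub>R y) = c * a x y"
      using a_sym[OF x closed_scale[OF y]] a_scale[OF y x] a_sym[OF x y] by simp
    have "\<bar>a x y\<bar> \<le> Mu * sqrt (b x x) * sqrt (b y y)" using upper[OF x y] by (simp add: mult.assoc)
    also have "\<dots> \<le> Mu * sqrt (b x x) * (c\<^sub>2 * N y)"
      using Mu_nonneg nonneg[OF x] by (intro mult_left_mono le_N y) auto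
    finally show "\<bar>a x y\<bar> \<le> Mu * sqrt (b x x) * c\<^sub>2 * N y" by (simp add: mult.assoc)
  qed
qed

text \<open>The Riesz representation in the form \<open>b\<close>. Since \<open>N\<close> is
  equivalent to the norm of \<open>b\<close>, both norms admit the same bounded functionals.\<close>

lemma B_bij: "bij_betw B X (dual_space X N)"
  unfolding bij_betw_def
proof
  show "inj_on B X"
  proof (rule inj_onI)
    fix x y assume "x \<in> X" "y \<in> X" "B x = B y"
    then show "x = y"
      by (intro represent_unique) (auto simp: B_def dest: fun_cong split: if_splits simp: restrict_def fun_eq_iff)
  qed
  show "B ` X = dual_space X N"
  proof (intro subset_antisym image_subsetI subsetI)
    fix x assume x: "x \<in> X"
    show "B x \<in> dual_space X N" unfolding B_def
    proof (rule dual_spaceI[OF _ _ _ subspace])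
      fix c y assume y: "y \<in> X"
      have "\<bar>b x y\<bar> \<le> sqrt (b x x) * sqrt (b y y)" by (rule Cauchy_Schwarz[OF x y])
      also have "\<dots> \<le> sqrt (b x x) * (c\<^sub>2 * N y)"
        using nonneg[OF x] by (intro mult_left_mono le_N y) auto
      finally show "\<bar>b x y\<bar> \<le> sqrt (b x x) * c\<^sub>2 * N y" by (simp add: mult.assoc)
    qed (use x in \<open>auto simp: add_right scale_right\<close>)
  next
    fix F assume "F \<in> dual_space X N"
    then obtain C where F: "F \<in> extensional X" "\<forall>x\<in>X. \<forall>y\<in>X. F (x + y) = F x + F y"
      "\<forall>c. \<forall>x\<in>X. F (c *\<^sub>R x) = c * F x" "\<forall>x\<in>X. \<bar>F x\<bar> \<le> C * N x"
      unfolding dual_space_def by auto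
    have "\<exists>v\<in>X. \<forall>x\<in>X. b v x = F x"
    proof (rule riesz)
      fix x assume x: "x \<in> X"
      have "\<bar>F x\<bar> \<le> C * N x" using F(4) x by blast
      also have "\<dots> \<le> \<bar>C\<bar> * N x" using N_nonneg[OF x] by (intro mult_right_mono) auto
      also have "\<dots> \<le> \<bar>C\<bar> * (c\<^sub>1 * sqrt (b x x))" by (intro mult_left_mono N_le x) auto
      finally show "\<bar>F x\<bar> \<le> \<bar>C\<bar> * c\<^sub>1 * sqrt (b x x)" by (simp add: mult.assoc)
    qed (use F in auto)
    then obtain v where v: "v \<in> X" "\<forall>x\<in>X. b v x = F x" by blast
    have "B v = F"
      using F(1) v(2) by (auto simp: B_def restrict_def extensional_def)
    with v(1) show "F \<in> B ` X" by blast
  qed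
qed

lemma P_in: "x \<in> X \<Longrightarrow> P x \<in> X"
  and P_eq: "x \<in> X \<Longrightarrow> y \<in> X \<Longrightarrow> b (P x) y = a x y"
proof -
  assume x: "x \<in> X"
  then have "A x \<in> B ` X" using A_dual B_bij by (auto simp: bij_betw_def)
  then have "P x \<in> X \<and> B (P x) = A x"
    unfolding P_def by (simp add: inv_into_into f_inv_into_f)
  then show "P x \<in> X" "y \<in> X \<Longrightarrow> b (P x) y = a x y"
    by (auto simp: A_def B_def dest: fun_cong[where x = y])
qed

lemma P_lower: "x \<in> X \<Longrightarrow> sqrt (b x x) \<le> Ml * sqrt (b (P x) (P x))"
  by (rule lower) (simp_all add: P_in P_eq)

lemma P_upper: "x \<in> X \<Longrightarrow> sqrt (b (P x) (P x)) \<le> Mu * sqrt (b x x)"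
proof -
  assume x: "x \<in> X"
  have "sqrt (b (P x) (P x)) * sqrt (b (P x) (P x)) = a x (P x)"
    using nonneg[OF P_in[OF x]] P_eq[OF x P_in[OF x]] by simp
  also have "\<dots> \<le> (Mu * sqrt (b x x)) * sqrt (b (P x) (P x))"
    using upper[OF x P_in[OF x]] by (simp add: mult.assoc)
  finally have "sqrt (b (P x) (P x)) * sqrt (b (P x) (P x)) \<le> (Mu * sqrt (b x x)) * sqrt (b (P x) (P x))" .
  moreover have "sqrt (b (P x) (P x)) \<ge> 0" "Mu * sqrt (b x x) \<ge> 0"
    using Mu_nonneg nonneg[OF x] nonneg[OF P_in[OF x]] by auto
  ultimately show ?thesis by (rule mult_self_le_imp_le)
qed

lemma P_bij: "bij_betw P X X"
  unfolding bij_betw_def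
proof
  show "inj_on P X"
  proof (rule inj_onI)
    fix x y assume xy: "x \<in> X" "y \<in> X" "P x = P y"
    have d: "x - y \<in> X" using xy by (intro closed_diff)
    \<comment> \<open>The difference is mapped to 0, so the inverse bound with image 0 shows that
      its norm is 0.\<close>
    have "sqrt (b (x - y) (x - y)) \<le> Ml * sqrt (b 0 0)"
    proof (rule lower[OF d closed_zero])
      fix z assume z: "z \<in> X"
      have "a (x - y) z = a x z - a y z"
        using a_add[OF xy(1) closed_scale[OF xy(2)] z, of "- 1"] a_scale[OF xy(2) z, of "- 1"] by simp
      also have "\<dots> = 0" using P_eq[OF xy(1) z] P_eq[OF xy(2) z] xy(3) by simp
      finally show "b 0 z = a (x - y) z" using scale_left[OF z z, of 0] by simp
    qed
    moreover have "b 0 0 = 0" using scale_left[OF closed_zero closed_zero, of 0] by simp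
    ultimately have "b (x - y) (x - y) = 0" using nonneg[OF d] by simp
    then show "x = y" using definite[OF d] by simp
  qed
  show "P ` X = X"
  proof (intro subset_antisym image_subsetI subsetI)
    fix z assume z: "z \<in> X"
    then obtain x where x: "x \<in> X" "\<forall>y\<in>X. a x y = b z y" using surjective by blast
    have "P x = z" by (rule represent_unique) (use x z P_in P_eq in auto)
    with x(1) show "z \<in> P ` X" by blast
  qed (rule P_in)
qed

lemma P_cond: "cond_number X (\<lambda>x. sqrt (b x x)) P \<le> ennreal (Mu * Ml)"
proof -
  have pos: "sqrt (b x x) > 0" if "x \<in> X" "x \<noteq> 0" for x
    using nonneg[OF that(1)] definite[OF that(1)] that(2) by fastforce
  have "op_norm X (\<lambda>x. sqrt (b x x)) P \<le> ennreal Mu"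
    by (rule op_norm_le, erule P_upper, erule (1) pos)
  moreover have "op_norm X (\<lambda>x. sqrt (b x x)) (inv_into X P) \<le> ennreal Ml"
  proof (rule op_norm_le)
    fix z assume "z \<in> X"
    then have "inv_into X P z \<in> X" "P (inv_into X P z) = z"
      using P_bij by (auto simp: bij_betw_def inv_into_into f_inv_into_f)
    then show "sqrt (b (inv_into X P z) (inv_into X P z)) \<le> Ml * sqrt (b z z)"
      using P_lower by metis
  qed (rule pos)
  ultimately have "cond_number X (\<lambda>x. sqrt (b x x)) P \<le> ennreal Mu * ennreal Ml"
    unfolding cond_number_def by (rule mult_mono) auto
  also have "\<dots> = ennreal (Mu * Ml)"
    using Mu_nonneg Ml_nonneg by (simp add: ennreal_mult)
  finally show ?thesis .
qed

end

section \<open>The block operators in abstract form\<close>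

text \<open>Equivalent forms have the same Cauchy sequences and the same limits.\<close>

lemma hilbert_form_equivalent:
  assumes "hilbert_form V b"
    and add': "\<And>x y z. x \<in> V \<Longrightarrow> y \<in> V \<Longrightarrow> z \<in> V \<Longrightarrow> b' (x + y) z = b' x z + b' y z"
    and scale': "\<And>c x y. x \<in> V \<Longrightarrow> y \<in> V \<Longrightarrow> b' (c *\<^sub>R x) y = c * b' x y"
    and sym': "\<And>x y. x \<in> V \<Longrightarrow> y \<in> V \<Longrightarrow> b' x y = b' y x"
    and le: "\<And>x. x \<in> V \<Longrightarrow> b x x \<le> b' x x" and ge: "\<And>x. x \<in> V \<Longrightarrow> b' x x \<le> 2 * b x x"
  shows "hilbert_form V b'"
proof -
  interpret hilbert_form V b by fact
  show ?thesis
  proof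
    fix u :: "nat \<Rightarrow> 'a"
    assume u: "\<And>n. u n \<in> V" and C: "\<And>\<epsilon>. \<epsilon> > 0 \<Longrightarrow> \<exists>M. \<forall>m\<ge>M. \<forall>n\<ge>M. b' (u m - u n) (u m - u n) < \<epsilon>"
    have d: "u m - u n \<in> V" for m n using u by (intro closed_diff)
    have "\<exists>M. \<forall>m\<ge>M. \<forall>n\<ge>M. b (u m - u n) (u m - u n) < \<epsilon>" if "\<epsilon> > 0" for \<epsilon>
      using C[OF that] le[OF d] by (meson order_le_less_trans)
    from complete[OF u this] obtain l where l: "l \<in> V" "(\<lambda>n. b (u n - l) (u n - l)) \<longlonglongrightarrow> 0" by blast
    have dl: "u n - l \<in> V" for n using u l(1) by (intro closed_diff)
    have "(\<lambda>n. b' (u n - l) (u n - l)) \<longlonglongrightarrow> 0"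
    proof (rule tendsto_sandwich[OF _ _ tendsto_const])
      show "\<forall>\<^sub>F n in sequentially. 0 \<le> b' (u n - l) (u n - l)"
        by (intro always_eventually allI order_trans[OF nonneg[OF dl] le[OF dl]])
      show "\<forall>\<^sub>F n in sequentially. b' (u n - l) (u n - l) \<le> 2 * b (u n - l) (u n - l)"
        using ge[OF dl] by simp
      show "(\<lambda>n. 2 * b (u n - l) (u n - l)) \<longlonglongrightarrow> 0"
        using tendsto_mult_right[OF l(2), of 2] by (simp add: mult.commute)
    qed
    with l(1) show "\<exists>l\<in>V. (\<lambda>n. b' (u n - l) (u n - l)) \<longlonglongrightarrow> 0" by blast
  next
    fix x assume x: "x \<in> V" "b' x x = 0"
    then have "b x x = 0" using le[of x] nonneg[of x] by simp
    then show "x = 0" using definite x by blast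
  next
    fix x assume x: "x \<in> V"
    then show "0 \<le> b' x x" using le[of x] nonneg[of x] by simp
  qed (fact subspace add' scale' sym')+
qed

lemma young:
  fixes p q s :: real
  assumes "s > 0"
  shows "2 * (p * q) \<le> s * p\<^sup>2 + q\<^sup>2 / s"
proof -
  have "0 \<le> (s * p - q)\<^sup>2 / s" using assms by simp
  also have "\<dots> = s * p\<^sup>2 + q\<^sup>2 / s - 2 * (p * q)"
    using assms by (simp add: power2_eq_square field_simps)
  finally show ?thesis by simp
qed

lemma inner_bounds: "\<bar>2 * inner x y\<bar> \<le> s * (norm x)\<^sup>2 + (norm y)\<^sup>2 / s" if "s > 0"
  using young[OF that, of "norm x" "norm y"] Cauchy_Schwarz_ineq2[of x y] by (simp add: abs_mult)

text \<open>\<open>D\<^sub>1\<close> stands for the time derivative, \<open>D\<^sub>2\<close> for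
  the Laplacian, \<open>m\<close> for the inner product over the observation domain.
  \<open>D_closed\<close> expresses completeness of the state space, as closedness of the pair of
  operators. Cleared of fractions, the equations for \<open>C\<close> and \<open>N\<close> say that
  \<open>C\<close> and \<open>1 / N\<close> are roots of the cubic x^3 - x^2 - 2 x + 1; they are
  stored in the form in which the Young inequalities consume them.\<close>

locale heat_block =
  fixes Y V :: "'h::{real_inner, complete_space} set" and D\<^sub>1 D\<^sub>2 :: "'h \<Rightarrow> 'h"
    and m :: "'h \<Rightarrow> 'h \<Rightarrow> real" and \<alpha> \<kappa> c C N :: real
  assumes V: "subspace V" "closed V" and Y: "subspace Y"
    and D_in: "y \<in> Y \<Longrightarrow> D\<^sub>1 y \<in> V" "y \<in> Y \<Longrightarrow> D\<^sub>2 y \<in> V"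
    and D_add: "y \<in> Y \<Longrightarrow> z \<in> Y \<Longrightarrow> D\<^sub>1 (y + z) = D\<^sub>1 y + D\<^sub>1 z"
      "y \<in> Y \<Longrightarrow> z \<in> Y \<Longrightarrow> D\<^sub>2 (y + z) = D\<^sub>2 y + D\<^sub>2 z"
    and D_scale: "y \<in> Y \<Longrightarrow> D\<^sub>1 (s *\<^sub>R y) = s *\<^sub>R D\<^sub>1 y" "y \<in> Y \<Longrightarrow> D\<^sub>2 (s *\<^sub>R y) = s *\<^sub>R D\<^sub>2 y"
    and dissipative: "y \<in> Y \<Longrightarrow> inner (D\<^sub>1 y) (D\<^sub>2 y) \<le> 0"
    and poincare: "y \<in> Y \<Longrightarrow> norm y \<le> c * norm (D\<^sub>1 y)"
    and D_closed: "\<lbrakk>\<And>n. v n \<in> Y; (\<lambda>n. D\<^sub>1 (v n)) \<longlonglongrightarrow> g; (\<lambda>n. D\<^sub>2 (v n)) \<longlonglongrightarrow> k\<rbrakk>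
      \<Longrightarrow> \<exists>z\<in>Y. D\<^sub>1 z = g \<and> D\<^sub>2 z = k"
    and m_add: "m (y + z) w = m y w + m z w" and m_scale: "m (s *\<^sub>R y) w = s * m y w"
    and m_sym: "m y z = m z y" and m_nonneg: "m y y \<ge> 0" and m_le: "m y y \<le> (norm y)\<^sup>2"
    and \<alpha>: "\<alpha> > 0" and \<kappa>: "\<kappa> > 0"
    and C: "C > 1" "1 / C + 1 / (C - 1) = C" and N: "N \<ge> 2" "1 / N + 1 / (N - 1) = N - 1"
begin

definition "H y = D\<^sub>1 y - \<kappa> *\<^sub>R D\<^sub>2 y"

definition "X = Y \<times> V \<times> V"

definition "a = (\<lambda>(y, u, \<mu>) (y', u', \<mu>'). m y y' + inner (H y') \<mu> + (\<alpha> * inner u u' + inner \<mu> u')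
  + (inner (H y) \<mu>' + inner u \<mu>'))"

definition "b = (\<lambda>(y, u, \<mu>) (y', u', \<mu>').
  (m y y' + \<alpha> * \<kappa>\<^sup>2 * inner (D\<^sub>2 y) (D\<^sub>2 y') + \<alpha> * inner (D\<^sub>1 y) (D\<^sub>1 y'))
  + \<alpha> * inner u u' + (1 / \<alpha>) * inner \<mu> \<mu>')"

text \<open>In the unknowns sqrt(\<alpha>) H y, sqrt(\<alpha>) u and \<mu> / sqrt(\<alpha>), this
  form is \<open>m\<close> plus a sum of squares, and \<open>a\<close> couples the same three
  unknowns with coefficients 0 and 1. So \<alpha> and \<kappa> disappear, and the bounds are those
  of a fixed matrix.\<close>

definition "bt = (\<lambda>(y, u, \<mu>) (y', u', \<mu>').
  (m y y' + \<alpha> * inner (H y) (H y')) + \<alpha> * inner u u' + (1 / \<alpha>) * inner \<mu> \<mu>')"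

definition "XN = (\<lambda>(y, u, \<mu>). sqrt ((norm (H y))\<^sup>2 + (norm u)\<^sup>2 + (norm \<mu>)\<^sup>2))"

lemma H_in: "y \<in> Y \<Longrightarrow> H y \<in> V"
  unfolding H_def using D_in subspace_diff[OF V(1)] subspace_scale[OF V(1)] by blast

lemma H_add: "y \<in> Y \<Longrightarrow> z \<in> Y \<Longrightarrow> H (y + z) = H y + H z"
  unfolding H_def by (simp add: D_add scaleR_add_right)

lemma H_scale: "y \<in> Y \<Longrightarrow> H (s *\<^sub>R y) = s *\<^sub>R H y"
  unfolding H_def by (simp add: D_scale scaleR_diff_right)

lemma D1_diff: "y \<in> Y \<Longrightarrow> z \<in> Y \<Longrightarrow> D\<^sub>1 (y - z) = D\<^sub>1 y - D\<^sub>1 z"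
  using D_add(1)[of y "- 1 *\<^sub>R z"] D_scale(1)[of z "- 1"] subspace_scale[OF Y, of z "- 1"] by simp

lemma D2_diff: "y \<in> Y \<Longrightarrow> z \<in> Y \<Longrightarrow> D\<^sub>2 (y - z) = D\<^sub>2 y - D\<^sub>2 z"
  using D_add(2)[of y "- 1 *\<^sub>R z"] D_scale(2)[of z "- 1"] subspace_scale[OF Y, of z "- 1"] by simp

lemma H_diff: "y \<in> Y \<Longrightarrow> z \<in> Y \<Longrightarrow> H (y - z) = H y - H z"
  unfolding H_def by (simp add: D1_diff D2_diff scaleR_diff_right)

lemma H_zero: "H 0 = 0"
  using H_scale[OF subspace_0[OF Y], of 0] by simp

lemma m_zero: "m 0 y = 0" "m y 0 = 0"
  using m_scale[of 0 0 y] m_sym[of y 0] by simp_all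

lemma m_diff: "m (y - z) w = m y w - m z w"
  using m_add[of y "- 1 *\<^sub>R z" w] m_scale[of "- 1" z w] by simp

lemma norm_H_square: "(norm (H y))\<^sup>2 = (norm (D\<^sub>1 y))\<^sup>2 + \<kappa>\<^sup>2 * (norm (D\<^sub>2 y))\<^sup>2 - 2 * \<kappa> * inner (D\<^sub>1 y) (D\<^sub>2 y)"
  unfolding H_def power2_norm_eq_inner
  by (simp add: inner_diff_left inner_diff_right inner_commute[of "D\<^sub>2 y" "D\<^sub>1 y"] power2_eq_square algebra_simps)

text \<open>This is where dissipativity enters: the heat operator dominates both of its terms.\<close>

lemma norm_H_lower: "y \<in> Y \<Longrightarrow> (norm (D\<^sub>1 y))\<^sup>2 + \<kappa>\<^sup>2 * (norm (D\<^sub>2 y))\<^sup>2 \<le> (norm (H y))\<^sup>2"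
  unfolding norm_H_square using dissipative[of y] \<kappa> by (simp add: mult_nonneg_nonpos)

lemma norm_H_upper: "(norm (H y))\<^sup>2 \<le> 2 * ((norm (D\<^sub>1 y))\<^sup>2 + \<kappa>\<^sup>2 * (norm (D\<^sub>2 y))\<^sup>2)"
proof -
  have "\<bar>2 * inner (D\<^sub>1 y) (\<kappa> *\<^sub>R D\<^sub>2 y)\<bar> \<le> 1 * (norm (D\<^sub>1 y))\<^sup>2 + (norm (\<kappa> *\<^sub>R D\<^sub>2 y))\<^sup>2 / 1"
    by (rule inner_bounds) simp
  then show ?thesis unfolding norm_H_square by (simp add: power_mult_distrib)
qed

lemma subspace_X: "subspace X"
  unfolding X_def by (intro subspace_Times V Y)

lemma b_add: "x \<in> X \<Longrightarrow> y \<in> X \<Longrightarrow> z \<in> X \<Longrightarrow> b (x + y) z = b x z + b y z"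
  by (auto simp: X_def b_def D_add m_add inner_add_left algebra_simps add_divide_distrib)

lemma b_scale: "x \<in> X \<Longrightarrow> y \<in> X \<Longrightarrow> b (s *\<^sub>R x) y = s * b x y"
  by (auto simp: X_def b_def D_scale m_scale algebra_simps)

lemma b_sym: "b x y = b y x"
  by (cases x; cases y) (simp add: b_def m_sym inner_commute)

lemma bt_add: "x \<in> X \<Longrightarrow> y \<in> X \<Longrightarrow> z \<in> X \<Longrightarrow> bt (x + y) z = bt x z + bt y z"
  by (auto simp: X_def bt_def H_add m_add inner_add_left algebra_simps add_divide_distrib)

lemma bt_scale: "x \<in> X \<Longrightarrow> y \<in> X \<Longrightarrow> bt (s *\<^sub>R x) y = s * bt x y"
  by (auto simp: X_def bt_def H_scale m_scale algebra_simps)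

lemma bt_sym: "bt x y = bt y x"
  by (cases x; cases y) (simp add: bt_def m_sym inner_commute)

lemma a_add: "x \<in> X \<Longrightarrow> y \<in> X \<Longrightarrow> z \<in> X \<Longrightarrow> a (x + y) z = a x z + a y z"
  by (auto simp: X_def a_def H_add m_add inner_add_left inner_add_right algebra_simps)

lemma a_scale: "x \<in> X \<Longrightarrow> y \<in> X \<Longrightarrow> a (s *\<^sub>R x) y = s * a x y"
  by (auto simp: X_def a_def H_scale m_scale algebra_simps)

lemma a_sym: "a x y = a y x"
proof -
  obtain y1 u1 w1 y2 u2 w2 where "x = (y1, u1, w1)" "y = (y2, u2, w2)" by (metis prod.exhaust)
  then show ?thesis
    by (simp add: a_def m_sym[of y1 y2] inner_commute[of u1 u2] inner_commute[of w1 u2] inner_commute[of u1 w2])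
qed

lemma b_diag: "b (y, u, \<mu>) (y, u, \<mu>) =
    m y y + \<alpha> * ((norm (D\<^sub>1 y))\<^sup>2 + \<kappa>\<^sup>2 * (norm (D\<^sub>2 y))\<^sup>2) + \<alpha> * (norm u)\<^sup>2 + (norm \<mu>)\<^sup>2 / \<alpha>"
  by (simp add: b_def power2_norm_eq_inner algebra_simps)

lemma bt_diag: "bt (y, u, \<mu>) (y, u, \<mu>) =
    m y y + \<alpha> * (norm (H y))\<^sup>2 + \<alpha> * (norm u)\<^sup>2 + (norm \<mu>)\<^sup>2 / \<alpha>"
  by (simp add: bt_def power2_norm_eq_inner)

lemma a_diag: "a (y, u, \<mu>) (y, u, \<mu>) =
    m y y + 2 * inner (H y) \<mu> + \<alpha> * (norm u)\<^sup>2 + 2 * inner u \<mu>"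
  by (simp add: a_def power2_norm_eq_inner inner_commute)

lemma b_le_bt: "x \<in> X \<Longrightarrow> b x x \<le> bt x x"
  using norm_H_lower \<alpha> by (auto simp: X_def b_diag bt_diag simp del: distrib_left_numeral)

lemma bt_le_b: "x \<in> X \<Longrightarrow> bt x x \<le> 2 * b x x"
proof -
  assume "x \<in> X"
  obtain y u \<mu> where x: "x = (y, u, \<mu>)" by (metis prod.exhaust)
  have "\<alpha> * (norm (H y))\<^sup>2 \<le> \<alpha> * (2 * ((norm (D\<^sub>1 y))\<^sup>2 + \<kappa>\<^sup>2 * (norm (D\<^sub>2 y))\<^sup>2))"
    using norm_H_upper \<alpha> by (intro mult_left_mono) auto
  then have "\<alpha> * (norm (H y))\<^sup>2 \<le> 2 * (\<alpha> * ((norm (D\<^sub>1 y))\<^sup>2 + \<kappa>\<^sup>2 * (norm (D\<^sub>2 y))\<^sup>2))"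
    by (simp only: mult.left_commute)
  moreover have "0 \<le> \<alpha> * (norm u)\<^sup>2" "0 \<le> (norm \<mu>)\<^sup>2 / \<alpha>" using \<alpha> by auto
  ultimately show ?thesis
    unfolding x b_diag bt_diag using m_nonneg[of y] by argo
qed

text \<open>Of \<open>y\<close> itself the form sees only the seminorm \<open>m\<close>; the limit
  in the first component is recovered from the limits of \<open>D\<^sub>1 y\<close> and
  \<open>D\<^sub>2 y\<close> by closedness. The inequality \<open>poincare\<close> then controls the
  \<open>m\<close> term, and it also gives definiteness.\<close>

lemma hilbert_form_b: "hilbert_form X b"
proof
  show "subspace X" by (rule subspace_X)
  show "b x y = b y x" for x y by (rule b_sym)
  show "b x x \<ge> 0" for x
    using \<alpha> m_nonneg by (cases x) (auto simp: b_diag intro!: add_nonneg_nonneg)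
  show "x = 0" if "x \<in> X" "b x x = 0" for x
  proof -
    obtain y u \<mu> where x: "x = (y, u, \<mu>)" by (metis prod.exhaust)
    have y: "y \<in> Y" using that(1) by (auto simp: X_def x)
    have "m y y \<ge> 0" "\<alpha> * ((norm (D\<^sub>1 y))\<^sup>2 + \<kappa>\<^sup>2 * (norm (D\<^sub>2 y))\<^sup>2) \<ge> 0" "\<alpha> * (norm u)\<^sup>2 \<ge> 0" "(norm \<mu>)\<^sup>2 / \<alpha> \<ge> 0"
      using \<alpha> m_nonneg by auto
    then have 0: "\<alpha> * ((norm (D\<^sub>1 y))\<^sup>2 + \<kappa>\<^sup>2 * (norm (D\<^sub>2 y))\<^sup>2) = 0" "\<alpha> * (norm u)\<^sup>2 = 0" "(norm \<mu>)\<^sup>2 / \<alpha> = 0"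
      using that(2) unfolding x b_diag by linarith+
    then have "D\<^sub>1 y = 0" using \<alpha> \<kappa> by (simp add: add_nonneg_eq_0_iff)
    then have "y = 0" using poincare[OF y] by simp
    with 0 \<alpha> show ?thesis by (simp add: x zero_prod_def)
  qed
  fix v :: "nat \<Rightarrow> 'h \<times> 'h \<times> 'h"
  assume v: "\<And>n. v n \<in> X"
    and Cau: "\<And>\<epsilon>. \<epsilon> > 0 \<Longrightarrow> \<exists>M. \<forall>m\<ge>M. \<forall>n\<ge>M. b (v m - v n) (v m - v n) < \<epsilon>"
  define y u \<mu> where "y n = fst (v n)" and "u n = fst (snd (v n))" and "\<mu> n = snd (snd (v n))" for n
  have v_eq: "v n = (y n, u n, \<mu> n)" for n by (simp add: y_def u_def \<mu>_def)
  have in_X: "y n \<in> Y" "u n \<in> V" "\<mu> n \<in> V" for n using v[of n] by (auto simp: X_def v_eq)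
  have b_v: "b (v i - v j) (v i - v j) = m (y i - y j) (y i - y j)
      + \<alpha> * ((norm (D\<^sub>1 (y i) - D\<^sub>1 (y j)))\<^sup>2 + \<kappa>\<^sup>2 * (norm (D\<^sub>2 (y i) - D\<^sub>2 (y j)))\<^sup>2)
      + \<alpha> * (norm (u i - u j))\<^sup>2 + (norm (\<mu> i - \<mu> j))\<^sup>2 / \<alpha>" for i j
    by (simp add: v_eq b_diag D1_diff D2_diff in_X)
  have conv: "\<exists>l. f \<longlonglongrightarrow> l" if f: "\<And>i j. s * (norm (f i - f j))\<^sup>2 \<le> b (v i - v j) (v i - v j)" and s: "s > 0"
    for f :: "nat \<Rightarrow> 'h" and s
  proof -
    have "Cauchy f"
    proof (rule metric_CauchyI)
      fix e :: real assume e: "e > 0"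
      then have "s * e\<^sup>2 > 0" using s by simp
      then obtain M where M: "\<And>i j. i \<ge> M \<Longrightarrow> j \<ge> M \<Longrightarrow> b (v i - v j) (v i - v j) < s * e\<^sup>2"
        using Cau by blast
      have "dist (f i) (f j) < e" if "i \<ge> M" "j \<ge> M" for i j
      proof -
        have "s * (norm (f i - f j))\<^sup>2 < s * e\<^sup>2" using f[of i j] M[OF that] by linarith
        then show ?thesis using s e by (simp add: dist_norm power_less_imp_less_base)
      qed
      then show "\<exists>M. \<forall>i\<ge>M. \<forall>j\<ge>M. dist (f i) (f j) < e" by blast
    qed
    then show ?thesis by (auto simp: Cauchy_convergent_iff convergent_def)
  qed
  have parts: "\<alpha> * (norm (D\<^sub>1 (y i) - D\<^sub>1 (y j)))\<^sup>2 \<le> b (v i - v j) (v i - v j)"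
    "(\<alpha> * \<kappa>\<^sup>2) * (norm (D\<^sub>2 (y i) - D\<^sub>2 (y j)))\<^sup>2 \<le> b (v i - v j) (v i - v j)"
    "\<alpha> * (norm (u i - u j))\<^sup>2 \<le> b (v i - v j) (v i - v j)"
    "(1 / \<alpha>) * (norm (\<mu> i - \<mu> j))\<^sup>2 \<le> b (v i - v j) (v i - v j)" for i j
  proof -
    define p1 p2 p3 p4 p5 where "p1 = m (y i - y j) (y i - y j)"
      and "p2 = \<alpha> * (norm (D\<^sub>1 (y i) - D\<^sub>1 (y j)))\<^sup>2"
      and "p3 = (\<alpha> * \<kappa>\<^sup>2) * (norm (D\<^sub>2 (y i) - D\<^sub>2 (y j)))\<^sup>2"
      and "p4 = \<alpha> * (norm (u i - u j))\<^sup>2" and "p5 = (1 / \<alpha>) * (norm (\<mu> i - \<mu> j))\<^sup>2"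
    have "b (v i - v j) (v i - v j) = p1 + p2 + p3 + p4 + p5"
      unfolding b_v p1_def p2_def p3_def p4_def p5_def by (simp add: distrib_left)
    moreover have "p1 \<ge> 0" "p2 \<ge> 0" "p3 \<ge> 0" "p4 \<ge> 0" "p5 \<ge> 0"
      unfolding p1_def p2_def p3_def p4_def p5_def using \<alpha> m_nonneg by auto
    ultimately have "p2 \<le> b (v i - v j) (v i - v j)" "p3 \<le> b (v i - v j) (v i - v j)"
      "p4 \<le> b (v i - v j) (v i - v j)" "p5 \<le> b (v i - v j) (v i - v j)" by linarith+
    then show "\<alpha> * (norm (D\<^sub>1 (y i) - D\<^sub>1 (y j)))\<^sup>2 \<le> b (v i - v j) (v i - v j)"
      "(\<alpha> * \<kappa>\<^sup>2) * (norm (D\<^sub>2 (y i) - D\<^sub>2 (y j)))\<^sup>2 \<le> b (v i - v j) (v i - v j)"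
      "\<alpha> * (norm (u i - u j))\<^sup>2 \<le> b (v i - v j) (v i - v j)"
      "(1 / \<alpha>) * (norm (\<mu> i - \<mu> j))\<^sup>2 \<le> b (v i - v j) (v i - v j)"
      by (simp_all only: p2_def p3_def p4_def p5_def)
  qed
  obtain g where g: "(\<lambda>n. D\<^sub>1 (y n)) \<longlonglongrightarrow> g"
    using conv[OF parts(1)] \<alpha> by blast
  obtain k where k: "(\<lambda>n. D\<^sub>2 (y n)) \<longlonglongrightarrow> k"
    using conv[OF parts(2)] \<alpha> \<kappa> by auto
  obtain u' where u': "u \<longlonglongrightarrow> u'"
    using conv[OF parts(3)] \<alpha> by blast
  obtain \<mu>' where \<mu>': "\<mu> \<longlonglongrightarrow> \<mu>'"
    using conv[OF parts(4)] \<alpha> by auto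
  obtain z where z: "z \<in> Y" "D\<^sub>1 z = g" "D\<^sub>2 z = k" using D_closed[OF in_X(1) g k] by blast
  have uV: "u' \<in> V" "\<mu>' \<in> V"
    using closed_sequentially[OF V(2)] in_X u' \<mu>' by blast+
  have "(\<lambda>n. b (v n - (z, u', \<mu>')) (v n - (z, u', \<mu>'))) \<longlonglongrightarrow> 0"
  proof (rule tendsto_sandwich[OF _ _ tendsto_const])
    let ?f = "\<lambda>n. c\<^sup>2 * (norm (D\<^sub>1 (y n) - g))\<^sup>2 + \<alpha> * ((norm (D\<^sub>1 (y n) - g))\<^sup>2 + \<kappa>\<^sup>2 * (norm (D\<^sub>2 (y n) - k))\<^sup>2)
      + \<alpha> * (norm (u n - u'))\<^sup>2 + (norm (\<mu> n - \<mu>'))\<^sup>2 / \<alpha>"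
    show "\<forall>\<^sub>F n in sequentially. 0 \<le> b (v n - (z, u', \<mu>')) (v n - (z, u', \<mu>'))"
      using \<alpha> m_nonneg by (auto simp: v_eq b_diag intro!: always_eventually add_nonneg_nonneg)
    have "m (y n - z) (y n - z) \<le> c\<^sup>2 * (norm (D\<^sub>1 (y n) - g))\<^sup>2" for n
    proof -
      have "m (y n - z) (y n - z) \<le> (norm (y n - z))\<^sup>2" by (rule m_le)
      also have "\<dots> \<le> (c * norm (D\<^sub>1 (y n - z)))\<^sup>2"
        using poincare[OF subspace_diff[OF Y in_X(1)[of n] z(1)]] by (intro power_mono) auto
      finally show ?thesis by (simp add: D1_diff in_X z power_mult_distrib)
    qed
    then show "\<forall>\<^sub>F n in sequentially. b (v n - (z, u', \<mu>')) (v n - (z, u', \<mu>')) \<le> ?f n"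
      by (simp add: v_eq b_diag D1_diff D2_diff in_X z)
    have "?f \<longlonglongrightarrow> c\<^sup>2 * (norm (g - g))\<^sup>2 + \<alpha> * ((norm (g - g))\<^sup>2 + \<kappa>\<^sup>2 * (norm (k - k))\<^sup>2)
      + \<alpha> * (norm (u' - u'))\<^sup>2 + (norm (\<mu>' - \<mu>'))\<^sup>2 / \<alpha>"
      using \<alpha> by (intro tendsto_intros g k u' \<mu>') auto
    then show "?f \<longlonglongrightarrow> 0" by simp
  qed
  moreover have "(z, u', \<mu>') \<in> X" using z uV by (simp add: X_def)
  ultimately show "\<exists>l\<in>X. (\<lambda>n. b (v n - l) (v n - l)) \<longlonglongrightarrow> 0" by blast
qed (fact b_add b_scale)+

section \<open>Bounds of the block form and of its inverse in the stronger norm\<close>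

sublocale b: hilbert_form X b by (rule hilbert_form_b)

sublocale bt: hilbert_form X bt
  by (rule hilbert_form_equivalent[OF hilbert_form_b bt_add bt_scale bt_sym b_le_bt bt_le_b])

text \<open>The weights are dictated by what is left over. The square of \<open>H y\<close> does not
  occur in \<open>a\<close>, so its Young weight may be all of \<open>C\<close>; the square of
  \<open>u\<close> already occurs once, so \<open>C - 1\<close> remains. The reciprocal weights add
  up on the square of \<mu> to exactly \<open>C\<close>, by the equation for
  \<open>C\<close>.\<close>

lemma a_diag_upper:
  assumes "x \<in> X"
  shows "\<bar>a x x\<bar> \<le> C * bt x x"
proof -
  obtain y u \<mu> where x: "x = (y, u, \<mu>)" by (metis prod.exhaust)
  have h: "\<bar>2 * inner (H y) \<mu>\<bar> \<le> (C * \<alpha>) * (norm (H y))\<^sup>2 + (norm \<mu>)\<^sup>2 / (C * \<alpha>)"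
    using C(1) \<alpha> by (intro inner_bounds) simp
  have u: "\<bar>2 * inner u \<mu>\<bar> \<le> ((C - 1) * \<alpha>) * (norm u)\<^sup>2 + (norm \<mu>)\<^sup>2 / ((C - 1) * \<alpha>)"
    using C(1) \<alpha> by (intro inner_bounds) simp
  have "(norm \<mu>)\<^sup>2 / (C * \<alpha>) + (norm \<mu>)\<^sup>2 / ((C - 1) * \<alpha>) = (1 / C + 1 / (C - 1)) * ((norm \<mu>)\<^sup>2 / \<alpha>)"
    by (simp add: distrib_right add_divide_distrib)
  also have "\<dots> = C * ((norm \<mu>)\<^sup>2 / \<alpha>)" by (simp only: C(2))
  finally have \<mu>: "(norm \<mu>)\<^sup>2 / (C * \<alpha>) + (norm \<mu>)\<^sup>2 / ((C - 1) * \<alpha>) = C * ((norm \<mu>)\<^sup>2 / \<alpha>)" .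
  have e: "C * bt x x = C * m y y + (C * \<alpha>) * (norm (H y))\<^sup>2 + \<alpha> * (norm u)\<^sup>2 + ((C - 1) * \<alpha>) * (norm u)\<^sup>2
      + C * ((norm \<mu>)\<^sup>2 / \<alpha>)"
    unfolding x bt_diag by (simp add: algebra_simps)
  have mC: "m y y \<le> C * m y y" using mult_right_mono[of 1 C "m y y"] C(1) m_nonneg by simp
  have nn: "\<alpha> * (norm u)\<^sup>2 \<ge> 0" "m y y \<ge> 0" using \<alpha> m_nonneg by auto
  show ?thesis
    unfolding e unfolding x a_diag using h u \<mu> mC nn by linarith
qed

lemma a_upper:
  assumes "x \<in> X" "y \<in> X"
  shows "\<bar>a x y\<bar> \<le> C * (sqrt (bt x x) * sqrt (bt y y))"
proof (rule polarization_bound[OF subspace_X a_add a_scale a_sym bt_add bt_scale bt_sym _ a_diag_upper assms])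
  show "0 < bt x x" if "x \<in> X" "x \<noteq> 0" for x
    using bt.nonneg[OF that(1)] bt.definite[OF that(1)] that(2) by fastforce
qed

text \<open>\<open>G\<close> is the image of \<open>x\<close> under the operator preconditioned by
  the stronger form \<open>bt\<close>.\<close>

lemma bt_representation:
  assumes "x \<in> X"
  shows "\<exists>G\<in>X. \<forall>z\<in>X. bt G z = a x z"
proof (rule bt.riesz)
  fix z w s assume z: "z \<in> X" and w: "w \<in> X"
  show "a x (z + w) = a x z + a x w" using a_add[OF z w assms] by (simp add: a_sym)
  show "\<bar>a x z\<bar> \<le> C * sqrt (bt x x) * sqrt (bt z z)" using a_upper[OF assms z] by (simp add: mult.assoc)
next
  fix z s assume z: "z \<in> X"
  show "a x (s *\<^sub>R z) = s * a x z" using a_scale[OF z assms] by (simp add: a_sym)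
qed

text \<open>The rows of the system with representative \<open>(f, g, k)\<close>, read off by testing
  with one nonzero component; the second and third are tested with their own residuals. In the first
  row, \<mu> is eliminated by the other two, so that only the difference \<open>f - y\<close>
  remains on the left.\<close>

lemma block_equations:
  assumes x: "(y, u, \<mu>) \<in> X" and G: "(f, g, k) \<in> X"
    and eq: "\<And>z. z \<in> X \<Longrightarrow> bt (f, g, k) z = a (y, u, \<mu>) z"
  shows "\<alpha> *\<^sub>R g = \<alpha> *\<^sub>R u + \<mu>" and "k = \<alpha> *\<^sub>R (H y + u)"
    and "\<And>y'. y' \<in> Y \<Longrightarrow> m (f - y) y' + \<alpha> * inner (H (f - y)) (H y') = inner (\<alpha> *\<^sub>R g - k) (H y')"
proof -
  have in': "y \<in> Y" "u \<in> V" "\<mu> \<in> V" "f \<in> Y" "g \<in> V" "k \<in> V" using x G by (auto simp: X_def)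
  note V_cl = subspace_add[OF V(1)] subspace_diff[OF V(1)] subspace_scale[OF V(1)] H_in
  have 0: "0 \<in> Y" "0 \<in> V" using subspace_0 Y V by auto
  let ?d = "\<alpha> *\<^sub>R g - (\<alpha> *\<^sub>R u + \<mu>)"
  have d: "?d \<in> V" using in' by (intro V_cl)
  then have "(0, ?d, 0) \<in> X" using 0 by (simp add: X_def)
  from eq[OF this] have "inner ?d ?d = 0"
    by (simp add: bt_def a_def m_zero H_zero inner_diff_left inner_add_left)
  then show 1: "\<alpha> *\<^sub>R g = \<alpha> *\<^sub>R u + \<mu>" by simp
  let ?e = "k - \<alpha> *\<^sub>R (H y + u)"
  have "?e \<in> V" using in' by (intro V_cl)
  then have "(0, 0, ?e) \<in> X" using 0 by (simp add: X_def)
  from eq[OF this] have "inner k ?e / \<alpha> = inner (H y + u) ?e"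
    by (simp add: bt_def a_def m_zero H_zero inner_add_left)
  then have "inner k ?e - \<alpha> * inner (H y + u) ?e = 0" using \<alpha> by (simp add: field_simps)
  moreover have "inner k ?e - \<alpha> * inner (H y + u) ?e = inner ?e ?e"
    by (simp add: inner_diff_left)
  ultimately have "inner ?e ?e = 0" by simp
  then have "?e = 0" by (simp only: inner_eq_zero_iff)
  then show 2: "k = \<alpha> *\<^sub>R (H y + u)" by simp
  fix y' assume y': "y' \<in> Y"
  then have "(y', 0, 0) \<in> X" using 0 by (simp add: X_def)
  from eq[OF this] have "m f y' + \<alpha> * inner (H f) (H y') = m y y' + inner (H y') \<mu>"
    by (simp add: bt_def a_def)
  then show "m (f - y) y' + \<alpha> * inner (H (f - y)) (H y') = inner (\<alpha> *\<^sub>R g - k) (H y')"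
    unfolding 1 2 by (simp add: m_diff H_diff in' inner_diff_left inner_add_left inner_add_right
        inner_commute[of \<mu>] algebra_simps)
qed

text \<open>
  Eliminating \<open>u\<close> and \<open>\<mu>\<close> by the last two rows gives \<open>a x x = S y y + 2 \<langle>g, k\<rangle> - \<parallel>k\<parallel>\<^sup>2 / \<alpha>\<close>.
  In the resulting upper bound the terms quadratic in \<open>k\<close> cancel.
\<close>

lemma a_diag_lower:
  assumes x: "x \<in> X" and G: "G \<in> X" and eq: "\<And>z. z \<in> X \<Longrightarrow> bt G z = a x z"
  shows "\<bar>a x x\<bar> \<le> N * bt G G" and "G = 0 \<Longrightarrow> x = 0"
proof -
  obtain y u \<mu> where x_eq: "x = (y, u, \<mu>)" by (metis prod.exhaust)
  obtain f g k where G_eq: "G = (f, g, k)" by (metis prod.exhaust)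
  note X' = x[unfolded x_eq] G[unfolded G_eq]
  have eq': "bt (f, g, k) z = a (y, u, \<mu>) z" if "z \<in> X" for z using eq[OF that] by (simp add: x_eq G_eq)
  have eq1: "\<alpha> *\<^sub>R g = \<alpha> *\<^sub>R u + \<mu>" by (rule block_equations(1)[OF X' eq'])
  have eq2: "k = \<alpha> *\<^sub>R (H y + u)" by (rule block_equations(2)[OF X' eq'])
  have eq3: "m (f - y) y' + \<alpha> * inner (H (f - y)) (H y') = inner (\<alpha> *\<^sub>R g - k) (H y')" if "y' \<in> Y" for y'
    by (rule block_equations(3)[OF X' eq' that])
  have in': "y \<in> Y" "f \<in> Y" using X' by (auto simp: X_def)
  have u: "u = (1 / \<alpha>) *\<^sub>R k - H y" using eq2 \<alpha> by (simp add: scaleR_add_right)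
  have \<mu>: "\<mu> = \<alpha> *\<^sub>R g - k + \<alpha> *\<^sub>R H y" using eq1 eq2 by (simp add: algebra_simps)
  define v w where "v = f - y" and "w = \<alpha> *\<^sub>R g - k"
  have v: "v \<in> Y" unfolding v_def using in' by (intro subspace_diff[OF Y])
  \<comment> \<open>The first block of \<open>bt\<close>. With respect to it, \<open>v\<close>
    represents the functional \<open>y' \<mapsto> inner w (H y')\<close>, as the third block
    equation states.\<close>
  define S where "S p q = m p q + \<alpha> * inner (H p) (H q)" for p q
  have S_sym: "S p q = S q p" for p q by (simp add: S_def m_sym inner_commute)
  have S_v: "S v y' = inner w (H y')" if "y' \<in> Y" for y'
    using eq3[OF that] by (simp add: S_def v_def w_def)
  have S_diff: "S (p - q) z = S p z - S q z" if "p \<in> Y" "q \<in> Y" for p q z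
    using that by (simp add: S_def m_diff H_diff inner_diff_left algebra_simps)
  have H_le: "\<alpha> * (norm (H p))\<^sup>2 \<le> S p p" for p
    using m_nonneg[of p] by (simp add: S_def power2_norm_eq_inner)
  have S0: "S p p \<ge> 0" for p using H_le[of p] \<alpha> by (meson mult_nonneg_nonneg order_trans less_imp_le zero_le_power2)
  have y_eq: "y = f - v" by (simp add: v_def)
  \<comment> \<open>Expansion at \<open>y = f - v\<close>; the mixed term is explicit because
    \<open>v\<close> is known through the functional it represents.\<close>
  have S_y: "S y y = S f f - 2 * inner w (H f) + S v v"
    using S_diff[of f v y] S_diff[of f v f] S_diff[of f v v] S_v in' v S_sym[of f y] S_sym[of v y] S_sym[of f v]
    unfolding y_eq by (metis (no_types, lifting) S_sym add_diff_eq diff_add_eq diff_diff_eq2 mult_2)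
  \<comment> \<open>Testing the representation with \<open>v\<close> itself gives
    \<open>S v v = inner w (H v)\<close>, and \<open>S v v\<close> in turn dominates \<alpha> times
    the square of the norm of \<open>H v\<close>.\<close>
  have S_vv: "S v v \<le> (norm w)\<^sup>2 / \<alpha>"
  proof (cases "S v v = 0")
    case False
    then have pos: "S v v > 0" using S0[of v] by simp
    have "S v v \<le> norm w * norm (H v)"
      using S_v[OF v] norm_cauchy_schwarz[of w "H v"] by simp
    then have "\<alpha> * (S v v)\<^sup>2 \<le> \<alpha> * (norm w * norm (H v))\<^sup>2"
      using S0[of v] \<alpha> by (intro mult_left_mono power_mono) auto
    also have "\<dots> = (norm w)\<^sup>2 * (\<alpha> * (norm (H v))\<^sup>2)" by (simp add: power_mult_distrib)
    also have "\<dots> \<le> (norm w)\<^sup>2 * S v v" by (intro mult_left_mono H_le) auto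
    finally have "\<alpha> * S v v \<le> (norm w)\<^sup>2" using pos by (simp add: power2_eq_square)
    then show ?thesis using \<alpha> by (simp add: field_simps)
  qed (use \<alpha> in simp)
  have ax: "a x x = S y y + 2 * inner g k - (norm k)\<^sup>2 / \<alpha>"
  proof -
    have "a x x = m y y + inner (H y) (2 *\<^sub>R \<mu>) + inner u (\<alpha> *\<^sub>R u + 2 *\<^sub>R \<mu>)"
      unfolding x_eq a_diag power2_norm_eq_inner by (simp add: inner_add_right)
    also have "\<dots> = m y y + \<alpha> * inner (H y) (H y) + 2 * inner g k - inner k k / \<alpha>"
      unfolding u \<mu> using \<alpha>
      by (simp add: inner_add_left inner_add_right inner_diff_left inner_diff_right
          inner_commute[of k g] inner_commute[of "H y" g] inner_commute[of "H y" k] field_simps)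
    finally show ?thesis by (simp add: S_def power2_norm_eq_inner)
  qed
  \<comment> \<open>Scaled norms of the three components, in which \<open>bt G G\<close> is the
    plain sum of squares and \<alpha> no longer appears.\<close>
  define p g' k' where "p = sqrt (S f f)" and "g' = sqrt \<alpha> * norm g" and "k' = norm k / sqrt \<alpha>"
  have pgk: "p \<ge> 0" "g' \<ge> 0" "k' \<ge> 0" "p\<^sup>2 = S f f" "g'\<^sup>2 = \<alpha> * (norm g)\<^sup>2" "k'\<^sup>2 = (norm k)\<^sup>2 / \<alpha>"
    using S0[of f] \<alpha> by (simp_all add: p_def g'_def k'_def power_mult_distrib power_divide)
  have btG: "bt G G = p\<^sup>2 + g'\<^sup>2 + k'\<^sup>2"
    unfolding G_eq bt_diag pgk by (simp add: S_def power2_norm_eq_inner)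
  have gk: "\<bar>inner g k\<bar> \<le> g' * k'"
    using Cauchy_Schwarz_ineq2[of g k] \<alpha> by (simp add: g'_def k'_def)
  have "norm w \<le> \<alpha> * norm g + norm k"
    unfolding w_def using norm_triangle_ineq4[of "\<alpha> *\<^sub>R g" k] \<alpha> by simp
  also have "\<dots> = sqrt \<alpha> * (g' + k')" using \<alpha> by (simp add: g'_def k'_def algebra_simps flip: real_sqrt_mult)
  finally have w: "norm w \<le> sqrt \<alpha> * (g' + k')" .
  have Hf: "sqrt \<alpha> * norm (H f) \<le> p"
    unfolding p_def by (rule real_le_rsqrt) (use H_le[of f] \<alpha> in \<open>simp add: power_mult_distrib\<close>)
  have wHf: "- inner w (H f) \<le> (g' + k') * p"
  proof -
    have "- inner w (H f) \<le> norm w * norm (H f)" using Cauchy_Schwarz_ineq2[of w "H f"] by linarith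
    also have "\<dots> \<le> (sqrt \<alpha> * (g' + k')) * norm (H f)" by (intro mult_right_mono w) auto
    also have "\<dots> = (g' + k') * (sqrt \<alpha> * norm (H f))" by simp
    also have "\<dots> \<le> (g' + k') * p" using pgk by (intro mult_left_mono Hf) auto
    finally show ?thesis .
  qed
  have ww: "(norm w)\<^sup>2 / \<alpha> = g'\<^sup>2 - 2 * inner g k + k'\<^sup>2"
    unfolding w_def power2_norm_eq_inner pgk using \<alpha>
    by (simp add: inner_diff_left inner_diff_right inner_commute[of k g] power2_norm_eq_inner field_simps)
  have upper: "a x x \<le> N * bt G G"
  proof -
    \<comment> \<open>The bound for \<open>S v v\<close> contributes \<open>ww\<close>, whose mixed
      term and whose square of \<open>k'\<close> cancel against those in \<open>ax\<close>. What
      remains is the quadratic form with rows (1,1,1), (1,1,0), (1,0,0), which up to signs is the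
      inverse of the matrix behind \<open>a_diag_upper\<close>. Its diagonal fixes the weights:
      \<open>N\<close> for \<open>k'\<close>, \<open>N - 1\<close> for \<open>g'\<close>, and the
      equation for \<open>N\<close> closes the coefficient of the square of
      \<open>p\<close>.\<close>
    have "a x x \<le> p\<^sup>2 + 2 * (p * g') + 2 * (p * k') + g'\<^sup>2"
      using ax S_y S_vv ww wHf pgk by (simp add: algebra_simps)
    also have "2 * (p * k') \<le> p\<^sup>2 / N + N * k'\<^sup>2"
      using young[of N k' p] N by (simp add: mult.commute)
    also have "2 * (p * g') \<le> p\<^sup>2 / (N - 1) + (N - 1) * g'\<^sup>2"
      using young[of "N - 1" g' p] N by (simp add: mult.commute)
    finally have "a x x \<le> p\<^sup>2 + (1 / N + 1 / (N - 1)) * p\<^sup>2 + N * g'\<^sup>2 + N * k'\<^sup>2"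
      by (simp add: algebra_simps)
    then show ?thesis unfolding N(2) btG by (simp add: algebra_simps)
  qed
  have "- a x x \<le> 2 * (g' * k') + k'\<^sup>2"
    using ax S0[of y] gk pgk by (simp add: abs_le_iff)
  moreover have "2 * (g' * k') \<le> g'\<^sup>2 + k'\<^sup>2" using young[of 1 g' k'] by simp
  ultimately have "- a x x \<le> 2 * (p\<^sup>2 + g'\<^sup>2 + k'\<^sup>2)"
    using zero_le_power2[of p] zero_le_power2[of g'] by argo
  also have "\<dots> \<le> N * bt G G" unfolding btG using N by (intro mult_right_mono) auto
  finally have "- a x x \<le> N * bt G G" .
  with upper show "\<bar>a x x\<bar> \<le> N * bt G G" by simp
  assume "G = 0"
  then have 0: "f = 0" "g = 0" "k = 0" by (simp_all add: G_eq zero_prod_def)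
  then have "S v v \<le> 0" using S_vv by (simp add: w_def)
  then have "\<alpha> * (norm (H v))\<^sup>2 \<le> 0" using H_le[of v] by simp
  then have "H v = 0" using \<alpha> by (simp add: mult_le_0_iff)
  then have "(norm (D\<^sub>1 v))\<^sup>2 + \<kappa>\<^sup>2 * (norm (D\<^sub>2 v))\<^sup>2 \<le> 0" using norm_H_lower[OF v] by simp
  moreover have "0 \<le> \<kappa>\<^sup>2 * (norm (D\<^sub>2 v))\<^sup>2" by simp
  ultimately have "(norm (D\<^sub>1 v))\<^sup>2 \<le> 0" by linarith
  then have "D\<^sub>1 v = 0" by simp
  then have "v = 0" using poincare[OF v] by simp
  then show "x = 0" using 0 u \<mu> by (simp add: x_eq y_eq H_zero zero_prod_def)
qed

text \<open>The block equations solved backwards: the third gives \<open>v\<close>, then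
  \<open>y = f - v\<close>, and the remaining unknowns are explicit. Only \<open>v\<close> requires
  an existence theorem. The Riesz representation is applied on the whole product space to a
  functional of the first component, and the other two components of the representative are
  discarded.\<close>

lemma bt_surjective:
  assumes "G \<in> X"
  shows "\<exists>x\<in>X. \<forall>z\<in>X. a x z = bt G z"
proof -
  obtain f g k where G_eq: "G = (f, g, k)" by (metis prod.exhaust)
  have in': "f \<in> Y" "g \<in> V" "k \<in> V" using assms by (auto simp: X_def G_eq)
  note V_cl = subspace_add[OF V(1)] subspace_diff[OF V(1)] subspace_scale[OF V(1)] H_in
  define w where "w = \<alpha> *\<^sub>R g - k"
  have "\<exists>v\<in>X. \<forall>z\<in>X. bt v z = inner w (H (fst z))"
  proof (rule bt.riesz)
    fix z assume "z \<in> X"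
    obtain y u \<mu> where z: "z = (y, u, \<mu>)" by (metis prod.exhaust)
    have "\<alpha> * (norm (H y))\<^sup>2 \<le> bt z z"
      unfolding z bt_diag using m_nonneg[of y] \<alpha> by simp
    then have "sqrt \<alpha> * norm (H y) \<le> sqrt (bt z z)"
      using \<alpha> by (intro real_le_rsqrt) (simp add: power_mult_distrib)
    then have "norm (H y) \<le> sqrt (bt z z) / sqrt \<alpha>" using \<alpha> by (simp add: field_simps)
    then have "norm w * norm (H y) \<le> norm w * (sqrt (bt z z) / sqrt \<alpha>)" by (intro mult_left_mono) auto
    then show "\<bar>inner w (H (fst z))\<bar> \<le> norm w / sqrt \<alpha> * sqrt (bt z z)"
      using Cauchy_Schwarz_ineq2[of w "H y"] by (simp add: z)
  qed (auto simp: X_def H_add H_scale inner_add_right)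
  then obtain v v2 v3 where v: "(v, v2, v3) \<in> X" "\<And>z. z \<in> X \<Longrightarrow> bt (v, v2, v3) z = inner w (H (fst z))"
    by (metis prod.exhaust)
  have vY: "v \<in> Y" using v(1) by (simp add: X_def)
  have S_v: "m v y' + \<alpha> * inner (H v) (H y') = inner w (H y')" if "y' \<in> Y" for y'
    using v(2)[of "(y', 0, 0)"] that subspace_0[OF V(1)] by (simp add: X_def bt_def)
  define y where "y = f - v"
  have y: "y \<in> Y" unfolding y_def using in' vY by (intro subspace_diff[OF Y])
  define u \<mu> where "u = (1 / \<alpha>) *\<^sub>R k - H y" and "\<mu> = w + \<alpha> *\<^sub>R H y"
  have x: "(y, u, \<mu>) \<in> X"
    unfolding X_def u_def \<mu>_def w_def using in' y by (auto intro!: V_cl)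
  have "a (y, u, \<mu>) z = bt G z" if "z \<in> X" for z
  proof -
    obtain y' u' \<mu>' where z: "z = (y', u', \<mu>')" by (metis prod.exhaust)
    have y': "y' \<in> Y" using that by (simp add: X_def z)
    have 1: "m y y' + inner (H y') \<mu> = m f y' + \<alpha> * inner (H f) (H y')"
      using S_v[OF y'] in' vY
      by (simp add: y_def \<mu>_def m_diff H_diff inner_diff_left inner_diff_right inner_add_right
          inner_commute[of "H y'"] algebra_simps)
    have 2: "\<alpha> * inner u u' + inner \<mu> u' = \<alpha> * inner g u'"
      using \<alpha> by (simp add: u_def \<mu>_def w_def inner_diff_left inner_add_left algebra_simps)
    have 3: "inner (H y) \<mu>' + inner u \<mu>' = (1 / \<alpha>) * inner k \<mu>'"
      by (simp add: u_def inner_diff_left)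
    show ?thesis unfolding z G_eq a_def bt_def using 1 2 3 by simp
  qed
  with x show ?thesis by blast
qed

text \<open>Let \<open>T\<close> be the operator preconditioned by \<open>bt\<close>, so that
  \<open>T x = G\<close>. Polarization is applied with \<open>n\<close>, the form of
  \<open>T x\<close> and \<open>T y\<close>. For the preimage \<open>x0\<close> of \<open>x\<close>
  under \<open>T\<close>, the value \<open>a x x0\<close> is the squared norm of \<open>x\<close>,
  while the polarized bound is \<open>N\<close> times the norms of \<open>G\<close> and of
  \<open>x\<close>; one factor cancels.\<close>

lemma bt_lower:
  assumes x: "x \<in> X" and G: "G \<in> X" and eq: "\<And>z. z \<in> X \<Longrightarrow> bt G z = a x z"
  shows "sqrt (bt x x) \<le> N * sqrt (bt G G)"
proof -
  define T where "T x = (SOME G. G \<in> X \<and> (\<forall>z\<in>X. bt G z = a x z))" for x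
  have T: "T x \<in> X" "\<And>z. z \<in> X \<Longrightarrow> bt (T x) z = a x z" if "x \<in> X" for x
  proof -
    have "\<exists>G. G \<in> X \<and> (\<forall>z\<in>X. bt G z = a x z)" using bt_representation[OF that] by blast
    then have "T x \<in> X \<and> (\<forall>z\<in>X. bt (T x) z = a x z)" unfolding T_def by (rule someI_ex)
    then show "T x \<in> X" "\<And>z. z \<in> X \<Longrightarrow> bt (T x) z = a x z" by auto
  qed
  have T_unique: "T x = G" if "x \<in> X" "G \<in> X" "\<And>z. z \<in> X \<Longrightarrow> bt G z = a x z" for x G
    using that T by (intro bt.represent_unique) auto
  have T_add: "T (x + y) = T x + T y" if "x \<in> X" "y \<in> X" for x y
    using that by (intro T_unique) (auto simp: T a_add bt_add intro: bt.closed_add)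
  have T_scale: "T (s *\<^sub>R x) = s *\<^sub>R T x" if "x \<in> X" for x s
    using that by (intro T_unique) (auto simp: T a_scale bt_scale intro: bt.closed_scale)
  define n where "n x y = bt (T x) (T y)" for x y
  have bound: "\<bar>a x y\<bar> \<le> N * (sqrt (n x x) * sqrt (n y y))" if xy: "x \<in> X" "y \<in> X" for x y
  proof (rule polarization_bound[where n = n and a = a, OF subspace_X a_add a_scale a_sym _ _ _ _ _ xy])
    show "n (x + y) z = n x z + n y z" if "x \<in> X" "y \<in> X" "z \<in> X" for x y z
      using that by (simp add: n_def T_add T bt_add)
    show "n (s *\<^sub>R x) y = s * n x y" if "x \<in> X" "y \<in> X" for s x y
      using that by (simp add: n_def T_scale T bt_scale)
    show "n x y = n y x" for x y by (simp add: n_def bt_sym)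
    show "0 < n x x" if "x \<in> X" "x \<noteq> 0" for x
    proof -
      have "T x \<noteq> 0" using a_diag_lower(2)[OF that(1) T[OF that(1)]] that(2) by blast
      then show ?thesis
        unfolding n_def using bt.nonneg[OF T(1)] bt.definite[OF T(1)] that(1) by (metis less_eq_real_def)
    qed
    show "\<bar>a x x\<bar> \<le> N * n x x" if "x \<in> X" for x
      unfolding n_def by (rule a_diag_lower(1)[OF that T[OF that]])
  qed
  obtain x0 where x0: "x0 \<in> X" "\<forall>z\<in>X. a x0 z = bt x z" using bt_surjective[OF x] by blast
  have "T x = G" "T x0 = x" using T_unique x G eq x0 by auto
  then have "\<bar>a x x0\<bar> \<le> N * (sqrt (bt G G) * sqrt (bt x x))"
    using bound[OF x x0(1)] by (simp add: n_def)
  moreover have "a x x0 = sqrt (bt x x) * sqrt (bt x x)"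
    using x0 x a_sym[of x x0] bt.nonneg[OF x] by simp
  ultimately have "sqrt (bt x x) * sqrt (bt x x) \<le> (N * sqrt (bt G G)) * sqrt (bt x x)"
    using bt.nonneg[OF x] by simp
  moreover have "sqrt (bt x x) \<ge> 0" "N * sqrt (bt G G) \<ge> 0"
    using N bt.nonneg x G by auto
  ultimately show ?thesis by (rule mult_self_le_imp_le)
qed

text \<open>Transfer from \<open>bt\<close> to \<open>b\<close>. The upper bound loses sqrt 2 in
  each argument, in total the factor 2. The constants comparing \<open>XN\<close> with
  \<open>b\<close> are crude, since they only identify the dual space and do not enter the condition
  number.\<close>

lemma preconditioned: "\<exists>c\<^sub>1 c\<^sub>2. preconditioned X b a XN c\<^sub>1 c\<^sub>2 (2 * C) N"
proof (intro exI)
  show "preconditioned X b a XN (sqrt (2 / \<alpha> + \<alpha>)) (sqrt (c\<^sup>2 + \<alpha> + 1 / \<alpha>)) (2 * C) N"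
  proof
    show "a x y = a y x" for x y by (rule a_sym)
    show "XN x \<ge> 0" for x by (cases x) (simp add: XN_def)
    show "2 * C \<ge> 0" "N \<ge> 0" using C(1) N(1) by auto
    fix x assume x: "x \<in> X"
    obtain y u \<mu> where x_eq: "x = (y, u, \<mu>)" by (metis prod.exhaust)
    have y: "y \<in> Y" using x by (simp add: X_def x_eq)
    let ?D = "(norm (D\<^sub>1 y))\<^sup>2 + \<kappa>\<^sup>2 * (norm (D\<^sub>2 y))\<^sup>2"
    have "(norm (H y))\<^sup>2 + (norm u)\<^sup>2 + (norm \<mu>)\<^sup>2 \<le> (2 / \<alpha> + \<alpha>) * b x x"
    proof -
      have "(2 / \<alpha> + \<alpha>) * b x x = (2 / \<alpha> + \<alpha>) * m y y + 2 * ?D + \<alpha>\<^sup>2 * ?D + 2 * (norm u)\<^sup>2 + \<alpha>\<^sup>2 * (norm u)\<^sup>2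
          + 2 * (norm \<mu>)\<^sup>2 / \<alpha>\<^sup>2 + (norm \<mu>)\<^sup>2"
        unfolding x_eq b_diag using \<alpha> by (simp add: field_simps power2_eq_square)
      moreover have "0 \<le> (2 / \<alpha> + \<alpha>) * m y y" "0 \<le> \<alpha>\<^sup>2 * ?D" "0 \<le> (norm u)\<^sup>2" "0 \<le> \<alpha>\<^sup>2 * (norm u)\<^sup>2"
          "0 \<le> 2 * (norm \<mu>)\<^sup>2 / \<alpha>\<^sup>2"
        using \<alpha> m_nonneg by auto
      ultimately show ?thesis using norm_H_upper[of y] by linarith
    qed
    then show "XN x \<le> sqrt (2 / \<alpha> + \<alpha>) * sqrt (b x x)"
      unfolding x_eq XN_def by (simp flip: real_sqrt_mult)
    have "m y y \<le> c\<^sup>2 * (norm (H y))\<^sup>2"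
    proof -
      have "m y y \<le> (norm y)\<^sup>2" by (rule m_le)
      also have "\<dots> \<le> (c * norm (D\<^sub>1 y))\<^sup>2" using poincare[OF y] by (intro power_mono) auto
      also have "\<dots> \<le> c\<^sup>2 * (norm (H y))\<^sup>2"
      proof -
        have "0 \<le> \<kappa>\<^sup>2 * (norm (D\<^sub>2 y))\<^sup>2" by simp
        then have "(norm (D\<^sub>1 y))\<^sup>2 \<le> (norm (H y))\<^sup>2" using norm_H_lower[OF y] by linarith
        then show ?thesis by (simp add: power_mult_distrib mult_left_mono)
      qed
      finally show ?thesis .
    qed
    moreover have "\<alpha> * ?D \<le> \<alpha> * (norm (H y))\<^sup>2"
      using norm_H_lower[OF y] \<alpha> by (intro mult_left_mono) auto
    moreover have "(c\<^sup>2 + \<alpha> + 1 / \<alpha>) * ((norm (H y))\<^sup>2 + (norm u)\<^sup>2 + (norm \<mu>)\<^sup>2) =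
        c\<^sup>2 * (norm (H y))\<^sup>2 + c\<^sup>2 * (norm u)\<^sup>2 + c\<^sup>2 * (norm \<mu>)\<^sup>2
        + \<alpha> * (norm (H y))\<^sup>2 + \<alpha> * (norm u)\<^sup>2 + \<alpha> * (norm \<mu>)\<^sup>2
        + (norm (H y))\<^sup>2 / \<alpha> + (norm u)\<^sup>2 / \<alpha> + (norm \<mu>)\<^sup>2 / \<alpha>"
      by (simp add: algebra_simps add_divide_distrib)
    moreover have "0 \<le> c\<^sup>2 * (norm u)\<^sup>2" "0 \<le> c\<^sup>2 * (norm \<mu>)\<^sup>2" "0 \<le> \<alpha> * (norm \<mu>)\<^sup>2"
        "0 \<le> (norm (H y))\<^sup>2 / \<alpha>" "0 \<le> (norm u)\<^sup>2 / \<alpha>" using \<alpha> by auto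
    ultimately have "b x x \<le> (c\<^sup>2 + \<alpha> + 1 / \<alpha>) * ((norm (H y))\<^sup>2 + (norm u)\<^sup>2 + (norm \<mu>)\<^sup>2)"
      unfolding x_eq b_diag by linarith
    then show "sqrt (b x x) \<le> sqrt (c\<^sup>2 + \<alpha> + 1 / \<alpha>) * XN x"
      unfolding x_eq XN_def by (simp flip: real_sqrt_mult)
  next
    have two: "sqrt (bt x x) \<le> sqrt 2 * sqrt (b x x)" if "x \<in> X" for x
      using bt_le_b[OF that] by (simp flip: real_sqrt_mult)
    fix x y assume xy: "x \<in> X" "y \<in> X"
    have "\<bar>a x y\<bar> \<le> C * (sqrt (bt x x) * sqrt (bt y y))" by (rule a_upper[OF xy])
    also have "\<dots> \<le> C * ((sqrt 2 * sqrt (b x x)) * (sqrt 2 * sqrt (b y y)))"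
      using C(1) bt.nonneg xy b.nonneg by (intro mult_left_mono mult_mono two) auto
    also have "\<dots> = 2 * C * (sqrt (b x x) * sqrt (b y y))" by (simp add: algebra_simps)
    finally show "\<bar>a x y\<bar> \<le> 2 * C * (sqrt (b x x) * sqrt (b y y))" .
  next
    fix x z assume x: "x \<in> X" and z: "z \<in> X" and eq: "\<And>y. y \<in> X \<Longrightarrow> b z y = a x y"
    \<comment> \<open>No constant is lost here: enlarging the form shrinks the dual norm, so
      \<open>G\<close> is no longer in \<open>bt\<close> than \<open>z\<close> is in
      \<open>b\<close>, and the norm of \<open>x\<close> in \<open>b\<close> is at most its norm in
      \<open>bt\<close>. Both comparisons point the same way.\<close>
    obtain G where G: "G \<in> X" "\<And>y. y \<in> X \<Longrightarrow> bt G y = a x y" using bt_representation[OF x] by blast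
    have "sqrt (bt G G) * sqrt (bt G G) = b z G" using G eq bt.nonneg[OF G(1)] by simp
    also have "\<dots> \<le> sqrt (b z z) * sqrt (b G G)" using b.Cauchy_Schwarz[OF z G(1)] by simp
    also have "\<dots> \<le> sqrt (b z z) * sqrt (bt G G)"
      using b.nonneg[OF z] b_le_bt[OF G(1)] by (intro mult_left_mono) auto
    finally have "sqrt (bt G G) * sqrt (bt G G) \<le> sqrt (b z z) * sqrt (bt G G)" .
    moreover have "sqrt (bt G G) \<ge> 0" "sqrt (b z z) \<ge> 0"
      using b.nonneg[OF z] bt.nonneg[OF G(1)] by auto
    ultimately have "sqrt (bt G G) \<le> sqrt (b z z)" by (rule mult_self_le_imp_le)
    then have "N * sqrt (bt G G) \<le> N * sqrt (b z z)" using N(1) by (intro mult_left_mono) auto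
    moreover have "sqrt (b x x) \<le> sqrt (bt x x)" using b_le_bt[OF x] by simp
    ultimately show "sqrt (b x x) \<le> N * sqrt (b z z)" using bt_lower[OF x G] by linarith
  next
    fix z assume z: "z \<in> X"
    have "\<exists>G\<in>X. \<forall>y\<in>X. bt G y = b z y"
    proof (rule bt.riesz)
      fix y assume y: "y \<in> X"
      have "\<bar>b z y\<bar> \<le> sqrt (b z z) * sqrt (b y y)" by (rule b.Cauchy_Schwarz[OF z y])
      also have "\<dots> \<le> sqrt (b z z) * sqrt (bt y y)"
        using b.nonneg[OF z] b_le_bt[OF y] by (intro mult_left_mono) auto
      finally show "\<bar>b z y\<bar> \<le> sqrt (b z z) * sqrt (bt y y)" .
    qed (use z in \<open>auto simp: b.add_right b.scale_right\<close>)
    then obtain G where G: "G \<in> X" "\<And>y. y \<in> X \<Longrightarrow> bt G y = b z y" by blast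
    show "\<exists>x\<in>X. \<forall>y\<in>X. a x y = b z y" using bt_surjective[OF G(1)] G(2) by simp
  qed (fact a_add a_scale)+
qed

end

section \<open>Fubini's theorem and primitives in time\<close>

context
  fixes f :: "'a::euclidean_space \<times> 'b::euclidean_space \<Rightarrow> real"
  assumes f: "integrable lborel f"
begin

lemma integrable_pair: "integrable (lborel \<Otimes>\<^sub>M lborel) f"
  using f by (simp add: lborel_prod)

lemma integrable_case_prod_pair: "integrable (lborel \<Otimes>\<^sub>M lborel) (case_prod (\<lambda>x y. f (x, y)))"
  using integrable_pair by simp

lemma fubini_integrable_fst: "integrable lborel (\<lambda>x. LINT y|lborel. f (x, y))"
  by (rule lborel_pair.integrable_fst'[OF integrable_pair])

lemma fubini_fst: "(LINT x|lborel. LINT y|lborel. f (x, y)) = (LINT z|lborel. f z)"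
  using lborel_pair.integral_fst'[OF integrable_pair] by (simp add: lborel_prod)

lemma fubini_AE_integrable_snd: "AE y in lborel. integrable lborel (\<lambda>x. f (x, y))"
  by (rule lborel_pair.AE_integrable_snd[OF integrable_case_prod_pair])

lemma fubini_integrable_snd: "integrable lborel (\<lambda>y. LINT x|lborel. f (x, y))"
  by (rule lborel_pair.integrable_snd[OF integrable_case_prod_pair])

lemma fubini_snd: "(LINT y|lborel. LINT x|lborel. f (x, y)) = (LINT z|lborel. f z)"
  using lborel_pair.integral_snd[OF integrable_case_prod_pair] by (simp add: lborel_prod)

end

lemma fubini_integrable:
  fixes f :: "'a::euclidean_space \<times> 'b::euclidean_space \<Rightarrow> real"
  assumes "f \<in> borel_measurable borel"
    and "integrable lborel (\<lambda>x. LINT y|lborel. \<bar>f (x, y)\<bar>)"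
    and "AE x in lborel. integrable lborel (\<lambda>y. f (x, y))"
  shows "integrable lborel f"
proof -
  have "f \<in> borel_measurable (lborel \<Otimes>\<^sub>M lborel)" unfolding lborel_prod using assms(1) by simp
  from lborel_pair.Fubini_integrable[OF this] assms(2,3) show ?thesis by (simp add: lborel_prod)
qed

lemma integrable_tensor:
  fixes a :: "'a::euclidean_space \<Rightarrow> real" and b :: "'b::euclidean_space \<Rightarrow> real"
  assumes a: "integrable lborel a" and b: "integrable lborel b"
    and [measurable]: "a \<in> borel_measurable borel" "b \<in> borel_measurable borel"
  shows "integrable lborel (\<lambda>z. a (fst z) * b (snd z))"
proof (rule fubini_integrable)
  have "integrable lborel (\<lambda>x. \<bar>a x\<bar> * (LINT y|lborel. \<bar>b y\<bar>))"
    by (intro integrable_mult_left integrable_abs a)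
  then show "integrable lborel (\<lambda>x. LINT y|lborel. \<bar>a (fst (x, y)) * b (snd (x, y))\<bar>)"
    by (simp add: abs_mult)
  show "AE x in lborel. integrable lborel (\<lambda>y. a (fst (x, y)) * b (snd (x, y)))"
    using b by simp
  have [measurable]: "(fst :: 'a \<times> 'b \<Rightarrow> 'a) \<in> borel_measurable borel" "(snd :: 'a \<times> 'b \<Rightarrow> 'b) \<in> borel_measurable borel"
    by (auto intro!: borel_measurable_continuous_onI continuous_intros)
  show "(\<lambda>z. a (fst z) * b (snd z)) \<in> borel_measurable borel" by measurable
qed

lemma borel_Cauchy_Schwarz:
  fixes f g :: "'a::euclidean_space \<Rightarrow> real"
  assumes f: "f \<in> borel_measurable borel" "integrable lborel (\<lambda>x. (f x)\<^sup>2)"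
    and g: "g \<in> borel_measurable borel" "integrable lborel (\<lambda>x. (g x)\<^sup>2)"
  shows "integrable lborel (\<lambda>x. f x * g x)"
    and "(LINT x|lborel. f x * g x)\<^sup>2 \<le> (LINT x|lborel. (f x)\<^sup>2) * (LINT x|lborel. (g x)\<^sup>2)"
proof -
  note [measurable] = f(1) g(1)
  have i: "inner (abs_l2 u) (abs_l2 v) = (LINT x|lborel. u x * v x)"
    if u: "u \<in> borel_measurable borel" "integrable lborel (\<lambda>x. (u x)\<^sup>2)"
      and v: "v \<in> borel_measurable borel" "integrable lborel (\<lambda>x. (v x)\<^sup>2)" for u v :: "'a \<Rightarrow> real"
    unfolding inner_bor
  proof (rule integral_cong_AE)
    show "AE x in lborel. bor (abs_l2 u) x * bor (abs_l2 v) x = u x * v x"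
      using bor_abs_l2[OF u] bor_abs_l2[OF v] by eventually_elim simp
  qed (use u v in measurable)
  show "(LINT x|lborel. f x * g x)\<^sup>2 \<le> (LINT x|lborel. (f x)\<^sup>2) * (LINT x|lborel. (g x)\<^sup>2)"
    using Cauchy_Schwarz_ineq[of "abs_l2 f" "abs_l2 g"] i[OF f g] i[OF f f] i[OF g g]
    by (simp add: power2_eq_square)
  show "integrable lborel (\<lambda>x. f x * g x)"
  proof (rule integrable_cong_AE_imp[OF bor_mult_integrable[of "abs_l2 f" "abs_l2 g"]])
    show "AE x in lborel. bor (abs_l2 f) x * bor (abs_l2 g) x = f x * g x"
      using bor_abs_l2[OF f] bor_abs_l2[OF g] by eventually_elim simp
  qed measurable
qed

text \<open>The integral is taken over a fixed domain with the limits placed in the integrand, which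
  gives joint Borel measurability in \<open>t\<close> and \<open>x\<close>. For \<open>t\<close>
  below 0 the value is 0, and beyond \<open>T\<close> it stays constant.\<close>

definition primitive :: "real \<Rightarrow> (real \<times> 'a::euclidean_space) l2 \<Rightarrow> real \<Rightarrow> 'a \<Rightarrow> real" where
  "primitive T g t x = (LINT s|lborel. (if 0 < s \<and> s < T \<and> s < t then bor g (s, x) else 0))"

definition primitive_l2 ::
    "real \<Rightarrow> 'a::euclidean_space set \<Rightarrow> (real \<times> 'a) l2 \<Rightarrow> (real \<times> 'a) l2" where
  "primitive_l2 T \<Omega> g = abs_l2 (\<lambda>z. indicator (cyl T \<Omega>) z * primitive T g (fst z) (snd z))"

lemma primitive_measurable: "(\<lambda>z. primitive T g (fst z) (snd z)) \<in> borel_measurable borel"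
proof -
  have "(\<lambda>(z, s). if 0 < s \<and> s < T \<and> s < fst z then bor g (s, snd z) else 0)
      \<in> borel_measurable ((borel \<Otimes>\<^sub>M borel) \<Otimes>\<^sub>M lborel)"
    by measurable
  then have "(\<lambda>z. primitive T g (fst z) (snd z)) \<in> borel_measurable (borel \<Otimes>\<^sub>M borel)"
    unfolding primitive_def by (intro lborel.borel_measurable_lebesgue_integral) simp
  then show ?thesis by (simp add: borel_prod)
qed

lemma primitive_measurable_slice [measurable]: "primitive T g t \<in> borel_measurable borel"
proof -
  have "(\<lambda>x. primitive T g (fst (t, x)) (snd (t, x))) \<in> borel_measurable borel"
    by (rule measurable_compose[OF _ primitive_measurable]) (simp add: borel_prod[symmetric])
  then show ?thesis by simp
qed

text \<open>For almost every \<open>x\<close> a finite quantity, and integrable in \<open>x\<close>: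
  the majorant in all estimates of primitives.\<close>

definition time_energy :: "(real \<times> 'a::euclidean_space) l2 \<Rightarrow> 'a \<Rightarrow> real" where
  "time_energy g x = (LINT s|lborel. (bor g (s, x))\<^sup>2)"

lemma time_energy_integrable: "integrable lborel (time_energy g)"
  and time_energy_integral: "(LINT x|lborel. time_energy g x) = (norm g)\<^sup>2"
  using fubini_integrable_snd[OF bor_square_integrable[of g]] fubini_snd[OF bor_square_integrable[of g]]
  unfolding time_energy_def[abs_def] norm_bor_square by auto

lemma time_energy_nonneg: "time_energy g x \<ge> 0"
  unfolding time_energy_def by (rule Bochner_Integration.integral_nonneg) simp

lemma AE_time_square_integrable: "AE x in lborel. integrable lborel (\<lambda>s. (bor g (s, x))\<^sup>2)"
  by (rule fubini_AE_integrable_snd[OF bor_square_integrable])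

lemma bor_slice_measurable [measurable]:
  "(\<lambda>s. bor g (s, x)) \<in> borel_measurable borel" "(\<lambda>x. bor g (s, x)) \<in> borel_measurable borel"
  by measurable

lemma bor_interval_integrable:
  assumes "integrable lborel (\<lambda>s. (bor g (s, x))\<^sup>2)" and "a \<le> b"
    and [measurable]: "A \<in> sets borel" and A: "A \<subseteq> {a..b}"
  shows "integrable lborel (\<lambda>s. indicator A s * bor g (s, x))"
    and "(LINT s|lborel. indicator A s * bor g (s, x))\<^sup>2 \<le> (b - a) * time_energy g x"
proof -
  have e: "emeasure lborel A \<le> ennreal (b - a)"
    using emeasure_mono[of A "{a..b}" lborel] assms by simp
  then have fin: "emeasure lborel A < \<infinity>" by (simp add: le_less_trans ennreal_less_top)
  have sq: "(\<lambda>s. (indicator A s :: real)\<^sup>2) = indicator A" by (auto simp: indicator_def)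
  have i: "integrable lborel (\<lambda>s. (indicator A s :: real)\<^sup>2)"
    unfolding sq using fin by (intro integrable_real_indicator) simp_all
  have "measure lborel A \<le> b - a"
    using e assms(2) unfolding measure_def by (simp add: enn2real_leI)
  moreover have "(LINT s|lborel. (indicator A s :: real)\<^sup>2) = measure lborel A"
    unfolding sq by simp
  ultimately have le: "(LINT s|lborel. (indicator A s :: real)\<^sup>2) \<le> b - a" by simp
  show "integrable lborel (\<lambda>s. indicator A s * bor g (s, x))"
    by (rule borel_Cauchy_Schwarz(1)[OF _ i _ assms(1)]) auto
  have "(LINT s|lborel. indicator A s * bor g (s, x))\<^sup>2
      \<le> (LINT s|lborel. (indicator A s)\<^sup>2) * time_energy g x"
    unfolding time_energy_def by (rule borel_Cauchy_Schwarz(2)[OF _ i _ assms(1)]) auto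
  also have "\<dots> \<le> (b - a) * time_energy g x" by (intro mult_right_mono le time_energy_nonneg)
  finally show "(LINT s|lborel. indicator A s * bor g (s, x))\<^sup>2 \<le> (b - a) * time_energy g x" .
qed

lemma primitive_diff:
  assumes x: "integrable lborel (\<lambda>s. (bor g (s, x))\<^sup>2)" and "s \<le> t"
  shows "primitive T g t x - primitive T g s x = (LINT r|lborel. indicator ({0<..<T} \<inter> {s..<t}) r * bor g (r, x))"
    and "(primitive T g t x - primitive T g s x)\<^sup>2 \<le> (t - s) * time_energy g x"
proof -
  have p: "primitive T g t x = (LINT s|lborel. indicator ({0<..<T} \<inter> {..<t}) s * bor g (s, x))" for t
    unfolding primitive_def by (intro Bochner_Integration.integral_cong) (auto simp: indicator_def)
  have i: "integrable lborel (\<lambda>s. indicator ({0<..<T} \<inter> {..<t}) s * bor g (s, x))" for t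
    by (rule bor_interval_integrable(1)[OF x, of 0 "\<bar>T\<bar>"]) auto
  show eq: "primitive T g t x - primitive T g s x = (LINT r|lborel. indicator ({0<..<T} \<inter> {s..<t}) r * bor g (r, x))"
    unfolding p Bochner_Integration.integral_diff[OF i i, symmetric]
    using assms(2) by (intro Bochner_Integration.integral_cong) (auto simp: indicator_def)
  show "(primitive T g t x - primitive T g s x)\<^sup>2 \<le> (t - s) * time_energy g x"
    unfolding eq by (rule bor_interval_integrable(2)[OF x assms(2)]) auto
qed

lemma primitive_nonpos: "t \<le> 0 \<Longrightarrow> primitive T g t x = 0"
  unfolding primitive_def by (rule integral_eq_zero_AE) auto

lemma square_integral_le:
  fixes f h :: "'a::euclidean_space \<Rightarrow> real"
  assumes [measurable]: "f \<in> borel_measurable borel" and h: "integrable lborel h"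
    and le: "AE x in lborel. (f x)\<^sup>2 \<le> h x"
  shows "integrable lborel (\<lambda>x. (f x)\<^sup>2)" and "(LINT x|lborel. (f x)\<^sup>2) \<le> (LINT x|lborel. h x)"
proof -
  show i: "integrable lborel (\<lambda>x. (f x)\<^sup>2)"
  proof (rule Bochner_Integration.integrable_bound[OF h])
    show "AE x in lborel. norm ((f x)\<^sup>2) \<le> norm (h x)" using le by eventually_elim auto
  qed measurable
  show "(LINT x|lborel. (f x)\<^sup>2) \<le> (LINT x|lborel. h x)"
    by (rule integral_mono_AE[OF i h le])
qed

text \<open>Hoelder continuity of exponent 1/2 in time with values in L2, from the Cauchy-Schwarz
  inequality on the time interval. It makes the primitive a continuous path.\<close>

lemma primitive_diff_square:
  fixes g :: "(real \<times> 'a::euclidean_space) l2"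
  shows "integrable lborel (\<lambda>x. (primitive T g t x - primitive T g s x)\<^sup>2)"
    and "(LINT x|lborel. (primitive T g t x - primitive T g s x)\<^sup>2) \<le> \<bar>t - s\<bar> * (norm g)\<^sup>2"
proof -
  have le: "AE x in lborel. (primitive T g t x - primitive T g s x)\<^sup>2 \<le> \<bar>t - s\<bar> * time_energy g x"
    using AE_time_square_integrable[of g]
  proof eventually_elim
    case (elim x)
    then show ?case
      using primitive_diff(2)[OF elim, of s t T] primitive_diff(2)[OF elim, of t s T]
      by (cases "s \<le> t") (auto simp: power2_commute abs_if)
  qed
  have h: "integrable lborel (\<lambda>x. \<bar>t - s\<bar> * time_energy g x)"
    using time_energy_integrable[of g] by simp
  have m: "(\<lambda>x. primitive T g t x - primitive T g s x) \<in> borel_measurable borel" by measurable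
  show "integrable lborel (\<lambda>x. (primitive T g t x - primitive T g s x)\<^sup>2)"
    by (rule square_integral_le(1)[OF m h le])
  show "(LINT x|lborel. (primitive T g t x - primitive T g s x)\<^sup>2) \<le> \<bar>t - s\<bar> * (norm g)\<^sup>2"
    using square_integral_le(2)[OF m h le] time_energy_integral[of g] by simp
qed

lemma primitive_square:
  fixes g :: "(real \<times> 'a::euclidean_space) l2"
  shows "integrable lborel (\<lambda>x. (primitive T g t x)\<^sup>2)"
    and "(LINT x|lborel. (primitive T g t x)\<^sup>2) \<le> \<bar>t\<bar> * (norm g)\<^sup>2"
  using primitive_diff_square[where T = T and g = g and t = t and s = 0] by (simp_all add: primitive_nonpos)

lemma L2_fun_borel:
  assumes "S \<in> sets borel" "f \<in> borel_measurable borel" "integrable lborel (\<lambda>x. (f x)\<^sup>2)"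
  shows "L2_fun S f"
  by (rule L2_fun_restrict) (use assms in \<open>auto simp: L2_fun_UNIV measurable_completion integrable_completion\<close>)

lemma bor_toL2:
  assumes "S \<in> sets borel" "f \<in> borel_measurable borel" "integrable lborel (\<lambda>x. (f x)\<^sup>2)"
  shows "AE x in lborel. bor (toL2 S f) x = indicator S x * f x"
  using rep_toL2[OF _ L2_fun_borel[OF assms]] assms(1) rep_eq_bor[of "toL2 S f"]
  unfolding AE_completion_iff by (auto elim!: eventually_elim2)

section \<open>Test functions of time and weakly constant functions\<close>

lemma deriv_test_fun:
  fixes \<phi> :: "real \<Rightarrow> real"
  assumes "test_fun S \<phi>"
  shows "(\<phi> has_real_derivative deriv \<phi> t) (at t)" and "deriv \<phi> = partial 1 \<phi>"
proof -
  have "Ck (Suc 0) \<phi>" using assms unfolding test_fun_def by blast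
  then have d: "\<phi> differentiable at t" for t by (rule Ck_differentiable)
  then have D: "(\<phi> has_real_derivative deriv \<phi> t) (at t)" for t
    using DERIV_deriv_iff_real_differentiable by blast
  show "(\<phi> has_real_derivative deriv \<phi> t) (at t)" by (rule D)
  show "deriv \<phi> = partial 1 \<phi>"
    using partial_has_derivative[OF D[unfolded has_field_derivative_def]] by auto
qed

lemma test_fun_deriv:
  fixes \<phi> :: "real \<Rightarrow> real"
  shows "test_fun S \<phi> \<Longrightarrow> test_fun S (deriv \<phi>)"
  using test_fun_partial[of S \<phi> 1] deriv_test_fun(2)[of S \<phi>] by simp

lemma integral_deriv_after:
  fixes \<phi> :: "real \<Rightarrow> real"
  assumes \<phi>: "test_fun {0<..<T} \<phi>"
  shows "(LINT t|lborel. indicator {s<..} t * deriv \<phi> t) = - \<phi> s"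
proof -
  \<comment> \<open>The upper limit lies beyond the support for every \<open>s\<close>, including
    \<open>s > T\<close>, where both sides are 0.\<close>
  let ?b = "max s T"
  have c: "continuous_on UNIV (deriv \<phi>)" using test_fun_deriv[OF \<phi>] by (rule test_fun_continuous)
  have [measurable]: "deriv \<phi> \<in> borel_measurable borel" using c by (rule borel_measurable_continuous_onI)
  have "(LINT t|lborel. indicator {s<..} t * deriv \<phi> t) = (LINT t|lborel. indicator {s..?b} t *\<^sub>R deriv \<phi> t)"
  proof (rule integral_cong_AE)
    show "AE t in lborel. indicator {s<..} t * deriv \<phi> t = indicator {s..?b} t *\<^sub>R deriv \<phi> t"
      using AE_lborel_singleton[of s]
    proof eventually_elim
      case (elim t)
      have "deriv \<phi> t = 0" if "t > ?b"
        using that by (intro test_fun_support[OF test_fun_deriv[OF \<phi>]]) auto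
      then show ?case using elim by (cases "t > ?b") (auto simp: indicator_def)
    qed
  qed measurable
  also have "\<dots> = \<phi> ?b - \<phi> s"
    using deriv_test_fun(1)[OF \<phi>] c
    by (intro integral_FTC_Icc) (auto simp: has_field_derivative_at_within has_real_derivative_iff_has_vector_derivative[symmetric]
        intro: continuous_on_subset)
  also have "\<phi> ?b = 0" by (rule test_fun_support[OF \<phi>]) auto
  finally show ?thesis by simp
qed

text \<open>Carries the integrals in the definition of the weak time derivative over to Borel
  representatives on the whole line; the restriction to the time interval is absorbed by the support
  of the test function.\<close>

lemma slice_time_integral:
  assumes \<phi>: "test_fun {0<..<T} \<phi>"
  shows "AE x in lborel. (LINT t|lebesgue_on {0<..<T}. slice u t x * \<phi> t) = (LINT t|lborel. bor u (t, x) * \<phi> t)"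
  using AE_lborel_pair_swap[OF rep_eq_bor[of u]]
proof eventually_elim
  case (elim x)
  have m\<phi> [measurable]: "\<phi> \<in> borel_measurable borel" by (rule test_fun_square_integrable(1)[OF \<phi>])
  have mb: "(\<lambda>t. bor u (t, x) * \<phi> t) \<in> borel_measurable borel" by measurable
  have ae: "AE t in lebesgue. indicator {0<..<T} t *\<^sub>R (slice u t x * \<phi> t) = bor u (t, x) * \<phi> t"
    using AE_completion[OF elim]
    by eventually_elim (use test_fun_support[OF \<phi>] in \<open>auto simp: slice_def indicator_def\<close>)
  have "(LINT t|lebesgue_on {0<..<T}. slice u t x * \<phi> t) = (LINT t|lebesgue. indicator {0<..<T} t *\<^sub>R (slice u t x * \<phi> t))"
    by (rule integral_restrict_space) simp
  also have "\<dots> = (LINT t|lebesgue. bor u (t, x) * \<phi> t)"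
    using mb by (intro integral_cong_AE[OF _ _ ae] lebesgue_measurable_AE_cong[OF _ ae] measurable_completion) auto
  also have "\<dots> = (LINT t|lborel. bor u (t, x) * \<phi> t)"
    using mb by (intro integral_completion) simp
  finally show ?case .
qed

lemma tensor_l2:
  assumes [measurable]: "a \<in> borel_measurable borel" and "integrable lborel (\<lambda>t. (a t)\<^sup>2)"
  shows "AE z in lborel. bor (abs_l2 (\<lambda>z. a (fst z) * bor p (snd z)) :: (real \<times> 'a::euclidean_space) l2) z = a (fst z) * bor p (snd z)"
proof (rule bor_abs_l2)
  have "(\<lambda>z. a (fst z) * bor p (snd z)) \<in> borel_measurable (borel \<Otimes>\<^sub>M borel)" by measurable
  then show "(\<lambda>z. a (fst z) * bor p (snd z)) \<in> borel_measurable borel" by (simp add: borel_prod)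
  have "integrable lborel (\<lambda>z. (a (fst z))\<^sup>2 * (bor p (snd z))\<^sup>2)"
    by (rule integrable_tensor[OF assms(2) bor_square_integrable]) measurable
  then show "integrable lborel (\<lambda>z. (a (fst z) * bor p (snd z))\<^sup>2)" by (simp add: power_mult_distrib)
qed

lemma antiderivative_real:
  fixes f :: "real \<Rightarrow> real"
  assumes "continuous_on UNIV f"
  obtains F where "\<And>t. (F has_real_derivative f t) (at t)"
proof -
  have "\<exists>F. \<forall>t::real. (-\<infinity>::ereal) < t \<longrightarrow> t < (\<infinity>::ereal) \<longrightarrow> (F has_vector_derivative f t) (at t)"
    using assms by (intro einterval_antiderivative) (auto simp: continuous_on_eq_continuous_at)
  then show thesis
    using that by (auto simp: has_real_derivative_iff_has_vector_derivative)
qed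

lemma constant_where_derivative_zero:
  fixes F :: "real \<Rightarrow> real"
  assumes "\<And>t. (F has_real_derivative f t) (at t)" "a \<le> b" "\<And>t. t \<in> {a..b} \<Longrightarrow> f t = 0"
  shows "F a = F b"
proof (cases "a = b")
  case False
  then have ab: "a < b" using assms(2) by simp
  obtain z where "a < z" "z < b" "F b - F a = (b - a) * f z"
    using MVT2[OF ab, of F f] assms(1) by auto
  then show ?thesis using assms(3)[of z] by simp
qed simp

text \<open>
  The lemma of du Bois-Reymond for a continuous function. The test function is the difference of two
  translates of an antiderivative of a bump, so that \<open>F\<close> has the same local averages around any two points.
\<close>

lemma continuous_weakly_constant:
  fixes F :: "real \<Rightarrow> real"
  assumes F: "continuous_on UNIV F"
    and weak: "\<And>\<phi>. test_fun {0<..<T} \<phi> \<Longrightarrow> (LINT t|lborel. deriv \<phi> t * F t) = 0"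
    and a: "0 < a" and b: "b < T" and ab: "a < b"
  shows "F a = F b"
proof (rule ccontr)
  assume ne: "F a \<noteq> F b"
  \<comment> \<open>The sign factor normalizes to \<open>G 0 > 0\<close>, so that testing against a
    positive bump near 0 must give a positive number.\<close>
  define G where "G r = (F (r + a) - F (r + b)) * sgn (F a - F b)" for r
  have Gc: "continuous_on UNIV G"
    unfolding G_def by (intro continuous_intros continuous_on_compose2[OF F]) auto
  have G0: "G 0 > 0" using ne by (simp add: G_def sgn_if)
  obtain d where d: "d > 0" "\<And>r. \<bar>r\<bar> < d \<Longrightarrow> G r > 0"
  proof -
    have "isCont G 0" using Gc by (simp add: continuous_on_eq_continuous_at)
    then obtain d where "d > 0" "\<And>r. dist r 0 < d \<Longrightarrow> dist (G r) (G 0) < G 0"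
      using G0 unfolding continuous_at_eps_delta by metis
    then show thesis by (intro that[of d]) (auto simp: dist_real_def abs_less_iff)
  qed
  \<comment> \<open>Small enough that the translates of the bump to \<open>a\<close> and to
    \<open>b\<close> stay inside the open interval and that \<open>G\<close> is positive on the
    support of the bump.\<close>
  define \<delta> where "\<delta> = min d (min a (T - b)) / 2"
  have "\<delta> \<le> d / 2" "\<delta> \<le> a / 2" "\<delta> \<le> (T - b) / 2" "\<delta> > 0" using d a b by (auto simp: \<delta>_def)
  then have \<delta>: "\<delta> > 0" "\<delta> < d" "\<delta> < a" "b + \<delta> < T" using d a b by auto
  define \<beta> where "\<beta> = bump 1 (- \<delta>) \<delta>"
  have \<beta>_Ck: "Ck k \<beta>" for k unfolding \<beta>_def by (rule Ck_bump)
  have \<beta>_c: "continuous_on UNIV \<beta>" using \<beta>_Ck by (rule Ck_continuous)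
  have \<beta>_0: "\<beta> t = 0" if "\<bar>t\<bar> \<ge> \<delta>" for t
    unfolding \<beta>_def using that by (intro bump_eq_0) auto
  have \<beta>_pos: "\<beta> t > 0" if "\<bar>t\<bar> < \<delta>" for t
    unfolding \<beta>_def using that by (subst bump_pos_iff) auto
  obtain A where A: "\<And>t. (A has_real_derivative \<beta> t) (at t)" using antiderivative_real[OF \<beta>_c] by blast
  \<comment> \<open>An antiderivative of a bump is not compactly supported, but it is constant on
    either side of the bump. Away from the interval between \<open>a\<close> and \<open>b\<close>
    the two translates take the same constant, and the difference vanishes.\<close>
  define \<phi> where "\<phi> t = A (t - a) - A (t - b)" for t
  have d\<phi>: "(\<phi> has_real_derivative \<beta> (t - a) - \<beta> (t - b)) (at t)" for t
    unfolding \<phi>_def by (auto intro!: derivative_eq_intros DERIV_chain2[OF A])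
  have \<phi>_Ck: "Ck k \<phi>" for k
  proof -
    have "Ck k (\<lambda>t. \<beta> (t - a) + (- 1) * \<beta> (t - b))"
      using Ck_compose_affine[OF \<beta>_Ck, of k "- a" "1 :: real"] Ck_compose_affine[OF \<beta>_Ck, of k "- b" "1 :: real"]
      by (intro Ck_add Ck_mult Ck_const) (auto simp: inner_real_def)
    then have "Ck (Suc k) \<phi>" unfolding Ck_real_Suc[OF d\<phi>] by simp
    then show ?thesis by (rule Ck_Suc_D)
  qed
  have \<phi>_0: "\<phi> t = 0" if "t \<notin> {a - \<delta>..b + \<delta>}" for t
  proof (cases "t < a - \<delta>")
    case True
    then show ?thesis
      unfolding \<phi>_def using constant_where_derivative_zero[OF A, of "t - b" "t - a"] \<beta>_0 ab \<delta> by auto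
  next
    case False
    then show ?thesis
      unfolding \<phi>_def using constant_where_derivative_zero[OF A, of "t - b" "t - a"] \<beta>_0 ab \<delta> that by auto
  qed
  have "{t. \<phi> t \<noteq> 0} \<subseteq> {a - \<delta>..b + \<delta>}" using \<phi>_0 by blast
  then have sub: "closure {t. \<phi> t \<noteq> 0} \<subseteq> {a - \<delta>..b + \<delta>}" by (rule closure_minimal) simp
  have "compact (closure {t. \<phi> t \<noteq> 0})"
    using sub by (metis bounded_closed_interval bounded_subset closed_closure compact_eq_bounded_closed)
  moreover have "{a - \<delta>..b + \<delta>} \<subseteq> {0<..<T}" using \<delta> a by auto
  ultimately have \<phi>: "test_fun {0<..<T} \<phi>"
    unfolding test_fun_def using \<phi>_Ck sub by blast
  have "deriv \<phi> = (\<lambda>t. \<beta> (t - a) - \<beta> (t - b))" using DERIV_imp_deriv[OF d\<phi>] by auto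
  then have "(LINT t|lborel. (\<beta> (t - a) - \<beta> (t - b)) * F t) = 0" using weak[OF \<phi>] by simp
  have i: "integrable lborel (\<lambda>r. \<beta> r * K r)" if K: "continuous_on UNIV K" for K
  proof -
    have "integrable lborel (\<lambda>r. indicator {-\<delta>..\<delta>} r *\<^sub>R (\<beta> r * K r))"
      by (intro borel_integrable_compact continuous_intros continuous_on_subset[OF \<beta>_c] continuous_on_subset[OF K]) auto
    also have "(\<lambda>r. indicator {-\<delta>..\<delta>} r *\<^sub>R (\<beta> r * K r)) = (\<lambda>r. \<beta> r * K r)"
    proof
      fix r show "indicator {-\<delta>..\<delta>} r *\<^sub>R (\<beta> r * K r) = \<beta> r * K r"
        using \<beta>_0[of r] by (cases "r \<in> {-\<delta>..\<delta>}") auto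
    qed
    finally show ?thesis .
  qed
  have sh: "integrable lborel (\<lambda>t. \<beta> (t - c) * F t)"
      "(LINT t|lborel. \<beta> (t - c) * F t) = (LINT r|lborel. \<beta> r * F (r + c))" for c
  proof -
    have I: "integrable lborel (\<lambda>r. \<beta> r * F (r + c))"
      by (rule i) (intro continuous_intros continuous_on_compose2[OF F], auto)
    show "integrable lborel (\<lambda>t. \<beta> (t - c) * F t)"
      using lborel_integrable_real_affine[OF I, of 1 "- c"] by simp
    show "(LINT t|lborel. \<beta> (t - c) * F t) = (LINT r|lborel. \<beta> r * F (r + c))"
      using lborel_integral_real_affine[of 1 "\<lambda>t. \<beta> (t - c) * F t" c] by (simp add: add.commute)
  qed
  have "(LINT t|lborel. (\<beta> (t - a) - \<beta> (t - b)) * F t) = (LINT t|lborel. \<beta> (t - a) * F t) - (LINT t|lborel. \<beta> (t - b) * F t)"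
    unfolding left_diff_distrib by (rule Bochner_Integration.integral_diff[OF sh(1) sh(1)])
  then have "(LINT r|lborel. \<beta> r * F (r + a)) - (LINT r|lborel. \<beta> r * F (r + b)) = 0"
    using \<open>(LINT t|lborel. (\<beta> (t - a) - \<beta> (t - b)) * F t) = 0\<close> sh(2) by simp
  moreover have "(LINT r|lborel. \<beta> r * G r) = sgn (F a - F b) *
      ((LINT r|lborel. \<beta> r * F (r + a)) - (LINT r|lborel. \<beta> r * F (r + b)))"
  proof -
    have c: "continuous_on UNIV (\<lambda>r. F (r + c))" for c
      by (intro continuous_on_compose2[OF F] continuous_intros) auto
    have "(LINT r|lborel. \<beta> r * G r) = (LINT r|lborel. sgn (F a - F b) * (\<beta> r * F (r + a) - \<beta> r * F (r + b)))"
      by (intro Bochner_Integration.integral_cong) (auto simp: G_def algebra_simps)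
    then show ?thesis using i[OF c] by simp
  qed
  ultimately have "(LINT r|lborel. \<beta> r * G r) = 0" by simp
  moreover have nn: "\<beta> r * G r \<ge> 0" for r
    using \<beta>_0[of r] \<beta>_pos[of r] d(2)[of r] \<delta>(2) by (cases "\<bar>r\<bar> < \<delta>") (auto intro: less_imp_le mult_nonneg_nonneg)
  ultimately have "AE r in lborel. \<beta> r * G r = 0"
    using integral_nonneg_eq_0_iff_AE[OF i[OF Gc]] by simp
  then have "AE r in lborel. r \<notin> {-\<delta><..<\<delta>}"
  proof eventually_elim
    case (elim r)
    then show ?case using \<beta>_pos[of r] d(2)[of r] \<delta>(2) by (auto simp: abs_less_iff)
  qed
  then have "emeasure lborel {-\<delta><..<\<delta>} = 0"
    by (subst (asm) AE_iff_measurable[OF _ refl]) (auto simp: greaterThanLessThan_def greaterThan_def lessThan_def Int_def)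
  then show False using \<delta>(1) by simp
qed

section \<open>Primitives and weak time derivatives on the cylinder\<close>

locale cylinder =
  fixes T :: real and \<Omega> :: "'a::euclidean_space set"
  assumes T: "T > 0" and \<Omega>: "open \<Omega>"
begin

abbreviation "Q \<equiv> cyl T \<Omega>"
abbreviation "V \<equiv> L2_space Q"

lemma \<Omega>_meas [measurable]: "\<Omega> \<in> sets borel" using \<Omega> by simp

lemma Q_meas [measurable]: "Q \<in> sets borel" by (rule cyl_measurable) measurable

lemma Q_lebesgue: "Q \<in> sets lebesgue" using Q_meas by simp

lemma \<Omega>_lebesgue: "\<Omega> \<in> sets lebesgue" using \<Omega> by simp

lemma subspace_V: "subspace V" by (rule subspace_L2_space[OF Q_lebesgue])

lemma closed_V: "closed V" by (rule closed_L2_space[OF Q_lebesgue])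

lemma L2_fun_primitive: "L2_fun \<Omega> (primitive T g t)"
  by (intro L2_fun_borel primitive_square) measurable

text \<open>On each slice the square is at most \<open>T\<close> times the squared norm of
  \<open>g\<close>, and integration over time yields another factor \<open>T\<close>. This is the
  origin of the constant \<open>T\<close> in the Poincare inequality in time.\<close>

lemma primitive_indicator_square:
  "integrable lborel (\<lambda>z. (indicator Q z * primitive T g (fst z) (snd z))\<^sup>2)" (is "integrable lborel ?f")
  "(LINT z|lborel. (indicator Q z * primitive T g (fst z) (snd z))\<^sup>2) \<le> (T * norm g)\<^sup>2"
proof -
  note [measurable] = primitive_measurable[of T g]
  have m: "?f \<in> borel_measurable borel" by measurable
  have s: "integrable lborel (\<lambda>x. (indicator Q (t, x) * primitive T g t x)\<^sup>2)
      \<and> (LINT x|lborel. (indicator Q (t, x) * primitive T g t x)\<^sup>2) \<le> indicator {0<..<T} t * (T * (norm g)\<^sup>2)" for t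
  proof -
    have [measurable]: "(\<lambda>x. indicator Q (t, x) * primitive T g t x) \<in> borel_measurable borel" by measurable
    show ?thesis
    proof (cases "t \<in> {0<..<T}")
      case True
      have le: "AE x in lborel. (indicator Q (t, x) * primitive T g t x)\<^sup>2 \<le> (primitive T g t x)\<^sup>2"
        by (auto simp: indicator_def)
      have "\<bar>t\<bar> * (norm g)\<^sup>2 \<le> T * (norm g)\<^sup>2" using True by (intro mult_right_mono) auto
      then show ?thesis
        using square_integral_le[OF _ primitive_square(1) le] primitive_square(2)[of T g t] True by auto
    next
      case False
      then have "(\<lambda>x. (indicator Q (t, x) * primitive T g t x)\<^sup>2) = (\<lambda>_. 0)"
        by (auto simp: cyl_def indicator_def)
      then show ?thesis using T by simp
    qed
  qed
  have b: "integrable lborel (\<lambda>t. indicator {0<..<T} t * (T * (norm g)\<^sup>2))"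
    using T by (intro integrable_mult_left integrable_real_indicator) auto
  have [measurable]: "(\<lambda>t. LINT x|lborel. ?f (t, x)) \<in> borel_measurable lborel"
    by measurable
  have I: "integrable lborel (\<lambda>t. LINT x|lborel. ?f (t, x))"
  proof (rule Bochner_Integration.integrable_bound[OF b])
    show "AE t in lborel. norm (LINT x|lborel. ?f (t, x)) \<le> norm (indicator {0<..<T} t * (T * (norm g)\<^sup>2))"
      using s T by (intro AE_I2) (simp add: abs_of_nonneg Bochner_Integration.integral_nonneg)
  qed measurable
  show int: "integrable lborel ?f"
    by (rule fubini_integrable[OF m]) (use I s in \<open>auto\<close>)
  have "(LINT z|lborel. ?f z) = (LINT t|lborel. LINT x|lborel. ?f (t, x))"
    by (rule fubini_fst[OF int, symmetric])
  also have "\<dots> \<le> (LINT t|lborel. indicator {0<..<T} t * (T * (norm g)\<^sup>2))"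
    by (rule integral_mono[OF I b]) (use s in auto)
  also have "\<dots> = (T * norm g)\<^sup>2" using T by (simp add: power2_eq_square)
  finally show "(LINT z|lborel. ?f z) \<le> (T * norm g)\<^sup>2" .
qed

lemma bor_primitive_l2:
  "AE z in lborel. bor (primitive_l2 T \<Omega> g) z = indicator Q z * primitive T g (fst z) (snd z)"
  unfolding primitive_l2_def
  using primitive_measurable[of T g] by (intro bor_abs_l2 primitive_indicator_square(1)) measurable

lemma primitive_l2_in_V: "primitive_l2 T \<Omega> g \<in> V"
  unfolding L2_space_bor_iff using bor_primitive_l2[of g] by eventually_elim auto

lemma norm_primitive_l2_le: "norm (primitive_l2 T \<Omega> g) \<le> T * norm g"
proof -
  note [measurable] = primitive_measurable[of T g]
  have "(norm (primitive_l2 T \<Omega> g))\<^sup>2 = (LINT z|lborel. (indicator Q z * primitive T g (fst z) (snd z))\<^sup>2)"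
    unfolding norm_bor_square
  proof (rule integral_cong_AE)
    show "AE z in lborel. (bor (primitive_l2 T \<Omega> g) z)\<^sup>2 = (indicator Q z * primitive T g (fst z) (snd z))\<^sup>2"
      using bor_primitive_l2[of g] by eventually_elim simp
  qed measurable
  also have "\<dots> \<le> (T * norm g)\<^sup>2" by (rule primitive_indicator_square(2))
  finally show ?thesis by (rule power2_le_imp_le) (use T in simp)
qed

lemma sl_primitive_l2:
  "AE t in lborel. t \<in> {0<..<T} \<longrightarrow> sl \<Omega> (primitive_l2 T \<Omega> g) t = toL2 \<Omega> (primitive T g t)"
  using AE_lborel_pair[OF bor_primitive_l2[of g]] bor_sl[OF \<Omega>_meas, of "primitive_l2 T \<Omega> g"]
proof eventually_elim
  case (elim t)
  show ?case
  proof (rule impI, rule bor_eqI)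
    assume t: "t \<in> {0<..<T}"
    have "AE x in lborel. bor (toL2 \<Omega> (primitive T g t)) x = indicator \<Omega> x * primitive T g t x"
      by (intro bor_toL2 primitive_square) measurable
    then show "AE x in lborel. bor (sl \<Omega> (primitive_l2 T \<Omega> g) t) x = bor (toL2 \<Omega> (primitive T g t)) x"
      using elim by eventually_elim (use t in \<open>auto simp: cyl_def indicator_def\<close>)
  qed
qed

lemma norm_toL2_primitive_diff:
  "(norm (toL2 \<Omega> (primitive T g t) - toL2 \<Omega> (primitive T g s)))\<^sup>2 \<le> \<bar>t - s\<bar> * (norm g)\<^sup>2"
proof -
  let ?d = "\<lambda>x. primitive T g t x - primitive T g s x"
  have eq: "toL2 \<Omega> (primitive T g t) - toL2 \<Omega> (primitive T g s) = toL2 \<Omega> ?d"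
    by (rule toL2_diff[OF \<Omega>_lebesgue L2_fun_primitive L2_fun_primitive, symmetric])
  have "(norm (toL2 \<Omega> ?d))\<^sup>2 = (LINT x|lborel. (indicator \<Omega> x * ?d x)\<^sup>2)"
    unfolding norm_bor_square
  proof (rule integral_cong_AE)
    have "AE x in lborel. bor (toL2 \<Omega> ?d) x = indicator \<Omega> x * ?d x"
      by (intro bor_toL2 primitive_diff_square) measurable
    then show "AE x in lborel. (bor (toL2 \<Omega> ?d) x)\<^sup>2 = (indicator \<Omega> x * ?d x)\<^sup>2"
      by eventually_elim simp
  qed measurable
  also have "\<dots> \<le> (LINT x|lborel. (?d x)\<^sup>2)"
    by (rule square_integral_le(2)[OF _ primitive_diff_square(1)]) (auto simp: indicator_def)
  also have "\<dots> \<le> \<bar>t - s\<bar> * (norm g)\<^sup>2" by (rule primitive_diff_square(2))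
  finally show ?thesis unfolding eq .
qed

lemma continuous_toL2_primitive: "continuous_on UNIV (\<lambda>t. toL2 \<Omega> (primitive T g t))"
proof (intro continuous_at_imp_continuous_on ballI)
  fix t :: real
  have "((\<lambda>s. toL2 \<Omega> (primitive T g s) - toL2 \<Omega> (primitive T g t)) \<longlongrightarrow> 0) (at t)"
  proof (rule Lim_null_comparison)
    have "norm (toL2 \<Omega> (primitive T g s) - toL2 \<Omega> (primitive T g t)) \<le> sqrt (\<bar>s - t\<bar> * (norm g)\<^sup>2)" for s
      by (rule real_le_rsqrt) (rule norm_toL2_primitive_diff)
    then show "\<forall>\<^sub>F s in at t. norm (toL2 \<Omega> (primitive T g s) - toL2 \<Omega> (primitive T g t)) \<le> sqrt (\<bar>s - t\<bar> * (norm g)\<^sup>2)"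
      by simp
    have "((\<lambda>s. sqrt (\<bar>s - t\<bar> * (norm g)\<^sup>2)) \<longlongrightarrow> sqrt (\<bar>t - t\<bar> * (norm g)\<^sup>2)) (at t)"
      by (intro tendsto_intros)
    then show "((\<lambda>s. sqrt (\<bar>s - t\<bar> * (norm g)\<^sup>2)) \<longlongrightarrow> 0) (at t)" by simp
  qed
  then show "isCont (\<lambda>t. toL2 \<Omega> (primitive T g t)) t"
    unfolding isCont_def by (rule LIM_zero_cancel)
qed

lemma vanishes_initially_primitive: "vanishes_initially T \<Omega> (primitive_l2 T \<Omega> g)"
  unfolding vanishes_initially_def
proof (intro exI conjI ballI)
  show "L2_fun \<Omega> (primitive T g t)" for t by (rule L2_fun_primitive)
  show "((\<lambda>s. L2_norm_fun \<Omega> (\<lambda>x. primitive T g s x - primitive T g t x)) \<longlongrightarrow> 0) (at t within {0..T})" for t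
  proof -
    have "((\<lambda>s. toL2 \<Omega> (primitive T g s)) \<longlongrightarrow> toL2 \<Omega> (primitive T g t)) (at t within UNIV)"
      using continuous_toL2_primitive[of g] unfolding continuous_on_def by blast
    then have "((\<lambda>s. toL2 \<Omega> (primitive T g s)) \<longlongrightarrow> toL2 \<Omega> (primitive T g t)) (at t within {0..T})"
      by (rule tendsto_within_subset) simp
    then have "((\<lambda>s. norm (toL2 \<Omega> (primitive T g s) - toL2 \<Omega> (primitive T g t))) \<longlongrightarrow> 0) (at t within {0..T})"
      by (intro tendsto_norm_zero LIM_zero)
    moreover have "norm (toL2 \<Omega> (primitive T g s) - toL2 \<Omega> (primitive T g t))
        = L2_norm_fun \<Omega> (\<lambda>x. primitive T g s x - primitive T g t x)" for s
      using norm_toL2[OF \<Omega>_lebesgue L2_fun_diff[OF L2_fun_primitive L2_fun_primitive]]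
        toL2_diff[OF \<Omega>_lebesgue L2_fun_primitive L2_fun_primitive] by metis
    ultimately show ?thesis by simp
  qed
  show "AE x in lebesgue_on \<Omega>. primitive T g 0 x = 0" by (simp add: primitive_nonpos)
  show "AE t in lebesgue_on {0<..<T}. AE x in lebesgue_on \<Omega>. primitive T g t x = slice (primitive_l2 T \<Omega> g) t x"
  proof -
    have "AE t in lborel. t \<in> {0<..<T} \<longrightarrow> (AE x in lborel. x \<in> \<Omega> \<longrightarrow> primitive T g t x = slice (primitive_l2 T \<Omega> g) t x)"
      using AE_lborel_pair[OF bor_primitive_l2[of g]] slice_AE[of "primitive_l2 T \<Omega> g"]
    proof eventually_elim
      case (elim t)
      show ?case
      proof
        assume "t \<in> {0<..<T}"
        then show "AE x in lborel. x \<in> \<Omega> \<longrightarrow> primitive T g t x = slice (primitive_l2 T \<Omega> g) t x"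
          using elim unfolding AE_completion_iff
          by (auto elim!: eventually_elim2 simp: cyl_def)
      qed
    qed
    then show ?thesis by (simp add: AE_lebesgue_on_iff \<Omega>_lebesgue AE_completion_iff)
  qed
qed

text \<open>Fubini's theorem on the region \<open>s < t\<close>: integrated over \<open>t\<close>
  first, the derivative of the test function leaves minus its value at \<open>s\<close>.\<close>

lemma primitive_by_parts:
  assumes x: "integrable lborel (\<lambda>s. (bor g (s, x))\<^sup>2)" and \<phi>: "test_fun {0<..<T} \<phi>"
  shows "(LINT t|lborel. primitive T g t x * deriv \<phi> t) = - (LINT s|lborel. bor g (s, x) * \<phi> s)"
proof -
  let ?\<gamma> = "\<lambda>s. indicator {0<..<T} s * bor g (s, x)"
  let ?f = "\<lambda>z. deriv \<phi> (fst z) * (if snd z < fst z then ?\<gamma> (snd z) else 0)"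
  have d\<phi>: "test_fun {0<..<T} (deriv \<phi>)" by (rule test_fun_deriv[OF \<phi>])
  have [measurable]: "deriv \<phi> \<in> borel_measurable borel" by (rule test_fun_square_integrable(1)[OF d\<phi>])
  have i\<gamma>: "integrable lborel ?\<gamma>"
    using T by (intro bor_interval_integrable(1)[OF x, of 0 T]) auto
  have id: "integrable lborel (deriv \<phi>)"
  proof -
    have sq: "(\<lambda>t. (indicator {0<..<T} t :: real)\<^sup>2) = indicator {0<..<T}" by (auto simp: indicator_def)
    have "integrable lborel (\<lambda>t. indicator {0<..<T} t * deriv \<phi> t)"
      using T by (intro borel_Cauchy_Schwarz(1) test_fun_square_integrable[OF d\<phi>])
        (auto simp: sq intro!: integrable_real_indicator)
    also have "(\<lambda>t. indicator {0<..<T} t * deriv \<phi> t) = deriv \<phi>"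
      using test_fun_support[OF d\<phi>] by (intro ext) (auto simp: indicator_def)
    finally show ?thesis .
  qed
  have int: "integrable lborel ?f"
  proof (rule Bochner_Integration.integrable_bound)
    show "integrable lborel (\<lambda>z. deriv \<phi> (fst z) * ?\<gamma> (snd z))"
      by (rule integrable_tensor[OF id i\<gamma>]) measurable
    show "?f \<in> borel_measurable lborel"
      unfolding lborel_prod[symmetric] by measurable
    show "AE z in lborel. norm (?f z) \<le> norm (deriv \<phi> (fst z) * ?\<gamma> (snd z))" by auto
  qed
  have "(LINT t|lborel. primitive T g t x * deriv \<phi> t) = (LINT t|lborel. LINT s|lborel. ?f (t, s))"
  proof (intro Bochner_Integration.integral_cong refl)
    fix t
    have "(LINT s|lborel. ?f (t, s)) = deriv \<phi> t * (LINT s|lborel. (if s < t then ?\<gamma> s else 0))"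
      by (simp cong: if_cong)
    also have "(LINT s|lborel. (if s < t then ?\<gamma> s else 0)) = primitive T g t x"
      unfolding primitive_def by (intro Bochner_Integration.integral_cong) (auto simp: indicator_def)
    finally show "primitive T g t x * deriv \<phi> t = (LINT s|lborel. ?f (t, s))" by (metis mult.commute)
  qed
  also have "\<dots> = (LINT s|lborel. LINT t|lborel. ?f (t, s))"
    using fubini_fst[OF int] fubini_snd[OF int] by simp
  also have "\<dots> = (LINT s|lborel. - (bor g (s, x) * \<phi> s))"
  proof (intro Bochner_Integration.integral_cong refl)
    fix s
    have "(LINT t|lborel. ?f (t, s)) = (LINT t|lborel. ?\<gamma> s * (indicator {s<..} t * deriv \<phi> t))"
      by (intro Bochner_Integration.integral_cong) (auto simp: indicator_def)
    also have "\<dots> = ?\<gamma> s * - \<phi> s" by (simp add: integral_deriv_after[OF \<phi>])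
    also have "\<dots> = - (bor g (s, x) * \<phi> s)"
      using test_fun_support[OF \<phi>, of s] by (auto simp: indicator_def)
    finally show "(LINT t|lborel. ?f (t, s)) = - (bor g (s, x) * \<phi> s)" .
  qed
  finally show ?thesis by simp
qed

lemma is_time_deriv_iff:
  "is_time_deriv T \<Omega> u g \<longleftrightarrow> (\<forall>\<phi>. test_fun {0<..<T} \<phi> \<longrightarrow> (AE x in lborel. x \<in> \<Omega> \<longrightarrow>
     (LINT t|lborel. bor u (t, x) * deriv \<phi> t) = - (LINT t|lborel. bor g (t, x) * \<phi> t)))"
proof -
  have "(AE x in lebesgue_on \<Omega>. (LINT t|lebesgue_on {0<..<T}. slice u t x * deriv \<phi> t) =
        - (LINT t|lebesgue_on {0<..<T}. slice g t x * \<phi> t)) \<longleftrightarrow>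
      (AE x in lborel. x \<in> \<Omega> \<longrightarrow>
        (LINT t|lborel. bor u (t, x) * deriv \<phi> t) = - (LINT t|lborel. bor g (t, x) * \<phi> t))"
    if \<phi>: "test_fun {0<..<T} \<phi>" for \<phi>
    unfolding AE_lebesgue_on_iff[OF \<Omega>_lebesgue] AE_completion_iff
    using slice_time_integral[OF test_fun_deriv[OF \<phi>], of u] slice_time_integral[OF \<phi>, of g]
    by (auto elim!: AE_mp)
  then show ?thesis unfolding is_time_deriv_def by auto
qed

lemma is_time_deriv_primitive: "is_time_deriv T \<Omega> (primitive_l2 T \<Omega> g) g"
  unfolding is_time_deriv_iff
proof (intro allI impI)
  fix \<phi> assume \<phi>: "test_fun {0<..<T} \<phi>"
  have [measurable]: "deriv \<phi> \<in> borel_measurable borel"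
    by (rule test_fun_square_integrable(1)[OF test_fun_deriv[OF \<phi>]])
  show "AE x in lborel. x \<in> \<Omega> \<longrightarrow> (LINT t|lborel. bor (primitive_l2 T \<Omega> g) (t, x) * deriv \<phi> t)
      = - (LINT t|lborel. bor g (t, x) * \<phi> t)"
    using AE_lborel_pair_swap[OF bor_primitive_l2[of g]] AE_time_square_integrable[of g]
  proof eventually_elim
    case (elim x)
    show ?case
    proof
      assume x: "x \<in> \<Omega>"
      have [measurable]: "(\<lambda>t. primitive T g t x) \<in> borel_measurable borel"
        using measurable_compose[OF _ primitive_measurable[of T g], of "\<lambda>t. (t, x)" borel]
        by (simp add: borel_prod[symmetric])
      have "(LINT t|lborel. bor (primitive_l2 T \<Omega> g) (t, x) * deriv \<phi> t) = (LINT t|lborel. primitive T g t x * deriv \<phi> t)"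
      proof (rule integral_cong_AE)
        show "AE t in lborel. bor (primitive_l2 T \<Omega> g) (t, x) * deriv \<phi> t = primitive T g t x * deriv \<phi> t"
          using elim(1) by eventually_elim
            (use x test_fun_support[OF test_fun_deriv[OF \<phi>]] in \<open>auto simp: cyl_def indicator_def\<close>)
      qed measurable
      then show "(LINT t|lborel. bor (primitive_l2 T \<Omega> g) (t, x) * deriv \<phi> t) = - (LINT t|lborel. bor g (t, x) * \<phi> t)"
        using primitive_by_parts[OF elim(2) \<phi>] by simp
    qed
  qed
qed

lemma inner_sl_measurable [measurable]:
  fixes p :: "'a l2"
  shows "(\<lambda>t. inner (sl \<Omega> u t) p) \<in> borel_measurable borel"
proof -
  have "inner (sl \<Omega> u t) p = (if integrable lborel (\<lambda>x. (bor u (t, x))\<^sup>2)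
      then (LINT x|lborel. indicator \<Omega> x * (bor u (t, x) * bor p x)) else 0)" for t
  proof (cases "integrable lborel (\<lambda>x. (bor u (t, x))\<^sup>2)")
    case True
    have "inner (sl \<Omega> u t) p = (LINT x|lborel. indicator \<Omega> x * (bor u (t, x) * bor p x))"
      unfolding inner_bor
    proof (rule integral_cong_AE)
      show "AE x in lborel. bor (sl \<Omega> u t) x * bor p x = indicator \<Omega> x * (bor u (t, x) * bor p x)"
        using bor_sl_if[OF \<Omega>_meas True] by eventually_elim simp
    qed measurable
    then show ?thesis using True by simp
  qed (simp add: sl_def)
  then show ?thesis by simp
qed

text \<open>Pairing in space with \<open>p\<close> and in time with \<open>a\<close> commute. The
  weak derivative, which is stated at almost every point \<open>x\<close>, thereby becomes a
  statement about the scalar function \<open>t \<mapsto> inner (sl \<Omega> u t) p\<close>.\<close>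

lemma inner_sl_time_weighted:
  fixes p :: "'a l2"
  assumes u: "u \<in> V" and [measurable]: "a \<in> borel_measurable borel" and a: "integrable lborel (\<lambda>t. (a t)\<^sup>2)"
  shows "(LINT t|lborel. a t * inner (sl \<Omega> u t) p) = (LINT x|lborel. bor p x * (LINT t|lborel. bor u (t, x) * a t))"
proof -
  let ?\<psi> = "abs_l2 (\<lambda>z. a (fst z) * bor p (snd z)) :: (real \<times> 'a) l2"
  let ?f = "\<lambda>z. bor u z * (a (fst z) * bor p (snd z))"
  have "(\<lambda>z. a (fst z) * bor p (snd z)) \<in> borel_measurable (borel \<Otimes>\<^sub>M borel)" by measurable
  then have int: "integrable lborel ?f"
    by (intro bor_mult_integrable_cong[OF tensor_l2[OF assms(2) a]]) (simp add: borel_prod)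
  have uQ: "AE t in lborel. AE x in lborel. (t, x) \<notin> Q \<longrightarrow> bor u (t, x) = 0"
    using AE_lborel_pair[OF u[unfolded L2_space_bor_iff]] .
  have eq: "AE t in lborel. a t * inner (sl \<Omega> u t) p = (LINT x|lborel. ?f (t, x))"
    using bor_sl[OF \<Omega>_meas, of u] uQ
  proof eventually_elim
    case (elim t)
    have "inner (sl \<Omega> u t) p = (LINT x|lborel. bor u (t, x) * bor p x)"
      unfolding inner_bor
    proof (rule integral_cong_AE)
      show "AE x in lborel. bor (sl \<Omega> u t) x * bor p x = bor u (t, x) * bor p x"
        using elim by eventually_elim (auto simp: cyl_def indicator_def)
    qed measurable
    then show ?case by (simp add: mult.left_commute)
  qed
  have "(LINT t|lborel. a t * inner (sl \<Omega> u t) p) = (LINT t|lborel. LINT x|lborel. ?f (t, x))"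
  proof (rule integral_cong_AE[OF _ _ eq])
    show "(\<lambda>t. LINT x|lborel. ?f (t, x)) \<in> borel_measurable lborel"
      by (rule borel_measurable_integrable[OF fubini_integrable_fst[OF int]])
    show "(\<lambda>t. a t * inner (sl \<Omega> u t) p) \<in> borel_measurable lborel" by measurable
  qed
  also have "\<dots> = (LINT x|lborel. LINT t|lborel. ?f (t, x))"
    using fubini_fst[OF int] fubini_snd[OF int] by simp
  also have "\<dots> = (LINT x|lborel. LINT t|lborel. bor p x * (bor u (t, x) * a t))"
    by (intro Bochner_Integration.integral_cong refl) simp
  also have "\<dots> = (LINT x|lborel. bor p x * (LINT t|lborel. bor u (t, x) * a t))" by simp
  finally show ?thesis .
qed

text \<open>The \<open>L\<^sup>2(\<Omega>)\<close>-valued difference of both sides is continuous, weakly constant, and zero initially.\<close>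

lemma time_deriv_imp_primitive:
  assumes y: "y \<in> V" and dy: "is_time_deriv T \<Omega> y g" and y0: "vanishes_initially T \<Omega> y"
  shows "y = primitive_l2 T \<Omega> g"
proof -
  obtain z :: "real \<Rightarrow> 'a \<Rightarrow> real" where z: "\<And>t. t \<in> {0..T} \<Longrightarrow> L2_fun \<Omega> (z t)"
    "\<And>t. t \<in> {0..T} \<Longrightarrow> ((\<lambda>s. L2_norm_fun \<Omega> (\<lambda>x. z s x - z t x)) \<longlongrightarrow> 0) (at t within {0..T})"
    "AE t in lebesgue_on {0<..<T}. AE x in lebesgue_on \<Omega>. z t x = slice y t x"
    "AE x in lebesgue_on \<Omega>. z 0 x = 0"
    using y0 unfolding vanishes_initially_def by blast
  define \<zeta> where "\<zeta> t = toL2 \<Omega> (z t) - toL2 \<Omega> (primitive T g t)" for t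
  \<comment> \<open>\<open>z\<close> is controlled only on the closed time interval, whereas the
    lemma on weakly constant functions needs continuity on the whole line; clamping the time
    argument supplies it.\<close>
  define cl where "cl t = max 0 (min T t)" for t
  have cl: "cl t \<in> {0..T}" for t using T by (auto simp: cl_def)
  have z_cont: "continuous_on {0..T} (\<lambda>t. toL2 \<Omega> (z t))"
    unfolding continuous_on_def
  proof
    fix t assume t: "t \<in> {0..T}"
    have "((\<lambda>s. toL2 \<Omega> (z s) - toL2 \<Omega> (z t)) \<longlongrightarrow> 0) (at t within {0..T})"
    proof (rule tendsto_norm_zero_cancel, rule Lim_transform_eventually[OF z(2)[OF t]])
      show "\<forall>\<^sub>F s in at t within {0..T}. L2_norm_fun \<Omega> (\<lambda>x. z s x - z t x) = norm (toL2 \<Omega> (z s) - toL2 \<Omega> (z t))"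
        unfolding eventually_at_filter
        using norm_toL2[OF \<Omega>_lebesgue L2_fun_diff[OF z(1) z(1)[OF t]]] toL2_diff[OF \<Omega>_lebesgue z(1) z(1)[OF t]]
        by (intro always_eventually) simp
    qed
    then show "((\<lambda>t. toL2 \<Omega> (z t)) \<longlongrightarrow> toL2 \<Omega> (z t)) (at t within {0..T})" by (rule LIM_zero_cancel)
  qed
  have \<zeta>_cont: "continuous_on UNIV (\<lambda>t. \<zeta> (cl t))"
  proof -
    have "continuous_on {0..T} \<zeta>"
      unfolding \<zeta>_def by (intro continuous_on_diff z_cont continuous_on_subset[OF continuous_toL2_primitive]) auto
    moreover have "continuous_on UNIV cl" unfolding cl_def by (intro continuous_intros)
    ultimately show ?thesis using cl by (auto intro: continuous_on_compose2)
  qed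
  have \<zeta>_0: "\<zeta> (cl 0) = 0"
  proof -
    have "cl 0 = 0" using T by (simp add: cl_def)
    moreover have "AE x in lebesgue_on \<Omega>. z 0 x = primitive T g 0 x"
      using z(4) by (simp add: primitive_nonpos)
    then have "toL2 \<Omega> (z 0) = toL2 \<Omega> (primitive T g 0)"
      using toL2_eq_iff[OF \<Omega>_lebesgue z(1)[of 0] L2_fun_primitive] T by simp
    ultimately show ?thesis by (simp add: \<zeta>_def)
  qed
  define w where "w = y - primitive_l2 T \<Omega> g"
  have w: "w \<in> V" unfolding w_def by (rule subspace_diff[OF subspace_V y primitive_l2_in_V])
  have sl_w: "AE t in lborel. t \<in> {0<..<T} \<longrightarrow> sl \<Omega> w t = \<zeta> (cl t)"
  proof -
    have zs: "AE t in lborel. t \<in> {0<..<T} \<longrightarrow> (AE x in lebesgue_on \<Omega>. z t x = slice y t x)"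
      using z(3) unfolding AE_lebesgue_on_iff[OF sets_completionI_sets[of "{0<..<T}" lborel], simplified] AE_completion_iff by simp
    show ?thesis
      using zs sl_primitive_l2[of g] sl_diff[OF \<Omega>_meas, of y "primitive_l2 T \<Omega> g"] toL2_slice[OF \<Omega>_meas, of y]
        L2_fun_slice[OF \<Omega>_meas, of y]
    proof eventually_elim
      case (elim t)
      show ?case
      proof
        assume t: "t \<in> {0<..<T}"
        then have "cl t = t" by (simp add: cl_def)
        moreover have "toL2 \<Omega> (z t) = toL2 \<Omega> (slice y t)"
          using elim(1,5) t toL2_eq_iff[OF \<Omega>_lebesgue z(1)[of t]] by simp
        ultimately show "sl \<Omega> w t = \<zeta> (cl t)" using elim t by (simp add: w_def \<zeta>_def)
      qed
    qed
  qed
  have const: "inner (\<zeta> (cl t)) p = 0" if t: "t \<in> {0<..<T}" and p: "p \<in> L2_space \<Omega>" for t p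
  proof -
    let ?F = "\<lambda>t. inner (\<zeta> (cl t)) p"
    have Fc: "continuous_on UNIV ?F" by (intro continuous_on_inner \<zeta>_cont continuous_on_const)
    have weak: "(LINT t|lborel. deriv \<phi> t * ?F t) = 0" if \<phi>: "test_fun {0<..<T} \<phi>" for \<phi>
    proof -
      note d\<phi> = test_fun_deriv[OF \<phi>]
      note md [measurable] = test_fun_square_integrable(1)[OF d\<phi>]
      have Fm [measurable]: "?F \<in> borel_measurable borel" by (rule borel_measurable_continuous_onI[OF Fc])
      have z0: "AE x in lborel. bor p x * (LINT t|lborel. bor w (t, x) * deriv \<phi> t) = 0"
      proof -
        have iu: "AE x in lborel. integrable lborel (\<lambda>t. bor u (t, x) * deriv \<phi> t)" for u :: "(real \<times> 'a) l2"
          using AE_time_square_integrable[of u]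
          by eventually_elim (rule borel_Cauchy_Schwarz(1)[OF _ _ test_fun_square_integrable[OF d\<phi>]], auto)
        show ?thesis
          using AE_lborel_pair_swap[OF bor_diff[of y "primitive_l2 T \<Omega> g"]] iu[of y] iu[of "primitive_l2 T \<Omega> g"]
            dy[unfolded is_time_deriv_iff, rule_format, OF \<phi>]
            is_time_deriv_primitive[of g, unfolded is_time_deriv_iff, rule_format, OF \<phi>]
            p[unfolded L2_space_bor_iff]
        proof eventually_elim
          case (elim x)
          show ?case
          proof (cases "x \<in> \<Omega>")
            case True
            have "(LINT t|lborel. bor w (t, x) * deriv \<phi> t)
                = (LINT t|lborel. bor y (t, x) * deriv \<phi> t - bor (primitive_l2 T \<Omega> g) (t, x) * deriv \<phi> t)"
            proof (rule integral_cong_AE)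
              show "AE t in lborel. bor w (t, x) * deriv \<phi> t
                  = bor y (t, x) * deriv \<phi> t - bor (primitive_l2 T \<Omega> g) (t, x) * deriv \<phi> t"
                using elim(1) unfolding w_def by eventually_elim (simp add: left_diff_distrib)
            qed measurable
            also have "\<dots> = 0" using elim True by simp
            finally show ?thesis by simp
          qed (use elim in simp)
        qed
      qed
      have "(LINT t|lborel. deriv \<phi> t * inner (sl \<Omega> w t) p) = (LINT x|lborel. bor p x * (LINT t|lborel. bor w (t, x) * deriv \<phi> t))"
        by (rule inner_sl_time_weighted[OF w test_fun_square_integrable[OF d\<phi>]])
      also have "\<dots> = 0" using z0 by (rule integral_eq_zero_AE)
      finally have 0: "(LINT t|lborel. deriv \<phi> t * inner (sl \<Omega> w t) p) = 0" .
      have ae: "AE t in lborel. deriv \<phi> t * ?F t = deriv \<phi> t * inner (sl \<Omega> w t) p"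
        using sl_w by eventually_elim (use test_fun_support[OF d\<phi>] in auto)
      have "(LINT t|lborel. deriv \<phi> t * ?F t) = (LINT t|lborel. deriv \<phi> t * inner (sl \<Omega> w t) p)"
        by (rule integral_cong_AE[OF _ _ ae]) measurable
      then show ?thesis using 0 by simp
    qed
    have "?F t = ?F 0"
    proof (rule LIMSEQ_unique)
      \<comment> \<open>Constancy is available between interior points in strict order only. Time 0
        is reached by continuity along points strictly between 0 and \<open>t\<close>, hence the two
        successors.\<close>
      let ?s = "\<lambda>n. t * inverse (real (Suc (Suc n)))"
      have s: "0 < ?s n" "?s n < t" for n
        using t by (auto simp: field_simps intro!: add_pos_nonneg)
      have "?s \<longlonglongrightarrow> t * 0" by (intro tendsto_intros LIMSEQ_Suc[OF LIMSEQ_inverse_real_of_nat])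
      then have "?s \<longlonglongrightarrow> 0" by simp
      then show "(\<lambda>n. ?F (?s n)) \<longlonglongrightarrow> ?F 0"
        using continuous_on_tendsto_compose[OF Fc] by auto
      have "?F (?s n) = ?F t" for n
        by (rule continuous_weakly_constant[OF Fc weak]) (use s t in auto)
      then show "(\<lambda>n. ?F (?s n)) \<longlonglongrightarrow> ?F t" by simp
    qed
    then show ?thesis using \<zeta>_0 by simp
  qed
  have "w = 0"
  proof (rule eq_if_sl_eq[OF \<Omega>_meas w subspace_0[OF subspace_V]])
    show "AE t in lborel. t \<in> {0<..<T} \<longrightarrow> sl \<Omega> w t = sl \<Omega> 0 t"
      using sl_w sl_in_L2_space[OF \<Omega>_meas, of w] sl_diff[OF \<Omega>_meas, of 0 0]
    proof eventually_elim
      case (elim t)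
      show ?case
      proof
        assume t: "t \<in> {0<..<T}"
        \<comment> \<open>\<open>const\<close> holds at every time and for every \<open>p\<close>,
          so \<open>p\<close> may be chosen depending on \<open>t\<close>: for almost every
          \<open>t\<close> the value itself is admissible, and no countable dense family is
          involved.\<close>
        then have "inner (\<zeta> (cl t)) (\<zeta> (cl t)) = 0" using elim by (intro const) auto
        then show "sl \<Omega> w t = sl \<Omega> 0 t" using elim t by simp
      qed
    qed
  qed
  then show ?thesis by (simp add: w_def)
qed

end

section \<open>Translations\<close>

lemma lborel_shift:
  fixes f :: "'a::euclidean_space \<Rightarrow> real"
  assumes [measurable]: "f \<in> borel_measurable borel"
  shows "integrable lborel (\<lambda>z. f (z - c)) \<longleftrightarrow> integrable lborel f"
    and "(LINT z|lborel. f (z - c)) = (LINT z|lborel. f z)"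
proof -
  have d: "lborel = distr lborel borel ((+) (- c))" by (rule lborel_distr_plus[symmetric])
  show "integrable lborel (\<lambda>z. f (z - c)) \<longleftrightarrow> integrable lborel f"
    by (subst (2) d, subst integrable_distr_eq) (auto simp: algebra_simps)
  show "(LINT z|lborel. f (z - c)) = (LINT z|lborel. f z)"
    by (subst (2) d, subst integral_distr) (auto simp: algebra_simps)
qed

lemma AE_lborel_shift:
  fixes c :: "'a::euclidean_space"
  assumes "AE z in lborel. P z"
  shows "AE z in lborel. P (z - c)"
proof -
  have "AE z in distr lborel borel ((+) (- c)). P z"
    by (subst lborel_distr_plus) (rule assms)
  then have "AE z in lborel. P (- c + z)" by (rule AE_distrD[rotated]) measurable
  then show ?thesis by (simp add: algebra_simps)
qed

definition shift :: "'a::euclidean_space \<Rightarrow> 'a l2 \<Rightarrow> 'a l2" where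
  "shift c u = abs_l2 (\<lambda>z. bor u (z - c))"

lemma bor_shift: "AE z in lborel. bor (shift c u) z = bor u (z - c)"
  unfolding shift_def
  by (rule bor_abs_l2) (use lborel_shift(1)[of "\<lambda>z. (bor u z)\<^sup>2" c] bor_square_integrable[of u] in auto)

lemma inner_shift_left: "inner (shift c u) v = (LINT z|lborel. bor u (z - c) * bor v z)"
  unfolding inner_bor
proof (rule integral_cong_AE)
  show "AE z in lborel. bor (shift c u) z * bor v z = bor u (z - c) * bor v z"
    using bor_shift[of c u] by eventually_elim simp
qed measurable

lemma shift_add: "shift c (u + v) = shift c u + shift c v"
  by (rule bor_eqI, use AE_lborel_shift[OF bor_add[of u v], of c] bor_shift[of c u] bor_shift[of c v]
    bor_shift[of c "u + v"] bor_add[of "shift c u" "shift c v"] in eventually_elim) simp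

lemma shift_scaleR: "shift c (r *\<^sub>R u) = r *\<^sub>R shift c u"
  by (rule bor_eqI, use AE_lborel_shift[OF bor_scaleR[of r u], of c] bor_shift[of c u]
    bor_shift[of c "r *\<^sub>R u"] bor_scaleR[of r "shift c u"] in eventually_elim) simp

lemma shift_diff: "shift c (u - v) = shift c u - shift c v"
  using shift_add[of c u "- 1 *\<^sub>R v"] shift_scaleR[of c "- 1" v] by simp

lemma norm_shift: "norm (shift c u) = norm u"
proof -
  have "(norm (shift c u))\<^sup>2 = (LINT z|lborel. (bor u (z - c))\<^sup>2)"
    unfolding norm_bor_square
  proof (rule integral_cong_AE)
    show "AE z in lborel. (bor (shift c u) z)\<^sup>2 = (bor u (z - c))\<^sup>2"
      using bor_shift[of c u] by eventually_elim simp
  qed measurable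
  also have "\<dots> = (norm u)\<^sup>2"
    unfolding norm_bor_square by (rule lborel_shift(2)[of "\<lambda>z. (bor u z)\<^sup>2"]) measurable
  finally show ?thesis by (simp add: power2_eq_iff_nonneg)
qed

text \<open>Translation is an isometry, so the squared distance equals 2 \<open>inner ?B ?B\<close>
  minus 2 \<open>inner (shift (c n) ?B) ?B\<close>. The inner product converges by dominated
  convergence: at a point of the open box the translated indicator is eventually 1, and the second
  factor removes all other points.\<close>

lemma shift_box_tendsto:
  fixes a b :: "'a::euclidean_space"
  assumes c: "c \<longlonglongrightarrow> 0"
  shows "(\<lambda>n. shift (c n) (box_l2 a b)) \<longlonglongrightarrow> box_l2 a b"
proof -
  let ?B = "box_l2 a b"
  have i: "inner (shift (c n) ?B) ?B = (LINT z|lborel. indicator (box a b) (z - c n) * indicator (box a b) z)" for n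
    unfolding inner_shift_left
  proof (rule integral_cong_AE)
    show "AE z in lborel. bor ?B (z - c n) * bor ?B z = indicator (box a b) (z - c n) * indicator (box a b) z"
      using AE_lborel_shift[OF bor_box_l2[of a b], of "c n"] bor_box_l2[of a b] by eventually_elim simp
  qed measurable
  have "(\<lambda>n. inner (shift (c n) ?B) ?B) \<longlonglongrightarrow> (LINT z|lborel. indicator (box a b) z)"
    unfolding i
  proof (rule integral_dominated_convergence[where w = "indicator (box a b)"])
    show "AE z in lborel. (\<lambda>n. indicator (box a b) (z - c n) * indicator (box a b) z) \<longlonglongrightarrow> (indicator (box a b) z :: real)"
    proof (rule AE_I2)
      fix z
      show "(\<lambda>n. indicator (box a b) (z - c n) * indicator (box a b) z) \<longlonglongrightarrow> (indicator (box a b) z :: real)"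
      proof (cases "z \<in> box a b")
        case True
        have "(\<lambda>n. z - c n) \<longlonglongrightarrow> z - 0" by (intro tendsto_intros c)
        then have "\<forall>\<^sub>F n in sequentially. z - c n \<in> box a b"
          using True open_box by (auto dest: topological_tendstoD)
        then have "\<forall>\<^sub>F n in sequentially. indicator (box a b) z = indicator (box a b) (z - c n) * (indicator (box a b) z :: real)"
          by eventually_elim (use True in simp)
        then show ?thesis by (rule Lim_transform_eventually[OF tendsto_const])
      qed simp
    qed
    show "integrable lborel (indicator (box a b) :: 'a \<Rightarrow> real)"
      using emeasure_lborel_box_finite[of a b] by (intro integrable_real_indicator) simp_all
  qed (auto simp: indicator_def)
  moreover have "(LINT z|lborel. indicator (box a b) z) = inner ?B ?B"
  proof -
    have "inner ?B ?B = (LINT z|lborel. bor ?B z * indicator (box a b) z)"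
      by (rule inner_bor_cong[OF bor_box_l2]) simp
    also have "\<dots> = (LINT z|lborel. indicator (box a b) z)"
    proof (rule integral_cong_AE)
      show "AE z in lborel. bor ?B z * indicator (box a b) z = indicator (box a b) z"
        using bor_box_l2[of a b] by eventually_elim (simp add: indicator_def)
    qed measurable
    finally show ?thesis by simp
  qed
  ultimately have l: "(\<lambda>n. inner (shift (c n) ?B) ?B) \<longlonglongrightarrow> inner ?B ?B" by simp
  have n2: "(norm (shift (c n) ?B - ?B))\<^sup>2 = 2 * inner ?B ?B - 2 * inner (shift (c n) ?B) ?B" for n
  proof -
    have "inner (shift (c n) ?B) (shift (c n) ?B) = inner ?B ?B"
      by (simp add: norm_shift flip: power2_norm_eq_inner)
    then show ?thesis
      unfolding power2_norm_eq_inner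
      by (simp add: inner_diff_left inner_diff_right inner_commute[of ?B "shift (c n) ?B"])
  qed
  have "(\<lambda>n. sqrt (2 * inner ?B ?B - 2 * inner (shift (c n) ?B) ?B)) \<longlonglongrightarrow> sqrt (2 * inner ?B ?B - 2 * inner ?B ?B)"
    by (intro tendsto_intros l)
  moreover have "norm (shift (c n) ?B - ?B) = sqrt (2 * inner ?B ?B - 2 * inner (shift (c n) ?B) ?B)" for n
    unfolding n2[symmetric] by simp
  ultimately have "(\<lambda>n. norm (shift (c n) ?B - ?B)) \<longlonglongrightarrow> 0"
    by (simp only: diff_self real_sqrt_zero)
  then show ?thesis by (rule LIM_zero_cancel[OF tendsto_norm_zero_cancel])
qed

text \<open>The elements on which translation is continuous form a subspace, closed because
  translations are isometries. It contains all boxes, and only 0 is orthogonal to these.\<close>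

lemma shift_tendsto:
  fixes u :: "'a::euclidean_space l2"
  assumes c: "c \<longlonglongrightarrow> 0"
  shows "(\<lambda>n. shift (c n) u) \<longlonglongrightarrow> u"
proof -
  define W where "W = {u :: 'a l2. (\<lambda>n. shift (c n) u) \<longlonglongrightarrow> u}"
  have "shift d 0 = 0" for d :: 'a using shift_scaleR[of d 0 0] by simp
  then have sub: "subspace W"
    unfolding subspace_def W_def by (auto simp: shift_add shift_scaleR intro!: tendsto_intros)
  moreover have "closed W"
    unfolding closed_sequential_limits
  proof (intro allI impI)
    fix v and l :: "'a l2"
    assume v: "(\<forall>n. v n \<in> W) \<and> v \<longlonglongrightarrow> l"
    have "(\<lambda>n. shift (c n) l) \<longlonglongrightarrow> l"
    proof (rule LIMSEQ_I)
      fix r :: real assume r: "r > 0"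
      then obtain m where m: "norm (v m - l) < r / 3"
        using v LIMSEQ_D[of v l "r / 3"] by auto
      have "(\<lambda>n. shift (c n) (v m)) \<longlonglongrightarrow> v m" using v by (auto simp: W_def)
      then obtain N where N: "\<And>n. n \<ge> N \<Longrightarrow> norm (shift (c n) (v m) - v m) < r / 3"
        using r LIMSEQ_D[of "\<lambda>n. shift (c n) (v m)" "v m" "r / 3"] by auto
      have "norm (shift (c n) l - l) < r" if "n \<ge> N" for n
      proof -
        have "shift (c n) l - l = (shift (c n) (l - v m) + (shift (c n) (v m) - v m)) + (v m - l)"
          by (simp add: shift_diff)
        then have "norm (shift (c n) l - l) \<le> norm (shift (c n) (l - v m)) + norm (shift (c n) (v m) - v m) + norm (v m - l)"
          by (simp only:) (intro norm_triangle_mono norm_triangle_le order_refl)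
        then show ?thesis using m N[OF that] by (simp add: norm_shift norm_minus_commute)
      qed
      then show "\<exists>N. \<forall>n\<ge>N. norm (shift (c n) l - l) < r" by blast
    qed
    then show "l \<in> W" by (simp add: W_def)
  qed
  ultimately have "W = UNIV"
  proof (rule closed_subspace_eq_UNIV)
    fix u :: "'a l2"
    assume orth: "\<And>v. v \<in> W \<Longrightarrow> inner u v = 0"
    show "u = 0"
    proof (rule zero_if_orthogonal_boxes)
      show "inner u (box_l2 a b) = 0" for a b
        by (rule orth) (simp add: W_def shift_box_tendsto[OF c])
    qed
  qed
  then show ?thesis by (auto simp: W_def)
qed

section \<open>The space of states\<close>

context cylinder
begin

text \<open>The graph of the Dirichlet Laplacian at almost every time, with the boundary condition
  included. Working with the relation gives linearity and closedness before the description in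
  \<open>lap\<close> is known to denote.\<close>

definition lap_rel :: "(real \<times> 'a) l2 \<Rightarrow> (real \<times> 'a) l2 \<Rightarrow> bool" where
  "lap_rel y k \<longleftrightarrow> y \<in> V \<and> k \<in> V \<and>
     (AE t in lborel. t \<in> {0<..<T} \<longrightarrow> (\<exists>G. dirichlet_lap \<Omega> (sl \<Omega> y t) (sl \<Omega> k t) G))"

lemma AE_lebesgue_on_time: "(AE t in lebesgue_on {0<..<T}. P t) \<longleftrightarrow> (AE t in lborel. t \<in> {0<..<T} \<longrightarrow> P t)"
  by (simp add: AE_lebesgue_on_iff AE_completion_iff)

lemma lap_rel_iff:
  assumes "y \<in> V" "k \<in> V"
  shows "lap_rel y k \<longleftrightarrow>
    (AE t in lebesgue_on {0<..<T}. slice y t \<in> H_Delta \<Omega> \<inter> H1_0 \<Omega>) \<and> is_laplacian T \<Omega> y k"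
proof -
  have ae: "AE t in lborel. (slice y t \<in> H_Delta \<Omega> \<inter> H1_0 \<Omega> \<and> weak_laplacian \<Omega> (slice y t) (slice k t))
      \<longleftrightarrow> (\<exists>G. dirichlet_lap \<Omega> (sl \<Omega> y t) (sl \<Omega> k t) G)"
    using L2_fun_slice[OF \<Omega>_meas, of y] L2_fun_slice[OF \<Omega>_meas, of k]
      toL2_slice[OF \<Omega>_meas, of y] toL2_slice[OF \<Omega>_meas, of k]
  proof eventually_elim
    case (elim t)
    then show ?case using dirichlet_lap_iff[OF \<Omega> elim(1,2)] by (auto simp: H_Delta_def)
  qed
  have "(AE t in lborel. t \<in> {0<..<T} \<longrightarrow> (\<exists>G. dirichlet_lap \<Omega> (sl \<Omega> y t) (sl \<Omega> k t) G)) \<longleftrightarrow>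
      (AE t in lborel. t \<in> {0<..<T} \<longrightarrow> slice y t \<in> H_Delta \<Omega> \<inter> H1_0 \<Omega> \<and> weak_laplacian \<Omega> (slice y t) (slice k t))"
    using ae by (auto elim!: AE_mp)
  also have "\<dots> \<longleftrightarrow> (AE t in lborel. (t \<in> {0<..<T} \<longrightarrow> slice y t \<in> H_Delta \<Omega> \<inter> H1_0 \<Omega>) \<and>
      (t \<in> {0<..<T} \<longrightarrow> weak_laplacian \<Omega> (slice y t) (slice k t)))"
    by (intro AE_cong) auto
  finally show ?thesis
    using assms unfolding lap_rel_def is_laplacian_def AE_lebesgue_on_time by (simp add: AE_conj_iff)
qed

lemma lap_rel_unique: "lap_rel y k \<Longrightarrow> lap_rel y l \<Longrightarrow> k = l"
  unfolding lap_rel_def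
  by (rule eq_if_sl_eq[OF \<Omega>_meas]) (auto elim!: AE_mp dest: dirichlet_lap_unique[OF \<Omega>])

lemma L2_HDelta_H10_iff: "y \<in> L2_HDelta_H10 T \<Omega> \<longleftrightarrow> (\<exists>k. lap_rel y k)"
proof
  assume "y \<in> L2_HDelta_H10 T \<Omega>"
  then show "\<exists>k. lap_rel y k" unfolding L2_HDelta_H10_def using lap_rel_iff by blast
next
  assume "\<exists>k. lap_rel y k"
  then obtain k where k: "lap_rel y k" by blast
  then have "y \<in> V" "k \<in> V" by (auto simp: lap_rel_def)
  then show "y \<in> L2_HDelta_H10 T \<Omega>"
    using k lap_rel_iff[of y k] unfolding L2_HDelta_H10_def by blast
qed

lemma lap_eq: "lap_rel y k \<Longrightarrow> lap T \<Omega> y = k"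
proof -
  assume k: "lap_rel y k"
  then have yk: "y \<in> V" "k \<in> V" by (auto simp: lap_rel_def)
  show ?thesis
    unfolding lap_def
  proof (rule the_equality)
    show "k \<in> V \<and> is_laplacian T \<Omega> y k" using k yk lap_rel_iff by blast
    fix l assume "l \<in> V \<and> is_laplacian T \<Omega> y l"
    then have "lap_rel y l" using k yk lap_rel_iff by blast
    then show "l = k" using k lap_rel_unique by blast
  qed
qed

lemma lap_rel_add: "lap_rel y k \<Longrightarrow> lap_rel z l \<Longrightarrow> lap_rel (y + z) (k + l)"
proof -
  assume a: "lap_rel y k" "lap_rel z l"
  then have ae: "AE t in lborel. t \<in> {0<..<T} \<longrightarrow> (\<exists>G. dirichlet_lap \<Omega> (sl \<Omega> y t) (sl \<Omega> k t) G)"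
    "AE t in lborel. t \<in> {0<..<T} \<longrightarrow> (\<exists>G. dirichlet_lap \<Omega> (sl \<Omega> z t) (sl \<Omega> l t) G)"
    by (auto simp: lap_rel_def)
  have "AE t in lborel. t \<in> {0<..<T} \<longrightarrow> (\<exists>G. dirichlet_lap \<Omega> (sl \<Omega> (y + z) t) (sl \<Omega> (k + l) t) G)"
    using ae sl_add[OF \<Omega>_meas, of y z] sl_add[OF \<Omega>_meas, of k l]
  proof eventually_elim
    case (elim t)
    show ?case
    proof
      assume t: "t \<in> {0<..<T}"
      obtain G where G: "dirichlet_lap \<Omega> (sl \<Omega> y t) (sl \<Omega> k t) G" using elim(1) t by blast
      obtain H where H: "dirichlet_lap \<Omega> (sl \<Omega> z t) (sl \<Omega> l t) H" using elim(2) t by blast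
      show "\<exists>G. dirichlet_lap \<Omega> (sl \<Omega> (y + z) t) (sl \<Omega> (k + l) t) G"
        using dirichlet_lap_add[OF \<Omega> G H] elim(3,4) by auto
    qed
  qed
  with a show ?thesis using subspace_add[OF subspace_V] by (auto simp: lap_rel_def)
qed

lemma lap_rel_scaleR: "lap_rel y k \<Longrightarrow> lap_rel (c *\<^sub>R y) (c *\<^sub>R k)"
proof -
  assume a: "lap_rel y k"
  then have ae: "AE t in lborel. t \<in> {0<..<T} \<longrightarrow> (\<exists>G. dirichlet_lap \<Omega> (sl \<Omega> y t) (sl \<Omega> k t) G)"
    by (auto simp: lap_rel_def)
  have "AE t in lborel. t \<in> {0<..<T} \<longrightarrow> (\<exists>G. dirichlet_lap \<Omega> (sl \<Omega> (c *\<^sub>R y) t) (sl \<Omega> (c *\<^sub>R k) t) G)"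
    using ae sl_scaleR[OF \<Omega>_meas, of c y] sl_scaleR[OF \<Omega>_meas, of c k]
  proof eventually_elim
    case (elim t)
    show ?case
    proof
      assume t: "t \<in> {0<..<T}"
      obtain G where G: "dirichlet_lap \<Omega> (sl \<Omega> y t) (sl \<Omega> k t) G" using elim(1) t by blast
      show "\<exists>G. dirichlet_lap \<Omega> (sl \<Omega> (c *\<^sub>R y) t) (sl \<Omega> (c *\<^sub>R k) t) G"
        using dirichlet_lap_scaleR[OF \<Omega> G, of c] elim(2,3) by auto
    qed
  qed
  with a show ?thesis using subspace_scale[OF subspace_V] by (auto simp: lap_rel_def)
qed

lemma lap_rel_diff: "lap_rel y k \<Longrightarrow> lap_rel z l \<Longrightarrow> lap_rel (y - z) (k - l)"
  using lap_rel_add[of y k "- 1 *\<^sub>R z" "- 1 *\<^sub>R l"] lap_rel_scaleR[of z l "- 1"] by simp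

text \<open>Convergence in space-time yields convergence of slices only along subsequences. One for
  \<open>y\<close> and a further one for \<open>k\<close> make both converge at almost every time,
  where the Laplacian on \<Omega> is closed.\<close>

lemma lap_rel_closed:
  assumes r: "\<And>n. lap_rel (y n) (k n)" and y: "y \<longlonglongrightarrow> y'" and k: "k \<longlonglongrightarrow> k'"
  shows "lap_rel y' k'"
proof -
  have in_V: "y n \<in> V" "k n \<in> V" for n using r[of n] by (auto simp: lap_rel_def)
  obtain p where p: "strict_mono p" "AE t in lborel. (\<lambda>n. sl \<Omega> (y (p n)) t) \<longlonglongrightarrow> sl \<Omega> y' t"
    using sl_subseq_tendsto[OF \<Omega>_meas in_V(1) y] by blast
  have kp: "(\<lambda>n. k (p n)) \<longlonglongrightarrow> k'" using LIMSEQ_subseq_LIMSEQ[OF k p(1)] by (simp add: o_def)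
  obtain q where q: "strict_mono q" "AE t in lborel. (\<lambda>n. sl \<Omega> (k (p (q n))) t) \<longlonglongrightarrow> sl \<Omega> k' t"
    using sl_subseq_tendsto[OF \<Omega>_meas _ kp, OF in_V(2)] by blast
  have "AE t in lborel. \<forall>n. t \<in> {0<..<T} \<longrightarrow> (\<exists>G. dirichlet_lap \<Omega> (sl \<Omega> (y n) t) (sl \<Omega> (k n) t) G)"
    unfolding AE_all_countable using r by (auto simp: lap_rel_def)
  with p(2) q(2) have "AE t in lborel. t \<in> {0<..<T} \<longrightarrow> (\<exists>G. dirichlet_lap \<Omega> (sl \<Omega> y' t) (sl \<Omega> k' t) G)"
  proof eventually_elim
    case (elim t)
    have "(\<lambda>n. sl \<Omega> (y (p (q n))) t) \<longlonglongrightarrow> sl \<Omega> y' t"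
      using LIMSEQ_subseq_LIMSEQ[OF elim(1) q(1)] by (simp add: o_def)
    then show ?case
      using dirichlet_lap_closed[OF \<Omega>, of "\<lambda>n. sl \<Omega> (y (p (q n))) t" "\<lambda>n. sl \<Omega> (k (p (q n))) t"] elim by blast
  qed
  moreover have "y' \<in> V" "k' \<in> V" using closed_sequentially[OF closed_V] in_V y k by blast+
  ultimately show ?thesis by (simp add: lap_rel_def)
qed

section \<open>Dissipativity: the pairing of the time derivative with the Laplacian is
  nonpositive\<close>

lemma lap_rel_symmetric:
  assumes "lap_rel y k" "lap_rel z l"
  shows "inner k z = inner l y"
proof -
  have V: "k \<in> V" "l \<in> V" using assms by (auto simp: lap_rel_def)
  have "inner k z = (LINT t|lborel. inner (sl \<Omega> k t) (sl \<Omega> z t))" by (rule inner_sl(2)[OF \<Omega>_meas V(1)])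
  also have "\<dots> = (LINT t|lborel. inner (sl \<Omega> l t) (sl \<Omega> y t))"
  proof (rule integral_cong_AE)
    have "AE t in lborel. t \<in> {0<..<T} \<longrightarrow> (\<exists>G. dirichlet_lap \<Omega> (sl \<Omega> y t) (sl \<Omega> k t) G)"
      "AE t in lborel. t \<in> {0<..<T} \<longrightarrow> (\<exists>G. dirichlet_lap \<Omega> (sl \<Omega> z t) (sl \<Omega> l t) G)"
      using assms by (auto simp: lap_rel_def)
    then show "AE t in lborel. inner (sl \<Omega> k t) (sl \<Omega> z t) = inner (sl \<Omega> l t) (sl \<Omega> y t)"
      using sl_outside[OF \<Omega>_meas V(1)] sl_outside[OF \<Omega>_meas V(2)]
    proof eventually_elim
      case (elim t)
      show ?case
      proof (cases "t \<in> {0<..<T}")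
        case True
        obtain G where G: "dirichlet_lap \<Omega> (sl \<Omega> y t) (sl \<Omega> k t) G" using elim(1) True by blast
        obtain H where H: "dirichlet_lap \<Omega> (sl \<Omega> z t) (sl \<Omega> l t) H" using elim(2) True by blast
        show ?thesis by (rule dirichlet_lap_symmetric[OF \<Omega> G H])
      qed (use elim in simp)
    qed
  qed (use inner_sl(1)[OF \<Omega>_meas V(1)] inner_sl(1)[OF \<Omega>_meas V(2)] in auto)
  also have "\<dots> = inner l y" by (rule inner_sl(2)[OF \<Omega>_meas V(2), symmetric])
  finally show ?thesis .
qed

lemma lap_rel_AE_nonpos:
  assumes "lap_rel y k"
  shows "AE t in lborel. inner (sl \<Omega> k t) (sl \<Omega> y t) \<le> 0"
proof -
  have k: "k \<in> V" and ae: "AE t in lborel. t \<in> {0<..<T} \<longrightarrow> (\<exists>G. dirichlet_lap \<Omega> (sl \<Omega> y t) (sl \<Omega> k t) G)"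
    using assms by (auto simp: lap_rel_def)
  show ?thesis using ae sl_outside[OF \<Omega>_meas k]
  proof eventually_elim
    case (elim t)
    then show ?case using dirichlet_lap_nonpos[OF \<Omega>] by (cases "t \<in> {0<..<T}") auto
  qed
qed

lemma lap_rel_nonpos:
  assumes "lap_rel y k"
  shows "inner k y \<le> 0"
proof -
  have k: "k \<in> V" using assms by (simp add: lap_rel_def)
  have "inner k y = (LINT t|lborel. inner (sl \<Omega> k t) (sl \<Omega> y t))" by (rule inner_sl(2)[OF \<Omega>_meas k])
  also have "\<dots> \<le> (LINT (t::real)|lborel. 0)"
    by (rule integral_mono_AE[OF inner_sl(1)[OF \<Omega>_meas k] _ lap_rel_AE_nonpos[OF assms]]) simp
  finally show ?thesis by simp
qed

text \<open>Translation in time within the cylinder. For positive \<open>h\<close> the values before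
  time \<open>h\<close> are 0, which lies in the domain of the Laplacian, so the delayed function
  stays in that domain.\<close>

definition delay :: "real \<Rightarrow> (real \<times> 'a) l2 \<Rightarrow> (real \<times> 'a) l2" where
  "delay h u = cut Q (shift (h, 0) u)"

lemma sl_delay: "AE t in lborel. t \<in> {0<..<T} \<longrightarrow> sl \<Omega> (delay h u) t = sl \<Omega> u (t - h)"
proof -
  have "AE z in lborel. bor (delay h u) z = indicator Q z * bor u (z - (h, 0))"
    using bor_cut[OF Q_lebesgue, of "shift (h, 0) u"] bor_shift[of "(h, 0)" u]
    unfolding delay_def by eventually_elim simp
  from AE_lborel_pair[OF this] bor_sl[OF \<Omega>_meas, of "delay h u"] AE_lborel_shift[OF bor_sl[OF \<Omega>_meas, of u], of h]
  show ?thesis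
  proof eventually_elim
    case (elim t)
    show ?case
      by (rule impI, rule bor_eqI, use elim in eventually_elim) (auto simp: cyl_def indicator_def)
  qed
qed

lemma delay_in_V: "delay h u \<in> V"
  unfolding delay_def by (rule cut_in_L2_space[OF Q_lebesgue])

lemma lap_rel_delay:
  assumes "lap_rel y k" "h > 0"
  shows "lap_rel (delay h y) (delay h k)"
proof -
  have V: "y \<in> V" "k \<in> V" and ae: "AE t in lborel. t \<in> {0<..<T} \<longrightarrow> (\<exists>G. dirichlet_lap \<Omega> (sl \<Omega> y t) (sl \<Omega> k t) G)"
    using assms(1) by (auto simp: lap_rel_def)
  have "AE t in lborel. t \<in> {0<..<T} \<longrightarrow> (\<exists>G. dirichlet_lap \<Omega> (sl \<Omega> (delay h y) t) (sl \<Omega> (delay h k) t) G)"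
    using AE_lborel_shift[OF ae, of h] AE_lborel_shift[OF sl_outside[OF \<Omega>_meas V(1)], of h]
      AE_lborel_shift[OF sl_outside[OF \<Omega>_meas V(2)], of h] sl_delay[of h y] sl_delay[of h k]
  proof eventually_elim
    case (elim t)
    then show ?case
      using dirichlet_lap_zero[OF \<Omega>] by (cases "t - h \<in> {0<..<T}") auto
  qed
  then show ?thesis by (simp add: lap_rel_def delay_in_V)
qed

text \<open>The delay discards the values on the last stretch of length \<open>h\<close>, and the
  pairing there is nonpositive; dropping it can only increase the integral.\<close>

lemma delay_energy:
  assumes "lap_rel y k" "h > 0"
  shows "inner k y \<le> inner (delay h k) (delay h y)"
proof -
  have k: "k \<in> V" using assms(1) by (simp add: lap_rel_def)
  let ?e = "\<lambda>t. inner (sl \<Omega> k t) (sl \<Omega> y t)"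
  have i: "integrable lborel ?e" by (rule inner_sl(1)[OF \<Omega>_meas k])
  then have m: "?e \<in> borel_measurable borel" by auto
  have "inner k y = (LINT t|lborel. ?e (t - h))"
    unfolding inner_sl(2)[OF \<Omega>_meas k] by (rule lborel_shift(2)[OF m, symmetric])
  also have "\<dots> \<le> (LINT t|lborel. inner (sl \<Omega> (delay h k) t) (sl \<Omega> (delay h y) t))"
  proof (rule integral_mono_AE)
    show "integrable lborel (\<lambda>t. ?e (t - h))" using i lborel_shift(1)[OF m] by simp
    show "integrable lborel (\<lambda>t. inner (sl \<Omega> (delay h k) t) (sl \<Omega> (delay h y) t))"
      by (rule inner_sl(1)[OF \<Omega>_meas delay_in_V])
    show "AE t in lborel. ?e (t - h) \<le> inner (sl \<Omega> (delay h k) t) (sl \<Omega> (delay h y) t)"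
      using AE_lborel_shift[OF lap_rel_AE_nonpos[OF assms(1)], of h] sl_delay[of h k] sl_delay[of h y]
        sl_outside[OF \<Omega>_meas delay_in_V[of h k]]
    proof eventually_elim
      case (elim t)
      then show ?case by (cases "t \<in> {0<..<T}") auto
    qed
  qed
  also have "\<dots> = inner (delay h k) (delay h y)" by (rule inner_sl(2)[OF \<Omega>_meas delay_in_V, symmetric])
  finally show ?thesis .
qed

text \<open>A discrete version of differentiating the Dirichlet energy. Expanding the nonpositive
  pairing of \<open>k - delay h k\<close> with \<open>y - delay h y\<close>, symmetry merges the two
  mixed terms, and \<open>delay_energy\<close> replaces the delayed square by the undelayed one;
  half of the result is the claim.\<close>

lemma backward_difference_nonpos:
  assumes "lap_rel y k" "h > 0"
  shows "inner k (y - shift (h, 0) y) \<le> 0"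
proof -
  have k: "k \<in> V" using assms(1) by (simp add: lap_rel_def)
  note d = lap_rel_delay[OF assms]
  have "inner k (delay h y) = inner k (shift (h, 0) y)"
    unfolding delay_def
    by (metis Q_lebesgue cut_eq inner_commute inner_cut_right k)
  moreover have "inner (k - delay h k) (y - delay h y) \<le> 0"
    by (rule lap_rel_nonpos[OF lap_rel_diff[OF assms(1) d]])
  moreover have "inner k (delay h y) = inner (delay h k) y" by (rule lap_rel_symmetric[OF assms(1) d])
  ultimately show ?thesis
    using delay_energy[OF assms] by (simp add: inner_diff_left inner_diff_right)
qed

text \<open>The increment of the primitive from \<open>t - h\<close> to \<open>t\<close> is the
  integral of g(t - r) over \<open>r\<close> from 0 to \<open>h\<close>. Paired with
  \<open>k\<close>, Fubini's theorem exhibits it as an integral of translates of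
  \<open>g\<close>.\<close>

lemma backward_difference_eq:
  assumes g: "g \<in> V" and k: "k \<in> V" and h: "h > 0"
  shows "integrable lborel (\<lambda>r. indicator {0<..h} r * inner (shift (r, 0) g) k)"
    and "inner k (primitive_l2 T \<Omega> g - shift (h, 0) (primitive_l2 T \<Omega> g)) =
      (LINT r|lborel. indicator {0<..h} r * inner (shift (r, 0) g) k)"
proof -
  let ?y = "primitive_l2 T \<Omega> g"
  define f where "f q = indicator {0<..h} (fst q) * (bor k (snd q) * bor g (snd q - (fst q, 0)))"
    for q :: "real \<times> real \<times> 'a"
  have fm: "f \<in> borel_measurable borel"
  proof -
    have "(\<lambda>q::real \<times> real \<times> 'a. snd q - (fst q, 0)) \<in> borel_measurable borel"
      by (intro borel_measurable_continuous_onI continuous_intros)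
    then have "(\<lambda>q. bor g (snd q - (fst q, 0 :: 'a))) \<in> borel_measurable borel"
      by (rule measurable_compose) simp
    moreover have "(\<lambda>q::real \<times> real \<times> 'a. bor k (snd q)) \<in> borel_measurable borel"
      by (rule measurable_compose[OF borel_measurable_continuous_onI]) (auto intro!: continuous_intros)
    moreover have "(\<lambda>q::real \<times> real \<times> 'a. indicator {0<..h} (fst q) :: real) \<in> borel_measurable borel"
      by (rule measurable_compose[OF borel_measurable_continuous_onI]) (auto intro!: continuous_intros)
    ultimately show ?thesis unfolding f_def by (intro borel_measurable_times)
  qed
  have slice_int: "integrable lborel (\<lambda>z. bor k z * bor g (z - (r, 0)))"
      "(LINT z|lborel. \<bar>bor k z * bor g (z - (r, 0))\<bar>) \<le> norm k * norm g" for r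
  proof -
    have m1: "(\<lambda>z. \<bar>bor k z\<bar>) \<in> borel_measurable borel" "(\<lambda>z. \<bar>bor g (z - (r, 0))\<bar>) \<in> borel_measurable borel"
      "(\<lambda>z. bor g (z - (r, 0))) \<in> borel_measurable borel" by measurable
    have i1: "integrable lborel (\<lambda>z. (bor g (z - (r, 0)))\<^sup>2)"
      using lborel_shift(1)[of "\<lambda>z. (bor g z)\<^sup>2" "(r, 0)"] bor_square_integrable[of g] by simp
    have n1: "(LINT z|lborel. (bor g (z - (r, 0)))\<^sup>2) = (norm g)\<^sup>2"
      using lborel_shift(2)[of "\<lambda>z. (bor g z)\<^sup>2" "(r, 0)"] norm_bor_square[of g] by simp
    show "integrable lborel (\<lambda>z. bor k z * bor g (z - (r, 0)))"
      by (rule borel_Cauchy_Schwarz(1)[OF bor_measurable bor_square_integrable m1(3) i1])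
    have "(LINT z|lborel. \<bar>bor k z\<bar> * \<bar>bor g (z - (r, 0))\<bar>)\<^sup>2
        \<le> (LINT z|lborel. (\<bar>bor k z\<bar>)\<^sup>2) * (LINT z|lborel. (\<bar>bor g (z - (r, 0))\<bar>)\<^sup>2)"
      using bor_square_integrable[of k] i1 by (intro borel_Cauchy_Schwarz(2) m1) simp_all
    also have "\<dots> = (norm k * norm g)\<^sup>2"
      using n1 by (simp add: norm_bor_square[of k] power_mult_distrib)
    finally have "(LINT z|lborel. \<bar>bor k z\<bar> * \<bar>bor g (z - (r, 0))\<bar>) \<le> norm k * norm g"
      by (rule power2_le_imp_le) simp
    then show "(LINT z|lborel. \<bar>bor k z * bor g (z - (r, 0))\<bar>) \<le> norm k * norm g" by (simp add: abs_mult)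
  qed
  have f_int: "integrable lborel f"
  proof (rule fubini_integrable[OF fm])
    have b: "integrable lborel (\<lambda>r. indicator {0<..h} r * (norm k * norm g))"
      using h by (intro integrable_mult_left integrable_real_indicator) auto
    show "integrable lborel (\<lambda>r. LINT z|lborel. \<bar>f (r, z)\<bar>)"
    proof (rule Bochner_Integration.integrable_bound[OF b])
      have "(\<lambda>q. \<bar>f q\<bar>) \<in> borel_measurable (lborel \<Otimes>\<^sub>M lborel)" unfolding lborel_prod using fm by simp
      then show "(\<lambda>r. LINT z|lborel. \<bar>f (r, z)\<bar>) \<in> borel_measurable lborel"
        by (intro lborel.borel_measurable_lebesgue_integral) simp
      show "AE r in lborel. norm (LINT z|lborel. \<bar>f (r, z)\<bar>) \<le> norm (indicator {0<..h} r * (norm k * norm g))"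
        using slice_int(2) by (intro AE_I2) (simp add: f_def indicator_def)
    qed
    show "AE r in lborel. integrable lborel (\<lambda>z. f (r, z))"
      using slice_int(1) by (intro AE_I2) (simp add: f_def)
  qed
  have f_r: "(LINT z|lborel. f (r, z)) = indicator {0<..h} r * inner (shift (r, 0) g) k" for r
    unfolding inner_shift_left by (simp add: f_def mult.commute)
  show "integrable lborel (\<lambda>r. indicator {0<..h} r * inner (shift (r, 0) g) k)"
    using fubini_integrable_fst[OF f_int] unfolding f_r .
  have yz: "AE z in lborel. bor k z * (bor ?y z - bor ?y (z - (h, 0))) = (LINT r|lborel. f (r, z))"
  proof -
    have gz: "AE x in lborel. AE s in lborel. (s, x) \<notin> Q \<longrightarrow> bor g (s, x) = 0"
      using AE_lborel_pair_swap[OF g[unfolded L2_space_bor_iff]] .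
    \<comment> \<open>A property of the space variable alone that fails only on a null set
      \<open>N\<close> fails in space-time only on the null set
      \<open>UNIV \<times> N\<close>.\<close>
    have good: "AE z in (lborel :: (real \<times> 'a) measure). (AE s in lborel. (s, snd z) \<notin> Q \<longrightarrow> bor g (s, snd z) = 0) \<and>
        integrable lborel (\<lambda>s. (bor g (s, snd z))\<^sup>2)"
    proof -
      define ok where "ok x \<longleftrightarrow> (AE s in lborel. (s, x) \<notin> Q \<longrightarrow> bor g (s, x) = 0) \<and>
        integrable lborel (\<lambda>s. (bor g (s, x))\<^sup>2)" for x
      have "AE x in lborel. ok x"
        using gz AE_time_square_integrable[of g] by eventually_elim (simp add: ok_def)
      then obtain N where "{x \<in> space lborel. \<not> ok x} \<subseteq> N" "emeasure lborel N = 0" "N \<in> sets lborel"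
        by (rule AE_E)
      then have N: "N \<in> null_sets lborel" "\<And>x. x \<notin> N \<Longrightarrow> ok x" by (auto simp: null_sets_def)
      have "UNIV \<times> N \<in> null_sets (lborel \<Otimes>\<^sub>M lborel :: (real \<times> 'a) measure)"
        using N(1) by (intro lborel.times_in_null_sets2) simp_all
      then have "AE z in (lborel :: (real \<times> 'a) measure). z \<notin> UNIV \<times> N" unfolding lborel_prod by (rule AE_not_in)
      then show ?thesis unfolding ok_def[symmetric] by eventually_elim (metis N(2) UNIV_I mem_Times_iff)
    qed
    show ?thesis
      using k[unfolded L2_space_bor_iff] bor_primitive_l2[of g] AE_lborel_shift[OF bor_primitive_l2[of g], of "(h, 0)"] good
    proof eventually_elim
      case (elim z)
      obtain t x where z: "z = (t, x)" by fastforce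
      show ?case
      proof (cases "z \<in> Q")
        case False
        then have "bor k z = 0" using elim(1) by simp
        then show ?thesis by (simp add: f_def)
      next
        case True
        then have t: "0 < t" "t < T" "x \<in> \<Omega>" by (auto simp: z cyl_def)
        have x: "integrable lborel (\<lambda>s. (bor g (s, x))\<^sup>2)" using elim(4) by (simp add: z)
        have g0: "AE s in lborel. s \<notin> {0<..<T} \<longrightarrow> bor g (s, x) = 0"
          using elim(4) t by (auto simp: z cyl_def elim!: eventually_mono)
        have b1: "bor ?y z = primitive T g t x" using elim(2) True by (simp add: z)
        \<comment> \<open>If \<open>t - h \<le> 0\<close> the shifted point has left the cylinder,
          and the indicator and the primitive are both 0 there: this is where the zero initial value
          enters.\<close>
        have b2: "bor ?y (z - (h, 0)) = primitive T g (t - h) x"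
          using elim(3) t h primitive_nonpos[of "t - h" T g x] by (auto simp: z cyl_def indicator_def)
        have "primitive T g t x - primitive T g (t - h) x
            = (LINT s|lborel. indicator ({0<..<T} \<inter> {t - h..<t}) s * bor g (s, x))"
          using h by (intro primitive_diff(1)[OF x]) simp
        also have "\<dots> = (LINT s|lborel. indicator {t - h..<t} s * bor g (s, x))"
        proof (rule integral_cong_AE)
          show "AE s in lborel. indicator ({0<..<T} \<inter> {t - h..<t}) s * bor g (s, x) = indicator {t - h..<t} s * bor g (s, x)"
            using g0 by eventually_elim (auto simp: indicator_def)
        qed measurable
        \<comment> \<open>The substitution s = t - r maps the interval from \<open>t - h\<close>
          inclusive to \<open>t\<close> exclusive onto that from 0 exclusive to \<open>h\<close>
          inclusive.\<close>
        also have "\<dots> = (LINT r|lborel. indicator {t - h..<t} (t + (- 1) * r) * bor g (t + (- 1) * r, x))"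
          using lborel_integral_real_affine[of "- 1" "\<lambda>s. indicator {t - h..<t} s * bor g (s, x)" t] by simp
        also have "\<dots> = (LINT r|lborel. indicator {0<..h} r * bor g (z - (r, 0)))"
          by (intro Bochner_Integration.integral_cong) (auto simp: indicator_def z)
        finally have "bor k z * (primitive T g t x - primitive T g (t - h) x)
            = (LINT r|lborel. bor k z * (indicator {0<..h} r * bor g (z - (r, 0))))" by simp
        also have "\<dots> = (LINT r|lborel. f (r, z))"
          by (intro Bochner_Integration.integral_cong) (auto simp: f_def)
        finally show ?thesis by (simp only: b1 b2)
      qed
    qed
  qed
  have "inner k (?y - shift (h, 0) ?y) = (LINT z|lborel. bor k z * (bor ?y z - bor ?y (z - (h, 0))))"
  proof (rule inner_bor_cong)
    show "AE z in lborel. bor (?y - shift (h, 0) ?y) z = bor ?y z - bor ?y (z - (h, 0))"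
      using bor_diff[of ?y "shift (h, 0) ?y"] bor_shift[of "(h, 0)" ?y] by eventually_elim simp
  qed measurable
  also have "\<dots> = (LINT z|lborel. LINT r|lborel. f (r, z))"
    by (rule integral_cong_AE[OF _ _ yz]) (use fubini_integrable_snd[OF f_int] in auto)
  also have "\<dots> = (LINT r|lborel. LINT z|lborel. f (r, z))"
    using fubini_fst[OF f_int] fubini_snd[OF f_int] by simp
  finally show "inner k (?y - shift (h, 0) ?y) = (LINT r|lborel. indicator {0<..h} r * inner (shift (r, 0) g) k)"
    unfolding f_r .
qed

text \<open>If the pairing were positive, continuity of translations would keep the pairing of
  \<open>k\<close> with short translates of \<open>g\<close> above half of it. Their integral would
  then be positive, although it equals the nonpositive pairing with a backward difference.\<close>

lemma primitive_dissipative: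
  assumes g: "g \<in> V" and k: "lap_rel (primitive_l2 T \<Omega> g) k"
  shows "inner g k \<le> 0"
proof (rule ccontr)
  assume "\<not> inner g k \<le> 0"
  then have pos: "inner g k > 0" by simp
  have kV: "k \<in> V" using k by (simp add: lap_rel_def)
  have "\<exists>h>0. \<forall>r\<in>{0<..h}. inner (shift (r, 0) g) k \<ge> inner g k / 2"
  proof (rule ccontr)
    assume "\<not> ?thesis"
    then have "\<forall>n. \<exists>r\<in>{0<..inverse (real (Suc n))}. inner (shift (r, 0) g) k < inner g k / 2"
      by (metis inverse_positive_iff_positive not_le of_nat_0_less_iff zero_less_Suc)
    then obtain r where r: "\<And>n. r n \<in> {0<..inverse (real (Suc n))}" "\<And>n. inner (shift (r n, 0) g) k < inner g k / 2"
      by metis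
    have "r \<longlonglongrightarrow> 0"
    proof (rule tendsto_sandwich[OF _ _ tendsto_const LIMSEQ_inverse_real_of_nat])
      have "0 \<le> r n" "r n \<le> inverse (real (Suc n))" for n using r(1)[of n] by auto
      then show "\<forall>\<^sub>F n in sequentially. 0 \<le> r n" "\<forall>\<^sub>F n in sequentially. r n \<le> inverse (real (Suc n))"
        by (simp_all only: always_eventually eventually_True)
    qed
    then have "(\<lambda>n. (r n, 0 :: 'a)) \<longlonglongrightarrow> 0" using tendsto_Pair[of r 0 sequentially "\<lambda>_. 0 :: 'a" 0] by (simp add: zero_prod_def)
    then have "(\<lambda>n. inner (shift (r n, 0) g) k) \<longlonglongrightarrow> inner g k"
      by (intro tendsto_intros shift_tendsto)
    then have "inner g k \<le> inner g k / 2"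
      by (rule LIMSEQ_le_const2) (use r(2) in \<open>auto intro: less_imp_le\<close>)
    then show False using pos by simp
  qed
  then obtain h where h: "h > 0" "\<And>r. r \<in> {0<..h} \<Longrightarrow> inner (shift (r, 0) g) k \<ge> inner g k / 2" by blast
  note bd = backward_difference_eq[OF g kV h(1)]
  have "h * (inner g k / 2) = (LINT r|lborel. indicator {0<..h} r * (inner g k / 2))" using h(1) by simp
  also have "\<dots> \<le> (LINT r|lborel. indicator {0<..h} r * inner (shift (r, 0) g) k)"
    using h by (intro integral_mono bd(1) integrable_mult_left integrable_real_indicator) (auto simp: indicator_def)
  also have "\<dots> \<le> 0" using backward_difference_nonpos[OF k h(1)] bd(2) by simp
  finally show False using h(1) pos by (simp add: mult_le_0_iff)
qed

end

section \<open>The state space as a set of primitives with a Dirichlet Laplacian\<close>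

lemma box_Pair_eq: "box (s, c) (t, d) = box s t \<times> box c d"
  by (force simp: box_def Basis_prod_def)

context cylinder
begin

lemma primitive_l2_add: "primitive_l2 T \<Omega> (g + h) = primitive_l2 T \<Omega> g + primitive_l2 T \<Omega> h"
proof (rule eq_if_sl_eq[OF \<Omega>_meas])
  show "primitive_l2 T \<Omega> (g + h) \<in> V" "primitive_l2 T \<Omega> g + primitive_l2 T \<Omega> h \<in> V"
    by (intro primitive_l2_in_V subspace_add[OF subspace_V])+
  have ae: "AE x in lborel. primitive T (g + h) t x = primitive T g t x + primitive T h t x" for t
    using AE_lborel_pair_swap[OF bor_add[of g h]] AE_time_square_integrable[of g] AE_time_square_integrable[of h]
  proof eventually_elim
    case (elim x)
    have p: "primitive T u t x = (LINT s|lborel. indicator ({0<..<T} \<inter> {..<t}) s * bor u (s, x))" for u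
      unfolding primitive_def by (intro Bochner_Integration.integral_cong) (auto simp: indicator_def)
    have i: "integrable lborel (\<lambda>s. indicator ({0<..<T} \<inter> {..<t}) s * bor u (s, x))"
      if "integrable lborel (\<lambda>s. (bor u (s, x))\<^sup>2)" for u :: "(real \<times> 'a) l2"
      by (rule bor_interval_integrable(1)[OF that, of 0 "\<bar>T\<bar>"]) auto
    have "primitive T (g + h) t x = (LINT s|lborel. indicator ({0<..<T} \<inter> {..<t}) s * bor g (s, x)
        + indicator ({0<..<T} \<inter> {..<t}) s * bor h (s, x))"
      unfolding p
    proof (rule integral_cong_AE)
      show "AE s in lborel. indicator ({0<..<T} \<inter> {..<t}) s * bor (g + h) (s, x) =
          indicator ({0<..<T} \<inter> {..<t}) s * bor g (s, x) + indicator ({0<..<T} \<inter> {..<t}) s * bor h (s, x)"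
        using elim(1) by eventually_elim (simp add: distrib_left)
    qed measurable
    then show ?case using Bochner_Integration.integral_add[OF i[OF elim(2)] i[OF elim(3)]] by (simp add: p)
  qed
  have tl: "toL2 \<Omega> (primitive T (g + h) t) = toL2 \<Omega> (primitive T g t) + toL2 \<Omega> (primitive T h t)" for t
  proof -
    have "AE x in lebesgue_on \<Omega>. primitive T (g + h) t x = primitive T g t x + primitive T h t x"
      unfolding AE_lebesgue_on_iff[OF \<Omega>_lebesgue] AE_completion_iff using ae[of t] by eventually_elim simp
    then show ?thesis
      using toL2_eq_iff[OF \<Omega>_lebesgue L2_fun_primitive L2_fun_add[OF L2_fun_primitive L2_fun_primitive]]
        toL2_add[OF \<Omega>_lebesgue L2_fun_primitive L2_fun_primitive] by metis
  qed
  show "AE t in lborel. t \<in> {0<..<T} \<longrightarrow> sl \<Omega> (primitive_l2 T \<Omega> (g + h)) t = sl \<Omega> (primitive_l2 T \<Omega> g + primitive_l2 T \<Omega> h) t"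
    using sl_primitive_l2[of "g + h"] sl_primitive_l2[of g] sl_primitive_l2[of h]
      sl_add[OF \<Omega>_meas, of "primitive_l2 T \<Omega> g" "primitive_l2 T \<Omega> h"]
    by eventually_elim (simp add: tl)
qed

lemma primitive_l2_scaleR: "primitive_l2 T \<Omega> (c *\<^sub>R g) = c *\<^sub>R primitive_l2 T \<Omega> g"
proof (rule eq_if_sl_eq[OF \<Omega>_meas])
  show "primitive_l2 T \<Omega> (c *\<^sub>R g) \<in> V" "c *\<^sub>R primitive_l2 T \<Omega> g \<in> V"
    by (intro primitive_l2_in_V subspace_scale[OF subspace_V])+
  have ae: "AE x in lborel. primitive T (c *\<^sub>R g) t x = c * primitive T g t x" for t
    using AE_lborel_pair_swap[OF bor_scaleR[of c g]]
  proof eventually_elim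
    case (elim x)
    have p: "primitive T u t x = (LINT s|lborel. indicator ({0<..<T} \<inter> {..<t}) s * bor u (s, x))" for u
      unfolding primitive_def by (intro Bochner_Integration.integral_cong) (auto simp: indicator_def)
    have "primitive T (c *\<^sub>R g) t x = (LINT s|lborel. c * (indicator ({0<..<T} \<inter> {..<t}) s * bor g (s, x)))"
      unfolding p
    proof (rule integral_cong_AE)
      show "AE s in lborel. indicator ({0<..<T} \<inter> {..<t}) s * bor (c *\<^sub>R g) (s, x) =
          c * (indicator ({0<..<T} \<inter> {..<t}) s * bor g (s, x))"
        using elim by eventually_elim simp
    qed measurable
    then show ?case by (simp add: p)
  qed
  have tl: "toL2 \<Omega> (primitive T (c *\<^sub>R g) t) = c *\<^sub>R toL2 \<Omega> (primitive T g t)" for t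
  proof -
    have "AE x in lebesgue_on \<Omega>. primitive T (c *\<^sub>R g) t x = c * primitive T g t x"
      unfolding AE_lebesgue_on_iff[OF \<Omega>_lebesgue] AE_completion_iff using ae[of t] by eventually_elim simp
    then show ?thesis
      using toL2_eq_iff[OF \<Omega>_lebesgue L2_fun_primitive L2_fun_scale[OF L2_fun_primitive]]
        toL2_scale[OF \<Omega>_lebesgue L2_fun_primitive] by metis
  qed
  show "AE t in lborel. t \<in> {0<..<T} \<longrightarrow> sl \<Omega> (primitive_l2 T \<Omega> (c *\<^sub>R g)) t = sl \<Omega> (c *\<^sub>R primitive_l2 T \<Omega> g) t"
    using sl_primitive_l2[of "c *\<^sub>R g"] sl_primitive_l2[of g] sl_scaleR[OF \<Omega>_meas, of c "primitive_l2 T \<Omega> g"]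
    by eventually_elim (simp add: tl)
qed

lemma bounded_linear_primitive_l2: "bounded_linear (primitive_l2 T \<Omega>)"
  by (rule bounded_linear_intro[where K = T])
    (simp_all add: primitive_l2_add primitive_l2_scaleR norm_primitive_l2_le mult.commute[of _ T])

text \<open>For fixed \<open>p\<close>, the scalar function
  \<open>t \<mapsto> inner (sl \<Omega> d t) p\<close> is square-integrable and orthogonal to all
  test functions of time, hence 0 almost everywhere. The exceptional times depend on
  \<open>p\<close>, but the slices of one box are multiples of one \<open>p\<close>, so
  orthogonality to every box follows.\<close>

lemma is_time_deriv_unique:
  assumes g: "g \<in> V" and h: "h \<in> V" and yg: "is_time_deriv T \<Omega> y g" and yh: "is_time_deriv T \<Omega> y h"
  shows "g = h"
proof -
  define d where "d = g - h"
  have d: "d \<in> V" unfolding d_def by (rule subspace_diff[OF subspace_V g h])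
  have zero: "AE t in lborel. inner (sl \<Omega> d t) p = 0" if p: "p \<in> L2_space \<Omega>" for p
  proof -
    let ?f = "\<lambda>t. inner (sl \<Omega> d t) p"
    have sq: "integrable lborel (\<lambda>t. (?f t)\<^sup>2)"
    proof (rule square_integral_le(1))
      show "integrable lborel (\<lambda>t. inner (sl \<Omega> d t) (sl \<Omega> d t) * inner p p)"
        using inner_sl(1)[OF \<Omega>_meas d] by (rule integrable_mult_left)
      show "AE t in lborel. (?f t)\<^sup>2 \<le> inner (sl \<Omega> d t) (sl \<Omega> d t) * inner p p"
        using Cauchy_Schwarz_ineq by blast
    qed measurable
    define U where "U = abs_l2 ?f"
    have U: "AE t in lborel. bor U t = ?f t" unfolding U_def by (rule bor_abs_l2[OF _ sq]) measurable
    have "AE t in lborel. t \<in> {0<..<T} \<longrightarrow> bor U t = 0"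
    proof (rule zero_AE_if_orthogonal_test_fun)
      fix \<phi> :: "real \<Rightarrow> real" assume \<phi>: "test_fun {0<..<T} \<phi>"
      note [measurable] = test_fun_square_integrable(1)[OF \<phi>]
      have "(LINT t|lborel. bor U t * \<phi> t) = (LINT t|lborel. \<phi> t * ?f t)"
      proof (rule integral_cong_AE)
        show "AE t in lborel. bor U t * \<phi> t = \<phi> t * ?f t" using U by eventually_elim simp
      qed measurable
      also have "\<dots> = (LINT x|lborel. bor p x * (LINT t|lborel. bor d (t, x) * \<phi> t))"
        by (rule inner_sl_time_weighted[OF d test_fun_square_integrable[OF \<phi>]])
      also have "\<dots> = 0"
      proof (rule integral_eq_zero_AE)
        have iu: "AE x in lborel. integrable lborel (\<lambda>t. bor u (t, x) * \<phi> t)" for u :: "(real \<times> 'a) l2"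
          using AE_time_square_integrable[of u]
          by eventually_elim (rule borel_Cauchy_Schwarz(1)[OF _ _ test_fun_square_integrable[OF \<phi>]], auto)
        show "AE x in lborel. bor p x * (LINT t|lborel. bor d (t, x) * \<phi> t) = 0"
          using AE_lborel_pair_swap[OF bor_diff[of g h]] iu[of g] iu[of h]
            yg[unfolded is_time_deriv_iff, rule_format, OF \<phi>] yh[unfolded is_time_deriv_iff, rule_format, OF \<phi>]
            p[unfolded L2_space_bor_iff]
        proof eventually_elim
          case (elim x)
          show ?case
          proof (cases "x \<in> \<Omega>")
            case True
            have "(LINT t|lborel. bor d (t, x) * \<phi> t) = (LINT t|lborel. bor g (t, x) * \<phi> t - bor h (t, x) * \<phi> t)"
            proof (rule integral_cong_AE)
              show "AE t in lborel. bor d (t, x) * \<phi> t = bor g (t, x) * \<phi> t - bor h (t, x) * \<phi> t"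
                using elim(1) unfolding d_def by eventually_elim (simp add: left_diff_distrib)
            qed measurable
            also have "\<dots> = 0" using elim True by simp
            finally show ?thesis by simp
          qed (use elim in simp)
        qed
      qed
      finally show "(LINT t|lborel. bor U t * \<phi> t) = 0" .
    qed simp
    then show ?thesis using U sl_outside[OF \<Omega>_meas d] by eventually_elim auto
  qed
  have "d = 0"
  proof (rule zero_if_orthogonal_boxes)
    fix a b :: "real \<times> 'a"
    let ?B = "box_l2 (snd a) (snd b)" and ?I = "box (fst a) (fst b)"
    define p where "p = cut \<Omega> ?B"
    have p: "AE x in lborel. bor p x = indicator \<Omega> x * indicator (box (snd a) (snd b)) x"
      using bor_cut[OF \<Omega>_lebesgue, of ?B] bor_box_l2[of "snd a" "snd b"] unfolding p_def by eventually_elim simp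
    have "AE t in lborel. inner (sl \<Omega> d t) (sl \<Omega> (box_l2 a b) t) = 0"
      using zero[OF cut_in_L2_space[OF \<Omega>_lebesgue], of ?B] bor_sl[OF \<Omega>_meas, of "box_l2 a b"]
        AE_lborel_pair[OF bor_box_l2[of a b]]
    proof eventually_elim
      case (elim t)
      have "sl \<Omega> (box_l2 a b) t = indicator ?I t *\<^sub>R p"
        by (rule bor_eqI, use elim(2,3) p bor_scaleR[of "indicator ?I t" p] in eventually_elim)
          (cases a; cases b; simp add: box_Pair_eq indicator_def)
      then show ?case using elim(1) by (simp add: p_def)
    qed
    then show "inner d (box_l2 a b) = 0"
      unfolding inner_sl(2)[OF \<Omega>_meas d] by (rule integral_eq_zero_AE)
  qed
  then show ?thesis by (simp add: d_def)
qed

lemma dt_eq: "g \<in> V \<Longrightarrow> dt T \<Omega> (primitive_l2 T \<Omega> g) = g"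
  unfolding dt_def
  by (rule the_equality) (auto simp: is_time_deriv_primitive intro: is_time_deriv_unique)

text \<open>The weak time derivative and the initial condition are together replaced by the bounded
  operator \<open>primitive_l2\<close>. Linearity and completeness of the state space then reduce to
  those of the Laplacian relation.\<close>

lemma Y_space_iff: "y \<in> Y_space T \<Omega> \<longleftrightarrow> (\<exists>g\<in>V. \<exists>k. y = primitive_l2 T \<Omega> g \<and> lap_rel y k)"
proof
  assume "y \<in> Y_space T \<Omega>"
  then have "\<exists>k. lap_rel y k" "y \<in> V" "\<exists>g\<in>V. is_time_deriv T \<Omega> y g" "vanishes_initially T \<Omega> y"
    by (auto simp: Y_space_def H1_0star_def L2_HDelta_H10_iff)
  then show "\<exists>g\<in>V. \<exists>k. y = primitive_l2 T \<Omega> g \<and> lap_rel y k" using time_deriv_imp_primitive by blast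
next
  assume "\<exists>g\<in>V. \<exists>k. y = primitive_l2 T \<Omega> g \<and> lap_rel y k"
  then show "y \<in> Y_space T \<Omega>"
    using primitive_l2_in_V is_time_deriv_primitive vanishes_initially_primitive
    by (auto simp: Y_space_def H1_0star_def L2_HDelta_H10_iff)
qed

lemma Y_space_cases:
  assumes "y \<in> Y_space T \<Omega>"
  shows "dt T \<Omega> y \<in> V" and "y = primitive_l2 T \<Omega> (dt T \<Omega> y)" and "lap_rel y (lap T \<Omega> y)"
  using assms unfolding Y_space_iff by (auto simp: dt_eq dest: lap_eq)

lemma Y_spaceI:
  assumes "g \<in> V" "y = primitive_l2 T \<Omega> g" "lap_rel y k"
  shows "y \<in> Y_space T \<Omega>" and "dt T \<Omega> y = g" and "lap T \<Omega> y = k"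
  using assms by (auto simp: Y_space_iff dt_eq lap_eq)

end

text \<open>Closedness combines boundedness of \<open>primitive_l2\<close>, by which convergent time
  derivatives force the states to converge, with closedness of the Laplacian relation.\<close>

lemma heat_block_Y_space:
  assumes cyl: "cylinder T \<Omega>" and q: "q \<in> sets lebesgue" and \<alpha>: "\<alpha> > 0" and \<kappa>: "\<kappa> > 0"
    and C: "C > 1" "1 / C + 1 / (C - 1) = C" and N: "N \<ge> 2" "1 / N + 1 / (N - 1) = N - 1"
  shows "heat_block (Y_space T \<Omega>) (L2_space (cyl T \<Omega>)) (dt T \<Omega>) (lap T \<Omega>) (l2_inner q) \<alpha> \<kappa> T C N"
proof -
  interpret cylinder T \<Omega> by (rule cyl)
  have add: "y + z \<in> Y_space T \<Omega>" "dt T \<Omega> (y + z) = dt T \<Omega> y + dt T \<Omega> z" "lap T \<Omega> (y + z) = lap T \<Omega> y + lap T \<Omega> z"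
    if "y \<in> Y_space T \<Omega>" "z \<in> Y_space T \<Omega>" for y z
  proof -
    have "dt T \<Omega> y + dt T \<Omega> z \<in> V"
      by (intro subspace_add[OF subspace_V] Y_space_cases(1) that)
    moreover have "y + z = primitive_l2 T \<Omega> (dt T \<Omega> y + dt T \<Omega> z)"
      using Y_space_cases(2)[OF that(1)] Y_space_cases(2)[OF that(2)] by (simp add: primitive_l2_add)
    moreover have "lap_rel (y + z) (lap T \<Omega> y + lap T \<Omega> z)"
      by (intro lap_rel_add Y_space_cases(3) that)
    ultimately show "y + z \<in> Y_space T \<Omega>" "dt T \<Omega> (y + z) = dt T \<Omega> y + dt T \<Omega> z" "lap T \<Omega> (y + z) = lap T \<Omega> y + lap T \<Omega> z"
      by (rule Y_spaceI)+
  qed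
  have scale: "s *\<^sub>R y \<in> Y_space T \<Omega>" "dt T \<Omega> (s *\<^sub>R y) = s *\<^sub>R dt T \<Omega> y" "lap T \<Omega> (s *\<^sub>R y) = s *\<^sub>R lap T \<Omega> y"
    if "y \<in> Y_space T \<Omega>" for s y
  proof -
    have "s *\<^sub>R dt T \<Omega> y \<in> V" by (intro subspace_scale[OF subspace_V] Y_space_cases(1) that)
    moreover have "s *\<^sub>R y = primitive_l2 T \<Omega> (s *\<^sub>R dt T \<Omega> y)"
      using Y_space_cases(2)[OF that] by (simp add: primitive_l2_scaleR)
    moreover have "lap_rel (s *\<^sub>R y) (s *\<^sub>R lap T \<Omega> y)" by (intro lap_rel_scaleR Y_space_cases(3) that)
    ultimately show "s *\<^sub>R y \<in> Y_space T \<Omega>" "dt T \<Omega> (s *\<^sub>R y) = s *\<^sub>R dt T \<Omega> y" "lap T \<Omega> (s *\<^sub>R y) = s *\<^sub>R lap T \<Omega> y"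
      by (rule Y_spaceI)+
  qed
  have zero: "0 \<in> Y_space T \<Omega>"
  proof (rule Y_spaceI(1))
    show "0 \<in> V" by (rule subspace_0[OF subspace_V])
    show "0 = primitive_l2 T \<Omega> 0" using linear_0[OF bounded_linear.linear[OF bounded_linear_primitive_l2]] by simp
    have "AE t in lborel. sl \<Omega> 0 t = 0" using sl_scaleR[OF \<Omega>_meas, of 0 0] by simp
    then have "AE t in lborel. t \<in> {0<..<T} \<longrightarrow> (\<exists>G. dirichlet_lap \<Omega> (sl \<Omega> 0 t) (sl \<Omega> 0 t) G)"
      using dirichlet_lap_zero[OF \<Omega>] by (auto elim!: eventually_mono)
    then show "lap_rel 0 0" using subspace_0[OF subspace_V] by (simp add: lap_rel_def)
  qed
  show ?thesis
  proof
    show "subspace V" "closed V" by (rule subspace_V closed_V)+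
    show "subspace (Y_space T \<Omega>)" unfolding subspace_def using zero add(1) scale(1) by blast
    show "inner (dt T \<Omega> y) (lap T \<Omega> y) \<le> 0" if "y \<in> Y_space T \<Omega>" for y
      using primitive_dissipative[OF Y_space_cases(1)[OF that]] Y_space_cases(2,3)[OF that] by metis
    show "norm y \<le> T * norm (dt T \<Omega> y)" if "y \<in> Y_space T \<Omega>" for y
      using norm_primitive_l2_le[of "dt T \<Omega> y"] Y_space_cases(2)[OF that] by metis
    show "lap T \<Omega> y \<in> V" if "y \<in> Y_space T \<Omega>" for y
      using Y_space_cases(3)[OF that] by (simp add: lap_rel_def)
    show "\<exists>z\<in>Y_space T \<Omega>. dt T \<Omega> z = g \<and> lap T \<Omega> z = k"
      if v: "\<And>n. v n \<in> Y_space T \<Omega>" and g: "(\<lambda>n. dt T \<Omega> (v n)) \<longlonglongrightarrow> g" and k: "(\<lambda>n. lap T \<Omega> (v n)) \<longlonglongrightarrow> k"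
      for v g k
    proof -
      have gV: "g \<in> V" by (rule closed_sequentially[OF closed_V Y_space_cases(1)[OF v] g])
      have "(\<lambda>n. primitive_l2 T \<Omega> (dt T \<Omega> (v n))) \<longlonglongrightarrow> primitive_l2 T \<Omega> g"
        by (rule bounded_linear.tendsto[OF bounded_linear_primitive_l2 g])
      then have "v \<longlonglongrightarrow> primitive_l2 T \<Omega> g" using Y_space_cases(2)[OF v] by simp
      then have "lap_rel (primitive_l2 T \<Omega> g) k" by (rule lap_rel_closed[OF Y_space_cases(3)[OF v] _ k])
      then show ?thesis using Y_spaceI[OF gV refl] by blast
    qed
    show "l2_inner q (y + z) w = l2_inner q y w + l2_inner q z w" for y z w
      by (simp add: l2_inner_cut[OF q] cut_add[OF q] inner_add_left)
    show "l2_inner q (s *\<^sub>R y) w = s * l2_inner q y w" for s y w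
      by (simp add: l2_inner_cut[OF q] cut_scaleR[OF q])
    show "l2_inner q y z = l2_inner q z y" for y z
      by (simp add: l2_inner_cut[OF q] inner_commute)
    show "0 \<le> l2_inner q y y" for y by (simp add: l2_inner_cut[OF q])
    show "l2_inner q y y \<le> (norm y)\<^sup>2" for y
      unfolding l2_inner_cut[OF q] power2_norm_eq_inner[symmetric] by (intro power_mono norm_cut_le[OF q]) simp
  qed (fact \<alpha> \<kappa> C N add scale Y_space_cases)+
qed

section \<open>The condition number\<close>

text \<open>The angles 4 pi / 7 and 3 pi / 7 add up to pi, so their cosines cancel. Written in
  \<open>x\<close>, this is a quartic with the spurious factor \<open>x + 1\<close>, which is
  positive here and can be divided out.\<close>

lemma cos_pi_seventh_cubic:
  assumes "x = cos (pi / 7)"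
  shows "8 * x ^ 3 - 4 * x\<^sup>2 - 4 * x + 1 = 0"
proof -
  have "cos (4 * (pi / 7)) = cos (pi - 3 * (pi / 7))" by (rule arg_cong[where f = cos]) simp
  also have "\<dots> = - cos (3 * (pi / 7))" by (rule cos_pi_minus)
  finally have "cos (4 * (pi / 7)) + cos (3 * (pi / 7)) = 0" by simp
  moreover have "cos (4 * (pi / 7)) = 2 * (2 * x\<^sup>2 - 1)\<^sup>2 - 1"
    using cos_double_cos[of "2 * (pi / 7)"] cos_double_cos[of "pi / 7"] assms by simp
  moreover have "cos (3 * (pi / 7)) = 4 * x ^ 3 - 3 * x"
    using cos_treble_cos[of "pi / 7"] assms by simp
  ultimately have "(x + 1) * (8 * x ^ 3 - 4 * x\<^sup>2 - 4 * x + 1) = 0"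
    by (simp add: algebra_simps power2_eq_square power3_eq_cube)
  moreover have "x + 1 > 0" using cos_gt_zero[of "pi / 7"] assms pi_gt_zero by simp
  ultimately show ?thesis by simp
qed

lemma sin_pi_fourteenth: "sin (pi / 14) = 4 * cos (pi / 7) ^ 3 - 3 * cos (pi / 7)"
proof -
  have "sin (pi / 14) = cos (pi / 2 - pi / 14)" using sin_cos_eq[of "pi / 14"] by simp
  also have "pi / 2 - pi / 14 = 3 * (pi / 7)" by simp
  finally show ?thesis using cos_treble_cos[of "pi / 7"] by simp
qed

lemma cond_constants:
  defines "C \<equiv> 2 * cos (pi / 7)" and "N \<equiv> 1 / (2 * sin (pi / 14))"
  shows "C > 1" and "1 / C + 1 / (C - 1) = C" and "N \<ge> 2" and "1 / N + 1 / (N - 1) = N - 1"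
    and "2 * C * N = 2 * (cos (pi / 7) / sin (pi / 14))"
    and "\<bar>2 * (cos (pi / 7) / sin (pi / 14)) - 8.10\<bar> < 0.005"
proof -
  define c where "c = 2 * sin (pi / 14)"
  have cubic: "C ^ 3 - C\<^sup>2 - 2 * C + 1 = 0"
    using cos_pi_seventh_cubic[OF refl] by (simp add: C_def power_mult_distrib)
  \<comment> \<open>A crude bound, obtained by comparison with pi / 6, that singles out the largest
    root of the cubic.\<close>
  have C_low: "C \<ge> 1.5"
  proof -
    have "cos (pi / 6) \<le> cos (pi / 7)" by (intro cos_monotone_0_pi_le) auto
    moreover have "sqrt 3 \<ge> 1.5" by (rule real_le_rsqrt) (simp add: power2_eq_square)
    ultimately show ?thesis by (simp add: C_def cos_30)
  qed
  have bounds: "1.80193 < C" "C < 1.80195"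
  proof -
    \<comment> \<open>\<open>t - C\<close> divides the difference of the cubic at \<open>t\<close>
      and at its root \<open>C\<close>. The cofactor is positive for \<open>t \<ge> 1.5\<close>, so
      the sign of the cubic at a decimal number tells on which side of \<open>C\<close> it
      lies.\<close>
    have f: "t ^ 3 - t\<^sup>2 - 2 * t + 1 - (C ^ 3 - C\<^sup>2 - 2 * C + 1) = (t - C) * (t\<^sup>2 + t * C + C\<^sup>2 - t - C - 2)" for t :: real
      by (simp add: algebra_simps power2_eq_square power3_eq_cube)
    have pos: "t\<^sup>2 + t * C + C\<^sup>2 - t - C - 2 > 0" if "t \<ge> 1.5" for t :: real
    proof -
      have "t\<^sup>2 \<ge> 1.5 * t" "C\<^sup>2 \<ge> 1.5 * C"
        using that C_low by (auto simp: power2_eq_square intro: mult_right_mono)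
      moreover have "t * C \<ge> 1.5 * 1.5" by (rule mult_mono[OF that C_low]) (use that in simp_all)
      ultimately show ?thesis using that C_low by simp
    qed
    have "(1.80193 - C) * (1.80193\<^sup>2 + 1.80193 * C + C\<^sup>2 - 1.80193 - C - 2) < 0"
      unfolding f[symmetric] cubic by (simp add: power2_eq_square power3_eq_cube)
    then show "1.80193 < C" using pos[of "1.80193"] by (simp add: mult_less_0_iff)
    have "(1.80195 - C) * (1.80195\<^sup>2 + 1.80195 * C + C\<^sup>2 - 1.80195 - C - 2) > 0"
      unfolding f[symmetric] cubic by (simp add: power2_eq_square power3_eq_cube)
    then show "C < 1.80195" using pos[of "1.80195"] by (simp add: zero_less_mult_iff)
  qed
  \<comment> \<open>\<open>c\<close> is 2 cos(3 pi / 7), a second root of the cubic; the triple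
    angle formula reduced by the cubic writes it as a quadratic polynomial in
    \<open>C\<close>.\<close>
  have c: "c = C\<^sup>2 - C - 1"
  proof -
    have "c = C ^ 3 - 3 * C" by (simp add: c_def C_def sin_pi_fourteenth power_mult_distrib)
    then show ?thesis using cubic by simp
  qed
  have c_bounds: "0.445 < c" "c < 0.4451"
  proof -
    have "1.80193\<^sup>2 < C\<^sup>2" "C\<^sup>2 < 1.80195\<^sup>2" using bounds by (auto intro!: power_strict_mono)
    moreover have "(C - 1.80193) * (C + 1.80193 - 1) > 0" "(1.80195 - C) * (C + 1.80195 - 1) > 0"
      using bounds by (auto intro!: mult_pos_pos)
    ultimately show "0.445 < c" "c < 0.4451"
      unfolding c by (simp_all add: algebra_simps power2_eq_square)
  qed
  have c_cubic: "c ^ 3 - c\<^sup>2 - 2 * c + 1 = 0"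
  proof -
    \<comment> \<open>Substituting the quadratic into the cubic gives degree 6, and the cubic in
      \<open>C\<close> splits off as a factor.\<close>
    have "c ^ 3 - c\<^sup>2 - 2 * c + 1 = (C ^ 3 - C\<^sup>2 - 2 * C + 1) * (C ^ 3 - 2 * C\<^sup>2 - C + 1)"
      unfolding c by (simp add: algebra_simps power2_eq_square power3_eq_cube)
    then show ?thesis unfolding cubic by simp
  qed
  show "C > 1" using bounds by simp
  show "1 / C + 1 / (C - 1) = C"
    using cubic bounds by (simp add: field_simps power2_eq_square power3_eq_cube)
  have N: "N = 1 / c" by (simp add: N_def c_def)
  show "N \<ge> 2" unfolding N using c_bounds by (simp add: field_simps)
  have e: "1 / N = c" "N - 1 = (1 - c) / c" using c_bounds by (simp_all add: N field_simps)
  have "c + c / (1 - c) = (1 - c) / c"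
    using c_cubic c_bounds by (simp add: field_simps power2_eq_square power3_eq_cube)
  then show "1 / N + 1 / (N - 1) = N - 1" unfolding e by simp
  have r: "2 * (cos (pi / 7) / sin (pi / 14)) = 2 * C / c"
    unfolding C_def c_def by simp
  show "2 * C * N = 2 * (cos (pi / 7) / sin (pi / 14))"
    unfolding r N by simp
  have "8.095 * c < 2 * C" "2 * C < 8.105 * c" using bounds c_bounds by simp_all
  then have "8.095 < 2 * C / c" "2 * C / c < 8.105" using c_bounds by (simp_all add: field_simps)
  moreover have "\<bar>x - 8.10\<bar> < 0.005" if "8.095 < x" "x < 8.105" for x :: real
    using that unfolding abs_less_iff by simp
  ultimately show "\<bar>2 * (cos (pi / 7) / sin (pi / 14)) - 8.10\<bar> < 0.005" unfolding r by blast
qed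

lemma op_norm_cong:
  assumes "\<And>x. x \<in> V \<Longrightarrow> N (K x) = N' (K' x)" "\<And>x. x \<in> V \<Longrightarrow> N x = N' x"
  shows "op_norm V N K = op_norm V N' K'"
  unfolding op_norm_def by (rule SUP_cong) (use assms in auto)

lemma inv_into_cong_on: "(\<And>x. x \<in> V \<Longrightarrow> f x = g x) \<Longrightarrow> inv_into V f = inv_into V g"
  unfolding inv_into_def by (intro ext arg_cong[where f = Eps]) auto

text \<open>\<open>precond_op\<close> and \<open>cond_number\<close> are built with
  \<open>inv_into\<close>, which returns arbitrary values outside the range of a map. The membership
  and bijectivity clauses certify that the bound concerns genuine inverses.\<close>

theorem lemma3:
  fixes \<Omega> :: "'a::euclidean_space set" and q :: "(real \<times> 'a) set" and T \<alpha> \<kappa> :: real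
  assumes "DIM('a) \<in> {2, 3}"
    and "open \<Omega>" and "connected \<Omega>" and "\<Omega> \<noteq> {}" and "bounded \<Omega>" and "lipschitz_boundary \<Omega>"
    and "T > 0"
    and "q \<in> sets lebesgue" and "q \<subseteq> cyl T \<Omega>"
    and "\<alpha> > 0" and "\<kappa> > 0"
  shows "cal_A \<alpha> \<kappa> T \<Omega> q \<in> X_space T \<Omega> \<rightarrow> X_dual \<kappa> T \<Omega> \<and>
         bij_betw (cal_B \<alpha> \<kappa> T \<Omega> q) (X_space T \<Omega>) (X_dual \<kappa> T \<Omega>) \<and>
         bij_betw (precond_op \<alpha> \<kappa> T \<Omega> q) (X_space T \<Omega>) (X_space T \<Omega>) \<and>
         cond_number (X_space T \<Omega>) (norm_cal_B \<alpha> \<kappa> T \<Omega> q) (precond_op \<alpha> \<kappa> T \<Omega> q)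
           \<le> ennreal (2 * (cos (pi / 7) / sin (pi / 14))) \<and>
         \<bar>2 * (cos (pi / 7) / sin (pi / 14)) - 8.10\<bar> < 0.005"
proof -
  let ?C = "2 * cos (pi / 7)" and ?N = "1 / (2 * sin (pi / 14))"
  have cyl: "cylinder T \<Omega>" by (rule cylinder.intro) fact+
  interpret cylinder T \<Omega> by (rule cyl)
  interpret hb: heat_block "Y_space T \<Omega>" V "dt T \<Omega>" "lap T \<Omega>" "l2_inner q" \<alpha> \<kappa> T ?C ?N
    by (rule heat_block_Y_space[OF cyl]) (fact assms cond_constants)+
  obtain c1 c2 where "preconditioned hb.X hb.b hb.a hb.XN c1 c2 (2 * ?C) ?N"
    using hb.preconditioned by blast
  then interpret pc: preconditioned hb.X hb.b hb.a hb.XN c1 c2 "2 * ?C" ?N .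
  have X: "X_space T \<Omega> = hb.X" by (simp add: X_space_def hb.X_def U_space_def)
  have H: "heat \<kappa> T \<Omega> y = hb.H y" for y by (simp add: heat_def hb.H_def)
  have ip: "l2_inner Q u v = inner u v" if "v \<in> V" for u v by (rule l2_inner_eq[OF Q_lebesgue that])
  have in_X: "y \<in> Y_space T \<Omega> \<and> u \<in> V \<and> \<mu> \<in> V" if "(y, u, \<mu>) \<in> hb.X" for y u \<mu>
    using that by (simp add: hb.X_def)
  have A: "cal_A \<alpha> \<kappa> T \<Omega> q x = pc.A x" if "x \<in> hb.X" for x
    unfolding pc.A_def cal_A_def X using that
    by (auto simp: fun_eq_iff restrict_def op_Mq_def op_M_def op_L_def adj_def hb.a_def H ip dest!: in_X split: prod.splits)
  have B: "cal_B \<alpha> \<kappa> T \<Omega> q x = pc.B x" if "x \<in> hb.X" for x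
    unfolding pc.B_def cal_B_def X using that
    by (auto simp: fun_eq_iff restrict_def op_Mq_def op_M_def op_B_def op_C_def hb.b_def ip hb.D_in
        dest!: in_X split: prod.splits)
  have XN: "X_norm \<kappa> T \<Omega> x = hb.XN x" if "x \<in> hb.X" for x
    unfolding X_norm_def hb.XN_def using that
    by (auto simp: Y_norm_def l2_norm_eq[OF Q_lebesgue] H hb.H_in dest!: in_X split: prod.splits)
  have dual: "X_dual \<kappa> T \<Omega> = dual_space hb.X hb.XN"
    unfolding X_dual_def X dual_space_def using XN by (intro Collect_cong conj_cong refl) auto
  have inv_B: "inv_into hb.X (cal_B \<alpha> \<kappa> T \<Omega> q) = inv_into hb.X pc.B"
    by (rule inv_into_cong_on) (rule B)
  have P: "precond_op \<alpha> \<kappa> T \<Omega> q x = pc.P x" if "x \<in> hb.X" for x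
    unfolding precond_op_def pc.P_def X inv_B A[OF that] ..
  have inv_P: "inv_into hb.X (precond_op \<alpha> \<kappa> T \<Omega> q) = inv_into hb.X pc.P"
    by (rule inv_into_cong_on) (rule P)
  have N: "norm_cal_B \<alpha> \<kappa> T \<Omega> q x = sqrt (hb.b x x)" if "x \<in> hb.X" for x
    unfolding norm_cal_B_def B[OF that] pc.B_def using that by simp
  have "cond_number hb.X (norm_cal_B \<alpha> \<kappa> T \<Omega> q) (precond_op \<alpha> \<kappa> T \<Omega> q)
      = cond_number hb.X (\<lambda>x. sqrt (hb.b x x)) pc.P"
  proof -
    have "inv_into hb.X pc.P x \<in> hb.X" if "x \<in> hb.X" for x
      using pc.P_bij that by (auto simp: bij_betw_def intro: inv_into_into)
    then show ?thesis
      unfolding cond_number_def inv_P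
      by (intro arg_cong2[where f = "(*)"] op_norm_cong) (simp_all add: P N pc.P_in)
  qed
  then have "cond_number (X_space T \<Omega>) (norm_cal_B \<alpha> \<kappa> T \<Omega> q) (precond_op \<alpha> \<kappa> T \<Omega> q)
      \<le> ennreal (2 * (cos (pi / 7) / sin (pi / 14)))"
    using pc.P_cond unfolding X cond_constants(5) by simp
  moreover have "cal_A \<alpha> \<kappa> T \<Omega> q \<in> X_space T \<Omega> \<rightarrow> X_dual \<kappa> T \<Omega>"
    using pc.A_dual unfolding X dual by (auto simp: A)
  moreover have "bij_betw (cal_B \<alpha> \<kappa> T \<Omega> q) (X_space T \<Omega>) (X_dual \<kappa> T \<Omega>)"
    unfolding X dual using pc.B_bij bij_betw_cong[of hb.X _ pc.B] B by metis
  moreover have "bij_betw (precond_op \<alpha> \<kappa> T \<Omega> q) (X_space T \<Omega>) (X_space T \<Omega>)"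
    unfolding X using pc.P_bij bij_betw_cong[of hb.X _ pc.P] P by metis
  ultimately show ?thesis using cond_constants(6) by blast
qed

end
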